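(* Let $(K,\mathcal{O},k)\subseteq(K',\mathcal{O}',k')$ be an extension of $p$-modular systems with $k,k'$ finite and $\mathcal{O},\mathcal{O}'$ absolutely unramified. Let $A$ be an $\mathcal{O}$-algebra that is finitely generated as an $\mathcal{O}$-module, and let $A'=\mathcal{O}'\otimes_{\mathcal{O}}A$. (a) Suppose $C$ is an indecomposable bounded chain complex of finitely generated $A'$-modules satisfying ${}^\sigma C\cong C$ for all $\sigma\in\mathrm{Gal}(k'/k)$, where $\sigma$ is regarded as the unique ring homomorphism of $\mathcal{O}'$ lifting $\sigma\in\mathrm{Gal}(k'/k)$. Then there exists a bounded chain complex $\tilde{C}$ of finitely generated $A$-modules such that $\mathcal{O}'\otimes_{\mathcal{O}}\tilde{C}\cong C$. Moreover, $\tilde{C}$ is unique up to isomorphism. (b) Conversely, let $\tilde{C}$ be a bounded chain complex of finitely generated $A$-modules and define $C:=\mathcal{O}'\otimes_{\mathcal{O}}\tilde{C}$. Then $C$ satisfies ${}^\sigma C\cong C$ for all $\sigma\in\mathrm{Gal}(k'/k)$.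
   Context: A $p$-modular system $(K,\mathcal{O},k)$ consists of a complete discrete valuation ring $\mathcal{O}$ with field of fractions $K$ of characteristic $0$ and residue field $k$ of characteristic $p$. An extension of $p$-modular systems means $\mathcal{O}\subseteq\mathcal{O}'$ with $J(\mathcal{O})\subseteq J(\mathcal{O}')$ (with induced inclusions $K\subseteq K'$, $k\subseteq k'$). Absolutely unramified means $J(\mathcal{O})=p\mathcal{O}$ and $J(\mathcal{O}')=p\mathcal{O}'$, equivalently $\mathcal{O}\cong W(k)$ and $\mathcal{O}'\cong W(k')$ (Witt vectors). Then every $\sigma\in\mathrm{Gal}(k'/k)$ lifts uniquely to a ring homomorphism $\sigma:\mathcal{O}'\to\mathcal{O}'$, which is an automorphism restricting to the identity on $\mathcal{O}$. Galois twist: for an $A'$-module $U$ and $\sigma:\mathcal{O}'\to\mathcal{O}'$ the unique ring automorphism lifting an element $\sigma\in\mathrm{Gal}(k'/k)$, ${}^\sigma U$ is the $A'$-module equal to $U$ as a module over the subalgebra $1\otimes A$ of $A'$, such that $\lambda\otimes a$ acts on ${}^\sigma U$ as $\sigma^{-1}(\lambda)\otimes a$ acts on $U$, for $a\in A$, $\lambda\in\mathcal{O}'$. This extends degreewise to chain complexes. Isomorphisms and indecomposability of complexes are taken in the category of chain complexes (not the homotopy category). *)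

theory Defs
  imports "HOL-Algebra.Algebra"
begin

section \<open>Modular systems\<close>

definition has_characteristic :: "('a, 'c) ring_scheme \<Rightarrow> nat \<Rightarrow> bool" where
  "has_characteristic R n \<longleftrightarrow> (\<forall>m::nat. add_pow R m \<one>\<^bsub>R\<^esub> = \<zero>\<^bsub>R\<^esub> \<longleftrightarrow> n dvd m)"

text \<open>Used for commutative rings only.\<close>

definition jacobson_radical :: "('a, 'c) ring_scheme \<Rightarrow> 'a set" where
  "jacobson_radical R = carrier R \<inter> \<Inter>{M. maximalideal M R}"

definition residue_field :: "('a, 'c) ring_scheme \<Rightarrow> 'a set ring" where
  "residue_field R = R Quot (jacobson_radical R)"

primrec ideal_power :: "('a, 'c) ring_scheme \<Rightarrow> 'a set \<Rightarrow> nat \<Rightarrow> 'a set" where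
  "ideal_power R I 0 = carrier R"
| "ideal_power R I (Suc n) = ideal_prod R I (ideal_power R I n)"

text \<open>Completeness for the \<open>I\<close>-adic topology includes the Hausdorff property.\<close>

definition adically_complete :: "('a, 'c) ring_scheme \<Rightarrow> 'a set \<Rightarrow> bool" where
  "adically_complete R I \<longleftrightarrow>
     (\<Inter>n. ideal_power R I n) = {\<zero>\<^bsub>R\<^esub>} \<and>
     (\<forall>x :: nat \<Rightarrow> 'a.
        (\<forall>i. x i \<in> carrier R) \<and>
        (\<forall>n. \<exists>N. \<forall>i\<ge>N. \<forall>j\<ge>N. x i \<ominus>\<^bsub>R\<^esub> x j \<in> ideal_power R I n) \<longrightarrow>
        (\<exists>l\<in>carrier R. \<forall>n. \<exists>N. \<forall>i\<ge>N. x i \<ominus>\<^bsub>R\<^esub> l \<in> ideal_power R I n))"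

locale discrete_valuation_ring = principal_domain R for R (structure) +
  assumes unique_maximalideal: "\<exists>!M. maximalideal M R"
    and not_field: "\<not> field R"

locale complete_discrete_valuation_ring = discrete_valuation_ring R for R (structure) +
  assumes complete: "adically_complete R (jacobson_radical R)"

text \<open>\<open>R\<close> is a subring of \<open>S\<close>: the inclusion is a (unital) ring homomorphism.\<close>

definition is_subring_of :: "('a, 'c) ring_scheme \<Rightarrow> ('a, 'd) ring_scheme \<Rightarrow> bool" where
  "is_subring_of R S \<longleftrightarrow> ring R \<and> ring S \<and> (\<lambda>x. x) \<in> ring_hom R S"

definition is_fraction_field :: "('a, 'c) ring_scheme \<Rightarrow> ('a, 'd) ring_scheme \<Rightarrow> bool" where
  "is_fraction_field K R \<longleftrightarrow> field K \<and> is_subring_of R K \<and>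
     (\<forall>x\<in>carrier K. \<exists>a\<in>carrier R. \<exists>b\<in>carrier R - {\<zero>\<^bsub>R\<^esub>}. x = a \<otimes>\<^bsub>K\<^esub> inv\<^bsub>K\<^esub> b)"

definition p_modular_system ::
    "nat \<Rightarrow> ('a, 'c) ring_scheme \<Rightarrow> ('a, 'd) ring_scheme \<Rightarrow> bool" where
  "p_modular_system p K R \<longleftrightarrow>
     Factorial_Ring.prime p \<and>
     complete_discrete_valuation_ring R \<and>
     is_fraction_field K R \<and>
     has_characteristic K 0 \<and>
     has_characteristic (residue_field R) p"

definition p_modular_extension ::
    "nat \<Rightarrow> ('a, 'c) ring_scheme \<Rightarrow> ('a, 'd) ring_scheme \<Rightarrow>
     ('a, 'e) ring_scheme \<Rightarrow> ('a, 'f) ring_scheme \<Rightarrow> bool" where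
  "p_modular_extension p K R K' R' \<longleftrightarrow>
     p_modular_system p K R \<and> p_modular_system p K' R' \<and>
     is_subring_of R R' \<and> jacobson_radical R \<subseteq> jacobson_radical R'"

definition absolutely_unramified :: "nat \<Rightarrow> ('a, 'c) ring_scheme \<Rightarrow> bool" where
  "absolutely_unramified p R \<longleftrightarrow> jacobson_radical R = PIdl\<^bsub>R\<^esub> (add_pow R p \<one>\<^bsub>R\<^esub>)"

text \<open>
  The residue field of \<open>R\<close> is embedded in that of \<open>R'\<close> by sending the class of \<open>x\<close> in \<open>R\<close> to
  the class of \<open>x\<close> in \<open>R'\<close>; its image is the subfield to be fixed.
\<close>

definition residue_galois_group ::
    "('a, 'c) ring_scheme \<Rightarrow> ('a, 'd) ring_scheme \<Rightarrow> ('a set \<Rightarrow> 'a set) set" where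
  "residue_galois_group R R' =
     {\<sigma> \<in> ring_iso (residue_field R') (residue_field R').
        \<forall>x\<in>carrier R. \<sigma> (jacobson_radical R' +>\<^bsub>R'\<^esub> x) = jacobson_radical R' +>\<^bsub>R'\<^esub> x}"

text \<open>Extensionality only makes the lift unique as a function on the whole type.\<close>

definition residue_lift :: "('a, 'c) ring_scheme \<Rightarrow> ('a set \<Rightarrow> 'a set) \<Rightarrow> 'a \<Rightarrow> 'a" where
  "residue_lift R' \<sigma> =
     (THE \<tau>. \<tau> \<in> ring_hom R' R' \<and> \<tau> \<in> extensional (carrier R') \<and>
        (\<forall>x\<in>carrier R'.
           \<sigma> (jacobson_radical R' +>\<^bsub>R'\<^esub> x) = jacobson_radical R' +>\<^bsub>R'\<^esub> \<tau> x))"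


section \<open>Modules over non-commutative rings\<close>

text \<open>
  The library locale \<^locale>\<open>module\<close> requires a commutative ring of scalars, and \<^locale>\<open>algebra\<close> a
  commutative algebra. As there, the fields \<open>mult\<close> and \<open>one\<close> of a module are irrelevant.
\<close>

locale left_module = R?: ring R + M?: abelian_group M
  for R :: "('r, 'c) ring_scheme" (structure) and M :: "('r, 'm, 'd) module_scheme" (structure) +
  assumes smult_closed:
      "\<lbrakk>a \<in> carrier R; x \<in> carrier M\<rbrakk> \<Longrightarrow> a \<odot>\<^bsub>M\<^esub> x \<in> carrier M"
    and smult_l_distr:
      "\<lbrakk>a \<in> carrier R; b \<in> carrier R; x \<in> carrier M\<rbrakk> \<Longrightarrow>
       (a \<oplus>\<^bsub>R\<^esub> b) \<odot>\<^bsub>M\<^esub> x = a \<odot>\<^bsub>M\<^esub> x \<oplus>\<^bsub>M\<^esub> b \<odot>\<^bsub>M\<^esub> x"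
    and smult_r_distr:
      "\<lbrakk>a \<in> carrier R; x \<in> carrier M; y \<in> carrier M\<rbrakk> \<Longrightarrow>
       a \<odot>\<^bsub>M\<^esub> (x \<oplus>\<^bsub>M\<^esub> y) = a \<odot>\<^bsub>M\<^esub> x \<oplus>\<^bsub>M\<^esub> a \<odot>\<^bsub>M\<^esub> y"
    and smult_assoc:
      "\<lbrakk>a \<in> carrier R; b \<in> carrier R; x \<in> carrier M\<rbrakk> \<Longrightarrow>
       (a \<otimes>\<^bsub>R\<^esub> b) \<odot>\<^bsub>M\<^esub> x = a \<odot>\<^bsub>M\<^esub> (b \<odot>\<^bsub>M\<^esub> x)"
    and smult_one:
      "x \<in> carrier M \<Longrightarrow> \<one>\<^bsub>R\<^esub> \<odot>\<^bsub>M\<^esub> x = x"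

locale associative_algebra = module R A + A?: ring A
  for R :: "('r, 'c) ring_scheme" (structure) and A :: "('r, 'a, 'd) module_scheme" (structure) +
  assumes smult_mult_left:
      "\<lbrakk>r \<in> carrier R; x \<in> carrier A; y \<in> carrier A\<rbrakk> \<Longrightarrow>
       (r \<odot>\<^bsub>A\<^esub> x) \<otimes>\<^bsub>A\<^esub> y = r \<odot>\<^bsub>A\<^esub> (x \<otimes>\<^bsub>A\<^esub> y)"
    and smult_mult_right:
      "\<lbrakk>r \<in> carrier R; x \<in> carrier A; y \<in> carrier A\<rbrakk> \<Longrightarrow>
       x \<otimes>\<^bsub>A\<^esub> (r \<odot>\<^bsub>A\<^esub> y) = r \<odot>\<^bsub>A\<^esub> (x \<otimes>\<^bsub>A\<^esub> y)"

definition finitely_generated_module ::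
    "('r, 'c) ring_scheme \<Rightarrow> ('r, 'm, 'd) module_scheme \<Rightarrow> bool" where
  "finitely_generated_module R M \<longleftrightarrow>
     (\<exists>S. finite S \<and> S \<subseteq> carrier M \<and>
        (\<forall>x\<in>carrier M. \<exists>c\<in>S \<rightarrow> carrier R. x = (\<Oplus>\<^bsub>M\<^esub>s\<in>S. c s \<odot>\<^bsub>M\<^esub> s)))"

definition left_module_hom ::
    "('r, 'c) ring_scheme \<Rightarrow> ('r, 'm, 'd) module_scheme \<Rightarrow> ('r, 'n, 'e) module_scheme \<Rightarrow>
     ('m \<Rightarrow> 'n) set" where
  "left_module_hom R M N =
     {h \<in> carrier M \<rightarrow> carrier N.
        (\<forall>x\<in>carrier M. \<forall>y\<in>carrier M. h (x \<oplus>\<^bsub>M\<^esub> y) = h x \<oplus>\<^bsub>N\<^esub> h y) \<and>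
        (\<forall>a\<in>carrier R. \<forall>x\<in>carrier M. h (a \<odot>\<^bsub>M\<^esub> x) = a \<odot>\<^bsub>N\<^esub> h x)}"

text \<open>A module over an \<open>R\<close>-algebra \<open>A\<close>, viewed as an \<open>R\<close>-module via \<open>r \<mapsto> r \<cdot> 1\<close>.\<close>

definition restrict_scalars ::
    "('r, 'a, 'c) module_scheme \<Rightarrow> ('a, 'm) module \<Rightarrow> ('r, 'm) module" where
  "restrict_scalars A M =
     \<lparr>carrier = carrier M, monoid.mult = monoid.mult M, monoid.one = monoid.one M,
      ring.zero = ring.zero M, ring.add = ring.add M,
      smult = (\<lambda>r x. (r \<odot>\<^bsub>A\<^esub> \<one>\<^bsub>A\<^esub>) \<odot>\<^bsub>M\<^esub> x)\<rparr>"

text \<open>A ring as an algebra over itself and, by the same operation, over any of its subrings.\<close>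

definition regular_algebra :: "('s, 'c) ring_scheme \<Rightarrow> ('s, 's) module" where
  "regular_algebra S =
     \<lparr>carrier = carrier S, monoid.mult = monoid.mult S, monoid.one = monoid.one S,
      ring.zero = ring.zero S, ring.add = ring.add S,
      smult = monoid.mult S\<rparr>"


section \<open>Tensor products\<close>

text \<open>
  For modules \<open>M\<close>, \<open>N\<close> over a commutative ring \<open>R\<close>, the tensor product is the free abelian group on
  \<open>M \<times> N\<close> modulo the subgroup generated by the bilinearity and balancing relations. The library's
  free abelian groups are written multiplicatively, so cosets are formed with \<open>#>\<close>.
\<close>

definition tensor_relations ::
    "('r, 'c) ring_scheme \<Rightarrow> ('r, 'm, 'd) module_scheme \<Rightarrow> ('r, 'n, 'e) module_scheme \<Rightarrow>
     ('m \<times> 'n \<Rightarrow>\<^sub>0 int) set" where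
  "tensor_relations R M N =
     generate (free_Abelian_group (carrier M \<times> carrier N))
      ({frag_of (x \<oplus>\<^bsub>M\<^esub> x', y) - frag_of (x, y) - frag_of (x', y) | x x' y.
          x \<in> carrier M \<and> x' \<in> carrier M \<and> y \<in> carrier N} \<union>
       {frag_of (x, y \<oplus>\<^bsub>N\<^esub> y') - frag_of (x, y) - frag_of (x, y') | x y y'.
          x \<in> carrier M \<and> y \<in> carrier N \<and> y' \<in> carrier N} \<union>
       {frag_of (r \<odot>\<^bsub>M\<^esub> x, y) - frag_of (x, r \<odot>\<^bsub>N\<^esub> y) | r x y.
          r \<in> carrier R \<and> x \<in> carrier M \<and> y \<in> carrier N})"

definition tensor_class ::
    "('r, 'c) ring_scheme \<Rightarrow> ('r, 'm, 'd) module_scheme \<Rightarrow> ('r, 'n, 'e) module_scheme \<Rightarrow>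
     ('m \<times> 'n \<Rightarrow>\<^sub>0 int) \<Rightarrow> ('m \<times> 'n \<Rightarrow>\<^sub>0 int) set" where
  "tensor_class R M N u =
     tensor_relations R M N #>\<^bsub>free_Abelian_group (carrier M \<times> carrier N)\<^esub> u"

definition tensor_group ::
    "('r, 'c) ring_scheme \<Rightarrow> ('r, 'm, 'd) module_scheme \<Rightarrow> ('r, 'n, 'e) module_scheme \<Rightarrow>
     ('m \<times> 'n \<Rightarrow>\<^sub>0 int) set monoid" where
  "tensor_group R M N =
     free_Abelian_group (carrier M \<times> carrier N) Mod tensor_relations R M N"

text \<open>
  The map \<open>x \<otimes> y \<mapsto> f x \<otimes> g y\<close> into the tensor product of \<open>M\<close> and \<open>N\<close>, for \<open>R\<close>-linear \<open>f\<close>, \<open>g\<close>.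
  As in \<^const>\<open>rcoset_mult\<close>, the union is over representatives of one coset, and all of its members
  coincide.
\<close>

definition tensor_map ::
    "('r, 'c) ring_scheme \<Rightarrow> ('r, 'm, 'd) module_scheme \<Rightarrow> ('r, 'n, 'e) module_scheme \<Rightarrow>
     ('u \<Rightarrow> 'm) \<Rightarrow> ('v \<Rightarrow> 'n) \<Rightarrow> ('u \<times> 'v \<Rightarrow>\<^sub>0 int) set \<Rightarrow> ('m \<times> 'n \<Rightarrow>\<^sub>0 int) set" where
  "tensor_map R M N f g P =
     (\<Union>u\<in>P. tensor_class R M N (frag_extend (\<lambda>(x, y). frag_of (f x, g y)) u))"

text \<open>
  The biadditive operation \<open>(a \<otimes> b) (x \<otimes> y) = f a x \<otimes> g b y\<close> with values in the tensor product of \<open>M\<close>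
  and \<open>N\<close>; it specialises both to the product of two algebras and to their action on a tensor
  product of modules.
\<close>

definition tensor_action ::
    "('r, 'c) ring_scheme \<Rightarrow> ('r, 'm, 'd) module_scheme \<Rightarrow> ('r, 'n, 'e) module_scheme \<Rightarrow>
     ('a \<Rightarrow> 'm \<Rightarrow> 'm) \<Rightarrow> ('b \<Rightarrow> 'n \<Rightarrow> 'n) \<Rightarrow>
     ('a \<times> 'b \<Rightarrow>\<^sub>0 int) set \<Rightarrow> ('m \<times> 'n \<Rightarrow>\<^sub>0 int) set \<Rightarrow> ('m \<times> 'n \<Rightarrow>\<^sub>0 int) set" where
  "tensor_action R M N f g P Q =
     (\<Union>u\<in>P. \<Union>v\<in>Q. tensor_class R M N
        (frag_extend (\<lambda>(a, b). frag_extend (\<lambda>(x, y). frag_of (f a x, g b y)) v) u))"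

definition tensor_algebra ::
    "('r, 'c) ring_scheme \<Rightarrow> ('r, 'a, 'd) module_scheme \<Rightarrow> ('r, 'b, 'e) module_scheme \<Rightarrow>
     ('a \<times> 'b \<Rightarrow>\<^sub>0 int) set ring" where
  "tensor_algebra R A B =
     \<lparr>carrier = carrier (tensor_group R A B),
      monoid.mult = tensor_action R A B (monoid.mult A) (monoid.mult B),
      monoid.one = tensor_class R A B (frag_of (\<one>\<^bsub>A\<^esub>, \<one>\<^bsub>B\<^esub>)),
      ring.zero = monoid.one (tensor_group R A B),
      ring.add = monoid.mult (tensor_group R A B)\<rparr>"

text \<open>\<open>S \<otimes>\<^sub>R A\<close> for an extension \<open>S\<close> of \<open>R\<close> and an \<open>R\<close>-algebra \<open>A\<close>.\<close>

definition base_change_algebra ::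
    "('s, 'c) ring_scheme \<Rightarrow> ('s, 'd) ring_scheme \<Rightarrow> ('s, 'a, 'e) module_scheme \<Rightarrow>
     ('s \<times> 'a \<Rightarrow>\<^sub>0 int) set ring" where
  "base_change_algebra R S A = tensor_algebra R (regular_algebra S) A"

text \<open>\<open>S \<otimes>\<^sub>R M\<close> as a module over \<open>S \<otimes>\<^sub>R A\<close>, for an \<open>A\<close>-module \<open>M\<close>.\<close>

definition base_change_module ::
    "('s, 'c) ring_scheme \<Rightarrow> ('s, 'd) ring_scheme \<Rightarrow> ('s, 'a, 'e) module_scheme \<Rightarrow>
     ('a, 'm) module \<Rightarrow> (('s \<times> 'a \<Rightarrow>\<^sub>0 int) set, ('s \<times> 'm \<Rightarrow>\<^sub>0 int) set) module" where
  "base_change_module R S A M =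
     (let T = tensor_group R (regular_algebra S) (restrict_scalars A M) in
      \<lparr>carrier = carrier T, monoid.mult = undefined, monoid.one = undefined,
       ring.zero = monoid.one T, ring.add = monoid.mult T,
       smult = tensor_action R (regular_algebra S) (restrict_scalars A M)
                 (monoid.mult S) (smult M)\<rparr>)"

text \<open>The twist of an \<open>S \<otimes>\<^sub>R A\<close>-module by an automorphism \<open>\<tau>\<close> of \<open>S\<close> over \<open>R\<close>.\<close>

definition galois_twist ::
    "('s, 'c) ring_scheme \<Rightarrow> ('s, 'd) ring_scheme \<Rightarrow> ('s, 'a, 'e) module_scheme \<Rightarrow> ('s \<Rightarrow> 's) \<Rightarrow>
     (('s \<times> 'a \<Rightarrow>\<^sub>0 int) set, 'm) module \<Rightarrow> (('s \<times> 'a \<Rightarrow>\<^sub>0 int) set, 'm) module" where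
  "galois_twist R S A \<tau> U =
     U\<lparr>smult := \<lambda>x u.
         tensor_map R (regular_algebra S) A (inv_into (carrier S) \<tau>) (\<lambda>a. a) x \<odot>\<^bsub>U\<^esub> u\<rparr>"


section \<open>Chain complexes\<close>

record ('r, 'm) chain_complex =
  chain_obj :: "int \<Rightarrow> ('r, 'm) module"
  chain_diff :: "int \<Rightarrow> 'm \<Rightarrow> 'm"

definition is_chain_complex :: "('r, 'c) ring_scheme \<Rightarrow> ('r, 'm) chain_complex \<Rightarrow> bool" where
  "is_chain_complex R C \<longleftrightarrow>
     (\<forall>n. left_module R (chain_obj C n)) \<and>
     (\<forall>n. chain_diff C n \<in> left_module_hom R (chain_obj C n) (chain_obj C (n - 1))) \<and>
     (\<forall>n. \<forall>x\<in>carrier (chain_obj C n).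
        chain_diff C (n - 1) (chain_diff C n x) = \<zero>\<^bsub>chain_obj C (n - 2)\<^esub>)"

definition bounded_complex :: "('r, 'm) chain_complex \<Rightarrow> bool" where
  "bounded_complex C \<longleftrightarrow>
     (\<exists>a b. \<forall>n. n < a \<or> b < n \<longrightarrow> carrier (chain_obj C n) = {\<zero>\<^bsub>chain_obj C n\<^esub>})"

definition is_bounded_fg_complex ::
    "('r, 'c) ring_scheme \<Rightarrow> ('r, 'm) chain_complex \<Rightarrow> bool" where
  "is_bounded_fg_complex R C \<longleftrightarrow>
     is_chain_complex R C \<and> bounded_complex C \<and>
     (\<forall>n. finitely_generated_module R (chain_obj C n))"

definition complex_isomorphic ::
    "('r, 'c) ring_scheme \<Rightarrow> ('r, 'm) chain_complex \<Rightarrow> ('r, 'n) chain_complex \<Rightarrow> bool" where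
  "complex_isomorphic R C D \<longleftrightarrow>
     (\<exists>f. \<forall>n.
        f n \<in> left_module_hom R (chain_obj C n) (chain_obj D n) \<and>
        bij_betw (f n) (carrier (chain_obj C n)) (carrier (chain_obj D n)) \<and>
        (\<forall>x\<in>carrier (chain_obj C n).
           f (n - 1) (chain_diff C n x) = chain_diff D n (f n x)))"

definition is_subcomplex ::
    "('r, 'c) ring_scheme \<Rightarrow> ('r, 'm) chain_complex \<Rightarrow> (int \<Rightarrow> 'm set) \<Rightarrow> bool" where
  "is_subcomplex R C D \<longleftrightarrow>
     (\<forall>n. submodule (D n) R (chain_obj C n) \<and> chain_diff C n ` D n \<subseteq> D (n - 1))"

text \<open>Nonzero, and not the (internal) direct sum of two nonzero subcomplexes.\<close>

definition indecomposable_complex ::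
    "('r, 'c) ring_scheme \<Rightarrow> ('r, 'm) chain_complex \<Rightarrow> bool" where
  "indecomposable_complex R C \<longleftrightarrow>
     (\<exists>n. carrier (chain_obj C n) \<noteq> {\<zero>\<^bsub>chain_obj C n\<^esub>}) \<and>
     (\<forall>D E. is_subcomplex R C D \<and> is_subcomplex R C E \<and>
        (\<forall>n. D n <+>\<^bsub>chain_obj C n\<^esub> E n = carrier (chain_obj C n)) \<and>
        (\<forall>n. D n \<inter> E n = {\<zero>\<^bsub>chain_obj C n\<^esub>}) \<longrightarrow>
        (\<forall>n. D n = {\<zero>\<^bsub>chain_obj C n\<^esub>}) \<or> (\<forall>n. E n = {\<zero>\<^bsub>chain_obj C n\<^esub>}))"

definition base_change_complex ::
    "('s, 'c) ring_scheme \<Rightarrow> ('s, 'd) ring_scheme \<Rightarrow> ('s, 'a, 'e) module_scheme \<Rightarrow>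
     ('a, 'm) chain_complex \<Rightarrow>
     (('s \<times> 'a \<Rightarrow>\<^sub>0 int) set, ('s \<times> 'm \<Rightarrow>\<^sub>0 int) set) chain_complex" where
  "base_change_complex R S A C =
     \<lparr>chain_obj = (\<lambda>n. base_change_module R S A (chain_obj C n)),
      chain_diff = (\<lambda>n. tensor_map R (regular_algebra S) (restrict_scalars A (chain_obj C (n - 1)))
                          (\<lambda>s. s) (chain_diff C n))\<rparr>"

definition galois_twist_complex ::
    "('s, 'c) ring_scheme \<Rightarrow> ('s, 'd) ring_scheme \<Rightarrow> ('s, 'a, 'e) module_scheme \<Rightarrow> ('s \<Rightarrow> 's) \<Rightarrow>
     (('s \<times> 'a \<Rightarrow>\<^sub>0 int) set, 'm) chain_complex \<Rightarrow>
     (('s \<times> 'a \<Rightarrow>\<^sub>0 int) set, 'm) chain_complex" where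
  "galois_twist_complex R S A \<tau> C =
     \<lparr>chain_obj = (\<lambda>n. galois_twist R S A \<tau> (chain_obj C n)), chain_diff = chain_diff C\<rparr>"

text \<open>Invariance under all twists by lifts of elements of the Galois group of the residue fields.\<close>

definition galois_stable ::
    "('s, 'c) ring_scheme \<Rightarrow> ('s, 'd) ring_scheme \<Rightarrow> ('s, 'a, 'e) module_scheme \<Rightarrow>
     (('s \<times> 'a \<Rightarrow>\<^sub>0 int) set, 'm) chain_complex \<Rightarrow> bool" where
  "galois_stable R S A C \<longleftrightarrow>
     (\<forall>\<sigma>\<in>residue_galois_group R S.
        complex_isomorphic (base_change_algebra R S A)
          (galois_twist_complex R S A (residue_lift S \<sigma>) C) C)"

end

theory Submission
  imports Defs "HOL-Library.Diagonal_Subsequence"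
begin

text \<open>
  Let \<open>F\<close> be the lift of Frobenius generating the Galois group, of order \<open>m\<close>. An \<open>S \<otimes> A\<close>-complex
  \<open>C\<close> descends to \<open>A\<close> as soon as it carries an \<open>A\<close>-linear, \<open>F\<close>-semilinear chain automorphism \<open>psi\<close>
  with \<open>psi\<^sup>m = 1\<close>: the fixed points of \<open>psi\<close> form the descended complex, because \<open>S\<close> has a basis and
  a dual basis for the trace form. Stability under Galois twists only provides a semilinear
  automorphism \<open>phi\<close>, and \<open>phi\<^sup>m\<close> need not be the identity.

  To correct \<open>phi\<close>, view endomorphisms of \<open>C\<close> as endomorphisms of its total module. They are compact
  for the \<open>p\<close>-adic topology, so Fitting's lemma applies and indecomposability makes every endomorphism
  bijective or topologically nilpotent. If \<open>psi\<^sup>m = phi\<^sup>m\<close>, then a Lagrange resolvent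
  \<open>\<Sum>\<^sub>i psi\<^sup>i \<theta> phi\<^sup>-\<^sup>i\<close> intertwines \<open>psi\<close> and \<open>phi\<close>, and since the identity is an \<open>S\<close>-linear
  combination of such resolvents, one of them is bijective. This is Hilbert 90 for the endomorphism ring, and it
  gives uniqueness. Modulo \<open>p\<^sup>k\<close> the units of the bicommutant of \<open>phi\<^sup>m\<close> form a finite abelian group
  normalised by \<open>phi\<close>; in a finite group, Hilbert 90 implies by counting that norms are surjective
  onto the invariants, so that some unit \<open>u\<close> satisfies \<open>(u phi)\<^sup>m = 1\<close> modulo \<open>p\<^sup>k\<close>. A limit of
  these \<open>u phi\<close> for \<open>k \<rightarrow> \<infinity>\<close> is the required \<open>psi\<close>.
\<close>

section \<open>Congruences in abelian groups\<close>

text \<open>Counting needs a finite group and the norm needs a commutative one; the unit group of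
  the endomorphism ring is in general neither. This dictates both the reduction modulo
  \<open>p ^ k\<close> and the passage to the bicommutant of \<open>phi ^^ m\<close>: it is
  commutative, it contains \<open>phi ^^ m\<close>, whose inverse has to be a norm, and it is stable
  under conjugation by \<open>phi\<close>, so that it also contains the resolvents comparing
  \<open>u phi\<close> with \<open>phi\<close>. The solutions found for different \<open>k\<close>
  are unrelated, and compactness takes the place of their coherence. The complex is replaced by a
  single module with a set of operators that endomorphisms must commute with. Limits, idempotents
  and resolvents are then formed once, and the conditions on a chain map are equations that survive
  all three constructions. The dual bases come from roots of unity. If \<open>z\<close> generates
  the nonzero residues of \<open>S\<close> and \<open>N\<close> is their number, then
  \<open>z^(-i) / N\<close> and \<open>z^i\<close> are dual for the trace form, since
  \<open>N\<close> is invertible modulo \<open>p\<close> although \<open>m\<close> may not be.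
  Averages over the powers of \<open>z\<close> also provide the lift of Frobenius.\<close>

definition add_hom :: "('a, 'c) ring_scheme \<Rightarrow> ('b, 'd) ring_scheme \<Rightarrow> ('a \<Rightarrow> 'b) set" where
 "add_hom G H =
   {f \<in> carrier G \<rightarrow> carrier H.
    \<forall>x\<in>carrier G. \<forall>y\<in>carrier G. f (x \<oplus>\<^bsub>G\<^esub> y) = f x \<oplus>\<^bsub>H\<^esub> f y}"

text \<open>Congruence modulo \<open>N G\<close>, with membership in the carrier built in so that
  congruences chain without side conditions. For \<open>N = 0\<close> it is equality, and one lemma
  on resolvents thereby covers both exact and approximate intertwining.\<close>

definition acong :: "('a, 'c) ring_scheme \<Rightarrow> nat \<Rightarrow> 'a \<Rightarrow> 'a \<Rightarrow> bool" where
 "acong G N x y \<longleftrightarrow>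
   x \<in> carrier G \<and> y \<in> carrier G \<and> (\<exists>z\<in>carrier G. x = y \<oplus>\<^bsub>G\<^esub> add_pow G N z)"

lemma add_homI:
 assumes "\<And>x. x \<in> carrier G \<Longrightarrow> f x \<in> carrier H"
  and "\<And>x y. \<lbrakk>x \<in> carrier G; y \<in> carrier G\<rbrakk> \<Longrightarrow> f (x \<oplus>\<^bsub>G\<^esub> y) = f x \<oplus>\<^bsub>H\<^esub> f y"
 shows "f \<in> add_hom G H"
 using assms by (auto simp: add_hom_def)

lemma add_hom_closed: "\<lbrakk>f \<in> add_hom G H; x \<in> carrier G\<rbrakk> \<Longrightarrow> f x \<in> carrier H"
 by (auto simp: add_hom_def)

lemma add_hom_add:
 "\<lbrakk>f \<in> add_hom G H; x \<in> carrier G; y \<in> carrier G\<rbrakk> \<Longrightarrow> f (x \<oplus>\<^bsub>G\<^esub> y) = f x \<oplus>\<^bsub>H\<^esub> f y"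
 by (auto simp: add_hom_def)

lemma add_hom_comp:
 "\<lbrakk>f \<in> add_hom G H; g \<in> add_hom H L\<rbrakk> \<Longrightarrow> (\<lambda>x. g (f x)) \<in> add_hom G L"
 by (auto simp: add_hom_def Pi_iff)

lemma add_hom_id: "(\<lambda>x. x) \<in> add_hom G G"
 by (auto simp: add_hom_def)

lemma add_hom_funpow: "f \<in> add_hom G G \<Longrightarrow> f ^^ n \<in> add_hom G G"
 by (induction n) (auto simp: add_hom_def Pi_iff)

lemma add_hom_zero:
 assumes "abelian_group G" "abelian_group H" "f \<in> add_hom G H"
 shows "f \<zero>\<^bsub>G\<^esub> = \<zero>\<^bsub>H\<^esub>"
proof -
 interpret G: abelian_group G by fact
 interpret H: abelian_group H by fact
 have "f \<zero>\<^bsub>G\<^esub> \<oplus>\<^bsub>H\<^esub> f \<zero>\<^bsub>G\<^esub> = f \<zero>\<^bsub>G\<^esub>"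
  using add_hom_add[OF assms(3), of "\<zero>\<^bsub>G\<^esub>" "\<zero>\<^bsub>G\<^esub>"] by simp
 then show ?thesis
  using add_hom_closed[OF assms(3), of "\<zero>\<^bsub>G\<^esub>"] by (metis G.zero_closed H.add.r_cancel_one)
qed

lemma add_hom_minus:
 assumes "abelian_group G" "abelian_group H" "f \<in> add_hom G H" "x \<in> carrier G"
 shows "f (\<ominus>\<^bsub>G\<^esub> x) = \<ominus>\<^bsub>H\<^esub> f x"
proof -
 interpret G: abelian_group G by fact
 interpret H: abelian_group H by fact
 have "f (\<ominus>\<^bsub>G\<^esub> x) \<oplus>\<^bsub>H\<^esub> f x = \<zero>\<^bsub>H\<^esub>"
  using add_hom_add[OF assms(3), of "\<ominus>\<^bsub>G\<^esub> x" x] assms add_hom_zero[OF assms(1-3)]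
  by (simp add: G.l_neg)
 then show ?thesis
  using assms add_hom_closed[OF assms(3)] by (metis G.a_inv_closed H.minus_equality)
qed

lemma add_hom_add_pow:
 assumes "abelian_group G" "abelian_group H" "f \<in> add_hom G H" "x \<in> carrier G"
 shows "f (add_pow G (n::nat) x) = add_pow H n (f x)"
proof -
 interpret G: abelian_group G by fact
 interpret H: abelian_group H by fact
 show ?thesis
  using assms add_hom_zero[OF assms(1-3)]
  by (induction n) (auto simp: add_hom_add)
qed

lemma add_hom_finsum:
 assumes "abelian_group G" "abelian_group H" "f \<in> add_hom G H" "g \<in> I \<rightarrow> carrier G"
 shows "f (\<Oplus>\<^bsub>G\<^esub>i\<in>I. g i) = (\<Oplus>\<^bsub>H\<^esub>i\<in>I. f (g i))"
proof -
 interpret G: abelian_group G by fact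
 interpret H: abelian_group H by fact
 note cl = add_hom_closed[OF assms(3)]
 show ?thesis
 proof (cases "finite I")
  case True
  then show ?thesis using assms(4)
  proof (induction I)
   case empty
   then show ?case by (simp add: add_hom_zero[OF assms(1-3)])
  next
   case (insert i I)
   then have "f (\<Oplus>\<^bsub>G\<^esub>i\<in>I. g i) = (\<Oplus>\<^bsub>H\<^esub>i\<in>I. f (g i))" by auto
   moreover have "(\<lambda>i. f (g i)) \<in> I \<rightarrow> carrier H" using insert by (auto intro: cl)
   ultimately show ?case
    using insert
    by (simp add: G.finsum_insert H.finsum_insert add_hom_add[OF assms(3)] cl Pi_iff
      G.finsum_closed)
  qed
 next
  case False
  then show ?thesis by (simp add: G.finsum_infinite H.finsum_infinite add_hom_zero[OF assms(1-3)])
 qed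
qed

lemma add_hom_finsum_fun:
 assumes "abelian_group G" "abelian_group H" "\<And>i. i \<in> I \<Longrightarrow> f i \<in> add_hom G H"
 shows "(\<lambda>x. \<Oplus>\<^bsub>H\<^esub>i\<in>I. f i x) \<in> add_hom G H"
proof (rule add_homI)
 interpret G: abelian_group G by fact
 interpret H: abelian_group H by fact
 note cl = add_hom_closed[OF assms(3)]
 show "(\<Oplus>\<^bsub>H\<^esub>i\<in>I. f i x) \<in> carrier H" if "x \<in> carrier G" for x
  using cl that by (intro H.finsum_closed) auto
 fix x y assume xy: "x \<in> carrier G" "y \<in> carrier G"
 have "(\<Oplus>\<^bsub>H\<^esub>i\<in>I. f i (x \<oplus>\<^bsub>G\<^esub> y)) = (\<Oplus>\<^bsub>H\<^esub>i\<in>I. f i x \<oplus>\<^bsub>H\<^esub> f i y)"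
  using cl xy by (intro H.finsum_cong') (auto simp: add_hom_add[OF assms(3)])
 also have "\<dots> = (\<Oplus>\<^bsub>H\<^esub>i\<in>I. f i x) \<oplus>\<^bsub>H\<^esub> (\<Oplus>\<^bsub>H\<^esub>i\<in>I. f i y)"
  using cl xy by (intro H.finsum_addf) auto
 finally show "(\<Oplus>\<^bsub>H\<^esub>i\<in>I. f i (x \<oplus>\<^bsub>G\<^esub> y)) =
   (\<Oplus>\<^bsub>H\<^esub>i\<in>I. f i x) \<oplus>\<^bsub>H\<^esub> (\<Oplus>\<^bsub>H\<^esub>i\<in>I. f i y)" .
qed

context abelian_group
begin

text \<open>The two sums of length \<open>n\<close> differ by \<open>g n\<close> and
  \<open>g 0\<close>, whatever \<open>g\<close> is. Not assuming periodicity allows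
  \<open>g n\<close> and \<open>g 0\<close> to be merely congruent, as happens for resolvents modulo
  \<open>p ^ k\<close>.\<close>

lemma finsum_shift:
 assumes "\<And>i. g i \<in> carrier G"
 shows "(\<Oplus>i\<in>{..<n}. g (Suc i)) \<oplus> g 0 = (\<Oplus>i\<in>{..<n::nat}. g i) \<oplus> g n"
proof (induction n)
 case (Suc n)
 have cl: "(\<Oplus>i\<in>{..<n}. g (Suc i)) \<in> carrier G" "(\<Oplus>i\<in>{..<n}. g i) \<in> carrier G" for n
  using assms by (auto intro!: finsum_closed)
 have "(\<Oplus>i\<in>{..<Suc n}. g (Suc i)) \<oplus> g 0 = g (Suc n) \<oplus> ((\<Oplus>i\<in>{..<n}. g (Suc i)) \<oplus> g 0)"
  unfolding lessThan_Suc using assms cl by (subst finsum_insert) (auto simp: a_assoc)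
 also have "\<dots> = (\<Oplus>i\<in>{..<Suc n}. g i) \<oplus> g (Suc n)"
  unfolding Suc lessThan_Suc using assms cl by (subst finsum_insert) (auto simp: a_ac)
 finally show ?case .
qed simp

lemma finsum_cyclic_shift:
 assumes "\<And>i. g i \<in> carrier G" "g N = g 0"
 shows "(\<Oplus>i\<in>{..<N}. g (Suc i)) = (\<Oplus>i\<in>{..<N::nat}. g i)"
proof -
 have "(\<Oplus>i\<in>{..<N}. g (Suc i)) \<in> carrier G" "(\<Oplus>i\<in>{..<N}. g i) \<in> carrier G"
  using assms(1) by (auto intro!: finsum_closed)
 then show ?thesis using finsum_shift[of g N, OF assms(1)] assms by simp
qed

lemma diff_zero_imp_eq:
 assumes "x \<in> carrier G" "y \<in> carrier G" "x \<oplus> \<ominus> y = \<zero>"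
 shows "x = y"
 using assms by (metis a_inv_closed add.inv_equality minus_minus)

lemma acong_carrier: "acong G N x y \<Longrightarrow> x \<in> carrier G" "acong G N x y \<Longrightarrow> y \<in> carrier G"
 by (auto simp: acong_def)

lemma acong_refl: "x \<in> carrier G \<Longrightarrow> acong G N x x"
 by (auto simp: acong_def intro!: bexI[of _ \<zero>])

lemma acong_sym: "acong G N x y \<Longrightarrow> acong G N y x"
proof -
 assume "acong G N x y"
 then obtain z where z: "z \<in> carrier G" "x \<in> carrier G" "y \<in> carrier G" "x = y \<oplus> add_pow G N z"
  by (auto simp: acong_def)
 then have "y = x \<oplus> add_pow G N (\<ominus> z)"
  by (simp add: add.nat_pow_inv a_assoc r_neg)
 then show ?thesis using z unfolding acong_def by blast
qed

lemma acong_trans [trans]: "\<lbrakk>acong G N x y; acong G N y z\<rbrakk> \<Longrightarrow> acong G N x z"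
proof -
 assume "acong G N x y" "acong G N y z"
 then obtain u v where z: "u \<in> carrier G" "v \<in> carrier G" "x \<in> carrier G" "y \<in> carrier G"
   "z \<in> carrier G" "x = y \<oplus> add_pow G N u" "y = z \<oplus> add_pow G N v"
  by (auto simp: acong_def)
 then have "x = z \<oplus> add_pow G N (v \<oplus> u)"
  by (simp add: add.nat_pow_distrib a_assoc)
 then show ?thesis using z unfolding acong_def by blast
qed

lemma acong_join: "\<lbrakk>acong G N x z; acong G N y z\<rbrakk> \<Longrightarrow> acong G N x y"
 by (rule acong_trans[OF _ acong_sym])

lemma acong_add: "\<lbrakk>acong G N x y; acong G N x' y'\<rbrakk> \<Longrightarrow> acong G N (x \<oplus> x') (y \<oplus> y')"
proof -
 assume "acong G N x y" "acong G N x' y'"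
 then obtain u v where z: "u \<in> carrier G" "v \<in> carrier G" "x \<in> carrier G" "y \<in> carrier G"
   "x' \<in> carrier G" "y' \<in> carrier G" "x = y \<oplus> add_pow G N u" "x' = y' \<oplus> add_pow G N v"
  by (auto simp: acong_def)
 then have "x \<oplus> x' = (y \<oplus> y') \<oplus> add_pow G N (u \<oplus> v)"
  by (simp add: add.nat_pow_distrib a_ac)
 then show ?thesis using z unfolding acong_def by blast
qed

lemma acong_dvd: "\<lbrakk>acong G N x y; N' dvd N\<rbrakk> \<Longrightarrow> acong G N' x y"
proof -
 assume "acong G N x y" "N' dvd N"
 then obtain u k where z: "u \<in> carrier G" "x \<in> carrier G" "y \<in> carrier G"
   "x = y \<oplus> add_pow G N u" "N = k * N'"
  unfolding acong_def by (metis dvdE mult.commute)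
 then have "x = y \<oplus> add_pow G N' (add_pow G k u)"
  by (simp add: add.nat_pow_pow mult.commute)
 moreover have "add_pow G k u \<in> carrier G" using z by simp
 ultimately show ?thesis using z unfolding acong_def by blast
qed

lemma acong_le_power: "\<lbrakk>acong G (p ^ n) x y; k \<le> n\<rbrakk> \<Longrightarrow> acong G (p ^ k) x y"
 by (rule acong_dvd) (auto simp: le_imp_power_dvd)

lemma acong_zero_iff: "acong G 0 x y \<longleftrightarrow> x \<in> carrier G \<and> x = y"
 by (auto simp: acong_def)

lemma acong_one: "\<lbrakk>x \<in> carrier G; y \<in> carrier G\<rbrakk> \<Longrightarrow> acong G 1 x y"
 unfolding acong_def by (auto intro!: bexI[of _ "\<ominus> y \<oplus> x"] simp: r_neg2)

lemma acong_add_pow: "x \<in> carrier G \<Longrightarrow> acong G N (add_pow G N x) \<zero>"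
 unfolding acong_def by auto

lemma acong_zeroE:
 assumes "acong G N x \<zero>" obtains z where "z \<in> carrier G" "x = add_pow G N z"
 using assms by (auto simp: acong_def)

lemma acong_add_hom:
 assumes "acong G N x y" "abelian_group H" "f \<in> add_hom G H"
 shows "acong H N (f x) (f y)"
proof -
 obtain u where u: "u \<in> carrier G" "x \<in> carrier G" "y \<in> carrier G" "x = y \<oplus> add_pow G N u"
  using assms(1) by (auto simp: acong_def)
 have "f x = f y \<oplus>\<^bsub>H\<^esub> add_pow H N (f u)"
  using u add_hom_add_pow[OF abelian_group_axioms assms(2,3)]
  by (simp add: add_hom_add[OF assms(3)])
 then show ?thesis
  using u add_hom_closed[OF assms(3)] unfolding acong_def by blast
qed

lemma acong_mult_pow:
 fixes M :: nat
 assumes "acong G N x y" shows "acong G (M * N) (add_pow G M x) (add_pow G M y)"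
proof -
 obtain u where u: "u \<in> carrier G" "x \<in> carrier G" "y \<in> carrier G" "x = y \<oplus> add_pow G N u"
  using assms by (auto simp: acong_def)
 then have "add_pow G M x = add_pow G M y \<oplus> add_pow G (M * N) u"
  by (simp add: add.nat_pow_distrib add.nat_pow_pow mult.commute)
 then show ?thesis using u unfolding acong_def by (meson add.nat_pow_closed)
qed

lemma acong_finsum:
 assumes "\<And>i. i \<in> I \<Longrightarrow> acong G N (f i) (g i)"
 shows "acong G N (\<Oplus>i\<in>I. f i) (\<Oplus>i\<in>I. g i)"
proof (cases "finite I")
 case True
 then show ?thesis using assms
 proof (induction I)
  case (insert i I)
  then have "f \<in> I \<rightarrow> carrier G" "g \<in> I \<rightarrow> carrier G" "f i \<in> carrier G" "g i \<in> carrier G"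
   using acong_carrier by blast+
  then show ?case using insert by (auto simp: finsum_insert intro!: acong_add)
 qed (simp add: acong_refl)
qed (simp add: finsum_infinite acong_refl)

lemma finsum_swap:
 assumes "finite I" "finite J" "\<And>i j. \<lbrakk>i \<in> I; j \<in> J\<rbrakk> \<Longrightarrow> f i j \<in> carrier G"
 shows "(\<Oplus>i\<in>I. \<Oplus>j\<in>J. f i j) = (\<Oplus>j\<in>J. \<Oplus>i\<in>I. f i j)"
 using assms(1,3)
proof (induction I)
 case empty
 then show ?case by simp
next
 case (insert i I)
 have cl: "f i \<in> J \<rightarrow> carrier G" "\<And>j. j \<in> J \<Longrightarrow> (\<Oplus>i\<in>I. f i j) \<in> carrier G"
  "\<And>i. i \<in> I \<Longrightarrow> (\<Oplus>j\<in>J. f i j) \<in> carrier G"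
  using insert by (auto intro!: finsum_closed)
 have "(\<Oplus>j\<in>J. \<Oplus>i\<in>insert i I. f i j) = (\<Oplus>j\<in>J. f i j \<oplus> (\<Oplus>i\<in>I. f i j))"
  using insert cl by (intro finsum_cong') (auto simp: finsum_insert)
 also have "\<dots> = (\<Oplus>j\<in>J. f i j) \<oplus> (\<Oplus>j\<in>J. \<Oplus>i\<in>I. f i j)"
  using cl by (intro finsum_addf) auto
 also have "\<dots> = (\<Oplus>j\<in>J. f i j) \<oplus> (\<Oplus>i\<in>I. \<Oplus>j\<in>J. f i j)"
  using insert by auto
 also have "\<dots> = (\<Oplus>i\<in>insert i I. \<Oplus>j\<in>J. f i j)"
  using insert cl by (subst finsum_insert) (auto intro!: finsum_closed)
 finally show ?case by simp
qed

lemma finsum_delta: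
 assumes "finite I" "j \<in> I" "x \<in> carrier G" "\<And>i. i \<in> I \<Longrightarrow> f i = (if i = j then x else \<zero>)"
 shows "(\<Oplus>i\<in>I. f i) = x"
proof -
 have "(\<Oplus>i\<in>I. f i) = (\<Oplus>i\<in>I. if j = i then x else \<zero>)"
  using assms by (intro finsum_cong') auto
 then show ?thesis using finsum_singleton[of j I "\<lambda>_. x"] assms by simp
qed

end

text \<open>The three conditions say that \<open>G\<close> is the inverse limit of the finite groups
  \<open>G / p ^ k G\<close>, hence compact for the \<open>p\<close>-adic topology. Completeness is
  asked for sequences with the explicit rate \<open>p ^ n\<close>, so that no Cauchy modulus has to
  be carried along, and the limit inherits the same rate.\<close>

locale padic_group = abelian_group G for G (structure) +
 fixes p :: nat
 assumes separated:
   "\<lbrakk>x \<in> carrier G; \<And>k. acong G (p ^ k) x \<zero>\<rbrakk> \<Longrightarrow> x = \<zero>"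
  and complete:
   "(\<And>n. acong G (p ^ n) (f (Suc n)) (f n)) \<Longrightarrow> \<exists>l. \<forall>n. acong G (p ^ n) l (f n)"
  and finite_residue:
   "\<exists>W. finite W \<and> W \<subseteq> carrier G \<and> (\<forall>x\<in>carrier G. \<exists>y\<in>W. acong G p x y)"
begin

lemma acong_eqI:
 assumes "x \<in> carrier G" "y \<in> carrier G" "\<And>k. acong G (p ^ k) x y"
 shows "x = y"
proof -
 have "acong G (p ^ k) (x \<oplus> \<ominus> y) (y \<oplus> \<ominus> y)" for k
  using assms by (intro acong_add acong_refl) auto
 then have "x \<oplus> \<ominus> y = \<zero>"
  using assms by (intro separated) (auto simp: r_neg)
 then show ?thesis by (rule diff_zero_imp_eq[OF assms(1,2)])
qed

text \<open>Write \<open>x = y + p ^ k z\<close> with \<open>y\<close> from the representatives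
  modulo \<open>p ^ k\<close>, and replace \<open>z\<close> by its representative modulo
  \<open>p\<close>.\<close>

lemma finite_residue_power:
 "\<exists>W. finite W \<and> W \<subseteq> carrier G \<and> (\<forall>x\<in>carrier G. \<exists>y\<in>W. acong G (p ^ k) x y)"
proof (induction k)
 case 0
 show ?case by (rule exI[of _ "{\<zero>}"]) (use acong_one in auto)
next
 case (Suc k)
 then obtain W where W: "finite W" "W \<subseteq> carrier G" "\<And>x. x \<in> carrier G \<Longrightarrow> \<exists>y\<in>W. acong G (p ^ k) x y"
  by blast
 obtain Y where Y: "finite Y" "Y \<subseteq> carrier G" "\<And>x. x \<in> carrier G \<Longrightarrow> \<exists>y\<in>Y. acong G p x y"
  using finite_residue by blast
 let ?Z = "(\<lambda>(x, y). x \<oplus> add_pow G (p ^ k) y) ` (W \<times> Y)"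
 have "\<exists>y\<in>?Z. acong G (p ^ Suc k) x y" if xc: "x \<in> carrier G" for x
 proof -
  obtain y where y: "y \<in> W" "acong G (p ^ k) x y" using W(3)[OF xc] by blast
  then obtain z where z: "z \<in> carrier G" "x = y \<oplus> add_pow G (p ^ k) z" by (auto simp: acong_def)
  obtain w where w: "w \<in> Y" "acong G p z w" using Y(3)[OF z(1)] by blast
  have "acong G (p ^ Suc k) (add_pow G (p ^ k) z) (add_pow G (p ^ k) w)"
   unfolding power_Suc2 by (rule acong_mult_pow) (rule w)
  then have "acong G (p ^ Suc k) (y \<oplus> add_pow G (p ^ k) z) (y \<oplus> add_pow G (p ^ k) w)"
   using y(1) W(2) by (intro acong_add[OF acong_refl]) blast+
  then show ?thesis using z(2) y(1) w(1) by (intro bexI[of _ "y \<oplus> add_pow G (p ^ k) w"]) auto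
 qed
 then show ?case using W(1,2) Y(1,2) by (intro exI[of _ ?Z]) (auto intro!: a_closed add.nat_pow_closed)
qed

text \<open>\<open>W\<close> is the image of \<open>\<rho>\<close>, so it has exactly one element
  per class and \<open>\<rho>\<close> is constant on classes. It serves as a finite model of
  \<open>G / p ^ k G\<close> inside the type of \<open>G\<close>, without passing to sets of
  cosets.\<close>

lemma representatives:
 obtains W \<rho> where "finite W" "W \<subseteq> carrier G" "\<And>x. x \<in> carrier G \<Longrightarrow> \<rho> x \<in> W"
  "\<And>x. x \<in> carrier G \<Longrightarrow> acong G (p ^ k) (\<rho> x) x" "\<And>x. x \<in> W \<Longrightarrow> \<rho> x = x"
  "\<And>x y. acong G (p ^ k) x y \<Longrightarrow> \<rho> x = \<rho> y"
proof -
 obtain W where W: "finite W" "W \<subseteq> carrier G" "\<And>x. x \<in> carrier G \<Longrightarrow> \<exists>y\<in>W. acong G (p ^ k) x y"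
  using finite_residue_power[of k] by metis
 define \<rho> where "\<rho> x = (SOME y. y \<in> W \<and> acong G (p ^ k) x y)" for x
 have \<rho>: "\<rho> x \<in> W" "acong G (p ^ k) x (\<rho> x)" if "x \<in> carrier G" for x
 proof -
  have "\<exists>y. y \<in> W \<and> acong G (p ^ k) x y" using W(3)[OF that] by blast
  then have "\<rho> x \<in> W \<and> acong G (p ^ k) x (\<rho> x)" unfolding \<rho>_def by (rule someI_ex)
  then show "\<rho> x \<in> W" "acong G (p ^ k) x (\<rho> x)" by auto
 qed
 have eq: "\<rho> x = \<rho> y" if "acong G (p ^ k) x y" for x y
 proof -
  have "(\<lambda>z. z \<in> W \<and> acong G (p ^ k) x z) = (\<lambda>z. z \<in> W \<and> acong G (p ^ k) y z)"
   using that acong_trans acong_sym by blast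
  then show ?thesis by (simp add: \<rho>_def)
 qed
 show ?thesis
 proof (rule that[of "\<rho> ` carrier G" \<rho>])
  show "finite (\<rho> ` carrier G)" using \<rho> W finite_subset[of "\<rho> ` carrier G" W] by blast
  show "\<rho> x = x" if "x \<in> \<rho> ` carrier G" for x
   using that \<rho> eq acong_sym by auto
 qed (use \<rho> W eq acong_sym in auto)
qed

text \<open>Additive maps preserve congruence modulo \<open>p ^ k\<close>, so modulo
  \<open>p ^ k\<close> such a map is determined by its values on finitely many representatives, and
  only finitely many maps exist. Constant subsequences for every \<open>k\<close> and the diagonal
  argument give a uniformly convergent subsequence.\<close>

lemma add_hom_compact:
 fixes f :: "nat \<Rightarrow> 'a \<Rightarrow> 'a"
 assumes f: "\<And>n. f n \<in> add_hom G G"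
 obtains r g where "strict_mono r" "g \<in> add_hom G G"
  "\<And>k n x. \<lbrakk>k \<le> n; x \<in> carrier G\<rbrakk> \<Longrightarrow> acong G (p ^ k) (g x) (f (r n) x)"
proof -
 define P where "P k s \<longleftrightarrow> (\<forall>i j. \<forall>x\<in>carrier G. acong G (p ^ k) (f (s i) x) (f (s j) x))"
  for k and s :: "nat \<Rightarrow> nat"
 note cl = add_hom_closed[OF f]
 interpret subseqs P
 proof
  fix k and s :: "nat \<Rightarrow> nat" assume "strict_mono s"
  obtain W \<rho> where W: "finite W" "W \<subseteq> carrier G" "\<And>x. x \<in> carrier G \<Longrightarrow> \<rho> x \<in> W"
   "\<And>x. x \<in> carrier G \<Longrightarrow> acong G (p ^ k) (\<rho> x) x"
   "\<And>x. x \<in> W \<Longrightarrow> \<rho> x = x" "\<And>x y. acong G (p ^ k) x y \<Longrightarrow> \<rho> x = \<rho> y"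
   by (rule representatives[of k]; rule that; assumption)
  \<comment> \<open>The reduction of the \<open>i\<close>-th map modulo \<open>p ^ k\<close>, as an
    element of the finite set \<open>W \<rightarrow>\<^sub>E W\<close>.\<close>
  define h where "h i = restrict (\<lambda>x. \<rho> (f (s i) x)) W" for i
  have "h ` UNIV \<subseteq> (W \<rightarrow>\<^sub>E W)"
   unfolding h_def using W cl by (auto simp: subset_iff)
  then have "finite (h ` UNIV)"
   using W(1) by (meson finite_PiE finite_subset)
  then obtain i0 where i0: "infinite {i. h i = h i0}"
   using pigeonhole_infinite[of UNIV h] by auto
  define r where "r = enumerate {i. h i = h i0}"
  have "strict_mono r" unfolding r_def using i0 by (rule strict_mono_enumerate)
  moreover have hr: "h (r i) = h i0" for i
   using enumerate_in_set[OF i0] unfolding r_def by blast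
  have "acong G (p ^ k) (f (s (r i)) x) (f (s (r j)) x)" if x: "x \<in> carrier G" for i j x
  proof -
   have A: "acong G (p ^ k) (f (s i) x) (h i (\<rho> x))" for i
   proof -
    have "acong G (p ^ k) (f (s i) x) (f (s i) (\<rho> x))"
     by (rule acong_add_hom[OF acong_sym[OF W(4)[OF x]] abelian_group_axioms f])
    also have "acong G (p ^ k) (f (s i) (\<rho> x)) (h i (\<rho> x))"
     using W(2) W(3)[OF x] by (simp add: h_def subset_iff acong_sym[OF W(4)] cl)
    finally show ?thesis .
   qed
   have "acong G (p ^ k) (f (s (r i)) x) (h i0 (\<rho> x))" "acong G (p ^ k) (f (s (r j)) x) (h i0 (\<rho> x))"
    using A[of "r i"] A[of "r j"] hr by auto
   then show ?thesis by (rule acong_join)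
  qed
  ultimately show "\<exists>r'. strict_mono r' \<and> P k (s \<circ> r')"
   unfolding P_def by auto
 qed
 have D: "P k (diagseq \<circ> ((+) (Suc k)))" for k
  by (rule diagseq_holds) (auto simp: P_def)
 \<comment> \<open>The diagonal sequence is known to satisfy \<open>P k\<close> from index
   \<open>Suc k\<close> on; the shift by one makes agreement modulo \<open>p ^ k\<close> start at
   \<open>n = k\<close>.\<close>
 define r where "r n = diagseq (Suc n)" for n
 have r: "strict_mono r"
  using subseq_diagseq by (auto simp: r_def strict_mono_def)
 have C: "acong G (p ^ k) (f (r i) x) (f (r j) x)" if kij: "k \<le> i" "k \<le> j" and x: "x \<in> carrier G" for k i j x
 proof -
  obtain i' j' where "i = k + i'" "j = k + j'" using kij by (auto simp: le_iff_add)
  then show ?thesis using D[of k] x unfolding P_def r_def by auto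
 qed
 have "\<exists>l. \<forall>n. acong G (p ^ n) l (f (r n) x)" if "x \<in> carrier G" for x
  by (rule complete) (use C that in auto)
 then obtain g where g: "\<And>x n. x \<in> carrier G \<Longrightarrow> acong G (p ^ n) (g x) (f (r n) x)"
  by metis
 have g': "acong G (p ^ k) (g x) (f (r n) x)" if "k \<le> n" "x \<in> carrier G" for k n x
  using acong_le_power[OF g that(1)] that by blast
 have "g \<in> add_hom G G"
 proof (rule add_homI)
  show gc: "g x \<in> carrier G" if "x \<in> carrier G" for x
   using g[OF that] acong_carrier by blast
  fix x y assume xy: "x \<in> carrier G" "y \<in> carrier G"
  show "g (x \<oplus> y) = g x \<oplus> g y"
  proof (rule acong_eqI)
   fix k
   have "acong G (p ^ k) (g (x \<oplus> y)) (f (r k) x \<oplus> f (r k) y)"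
    using g[of "x \<oplus> y" k] xy by (simp add: add_hom_add[OF f])
   moreover have "acong G (p ^ k) (g x \<oplus> g y) (f (r k) x \<oplus> f (r k) y)"
    using g xy by (intro acong_add) auto
   ultimately show "acong G (p ^ k) (g (x \<oplus> y)) (g x \<oplus> g y)"
    by (rule acong_join)
  qed (use gc xy in auto)
 qed
 then show ?thesis using that r g' by blast
qed

text \<open>Modulo \<open>p ^ k\<close> the orbit of each \<open>x\<close> is eventually periodic,
  with preperiod and period at most the number \<open>N\<close> of residue classes. All periods
  divide \<open>fact N\<close>, which makes the statement uniform in \<open>x\<close>.\<close>

lemma funpow_stable:
 assumes f: "f \<in> add_hom G G"
 obtains N where "\<And>a b x. \<lbrakk>N \<le> a; N \<le> b; fact N dvd a; fact N dvd b; x \<in> carrier G\<rbrakk> \<Longrightarrow>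
  acong G (p ^ k) ((f ^^ a) x) ((f ^^ b) x)"
proof -
 obtain W \<rho> where W: "finite W" "W \<subseteq> carrier G" "\<And>x. x \<in> carrier G \<Longrightarrow> \<rho> x \<in> W"
  "\<And>x. x \<in> carrier G \<Longrightarrow> acong G (p ^ k) (\<rho> x) x"
  "\<And>x. x \<in> W \<Longrightarrow> \<rho> x = x" "\<And>x y. acong G (p ^ k) x y \<Longrightarrow> \<rho> x = \<rho> y"
  by (rule representatives[of k]; rule that; assumption)
 note fp = add_hom_funpow[OF f]
 note fpc = add_hom_closed[OF fp]
 have le: "acong G (p ^ k) ((f ^^ a) x) ((f ^^ b) x)"
  if ab: "card W \<le> a" "a \<le> b" "fact (card W) dvd a" "fact (card W) dvd b" and x: "x \<in> carrier G"
  for a b x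
 proof -
  have "\<not> inj_on (\<lambda>i. \<rho> ((f ^^ i) x)) {..card W}"
  proof
   assume "inj_on (\<lambda>i. \<rho> ((f ^^ i) x)) {..card W}"
   then have "card {..card W} \<le> card W"
    using W x fpc by (intro card_inj_on_le[OF _ _ W(1)]) auto
   then show False by simp
  qed
  then obtain i j where ij: "i < j" "j \<le> card W" "\<rho> ((f ^^ i) x) = \<rho> ((f ^^ j) x)"
   unfolding inj_on_def by (metis atMost_iff linorder_neqE_nat)
  define l where "l = j - i"
  have base: "acong G (p ^ k) ((f ^^ j) x) ((f ^^ i) x)"
   using ij(3) W(4) x fpc acong_trans acong_sym by metis
  have step: "acong G (p ^ k) ((f ^^ (t + l)) x) ((f ^^ t) x)" if "i \<le> t" for t
  proof -
   have "acong G (p ^ k) ((f ^^ (t - i)) ((f ^^ j) x)) ((f ^^ (t - i)) ((f ^^ i) x))"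
    by (rule acong_add_hom[OF base abelian_group_axioms fp])
   moreover have "t - i + j = t + l" "t - i + i = t" using that ij l_def by auto
   ultimately show ?thesis by (metis comp_apply funpow_add)
  qed
  have steps: "acong G (p ^ k) ((f ^^ (a + c * l)) x) ((f ^^ a) x)" for c
  proof (induction c)
   case 0 then show ?case using fpc x acong_refl by auto
  next
   case (Suc c)
   have "acong G (p ^ k) ((f ^^ (a + c * l + l)) x) ((f ^^ (a + c * l)) x)"
    by (rule step) (use ij ab in auto)
   moreover have "a + c * l + l = a + Suc c * l" by simp
   ultimately show ?case using Suc.IH acong_trans by metis
  qed
  have "l dvd fact (card W)" using ij l_def by (intro dvd_fact) auto
  then have "l dvd b - a" using ab by (meson dvd_diff_nat dvd_trans)
  then obtain c where "b - a = l * c" by (auto simp: dvd_def)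
  then have "b = a + c * l" using ab by (simp add: mult.commute)
  then show ?thesis using steps acong_sym by blast
 qed
 show ?thesis
 proof (rule that[of "card W"])
  fix a b x assume "card W \<le> a" "card W \<le> b" "fact (card W) dvd a" "fact (card W) dvd b" "x \<in> carrier G"
  then show "acong G (p ^ k) ((f ^^ a) x) ((f ^^ b) x)"
   using le acong_sym by (cases "a \<le> b") (auto intro: le simp: not_le)
 qed
qed

end

section \<open>Linear combinations\<close>

text \<open>Indexed by a family rather than a set of generators: families such as products of
  generators may repeat, and coefficients belong to indices.\<close>

definition lincomb ::
  "('r, 'm, 'd) module_scheme \<Rightarrow> 'i set \<Rightarrow> ('i \<Rightarrow> 'm) \<Rightarrow> ('i \<Rightarrow> 'r) \<Rightarrow> 'm" where
 "lincomb M I g c = (\<Oplus>\<^bsub>M\<^esub>i\<in>I. c i \<odot>\<^bsub>M\<^esub> g i)"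

context left_module
begin

lemma additive_smult_left: "x \<in> carrier M \<Longrightarrow> (\<lambda>a. a \<odot>\<^bsub>M\<^esub> x) \<in> add_hom R M"
 by (rule add_homI) (auto simp: smult_closed smult_l_distr)

lemma additive_smult_right: "a \<in> carrier R \<Longrightarrow> (\<lambda>x. a \<odot>\<^bsub>M\<^esub> x) \<in> add_hom M M"
 by (rule add_homI) (auto simp: smult_closed smult_r_distr)

lemma smult_zero_left: "x \<in> carrier M \<Longrightarrow> \<zero>\<^bsub>R\<^esub> \<odot>\<^bsub>M\<^esub> x = \<zero>\<^bsub>M\<^esub>"
 using add_hom_zero[OF R.abelian_group_axioms M.abelian_group_axioms additive_smult_left] .

lemma smult_zero_right: "a \<in> carrier R \<Longrightarrow> a \<odot>\<^bsub>M\<^esub> \<zero>\<^bsub>M\<^esub> = \<zero>\<^bsub>M\<^esub>"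
 using add_hom_zero[OF M.abelian_group_axioms M.abelian_group_axioms additive_smult_right] .

lemma smult_add_pow_right:
 "\<lbrakk>a \<in> carrier R; x \<in> carrier M\<rbrakk> \<Longrightarrow> a \<odot>\<^bsub>M\<^esub> add_pow M (n::nat) x = add_pow M n (a \<odot>\<^bsub>M\<^esub> x)"
 using add_hom_add_pow[OF M.abelian_group_axioms M.abelian_group_axioms additive_smult_right] .

lemma smult_add_pow_left:
 "\<lbrakk>a \<in> carrier R; x \<in> carrier M\<rbrakk> \<Longrightarrow> add_pow R (n::nat) a \<odot>\<^bsub>M\<^esub> x = add_pow M n (a \<odot>\<^bsub>M\<^esub> x)"
 using add_hom_add_pow[OF R.abelian_group_axioms M.abelian_group_axioms additive_smult_left] .

lemma additive_add_pow: "(\<lambda>x. add_pow M (n::nat) x) \<in> add_hom M M"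
 by (rule add_homI) (auto simp: M.add.nat_pow_distrib)

lemma lincomb_closed:
 "\<lbrakk>g \<in> I \<rightarrow> carrier M; c \<in> I \<rightarrow> carrier R\<rbrakk> \<Longrightarrow> lincomb M I g c \<in> carrier M"
 unfolding lincomb_def by (auto intro!: M.finsum_closed smult_closed)

lemma lincomb_cong:
 "\<lbrakk>I = I'; g' \<in> I' \<rightarrow> carrier M; c' \<in> I' \<rightarrow> carrier R; \<And>i. i \<in> I' \<Longrightarrow> g i = g' i;
  \<And>i. i \<in> I' \<Longrightarrow> c i = c' i\<rbrakk> \<Longrightarrow> lincomb M I g c = lincomb M I' g' c'"
 unfolding lincomb_def by (rule M.finsum_cong') (auto intro!: smult_closed)

lemma lincomb_insert:
 "\<lbrakk>finite I; i \<notin> I; g \<in> insert i I \<rightarrow> carrier M; c \<in> insert i I \<rightarrow> carrier R\<rbrakk> \<Longrightarrow>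
  lincomb M (insert i I) g c = c i \<odot>\<^bsub>M\<^esub> g i \<oplus>\<^bsub>M\<^esub> lincomb M I g c"
 unfolding lincomb_def by (rule M.finsum_insert) (auto intro!: smult_closed)

lemma lincomb_add:
 assumes "g \<in> I \<rightarrow> carrier M" "c \<in> I \<rightarrow> carrier R" "d \<in> I \<rightarrow> carrier R"
 shows "lincomb M I g (\<lambda>i. c i \<oplus>\<^bsub>R\<^esub> d i) = lincomb M I g c \<oplus>\<^bsub>M\<^esub> lincomb M I g d"
proof -
 have "lincomb M I g (\<lambda>i. c i \<oplus>\<^bsub>R\<^esub> d i) = (\<Oplus>\<^bsub>M\<^esub>i\<in>I. c i \<odot>\<^bsub>M\<^esub> g i \<oplus>\<^bsub>M\<^esub> d i \<odot>\<^bsub>M\<^esub> g i)"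
  unfolding lincomb_def using assms
  by (intro M.finsum_cong') (auto intro!: M.a_closed smult_closed smult_l_distr)
 also have "\<dots> = lincomb M I g c \<oplus>\<^bsub>M\<^esub> lincomb M I g d"
  unfolding lincomb_def using assms by (intro M.finsum_addf) (auto intro!: smult_closed)
 finally show ?thesis .
qed

lemma lincomb_smult:
 assumes "g \<in> I \<rightarrow> carrier M" "c \<in> I \<rightarrow> carrier R" "a \<in> carrier R"
 shows "lincomb M I g (\<lambda>i. a \<otimes>\<^bsub>R\<^esub> c i) = a \<odot>\<^bsub>M\<^esub> lincomb M I g c"
proof -
 have "a \<odot>\<^bsub>M\<^esub> lincomb M I g c = (\<Oplus>\<^bsub>M\<^esub>i\<in>I. a \<odot>\<^bsub>M\<^esub> (c i \<odot>\<^bsub>M\<^esub> g i))"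
  unfolding lincomb_def using assms
  by (intro add_hom_finsum[OF M.abelian_group_axioms M.abelian_group_axioms additive_smult_right])
    (auto intro!: smult_closed)
 also have "\<dots> = lincomb M I g (\<lambda>i. a \<otimes>\<^bsub>R\<^esub> c i)"
  unfolding lincomb_def using assms
  by (intro M.finsum_cong') (auto intro!: smult_closed R.m_closed simp: smult_assoc Pi_iff)
 finally show ?thesis by simp
qed

lemma lincomb_add_pow:
 assumes "g \<in> I \<rightarrow> carrier M" "c \<in> I \<rightarrow> carrier R"
 shows "lincomb M I g (\<lambda>i. add_pow R (n::nat) (c i)) = add_pow M n (lincomb M I g c)"
proof -
 have "add_pow M n (lincomb M I g c) = (\<Oplus>\<^bsub>M\<^esub>i\<in>I. add_pow M n (c i \<odot>\<^bsub>M\<^esub> g i))"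
  unfolding lincomb_def using assms
  by (intro add_hom_finsum[OF M.abelian_group_axioms M.abelian_group_axioms additive_add_pow])
    (auto intro!: smult_closed)
 also have "\<dots> = lincomb M I g (\<lambda>i. add_pow R (n::nat) (c i))"
  unfolding lincomb_def using assms
  by (intro M.finsum_cong')
    (auto intro!: smult_closed R.add.nat_pow_closed simp: smult_add_pow_left Pi_iff)
 finally show ?thesis by simp
qed

lemma lincomb_minus:
 assumes "g \<in> I \<rightarrow> carrier M" "c \<in> I \<rightarrow> carrier R"
 shows "lincomb M I g (\<lambda>i. \<ominus>\<^bsub>R\<^esub> c i) = \<ominus>\<^bsub>M\<^esub> lincomb M I g c"
proof -
 have "lincomb M I g (\<lambda>i. \<ominus>\<^bsub>R\<^esub> c i) \<oplus>\<^bsub>M\<^esub> lincomb M I g c = lincomb M I g (\<lambda>i. \<ominus>\<^bsub>R\<^esub> c i \<oplus>\<^bsub>R\<^esub> c i)"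
  using assms by (intro lincomb_add[symmetric]) auto
 also have "\<dots> = (\<Oplus>\<^bsub>M\<^esub>i\<in>I. \<zero>\<^bsub>M\<^esub>)"
  unfolding lincomb_def using assms
  by (intro M.finsum_cong') (auto simp: R.l_neg smult_zero_left Pi_iff)
 also have "\<dots> = \<zero>\<^bsub>M\<^esub>" by simp
 finally show ?thesis
  using assms by (intro M.minus_equality[symmetric]) (auto intro!: lincomb_closed)
qed

lemma lincomb_zero:
 assumes "g \<in> I \<rightarrow> carrier M" "\<And>i. i \<in> I \<Longrightarrow> c i = \<zero>\<^bsub>R\<^esub>"
 shows "lincomb M I g c = \<zero>\<^bsub>M\<^esub>"
proof -
 have "lincomb M I g c = (\<Oplus>\<^bsub>M\<^esub>i\<in>I. \<zero>\<^bsub>M\<^esub>)"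
  unfolding lincomb_def using assms by (intro M.finsum_cong') (auto simp: smult_zero_left Pi_iff)
 then show ?thesis by simp
qed

lemma lincomb_delta:
 assumes "finite I" "g \<in> I \<rightarrow> carrier M" "i \<in> I" "a \<in> carrier R"
 shows "lincomb M I g (\<lambda>j. if j = i then a else \<zero>\<^bsub>R\<^esub>) = a \<odot>\<^bsub>M\<^esub> g i"
 unfolding lincomb_def using assms
 by (intro M.finsum_delta[of _ i]) (auto intro!: smult_closed simp: smult_zero_left Pi_iff)

definition span_family :: "'i set \<Rightarrow> ('i \<Rightarrow> 'm) \<Rightarrow> 'm set" where
 "span_family I g = lincomb M I g ` (I \<rightarrow> carrier R)"

lemma span_family_add:
 assumes "g \<in> I \<rightarrow> carrier M" "x \<in> span_family I g" "y \<in> span_family I g"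
 shows "x \<oplus>\<^bsub>M\<^esub> y \<in> span_family I g"
proof -
 obtain c d where cd: "c \<in> I \<rightarrow> carrier R" "x = lincomb M I g c" "d \<in> I \<rightarrow> carrier R" "y = lincomb M I g d"
  using assms(2,3) by (auto simp: span_family_def)
 have "x \<oplus>\<^bsub>M\<^esub> y = lincomb M I g (\<lambda>i. c i \<oplus>\<^bsub>R\<^esub> d i)"
  unfolding cd(2,4) by (rule lincomb_add[OF assms(1) cd(1,3), symmetric])
 moreover have "(\<lambda>i. c i \<oplus>\<^bsub>R\<^esub> d i) \<in> I \<rightarrow> carrier R" using cd(1,3) by auto
 ultimately show ?thesis unfolding span_family_def by blast
qed

lemma span_family_minus:
 assumes "g \<in> I \<rightarrow> carrier M" "x \<in> span_family I g"
 shows "\<ominus>\<^bsub>M\<^esub> x \<in> span_family I g"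
proof -
 obtain c where c: "c \<in> I \<rightarrow> carrier R" "x = lincomb M I g c"
  using assms(2) by (auto simp: span_family_def)
 have "\<ominus>\<^bsub>M\<^esub> x = lincomb M I g (\<lambda>i. \<ominus>\<^bsub>R\<^esub> c i)"
  unfolding c(2) by (rule lincomb_minus[OF assms(1) c(1), symmetric])
 moreover have "(\<lambda>i. \<ominus>\<^bsub>R\<^esub> c i) \<in> I \<rightarrow> carrier R" using c(1) by auto
 ultimately show ?thesis unfolding span_family_def by blast
qed

lemma span_family_zero:
 assumes "g \<in> I \<rightarrow> carrier M" shows "\<zero>\<^bsub>M\<^esub> \<in> span_family I g"
 unfolding span_family_def
 using lincomb_zero[OF assms, of "\<lambda>_. \<zero>\<^bsub>R\<^esub>"] by (intro image_eqI[of _ _ "\<lambda>_. \<zero>\<^bsub>R\<^esub>"]) auto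

lemma span_family_gen:
 assumes "finite I" "g \<in> I \<rightarrow> carrier M" "i \<in> I" "a \<in> carrier R"
 shows "a \<odot>\<^bsub>M\<^esub> g i \<in> span_family I g"
 unfolding span_family_def
 using lincomb_delta[OF assms] assms(4)
 by (intro image_eqI[of _ _ "\<lambda>j. if j = i then a else \<zero>\<^bsub>R\<^esub>"]) auto

lemma span_family_finsum:
 assumes "g \<in> I \<rightarrow> carrier M" "\<And>j. j \<in> J \<Longrightarrow> f j \<in> span_family I g"
 shows "(\<Oplus>\<^bsub>M\<^esub>j\<in>J. f j) \<in> span_family I g"
proof (cases "finite J")
 case True
 have sub: "span_family I g \<subseteq> carrier M"
  unfolding span_family_def using lincomb_closed[OF assms(1)] by auto
 show ?thesis using True assms(2)
 proof (induction J)
  case empty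
  then show ?case using span_family_zero[OF assms(1)] by simp
 next
  case (insert j J)
  have fJ: "f \<in> J \<rightarrow> carrier M" "f j \<in> carrier M" using insert.prems sub by auto
  have "f j \<oplus>\<^bsub>M\<^esub> (\<Oplus>\<^bsub>M\<^esub>j\<in>J. f j) \<in> span_family I g"
   using insert by (intro span_family_add assms(1)) auto
  then show ?case using insert.hyps fJ by (simp add: M.finsum_insert)
 qed
qed (simp add: M.finsum_infinite span_family_zero[OF assms(1)])

text \<open>\<open>finitely_generated_module\<close> asks for a set of generators, where a
  non-injective family loses its indices. The induction over the index set merges the coefficients
  of equal generators.\<close>

lemma finitely_generated_familyI:
 assumes "finite I" "g \<in> I \<rightarrow> carrier M"
  and gen: "\<And>x. x \<in> carrier M \<Longrightarrow> \<exists>c\<in>I \<rightarrow> carrier R. x = lincomb M I g c"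
 shows "finitely_generated_module R M"
proof -
 let ?T = "g ` I"
 have T: "finite ?T" "?T \<subseteq> carrier M" "(\<lambda>t. t) \<in> ?T \<rightarrow> carrier M" using assms by auto
 have "\<exists>c\<in>?T \<rightarrow> carrier R. lincomb M I' g d = lincomb M ?T (\<lambda>t. t) c"
  if "d \<in> I' \<rightarrow> carrier R" "I' \<subseteq> I" for d I'
 proof -
  have "finite I'" using that assms finite_subset by blast
  then show ?thesis using that
  proof (induction I')
   case empty
   have "lincomb M {} g d = lincomb M ?T (\<lambda>t. t) (\<lambda>_. \<zero>\<^bsub>R\<^esub>)"
    using lincomb_zero[OF T(3), of "\<lambda>_. \<zero>\<^bsub>R\<^esub>"] by (simp add: lincomb_def)
   then show ?case by (rule bexI[of _ "\<lambda>_. \<zero>\<^bsub>R\<^esub>"]) auto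
  next
   case (insert i I')
   then obtain c where c: "c \<in> ?T \<rightarrow> carrier R" "lincomb M I' g d = lincomb M ?T (\<lambda>t. t) c" by auto
   define e where "e = (\<lambda>t. if t = g i then d i else \<zero>\<^bsub>R\<^esub>)"
   have e: "e \<in> ?T \<rightarrow> carrier R" "lincomb M ?T (\<lambda>t. t) e = d i \<odot>\<^bsub>M\<^esub> g i"
    using T insert.prems lincomb_delta[of ?T "\<lambda>t. t" "g i" "d i"] by (auto simp: e_def)
   have "g \<in> insert i I' \<rightarrow> carrier M" using insert assms by auto
   then have "lincomb M (insert i I') g d = lincomb M ?T (\<lambda>t. t) e \<oplus>\<^bsub>M\<^esub> lincomb M ?T (\<lambda>t. t) c"
    using insert e c by (subst lincomb_insert) auto
   also have "\<dots> = lincomb M ?T (\<lambda>t. t) (\<lambda>t. e t \<oplus>\<^bsub>R\<^esub> c t)"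
    using T e c by (intro lincomb_add[symmetric]) auto
   finally show ?case using e c by (intro bexI[of _ "\<lambda>t. e t \<oplus>\<^bsub>R\<^esub> c t"]) auto
  qed
 qed
 then have "\<exists>c\<in>?T \<rightarrow> carrier R. x = lincomb M ?T (\<lambda>t. t) c" if "x \<in> carrier M" for x
  using gen[OF that] by force
 then show ?thesis
  using T unfolding finitely_generated_module_def lincomb_def by (intro exI[of _ ?T]) auto
qed

lemma finitely_generated_spanI:
 assumes "finite I" "g \<in> I \<rightarrow> carrier M" "\<And>x. x \<in> carrier M \<Longrightarrow> x \<in> span_family I g"
 shows "finitely_generated_module R M"
 by (rule finitely_generated_familyI[OF assms(1,2)]) (use assms(3) in \<open>auto simp: span_family_def\<close>)

lemma finitely_generatedE:
 assumes "finitely_generated_module R M"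
 obtains T where "finite T" "T \<subseteq> carrier M"
  "\<And>x. x \<in> carrier M \<Longrightarrow> \<exists>c\<in>T \<rightarrow> carrier R. x = lincomb M T (\<lambda>t. t) c"
proof -
 obtain T where T: "finite T" "T \<subseteq> carrier M"
  "\<forall>x\<in>carrier M. \<exists>c\<in>T \<rightarrow> carrier R. x = (\<Oplus>\<^bsub>M\<^esub>s\<in>T. c s \<odot>\<^bsub>M\<^esub> s)"
  using assms unfolding finitely_generated_module_def by blast
 show ?thesis by (rule that[OF T(1,2)]) (use T(3) in \<open>simp add: lincomb_def\<close>)
qed

end

lemma (in module) left_module: "left_module R M"
 by (rule left_module.intro[OF R.ring_axioms M.abelian_group_axioms], rule left_module_axioms.intro)
  (auto simp: smult_l_distr smult_r_distr smult_assoc1)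

section \<open>Modules over an unramified complete discrete valuation ring\<close>

text \<open>A discrete valuation ring with uniformiser \<open>p\<close> and finite residue field,
  described by congruences: \<open>unit_or_p\<close> and \<open>one_not_p\<close> make
  \<open>p R\<close> the unique maximal ideal, and \<open>padic_group\<close> supplies completeness
  and finiteness of \<open>R / p R\<close>.\<close>

locale padic_ring = domain R + padic_group R p for R (structure) and p +
 assumes prime_p: "Factorial_Ring.prime (p::nat)"
  and p_nonzero: "add_pow R p \<one> \<noteq> \<zero>"
  and one_not_p: "\<not> acong R p \<one> \<zero>"
  and unit_or_p: "x \<in> carrier R \<Longrightarrow> x \<in> Units R \<or> acong R p x \<zero>"
begin

lemma add_pow_mult: "x \<in> carrier R \<Longrightarrow> add_pow R (n::nat) x = add_pow R n \<one> \<otimes> x"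
 using add_pow_ldistr[of \<one> x n] by simp

lemma p_torsion_free:
 assumes "x \<in> carrier R" "add_pow R (p ^ e) x = \<zero>"
 shows "x = \<zero>"
 using assms
proof (induction e)
 case (Suc e)
 have "add_pow R p (add_pow R (p ^ e) x) = \<zero>"
  using Suc.prems by (simp add: add.nat_pow_pow mult.commute)
 then have "add_pow R p \<one> \<otimes> add_pow R (p ^ e) x = \<zero>"
  using Suc.prems add_pow_mult[of "add_pow R (p ^ e) x" p] by simp
 then show ?case
  using Suc p_nonzero integral[of "add_pow R p \<one>" "add_pow R (p ^ e) x"] by auto
qed simp

lemma p_cancel:
 assumes "x \<in> carrier R" "y \<in> carrier R" "add_pow R (p ^ e) x = add_pow R (p ^ e) y"
 shows "x = y"
proof -
 have "add_pow R (p ^ e) (x \<oplus> \<ominus> y) = add_pow R (p ^ e) x \<oplus> \<ominus> add_pow R (p ^ e) y"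
  using assms(1,2) by (simp add: add.nat_pow_distrib add.nat_pow_inv)
 also have "\<dots> = \<zero>" using assms(2) unfolding assms(3) by (intro r_neg) simp
 finally have "x \<oplus> \<ominus> y = \<zero>" by (rule p_torsion_free[rotated]) (use assms(1,2) in simp)
 then show ?thesis by (rule diff_zero_imp_eq[OF assms(1,2)])
qed

text \<open>The exponent is one less than the least \<open>k\<close> for which \<open>p ^ k\<close>
  does not divide \<open>x\<close>; such a \<open>k\<close> exists because \<open>R\<close> is
  separated.\<close>

lemma p_factorization:
 assumes "x \<in> carrier R" "x \<noteq> \<zero>"
 obtains e u where "u \<in> Units R" "x = add_pow R (p ^ e) u"
proof -
 have ex: "\<exists>k. \<not> acong R (p ^ k) x \<zero>" using assms separated by blast
 define k where "k = (LEAST k. \<not> acong R (p ^ k) x \<zero>)"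
 have k: "\<not> acong R (p ^ k) x \<zero>" unfolding k_def by (rule LeastI_ex[OF ex])
 have "k \<noteq> 0" using k acong_one[OF assms(1), of \<zero>] by (metis power_0 zero_closed)
 then obtain e where e: "k = Suc e" by (cases k) auto
 have "acong R (p ^ e) x \<zero>"
  using not_less_Least[of e "\<lambda>k. \<not> acong R (p ^ k) x \<zero>"] e by (auto simp: k_def)
 then obtain u where u: "u \<in> carrier R" "x = add_pow R (p ^ e) u" by (rule acong_zeroE)
 have "\<not> acong R p u \<zero>"
 proof
  assume "acong R p u \<zero>"
  then have "acong R (p ^ e * p) (add_pow R (p ^ e) u) (add_pow R (p ^ e) \<zero>)"
   by (rule acong_mult_pow)
  then show False using k e u by (simp add: mult.commute)
 qed
 then show ?thesis using u unit_or_p that by blast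
qed

end

text \<open>\<open>e\<close> is the least valuation among the nonzero coefficients. Dividing a
  linear relation by \<open>p ^ e\<close> leaves a unit among its coefficients, so that one
  generator can be expressed by the others up to torsion.\<close>

lemma (in padic_ring) p_factorization_family:
 assumes "finite I" "c \<in> I \<rightarrow> carrier R" "i0 \<in> I" "c i0 \<noteq> \<zero>"
 obtains e d j where "j \<in> I" "d \<in> I \<rightarrow> carrier R" "d j \<in> Units R"
  "\<And>i. i \<in> I \<Longrightarrow> c i = add_pow R (p ^ e) (d i)"
proof -
 define Q where "Q e \<longleftrightarrow> (\<exists>j\<in>I. \<exists>u\<in>Units R. c j = add_pow R (p ^ e) u)" for e
 have "\<exists>e. Q e" using p_factorization[of "c i0"] assms unfolding Q_def by (metis PiE)
 then have "Q (LEAST e. Q e)" by (rule LeastI_ex)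
 then obtain e j u where e: "e = (LEAST e. Q e)" "j \<in> I" "u \<in> Units R" "c j = add_pow R (p ^ e) u"
  unfolding Q_def by blast
 have "\<exists>d. d \<in> carrier R \<and> c i = add_pow R (p ^ e) d" if i: "i \<in> I" for i
 proof (cases "c i = \<zero>")
  case True
  then show ?thesis by (intro exI[of _ \<zero>]) auto
 next
  case False
  then obtain e' u' where eu: "u' \<in> Units R" "c i = add_pow R (p ^ e') u'"
   using p_factorization[of "c i"] assms(2) i by (metis PiE)
  then have "Q e'" using i unfolding Q_def by blast
  then have "e \<le> e'" using e(1) by (simp add: Least_le)
  then have "p ^ e' = p ^ (e' - e) * p ^ e" by (simp flip: power_add)
  then show ?thesis
   using eu by (intro exI[of _ "add_pow R (p ^ (e' - e)) u'"]) (auto simp: add.nat_pow_pow Units_closed)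
 qed
 then obtain d where d: "\<And>i. i \<in> I \<Longrightarrow> d i \<in> carrier R \<and> c i = add_pow R (p ^ e) (d i)" by metis
 have "d j = u" using p_cancel[of "d j" u e] d[of j] e by (auto simp: Units_closed)
 then show ?thesis using that[of j d e] d e by auto
qed

locale padic_module = R?: padic_ring R p + module R M for R (structure) and p and M (structure) +
 assumes finitely_generated: "finitely_generated_module R M"
begin

interpretation lm: left_module R M by (rule left_module)

text \<open>Krull's intersection theorem, by induction on the number of generators. Without a
  nontrivial relation the coefficients are unique, and divisibility of \<open>x\<close> passes to
  them. With one, a generator is eliminated at the cost of a fixed power \<open>p ^ e\<close>, which
  is harmless since \<open>x\<close> is divisible by every power of \<open>p\<close>.\<close>

lemma separated_span:
 assumes "finite I" "g \<in> I \<rightarrow> carrier M" "x \<in> carrier M"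
  "\<And>k. \<exists>c\<in>I \<rightarrow> carrier R. x = add_pow M (p ^ k) (lincomb M I g c)"
 shows "x = \<zero>\<^bsub>M\<^esub>"
 using assms
proof (induction "card I" arbitrary: I)
 case 0
 then show ?case using 0(5)[of 0] by (auto simp: lincomb_def)
next
 case (Suc n)
 note I = Suc.prems(1) and g = Suc.prems(2) and x = Suc.prems(3)
 show ?case
 proof (cases "\<exists>c\<in>I \<rightarrow> carrier R. lincomb M I g c = \<zero>\<^bsub>M\<^esub> \<and> (\<exists>i\<in>I. c i \<noteq> \<zero>)")
  case False
  obtain c where c: "c \<in> I \<rightarrow> carrier R" "x = lincomb M I g c"
   using Suc.prems(4)[of 0] lm.lincomb_closed[OF g] by auto
  have "acong R (p ^ k) (c i) \<zero>" if i: "i \<in> I" for i k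
  proof -
   obtain d where d: "d \<in> I \<rightarrow> carrier R" "x = add_pow M (p ^ k) (lincomb M I g d)"
    using Suc.prems(4)[of k] by blast
   let ?d = "\<lambda>i. add_pow R (p ^ k) (d i)"
   have d': "?d \<in> I \<rightarrow> carrier R" "(\<lambda>i. \<ominus> ?d i) \<in> I \<rightarrow> carrier R" using d by auto
   have "lincomb M I g (\<lambda>i. c i \<oplus> \<ominus> ?d i) = lincomb M I g c \<oplus>\<^bsub>M\<^esub> \<ominus>\<^bsub>M\<^esub> lincomb M I g ?d"
    using lm.lincomb_add[OF g c(1) d'(2)] lm.lincomb_minus[OF g d'(1)] by simp
   also have "\<dots> = \<zero>\<^bsub>M\<^esub>"
    using lm.lincomb_add_pow[OF g d(1)] d(2) c(2) x by (simp add: M.r_neg)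
   finally have lc: "lincomb M I g (\<lambda>i. c i \<oplus> \<ominus> ?d i) = \<zero>\<^bsub>M\<^esub>" .
   have cd: "c i \<in> carrier R" "?d i \<in> carrier R" "(\<lambda>i. c i \<oplus> \<ominus> ?d i) \<in> I \<rightarrow> carrier R"
    using c d' i by auto
   have "c i \<oplus> \<ominus> ?d i = \<zero>"
    using False lc cd(3) i by blast
   then have "c i = ?d i"
    by (rule R.diff_zero_imp_eq[OF cd(1,2)])
   then show ?thesis using R.acong_add_pow[of "d i" "p ^ k"] d i by auto
  qed
  then have "c i = \<zero>" if "i \<in> I" for i using separated[of "c i"] c that by auto
  then show ?thesis using lm.lincomb_zero[OF g] c by auto
 next
  case True
  then obtain c i0 where c: "c \<in> I \<rightarrow> carrier R" "lincomb M I g c = \<zero>\<^bsub>M\<^esub>" "i0 \<in> I" "c i0 \<noteq> \<zero>" by blast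
  obtain e d j where e: "j \<in> I" and d: "d \<in> I \<rightarrow> carrier R" "d j \<in> Units R"
    "\<And>i. i \<in> I \<Longrightarrow> c i = add_pow R (p ^ e) (d i)"
   by (rule R.p_factorization_family[OF I c(1,3,4)]; rule that; assumption)
  define u where "u = d j"
  have dj: "d j = u" "u \<in> Units R" using d by (auto simp: u_def)
  define b where "b i = inv u \<otimes> d i" for i
  have u: "inv u \<in> carrier R" "u \<in> carrier R" using dj(2) by auto
  have b: "b \<in> I \<rightarrow> carrier R" "b j = \<one>"
   using funcset_mem[OF d(1)] u dj by (auto simp: b_def intro!: R.m_closed R.Units_l_inv)
  \<comment> \<open>The relation divided by \<open>p ^ e\<close> and by a unit, with coefficient
    \<open>\<one>\<close> at \<open>j\<close>. It need not vanish when \<open>M\<close> has torsion,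
    but \<open>p ^ e\<close> kills it.\<close>
  define h where "h = lincomb M I g b"
  have h: "h \<in> carrier M" unfolding h_def using lm.lincomb_closed g b by blast
  have h0: "add_pow M (p ^ e) h = \<zero>\<^bsub>M\<^esub>"
  proof -
   note dc = d(1)
   have "lincomb M I g c = lincomb M I g (\<lambda>i. add_pow R (p ^ e) (d i))"
    using d g by (intro lm.lincomb_cong) auto
   then have "add_pow M (p ^ e) (lincomb M I g d) = \<zero>\<^bsub>M\<^esub>"
    using lm.lincomb_add_pow[OF g dc] c by simp
   moreover have "h = inv u \<odot>\<^bsub>M\<^esub> lincomb M I g d"
    unfolding h_def b_def using lm.lincomb_smult[OF g dc u(1)] by simp
   ultimately show ?thesis
    using lm.smult_add_pow_right[of "inv u" "lincomb M I g d" "p ^ e"] u lm.lincomb_closed[OF g dc]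
    by (simp add: lm.smult_zero_right)
  qed
  let ?J = "I - {j}"
  have gJ: "g \<in> ?J \<rightarrow> carrier M" using g by auto
  have I': "I = insert j ?J" using e by auto
  have split: "lincomb M I g c' = c' j \<odot>\<^bsub>M\<^esub> g j \<oplus>\<^bsub>M\<^esub> lincomb M ?J g c'"
   if "c' \<in> I \<rightarrow> carrier R" for c'
   using lm.lincomb_insert[of ?J j g c'] I I' g that by auto
  show ?thesis
  proof (rule Suc.hyps(1)[of ?J])
   show "n = card ?J" using Suc.hyps(2) I e by simp
   show "\<exists>c\<in>?J \<rightarrow> carrier R. x = add_pow M (p ^ k) (lincomb M ?J g c)" for k
   proof -
    \<comment> \<open>Of the exponent \<open>e + k\<close>, the part \<open>e\<close> is spent on
      killing the multiple of \<open>h\<close> by which \<open>g j\<close> is eliminated.\<close>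
    obtain c' where c': "c' \<in> I \<rightarrow> carrier R" "x = add_pow M (p ^ (e + k)) (lincomb M I g c')"
     using Suc.prems(4) by blast
    let ?c1 = "\<lambda>i. \<ominus> (c' j \<otimes> b i)"
    let ?c2 = "\<lambda>i. c' i \<oplus> ?c1 i"
    have cj: "c' j \<in> carrier R" using c' e by auto
    have cc: "(\<lambda>i. c' j \<otimes> b i) \<in> I \<rightarrow> carrier R" "?c1 \<in> I \<rightarrow> carrier R" "?c2 \<in> I \<rightarrow> carrier R"
     using b c' cj by auto
    have lc: "lincomb M I g c' \<in> carrier M" using lm.lincomb_closed[OF g c'(1)] .
    have ch: "c' j \<odot>\<^bsub>M\<^esub> h \<in> carrier M" using cj h by (rule smult_closed)
    have "lincomb M I g ?c2 = lincomb M I g c' \<oplus>\<^bsub>M\<^esub> \<ominus>\<^bsub>M\<^esub> (c' j \<odot>\<^bsub>M\<^esub> h)"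
     unfolding h_def lm.lincomb_smult[OF g b(1) cj, symmetric] lm.lincomb_minus[OF g cc(1), symmetric]
     by (rule lm.lincomb_add[OF g c'(1) cc(2)])
    moreover have "lincomb M I g ?c2 = lincomb M ?J g ?c2"
    proof -
     have "?c2 j = \<zero>" using cj b(2) by (simp add: R.r_neg)
     then show ?thesis
      using split[OF cc(3)] lm.lincomb_closed[OF gJ, of ?c2] cc(3) lm.smult_zero_left[of "g j"] g e
      by (auto simp: Pi_iff)
    qed
    ultimately have eq: "lincomb M I g c' = lincomb M ?J g ?c2 \<oplus>\<^bsub>M\<^esub> c' j \<odot>\<^bsub>M\<^esub> h"
     using lc ch by (simp add: M.a_assoc M.l_neg)
    have ccJ: "?c2 \<in> ?J \<rightarrow> carrier R" using cc(3) by auto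
    have lJ: "lincomb M ?J g ?c2 \<in> carrier M" using lm.lincomb_closed[OF gJ, of ?c2] cc(3) by auto
    have "add_pow M (p ^ (e + k)) (c' j \<odot>\<^bsub>M\<^esub> h) = \<zero>\<^bsub>M\<^esub>"
    proof -
     have "add_pow M (p ^ e) (c' j \<odot>\<^bsub>M\<^esub> h) = \<zero>\<^bsub>M\<^esub>"
      using lm.smult_add_pow_right[OF cj h, of "p ^ e"] h0 lm.smult_zero_right[OF cj] by simp
     then show ?thesis
      using ch M.add.nat_pow_pow[of "c' j \<odot>\<^bsub>M\<^esub> h" "p ^ k" "p ^ e"]
      by (simp add: power_add mult.commute)
    qed
    then have "x = add_pow M (p ^ (e + k)) (lincomb M ?J g ?c2)"
     unfolding c'(2) eq using lJ ch by (simp add: M.add.nat_pow_distrib)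
    also have "\<dots> = add_pow M (p ^ k) (add_pow M (p ^ e) (lincomb M ?J g ?c2))"
     using lJ by (simp add: M.add.nat_pow_pow power_add mult.commute)
    also have "\<dots> = add_pow M (p ^ k) (lincomb M ?J g (\<lambda>i. add_pow R (p ^ e) (?c2 i)))"
     by (simp only: lm.lincomb_add_pow[OF gJ ccJ])
    finally show ?thesis using cc(3) by (intro bexI) auto
   qed
  qed (use I x gJ in auto)
 qed
qed

text \<open>Limits are taken in the coefficients. Consecutive differences are \<open>p ^ n\<close>
  times linear combinations of generators, and the partial sums of the chosen coefficients converge
  in \<open>R\<close>, whether or not these coefficients are unique. Relations among the generators
  matter for separatedness alone.\<close>

lemma padic_group_module: "padic_group M p"
proof -
 obtain T where T: "finite T" "T \<subseteq> carrier M"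
  "\<And>x. x \<in> carrier M \<Longrightarrow> \<exists>c\<in>T \<rightarrow> carrier R. x = lincomb M T (\<lambda>t. t) c"
  using lm.finitely_generatedE[OF finitely_generated] by metis
 have g: "(\<lambda>t. t) \<in> T \<rightarrow> carrier M" using T by auto
 note smc = R.acong_add_hom[OF _ M.abelian_group_axioms lm.additive_smult_left]
 show ?thesis
 proof
  fix x assume x: "x \<in> carrier M" and k: "\<And>k. acong M (p ^ k) x \<zero>\<^bsub>M\<^esub>"
  show "x = \<zero>\<^bsub>M\<^esub>"
  proof (rule separated_span[OF T(1) g x])
   fix k
   obtain z where "z \<in> carrier M" "x = add_pow M (p ^ k) z" using k M.acong_zeroE by blast
   then show "\<exists>c\<in>T \<rightarrow> carrier R. x = add_pow M (p ^ k) (lincomb M T (\<lambda>t. t) c)" using T(3) by blast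
  qed
 next
  fix f assume f: "\<And>n. acong M (p ^ n) (f (Suc n)) (f n)"
  have fc: "f n \<in> carrier M" for n using f M.acong_carrier by blast
  have "\<exists>c\<in>T \<rightarrow> carrier R. f (Suc n) = f n \<oplus>\<^bsub>M\<^esub> add_pow M (p ^ n) (lincomb M T (\<lambda>t. t) c)" for n
   using f[of n] T(3) unfolding acong_def by metis
  then obtain c where c: "\<And>n. c n \<in> T \<rightarrow> carrier R"
    "\<And>n. f (Suc n) = f n \<oplus>\<^bsub>M\<^esub> add_pow M (p ^ n) (lincomb M T (\<lambda>t. t) (c n))" by metis
  define s where "s n t = (\<Oplus>j\<in>{..<n}. add_pow R (p ^ j) (c j t))" for n t
  have s: "s n \<in> T \<rightarrow> carrier R" for n
   unfolding s_def using c by (auto intro!: R.finsum_closed)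
  have sS: "s (Suc n) t = s n t \<oplus> add_pow R (p ^ n) (c n t)" if "t \<in> T" for n t
   unfolding s_def lessThan_Suc using c(1) that
   by (subst R.finsum_insert) (auto intro!: R.a_comm R.finsum_closed R.add.nat_pow_closed)
  have "\<exists>l. \<forall>n. acong R (p ^ n) l (s n t)" if "t \<in> T" for t
  proof (rule complete)
   fix n
   have "c n t \<in> carrier R" "s n t \<in> carrier R" using c(1)[of n] s[of n] that by auto
   then show "acong R (p ^ n) (s (Suc n) t) (s n t)"
    using sS[OF that] unfolding acong_def by (auto intro!: R.a_closed)
  qed
  then obtain l where l: "\<And>t n. t \<in> T \<Longrightarrow> acong R (p ^ n) (l t) (s n t)" by metis
  have eq: "f n = f 0 \<oplus>\<^bsub>M\<^esub> lincomb M T (\<lambda>t. t) (s n)" for n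
  proof (induction n)
   case 0
   have "lincomb M T (\<lambda>t. t) (s 0) = \<zero>\<^bsub>M\<^esub>" by (rule lm.lincomb_zero[OF g]) (simp add: s_def)
   then show ?case using fc by simp
  next
   case (Suc n)
   have pc: "(\<lambda>t. add_pow R (p ^ n) (c n t)) \<in> T \<rightarrow> carrier R" using c by auto
   have "lincomb M T (\<lambda>t. t) (s (Suc n)) = lincomb M T (\<lambda>t. t) (\<lambda>t. s n t \<oplus> add_pow R (p ^ n) (c n t))"
    using sS funcset_mem[OF s[of n]] funcset_mem[OF c(1)[of n]] g
    by (intro lm.lincomb_cong) (auto intro!: R.a_closed R.add.nat_pow_closed)
   also have "\<dots> = lincomb M T (\<lambda>t. t) (s n) \<oplus>\<^bsub>M\<^esub> add_pow M (p ^ n) (lincomb M T (\<lambda>t. t) (c n))"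
    using lm.lincomb_add[OF g s pc] lm.lincomb_add_pow[OF g c(1)] by simp
   finally show ?case
    using c(2)[of n] Suc fc lm.lincomb_closed[OF g s] lm.lincomb_closed[OF g c(1)]
    by (simp add: M.a_assoc)
  qed
  show "\<exists>l. \<forall>n. acong M (p ^ n) l (f n)"
  proof (intro exI allI)
   fix n
   have "acong M (p ^ n) (lincomb M T (\<lambda>t. t) l) (lincomb M T (\<lambda>t. t) (s n))"
    unfolding lincomb_def using T l by (intro M.acong_finsum smc) auto
   then show "acong M (p ^ n) (f 0 \<oplus>\<^bsub>M\<^esub> lincomb M T (\<lambda>t. t) l) (f n)"
    unfolding eq[of n] using fc by (intro M.acong_add M.acong_refl)
  qed
 next
  obtain Y where Y: "finite Y" "Y \<subseteq> carrier R" "\<And>x. x \<in> carrier R \<Longrightarrow> \<exists>y\<in>Y. acong R p x y"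
   using finite_residue by metis
  let ?W = "(\<lambda>c. lincomb M T (\<lambda>t. t) c) ` (T \<rightarrow>\<^sub>E Y)"
  have "finite ?W" using T Y by (intro finite_imageI finite_PiE) auto
  moreover have "?W \<subseteq> carrier M" using Y g by (auto intro!: lm.lincomb_closed)
  moreover have "\<exists>y\<in>?W. acong M p x y" if x: "x \<in> carrier M" for x
  proof -
   obtain c where c: "c \<in> T \<rightarrow> carrier R" "x = lincomb M T (\<lambda>t. t) c" using T(3)[OF x] by blast
   have "\<forall>t\<in>T. \<exists>y. y \<in> Y \<and> acong R p (c t) y" using Y(3) c(1) by blast
   then obtain d where d: "\<And>t. t \<in> T \<Longrightarrow> d t \<in> Y \<and> acong R p (c t) (d t)" by metis
   have "acong M p x (lincomb M T (\<lambda>t. t) (restrict d T))"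
    unfolding c(2) lincomb_def using T d by (intro M.acong_finsum smc) auto
   then show ?thesis using d by (intro bexI[of _ "lincomb M T (\<lambda>t. t) (restrict d T)"]) auto
  qed
  ultimately show "\<exists>W. finite W \<and> W \<subseteq> carrier M \<and> (\<forall>x\<in>carrier M. \<exists>y\<in>W. acong M p x y)"
   by (intro exI[of _ ?W]) blast
 qed
qed

end

section \<open>Teichmueller representatives and lifts of residue automorphisms\<close>

context cring
begin

lemma binomial_expansion:
 assumes xy: "x \<in> carrier R" "y \<in> carrier R"
 shows "(x \<oplus> y) [^] (n::nat) = (\<Oplus>k\<in>{..n}. add_pow R (n choose k) (x [^] k \<otimes> y [^] (n - k)))"
proof (induction n)
 case 0
 show ?case using xy by simp
next
 case (Suc n)
 define t where "t k = x [^] k \<otimes> y [^] (n - k)" for k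
 define h where "h k = add_pow R (n choose k) (x [^] k \<otimes> y [^] (Suc n - k))" for k
 define f where "f k = add_pow R (n choose k) (x [^] Suc k \<otimes> y [^] (n - k))" for k
 define g where "g k = add_pow R (Suc n choose k) (x [^] k \<otimes> y [^] (Suc n - k))" for k
 have cl: "\<And>k. t k \<in> carrier R" "\<And>k. h k \<in> carrier R" "\<And>k. f k \<in> carrier R" "\<And>k. g k \<in> carrier R"
  using xy by (auto simp: t_def h_def f_def g_def simp del: nat_pow_Suc)
 let ?b = "\<lambda>k. add_pow R (n choose k) (t k)"
 have bx: "?b k \<otimes> x = f k" for k
 proof -
  have "t k \<otimes> x = x [^] Suc k \<otimes> y [^] (n - k)" using xy by (simp add: t_def m_ac)
  then show ?thesis using xy cl(1)[of k] unfolding f_def by (simp add: add_pow_ldistr)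
 qed
 have by': "?b k \<otimes> y = h k" if "k \<le> n" for k
 proof -
  have "Suc n - k = Suc (n - k)" using that by simp
  then show ?thesis using xy cl(1)[of k] unfolding h_def t_def
   by (simp add: add_pow_ldistr m_assoc)
 qed
 have "(x \<oplus> y) [^] Suc n = (\<Oplus>k\<in>{..n}. ?b k) \<otimes> x \<oplus> (\<Oplus>k\<in>{..n}. ?b k) \<otimes> y"
  using Suc xy cl(1) unfolding t_def[symmetric] by (simp add: r_distr finsum_closed)
 also have "\<dots> = (\<Oplus>k\<in>{..n}. f k) \<oplus> (\<Oplus>k\<in>{..n}. h k)"
 proof -
  have "(\<Oplus>k\<in>{..n}. ?b k) \<otimes> x = (\<Oplus>k\<in>{..n}. f k)"
   using xy cl by (subst finsum_ldistr) (auto simp: bx)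
  moreover have "(\<Oplus>k\<in>{..n}. ?b k) \<otimes> y = (\<Oplus>k\<in>{..n}. h k)"
   using xy cl by (subst finsum_ldistr) (auto simp: by' intro!: finsum_cong')
  ultimately show ?thesis by simp
 qed
 also have "(\<Oplus>k\<in>{..n}. h k) = (\<Oplus>k\<in>{..Suc n}. h k)"
 proof -
  have "h (Suc n) = \<zero>" unfolding h_def by (simp add: binomial_eq_0)
  then show ?thesis using cl by (simp add: finsum_Suc)
 qed
 also have "\<dots> = (\<Oplus>k\<in>{..n}. h (Suc k)) \<oplus> h 0"
  by (rule finsum_Suc2) (use cl in auto)
 also have "(\<Oplus>k\<in>{..n}. f k) \<oplus> ((\<Oplus>k\<in>{..n}. h (Suc k)) \<oplus> h 0) =
   (\<Oplus>k\<in>{..n}. f k \<oplus> h (Suc k)) \<oplus> h 0"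
  using cl by (simp add: finsum_addf finsum_closed a_assoc Pi_iff)
 also have "(\<Oplus>k\<in>{..n}. f k \<oplus> h (Suc k)) = (\<Oplus>k\<in>{..n}. g (Suc k))"
 proof (rule finsum_cong')
  fix k assume "k \<in> {..n}"
  have c: "x [^] Suc k \<otimes> y [^] (n - k) \<in> carrier R" using xy by (simp del: nat_pow_Suc)
  have "f k \<oplus> h (Suc k) = add_pow R ((n choose k) + (n choose Suc k)) (x [^] Suc k \<otimes> y [^] (n - k))"
   using add.nat_pow_mult[OF c] unfolding f_def h_def by (simp del: nat_pow_Suc)
  then show "f k \<oplus> h (Suc k) = g (Suc k)" unfolding g_def by (simp del: nat_pow_Suc)
 qed (use cl in auto)
 also have "h 0 = g 0" by (simp add: h_def g_def)
 also have "(\<Oplus>k\<in>{..n}. g (Suc k)) \<oplus> g 0 = (\<Oplus>k\<in>{..Suc n}. g k)"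
  by (rule finsum_Suc2[symmetric]) (use cl in auto)
 finally show ?case unfolding g_def .
qed

lemma additive_mult_left: "a \<in> carrier R \<Longrightarrow> (\<lambda>x. a \<otimes> x) \<in> add_hom R R"
 by (rule add_homI) (auto simp: r_distr)

lemma additive_mult_right: "a \<in> carrier R \<Longrightarrow> (\<lambda>x. x \<otimes> a) \<in> add_hom R R"
 by (rule add_homI) (auto simp: l_distr)

lemma acong_mult_left: "\<lbrakk>acong R N x y; a \<in> carrier R\<rbrakk> \<Longrightarrow> acong R N (a \<otimes> x) (a \<otimes> y)"
 by (rule acong_add_hom[OF _ abelian_group_axioms additive_mult_left])

lemma acong_mult: "\<lbrakk>acong R N x y; acong R N x' y'\<rbrakk> \<Longrightarrow> acong R N (x \<otimes> x') (y \<otimes> y')"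
 using acong_carrier[of N x y] acong_carrier[of N x' y']
  acong_trans[OF acong_add_hom[OF _ abelian_group_axioms additive_mult_right] acong_mult_left]
 by metis

lemma acong_pow: "acong R N x y \<Longrightarrow> acong R N (x [^] (n::nat)) (y [^] n)"
 by (induction n) (auto intro: acong_mult acong_refl)

text \<open>The inner binomial coefficients are divisible by \<open>p\<close>.\<close>

lemma acong_freshmans_dream:
 assumes "Factorial_Ring.prime (p::nat)" and xy: "x \<in> carrier R" "y \<in> carrier R"
 shows "acong R p ((x \<oplus> y) [^] p) (x [^] p \<oplus> y [^] p)"
proof -
 have p: "p > 1" using assms prime_gt_1_nat by blast
 define t where "t k = add_pow R (p choose k) (x [^] k \<otimes> y [^] (p - k))" for k
 have cl: "t k \<in> carrier R" for k using xy by (simp add: t_def)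
 have set: "{..p} = insert 0 (insert p {0<..<p})" using p by auto
 have "(x \<oplus> y) [^] p = t 0 \<oplus> (t p \<oplus> (\<Oplus>k\<in>{0<..<p}. t k))"
  unfolding binomial_expansion[OF xy] t_def[symmetric] set using p cl
  by (simp add: finsum_insert)
 also have "\<dots> = x [^] p \<oplus> (y [^] p \<oplus> (\<Oplus>k\<in>{0<..<p}. t k))"
  using xy cl by (subst a_lcomm) (auto simp: t_def)
 finally have eq: "(x \<oplus> y) [^] p = x [^] p \<oplus> (y [^] p \<oplus> (\<Oplus>k\<in>{0<..<p}. t k))" .
 have "acong R p (t k) \<zero>" if "k \<in> {0<..<p}" for k
 proof -
  have "p dvd (p choose k)" using that assms(1) by (intro dvd_choose_prime) auto
  then obtain c where "p choose k = c * p" by (metis dvdE mult.commute)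
  then have "t k = add_pow R p (add_pow R c (x [^] k \<otimes> y [^] (p - k)))"
   unfolding t_def using xy by (simp add: add.nat_pow_pow)
  then show ?thesis using xy by (simp add: acong_add_pow)
 qed
 then have "acong R p (\<Oplus>k\<in>{0<..<p}. t k) (\<Oplus>k\<in>{0<..<p}. \<zero>)" by (rule acong_finsum)
 then have "acong R p (x [^] p \<oplus> (y [^] p \<oplus> (\<Oplus>k\<in>{0<..<p}. t k))) (x [^] p \<oplus> (y [^] p \<oplus> \<zero>))"
  using xy by (intro acong_add acong_refl) auto
 then show ?thesis using xy eq by simp
qed

lemma acong_frobenius_power:
 assumes "Factorial_Ring.prime (p::nat)" and xy: "x \<in> carrier R" "y \<in> carrier R"
 shows "acong R p ((x \<oplus> y) [^] (p ^ n)) (x [^] (p ^ n) \<oplus> y [^] (p ^ n))"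
proof (induction n)
 case 0
 then show ?case using xy by (simp add: acong_refl)
next
 case (Suc n)
 have "acong R p (((x \<oplus> y) [^] (p ^ n)) [^] p) ((x [^] (p ^ n) \<oplus> y [^] (p ^ n)) [^] p)"
  by (rule acong_pow[OF Suc])
 also have "acong R p ((x [^] (p ^ n) \<oplus> y [^] (p ^ n)) [^] p)
   ((x [^] (p ^ n)) [^] p \<oplus> (y [^] (p ^ n)) [^] p)"
  using xy by (intro acong_freshmans_dream assms) auto
 finally show ?case using xy by (simp add: nat_pow_pow mult.commute)
qed

text \<open>Write \<open>a = b + p ^ k c\<close>. Then \<open>a ^ n - b ^ n = p ^ k c t\<close>,
  where \<open>t\<close> is congruent modulo \<open>p\<close> to the derivative
  \<open>n b ^ (n - 1)\<close> and so divisible by \<open>p\<close> when \<open>n\<close> is. The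
  condition \<open>k \<ge> 1\<close> lets \<open>a\<close> be replaced by \<open>b\<close> in
  \<open>t\<close>.\<close>

lemma acong_pow_improve:
 assumes ab: "acong R (p ^ k) a b" and "k \<ge> 1" "p dvd n"
 shows "acong R (p ^ Suc k) (a [^] n) (b [^] (n::nat))"
proof -
 obtain c where c: "c \<in> carrier R" "a \<in> carrier R" "b \<in> carrier R" "a = b \<oplus> add_pow R (p ^ k) c"
  using ab by (auto simp: acong_def)
 have ab1: "acong R p a b" using acong_le_power[OF ab assms(2)] by simp
 have "\<exists>t\<in>carrier R. a [^] n = b [^] n \<oplus> add_pow R (p ^ k) (c \<otimes> t) \<and>
   acong R p t (add_pow R n (b [^] (n - 1)))" for n :: nat
 proof (induction n)
  case 0
  show ?case using c by (intro bexI[of _ \<zero>]) (auto simp: acong_refl)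
 next
  case (Suc n)
  then obtain t where t: "t \<in> carrier R" "a [^] n = b [^] n \<oplus> add_pow R (p ^ k) (c \<otimes> t)"
   "acong R p t (add_pow R n (b [^] (n - 1)))" by blast
  let ?t = "b [^] n \<oplus> t \<otimes> a"
  have "a [^] Suc n = b [^] n \<otimes> a \<oplus> add_pow R (p ^ k) (c \<otimes> t) \<otimes> a"
   using t c(1-3) by (simp add: l_distr)
  also have "b [^] n \<otimes> a = b [^] Suc n \<oplus> add_pow R (p ^ k) (c \<otimes> b [^] n)"
   unfolding c(4) using c(1-3) by (simp add: r_distr add_pow_rdistr m_comm)
  also have "add_pow R (p ^ k) (c \<otimes> t) \<otimes> a = add_pow R (p ^ k) (c \<otimes> (t \<otimes> a))"
   using t c(1-3) by (simp add: add_pow_ldistr m_assoc)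
  also have "b [^] Suc n \<oplus> add_pow R (p ^ k) (c \<otimes> b [^] n) \<oplus> add_pow R (p ^ k) (c \<otimes> (t \<otimes> a))
    = b [^] Suc n \<oplus> add_pow R (p ^ k) (c \<otimes> ?t)"
   using t c(1-3) by (simp add: r_distr add.nat_pow_distrib a_assoc del: nat_pow_Suc)
  finally have 1: "a [^] Suc n = b [^] Suc n \<oplus> add_pow R (p ^ k) (c \<otimes> ?t)" .
  have "acong R p ?t (b [^] n \<oplus> add_pow R n (b [^] (n - 1)) \<otimes> b)"
   using c by (intro acong_add acong_mult t ab1 acong_refl) auto
  also have "b [^] n \<oplus> add_pow R n (b [^] (n - 1)) \<otimes> b = add_pow R (Suc n) (b [^] n)"
  proof (cases n)
   case 0
   then show ?thesis using c(3) by simp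
  next
   case (Suc n')
   then have "add_pow R n (b [^] (n - 1)) \<otimes> b = add_pow R n (b [^] n)"
    using c(3) add_pow_ldistr[of "b [^] n'" b n] by simp
   then show ?thesis using c(3) by (simp add: a_comm)
  qed
  finally show ?case using 1 t c(1-3) by (intro bexI[of _ ?t]) auto
 qed
 then obtain t where t: "t \<in> carrier R" "a [^] n = b [^] n \<oplus> add_pow R (p ^ k) (c \<otimes> t)"
   "acong R p t (add_pow R n (b [^] (n - 1)))" by blast
 have "acong R p (add_pow R n (b [^] (n - 1))) \<zero>"
  using acong_dvd[OF acong_add_pow[of "b [^] (n - 1)" n] assms(3)] c by simp
 then have "acong R p t \<zero>" using t(3) acong_trans by blast
 then obtain s where s: "s \<in> carrier R" "t = add_pow R p s" by (rule acong_zeroE)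
 have "add_pow R (p ^ k) (c \<otimes> t) = add_pow R (p ^ Suc k) (c \<otimes> s)"
  using s c(1) by (simp add: add_pow_rdistr add.nat_pow_pow)
 then show ?thesis using t c s(1) unfolding acong_def by (auto intro!: bexI[of _ "c \<otimes> s"])
qed

lemma acong_pow_iterate:
 assumes "acong R p a b" "p dvd Q"
 shows "acong R (p ^ Suc n) (a [^] (Q ^ n :: nat)) (b [^] (Q ^ n))"
proof (induction n)
 case 0
 then show ?case using assms acong_carrier[OF assms(1)] by simp
next
 case (Suc n)
 have "acong R (p ^ Suc (Suc n)) ((a [^] (Q ^ n)) [^] Q) ((b [^] (Q ^ n)) [^] Q)"
  using assms by (intro acong_pow_improve Suc) auto
 then show ?case using acong_carrier[OF assms(1)] by (simp add: nat_pow_pow mult.commute)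
qed

end

section \<open>The residue field and its roots of unity\<close>

context padic_ring
begin

lemma units_acong:
 assumes "acong R p x y" "y \<in> Units R" shows "x \<in> Units R"
proof (rule ccontr)
 assume "x \<notin> Units R"
 then have "acong R p x \<zero>" using unit_or_p acong_carrier assms by blast
 then have "acong R p y \<zero>" using assms(1) acong_sym acong_trans by blast
 then have "acong R p (inv y \<otimes> y) (inv y \<otimes> \<zero>)" using assms(2) by (intro acong_mult_left) auto
 then show False using assms(2) one_not_p by simp
qed

text \<open>The ideal \<open>p R\<close>; for an absolutely unramified discrete valuation ring it is
  the Jacobson radical, see \<open>unramified_dvr_padic_ring\<close>.\<close>

definition residue_ideal :: "'a set" where
 "residue_ideal = {x. acong R p x \<zero>}"

lemma residue_ideal_ideal: "ideal residue_ideal R"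
proof (rule idealI)
 show "ring R" by (rule ring_axioms)
 show "subgroup residue_ideal (add_monoid R)"
 proof (rule subgroup.intro)
  fix x y assume *: "x \<in> residue_ideal" "y \<in> residue_ideal"
  then show "x \<otimes>\<^bsub>add_monoid R\<^esub> y \<in> residue_ideal"
   using acong_add[of p x \<zero> y \<zero>] by (auto simp: residue_ideal_def)
  have "(\<lambda>x. \<ominus> x) \<in> add_hom R R" by (rule add_homI) (auto simp: minus_add)
  then have "acong R p (\<ominus> x) (\<ominus> \<zero>)"
   using * acong_add_hom[OF _ abelian_group_axioms] by (fastforce simp: residue_ideal_def)
  then show "inv\<^bsub>add_monoid R\<^esub> x \<in> residue_ideal" by (simp add: residue_ideal_def a_inv_def[symmetric])
 qed (auto simp: residue_ideal_def acong_carrier acong_refl)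
next
 fix a x assume "a \<in> residue_ideal" "x \<in> carrier R"
 then have "acong R p (x \<otimes> a) \<zero>" "a \<in> carrier R"
  using acong_mult_left[of p a \<zero> x] by (auto simp: residue_ideal_def acong_carrier)
 then show "x \<otimes> a \<in> residue_ideal" "a \<otimes> x \<in> residue_ideal"
  using \<open>x \<in> carrier R\<close> m_comm[of x a] by (simp_all add: residue_ideal_def)
qed

lemma residue_ideal_maximal: "maximalideal residue_ideal R"
proof (rule maximalidealI[OF residue_ideal_ideal])
 show "carrier R \<noteq> residue_ideal" using one_not_p by (auto simp: residue_ideal_def)
next
 fix J assume J: "ideal J R" "residue_ideal \<subseteq> J" "J \<subseteq> carrier R"
 show "J = residue_ideal \<or> J = carrier R"
 proof (cases "J \<subseteq> residue_ideal")
  case False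
  then obtain x where x: "x \<in> J" "\<not> acong R p x \<zero>" by (auto simp: residue_ideal_def)
  then have "x \<in> Units R" using unit_or_p J by blast
  have "inv x \<otimes> x \<in> J"
   by (rule ideal.I_l_closed[OF J(1) x(1)]) (use \<open>x \<in> Units R\<close> in simp)
  then have "\<one> \<in> J" using \<open>x \<in> Units R\<close> by simp
  then show ?thesis using ideal.one_imp_carrier[OF J(1)] by blast
 qed (use J in auto)
qed

definition residue :: "'a \<Rightarrow> 'a set" where
 "residue x = residue_ideal +> x"

abbreviation residues :: "'a set ring" where
 "residues \<equiv> R Quot residue_ideal"

lemma residue_field_field: "field residues"
 by (rule maximalideal.quotient_is_field[OF residue_ideal_maximal is_cring])

lemma residue_eq_iff:
 assumes "x \<in> carrier R" "y \<in> carrier R"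
 shows "residue x = residue y \<longleftrightarrow> acong R p x y"
proof -
 interpret I: ideal residue_ideal R by (rule residue_ideal_ideal)
 have "residue x = residue y \<longleftrightarrow> x \<ominus> y \<in> residue_ideal"
  using assms quotient_eq_iff_same_a_r_cos[OF residue_ideal_ideal] by (auto simp: residue_def)
 also have "\<dots> \<longleftrightarrow> acong R p x y"
 proof
  assume "x \<ominus> y \<in> residue_ideal"
  then have "acong R p (x \<ominus> y \<oplus> y) (\<zero> \<oplus> y)"
   using assms by (intro acong_add acong_refl) (auto simp: residue_ideal_def)
  then show "acong R p x y" using assms by (simp add: a_minus_def a_assoc l_neg)
 next
  assume "acong R p x y"
  then have "acong R p (x \<oplus> \<ominus> y) (y \<oplus> \<ominus> y)"
   using assms by (intro acong_add acong_refl) auto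
  then show "x \<ominus> y \<in> residue_ideal" using assms by (simp add: a_minus_def residue_ideal_def r_neg)
 qed
 finally show ?thesis .
qed

lemma residue_hom: "residue \<in> ring_hom R residues"
 unfolding residue_def[abs_def] by (rule ideal.rcos_ring_hom[OF residue_ideal_ideal])

lemma carrier_residues: "carrier residues = residue ` carrier R"
 unfolding FactRing_def A_RCOSETS_def' residue_def by auto

lemma finite_residues: "finite (carrier residues)"
proof -
 obtain W where W: "finite W" "W \<subseteq> carrier R" "\<And>x. x \<in> carrier R \<Longrightarrow> \<exists>y\<in>W. acong R p x y"
  using finite_residue by metis
 have "carrier residues \<subseteq> residue ` W"
 proof
  fix c assume "c \<in> carrier residues"
  then obtain x where "x \<in> carrier R" "c = residue x" unfolding carrier_residues by blast
  then show "c \<in> residue ` W" using W(2) W(3)[of x] residue_eq_iff[of x] by auto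
 qed
 then show ?thesis using W finite_surj by metis
qed

lemma residue_zero_iff: "x \<in> carrier R \<Longrightarrow> residue x = \<zero>\<^bsub>residues\<^esub> \<longleftrightarrow> acong R p x \<zero>"
 using residue_eq_iff[of x \<zero>] ring_hom_zero[OF residue_hom ring_axioms]
  field.is_ring[OF residue_field_field]
 by (metis zero_closed cring.axioms(1) domain.axioms(1) field.axioms(1) residue_field_field)

lemma residue_pow: "x \<in> carrier R \<Longrightarrow> residue (x [^] (n::nat)) = residue x [^]\<^bsub>residues\<^esub> n"
proof -
 assume x: "x \<in> carrier R"
 interpret k: field residues by (rule residue_field_field)
 show ?thesis
  by (induction n)
   (use x residue_hom in \<open>auto simp: ring_hom_one ring_hom_mult nat_pow_closed\<close>)
qed

definition residue_card :: nat where
 "residue_card = card (carrier residues)"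

text \<open>The nonzero residues form a group of order \<open>residue_card - 1\<close>, and the zero
  residue is fixed by every positive power.\<close>

lemma residue_card_pow_cong:
 assumes "x \<in> carrier R" shows "acong R p (x [^] residue_card) x"
proof (cases "acong R p x \<zero>")
 interpret k: field residues by (rule residue_field_field)
 have c: "residue_card > 1"
 proof -
  have "{\<zero>\<^bsub>residues\<^esub>, \<one>\<^bsub>residues\<^esub>} \<subseteq> carrier residues" by auto
  then have "card {\<zero>\<^bsub>residues\<^esub>, \<one>\<^bsub>residues\<^esub>} \<le> residue_card"
   unfolding residue_card_def using finite_residues card_mono by blast
  then show ?thesis using k.one_not_zero by auto
 qed
 {
  case True
  have "acong R p (x [^] residue_card) (\<zero> [^] residue_card)" using True by (rule acong_pow)
  also have "\<zero> [^] residue_card = \<zero>" using c by (intro nat_pow_zero) auto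
  finally show ?thesis using True acong_sym acong_trans by blast
 next
  case False
  then have r: "residue x \<in> carrier (Multiplicative_Group.mult_of residues)"
   using assms residue_zero_iff carrier_residues by auto
  interpret m: group "Multiplicative_Group.mult_of residues" by (rule k.field_mult_group)
  have "order (Multiplicative_Group.mult_of residues) = residue_card - 1"
   using k.order_mult_of[OF finite_residues] by (auto simp: residue_card_def order_def)
  then have "residue x [^]\<^bsub>residues\<^esub> (residue_card - 1) = \<one>\<^bsub>residues\<^esub>"
   using m.pow_order_eq_1[OF r] by (simp add: Multiplicative_Group.nat_pow_mult_of Multiplicative_Group.one_mult_of)
  then have "residue x [^]\<^bsub>residues\<^esub> (Suc (residue_card - 1)) = residue x"
   using r by simp
  then have "residue x [^]\<^bsub>residues\<^esub> residue_card = residue x" using c by simp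
  then show ?thesis
   using assms residue_pow[OF assms] residue_eq_iff[of "x [^] residue_card" x] by simp
 }
qed

lemma residue_card_gt_1: "residue_card > 1"
proof -
 interpret k: field residues by (rule residue_field_field)
 have "{\<zero>\<^bsub>residues\<^esub>, \<one>\<^bsub>residues\<^esub>} \<subseteq> carrier residues" by auto
 then have "card {\<zero>\<^bsub>residues\<^esub>, \<one>\<^bsub>residues\<^esub>} \<le> residue_card"
  unfolding residue_card_def using finite_residues card_mono by blast
 then show ?thesis using k.one_not_zero by auto
qed

text \<open>\<open>p\<close> annihilates the additive group of the residue field. A further prime
  divisor \<open>r\<close> of its order would give a subgroup of order \<open>r\<close>, whose
  elements have order dividing both \<open>r\<close> and \<open>p\<close>.\<close>

lemma residue_card_prime_power: "\<exists>f>0. residue_card = p ^ f"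
proof -
 interpret k: field residues by (rule residue_field_field)
 let ?A = "add_monoid residues"
 have res0: "add_pow residues p x = \<zero>\<^bsub>residues\<^esub>" if "x \<in> carrier residues" for x
 proof -
  obtain y where y: "y \<in> carrier R" "x = residue y" using \<open>x \<in> _\<close> carrier_residues by auto
  have "residue \<in> add_hom R residues"
   by (rule add_homI) (auto simp: ring_hom_closed[OF residue_hom] ring_hom_add[OF residue_hom])
  then have "residue (add_pow R p y) = add_pow residues p (residue y)"
   by (rule add_hom_add_pow[OF abelian_group_axioms k.abelian_group_axioms _ y(1)])
  then show ?thesis using y residue_zero_iff[of "add_pow R p y"] acong_add_pow[of y p] by simp
 qed
 have only_p: "r = p" if r: "Factorial_Ring.prime r" "r dvd residue_card" for r :: nat
 proof (rule ccontr)
  assume "r \<noteq> p"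
  obtain m where m: "residue_card = r ^ 1 * m" using r by auto
  have "\<exists>H. subgroup H ?A \<and> card H = r ^ 1"
   by (rule sylow_thm[OF r(1) k.add.group_axioms])
    (use m finite_residues in \<open>auto simp: order_def residue_card_def\<close>)
  then obtain H where H: "subgroup H ?A" "card H = r" by auto
  have "card H > 1" using H r prime_gt_1_nat by auto
  then have "\<not> H \<subseteq> {\<zero>\<^bsub>residues\<^esub>}" by (auto simp: subset_singleton_iff)
  then obtain h where h: "h \<in> H" "h \<noteq> \<zero>\<^bsub>residues\<^esub>" by blast
  interpret H: group "?A\<lparr>carrier := H\<rparr>" using k.add.subgroup_imp_group[OF H(1)] .
  have hc: "h \<in> carrier ?A" using h H(1) subgroup.mem_carrier by fastforce
  have "h [^]\<^bsub>?A\<lparr>carrier := H\<rparr>\<^esub> r = \<one>\<^bsub>?A\<lparr>carrier := H\<rparr>\<^esub>"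
   using H.pow_order_eq_1[of h] h H(2) by (simp add: order_def)
  then have "h [^]\<^bsub>?A\<^esub> r = \<one>\<^bsub>?A\<^esub>" by (simp add: nat_pow_def)
  then have "k.add.ord h dvd r" using k.add.pow_eq_id[of h r] hc by (simp add: add_pow_def)
  moreover have "k.add.ord h dvd p"
   using k.add.pow_eq_id[of h p] hc res0[of h] by (simp add: add_pow_def)
  moreover have "coprime r p" using r(1) prime_p \<open>r \<noteq> p\<close> primes_coprime by blast
  ultimately have "k.add.ord h = 1" by (metis coprime_common_divisor_nat)
  then have "add_pow residues (1::nat) h = \<zero>\<^bsub>residues\<^esub>"
   using k.add.pow_eq_id[of h 1] hc by simp
  then show False using h hc by simp
 qed
 have "residue_card \<noteq> 0" "\<not> is_unit p" using residue_card_gt_1 prime_p not_prime_unit by auto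
 then obtain m where m: "residue_card = p ^ multiplicity p residue_card * m" "\<not> p dvd m"
  using multiplicity_decompose'[of residue_card p] by metis
 have "m = 1"
 proof (rule ccontr)
  assume "m \<noteq> 1"
  then obtain r where "Factorial_Ring.prime r" "r dvd m" using prime_factor_nat by blast
  then show False using only_p[of r] m by (metis dvd_mult)
 qed
 then show ?thesis using m residue_card_gt_1
  by (metis bot_nat_0.not_eq_extremum less_irrefl mult.right_neutral power_0)
qed

lemma p_dvd_residue_card: "p dvd residue_card"
 using residue_card_prime_power by auto

text \<open>The representative is the limit of \<open>a ^ (q ^ n)\<close>, where \<open>q\<close> is
  the number of residues: raising a congruence modulo \<open>p\<close> to the power
  \<open>q ^ n\<close> improves it to one modulo \<open>p ^ (n + 1)\<close>.\<close>

lemma teichmuller: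
 assumes a: "a \<in> carrier R"
 obtains t where "acong R p t a" "t [^] residue_card = t"
proof -
 define f where "f n = a [^] (residue_card ^ n)" for n :: nat
 have f: "f n \<in> carrier R" for n using a by (simp add: f_def)
 have fS: "f (Suc n) = f n [^] residue_card" for n
  using a by (simp add: f_def nat_pow_pow mult.commute)
 have "acong R (p ^ Suc n) (f (Suc n)) (f n)" for n
 proof -
  have "acong R (p ^ Suc n) ((a [^] residue_card) [^] (residue_card ^ n)) (a [^] (residue_card ^ n))"
   by (rule acong_pow_iterate[OF residue_card_pow_cong[OF a] p_dvd_residue_card])
  then show ?thesis using a by (simp add: f_def nat_pow_pow)
 qed
 then have "acong R (p ^ n) (f (Suc n)) (f n)" for n
  by (rule acong_le_power) simp
 then obtain t where t: "\<And>n. acong R (p ^ n) t (f n)" using complete[of f] by blast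
 have tc: "t \<in> carrier R" using t acong_carrier by blast
 show ?thesis
 proof (rule that)
  have "acong R p t (f 1)" using t[of 1] by simp
  also have "acong R p (f 1) a" using residue_card_pow_cong[OF a] by (simp add: f_def)
  finally show "acong R p t a" .
  show "t [^] residue_card = t"
  proof (rule acong_eqI)
   fix k
   have "acong R (p ^ k) (t [^] residue_card) (f (Suc k))"
    unfolding fS by (rule acong_pow[OF t])
   moreover have "acong R (p ^ k) t (f (Suc k))" by (rule acong_le_power[OF t]) simp
   ultimately show "acong R (p ^ k) (t [^] residue_card) t" by (rule acong_join)
  qed (use tc in auto)
 qed
qed

lemma root_of_unity:
 assumes "t \<in> carrier R" "t [^] residue_card = t" "\<not> acong R p t \<zero>"
 shows "t \<in> Units R" "t [^] (residue_card - 1) = \<one>"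
proof -
 show t: "t \<in> Units R" using unit_or_p assms by blast
 have "residue_card = Suc (residue_card - 1)" using residue_card_gt_1 by simp
 then have "t [^] (residue_card - 1) \<otimes> t = t"
  using assms by (metis nat_pow_Suc)
 then have "t [^] (residue_card - 1) \<otimes> t = \<one> \<otimes> t" using assms by simp
 then show "t [^] (residue_card - 1) = \<one>"
  using t assms by (metis Units_inv_closed Units_r_inv m_assoc nat_pow_closed one_closed r_one)
qed

text \<open>The Teichmueller lift of a generator of the cyclic group of nonzero residues. Its powers
  and zero represent all residue classes, so that properties modulo \<open>p\<close> can be tested
  on them.\<close>

lemma primitive_root_of_unity:
 obtains z where "z \<in> Units R" "z [^] (residue_card - 1) = \<one>"
  "z [^] residue_card = z"
  "\<And>x. x \<in> carrier R \<Longrightarrow> acong R p x \<zero> \<or> (\<exists>i::nat. acong R p x (z [^] i))"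
proof -
 interpret k: field residues by (rule residue_field_field)
 obtain a where a: "a \<in> carrier (Multiplicative_Group.mult_of residues)"
  "carrier (Multiplicative_Group.mult_of residues) = {a [^]\<^bsub>residues\<^esub> i | i::nat. i \<in> UNIV}"
  using k.finite_field_mult_group_has_gen[OF finite_residues] by blast
 obtain b where b: "b \<in> carrier R" "a = residue b" using a carrier_residues by auto
 obtain z where z: "acong R p z b" "z [^] residue_card = z" by (rule teichmuller[OF b(1)])
 have zc: "z \<in> carrier R" using z acong_carrier by blast
 have az: "a = residue z" using b z zc residue_eq_iff acong_sym by auto
 have "\<not> acong R p z \<zero>" using a residue_zero_iff[OF zc] az by auto
 note ru = root_of_unity[OF zc z(2) this]
 show ?thesis
 proof (rule that[OF ru z(2)])
  fix x assume x: "x \<in> carrier R"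
  show "acong R p x \<zero> \<or> (\<exists>i::nat. acong R p x (z [^] i))"
  proof (cases "acong R p x \<zero>")
   case False
   then have "residue x \<in> carrier (Multiplicative_Group.mult_of residues)"
    using x residue_zero_iff carrier_residues by auto
   then obtain i :: nat where "residue x = a [^]\<^bsub>residues\<^esub> i" using a(2) by blast
   then have "residue x = residue (z [^] i)" using az residue_pow[OF zc] by simp
   then show ?thesis using x zc residue_eq_iff by auto
  qed simp
 qed
qed

lemma residue_card_power_pow_cong:
 assumes x: "x \<in> carrier R" shows "acong R p (x [^] (residue_card ^ n)) x"
proof (induction n)
 case 0
 then show ?case using x acong_refl by simp
next
 case (Suc n)
 have "acong R p ((x [^] (residue_card ^ n)) [^] residue_card) (x [^] residue_card)"
  by (rule acong_pow[OF Suc])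
 also have "acong R p (x [^] residue_card) x" by (rule residue_card_pow_cong[OF x])
 finally show ?case using x by (simp add: nat_pow_pow mult.commute)
qed

text \<open>The number of nonzero residues is \<open>-1\<close> modulo \<open>p\<close>. It is the
  denominator in averages over roots of unity.\<close>

lemma residue_card_minus_1_unit: "add_pow R (residue_card - 1) \<one> \<in> Units R"
proof (rule units_acong)
 have "Suc (residue_card - 1) = residue_card" using residue_card_gt_1 by simp
 then have "add_pow R (residue_card - 1) \<one> \<oplus> \<one> = add_pow R residue_card \<one>"
  by (metis add.nat_pow_Suc)
 moreover have "acong R p (add_pow R residue_card \<one>) \<zero>"
  using acong_dvd[OF acong_add_pow p_dvd_residue_card] by auto
 ultimately have "acong R p (add_pow R (residue_card - 1) \<one> \<oplus> \<one> \<oplus> \<ominus> \<one>) (\<zero> \<oplus> \<ominus> \<one>)"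
  by (intro acong_add acong_refl) auto
 then show "acong R p (add_pow R (residue_card - 1) \<one>) (\<ominus> \<one>)"
  by (simp add: a_assoc r_neg)
 show "\<ominus> \<one> \<in> Units R"
  unfolding Units_def by (auto intro!: bexI[of _ "\<ominus> \<one>"] simp: l_minus)
qed

end

lemma ring_hom_add_hom: "h \<in> ring_hom R S \<Longrightarrow> h \<in> add_hom R S"
 by (rule add_homI) (auto simp: ring_hom_closed ring_hom_add)

lemma ring_hom_pow:
 assumes "ring R" "h \<in> ring_hom R S" "x \<in> carrier R"
 shows "h (x [^]\<^bsub>R\<^esub> (n::nat)) = h x [^]\<^bsub>S\<^esub> n"
proof -
 interpret ring R by fact
 show ?thesis
  by (induction n) (use assms in \<open>auto simp: ring_hom_one ring_hom_mult\<close>)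
qed

text \<open>Split \<open>x\<close> as a high power of \<open>x\<close>, on which agreement modulo
  \<open>p\<close> improves to agreement modulo a high power of \<open>p\<close>, plus a multiple of
  \<open>p\<close>, on which the induction hypothesis gains one factor. Hence a ring homomorphism is
  determined by its reduction, and lifts of residue automorphisms are unique.\<close>

lemma ring_hom_eqI_residue:
 assumes "padic_ring R p" "padic_ring S p" "h \<in> ring_hom R S" "h' \<in> ring_hom R S"
  and res: "\<And>x. x \<in> carrier R \<Longrightarrow> acong S p (h x) (h' x)"
  and "x \<in> carrier R"
 shows "h x = h' x"
proof -
 interpret R: padic_ring R p by fact
 interpret S: padic_ring S p by fact
 let ?Q = "R.residue_card"
 note ad = ring_hom_add_hom[OF assms(3)] ring_hom_add_hom[OF assms(4)]
 note hc = ring_hom_closed[OF assms(3)] ring_hom_closed[OF assms(4)]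
 have "\<forall>x\<in>carrier R. acong S (p ^ Suc n) (h x) (h' x)" for n
 proof (induction n)
  case 0
  then show ?case using res by simp
 next
  case (Suc n)
  show ?case
  proof
   fix x assume x: "x \<in> carrier R"
   have "acong R p x (x [^]\<^bsub>R\<^esub> (?Q ^ Suc n))"
    by (rule R.acong_sym[OF R.residue_card_power_pow_cong[OF x]])
   then obtain z where z: "z \<in> carrier R" "x = x [^]\<^bsub>R\<^esub> (?Q ^ Suc n) \<oplus>\<^bsub>R\<^esub> add_pow R p z"
    unfolding acong_def by blast
   have eq: "g x = g x [^]\<^bsub>S\<^esub> (?Q ^ Suc n) \<oplus>\<^bsub>S\<^esub> add_pow S p (g z)" if g: "g \<in> ring_hom R S" for g
   proof -
    have "g (x [^]\<^bsub>R\<^esub> (?Q ^ Suc n) \<oplus>\<^bsub>R\<^esub> add_pow R p z) =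
      g x [^]\<^bsub>S\<^esub> (?Q ^ Suc n) \<oplus>\<^bsub>S\<^esub> add_pow S p (g z)"
     using x z(1) add_hom_add_pow[OF R.abelian_group_axioms S.abelian_group_axioms
       ring_hom_add_hom[OF g] z(1)]
     by (simp add: ring_hom_add[OF g] ring_hom_pow[OF R.ring_axioms g] del: power_Suc)
    then show ?thesis using z(2) by simp
   qed
   have "acong S (p ^ Suc (Suc n)) (h x [^]\<^bsub>S\<^esub> (?Q ^ Suc n)) (h' x [^]\<^bsub>S\<^esub> (?Q ^ Suc n))"
    by (rule S.acong_pow_iterate[OF res[OF x] R.p_dvd_residue_card])
   moreover have "acong S (p * p ^ Suc n) (add_pow S p (h z)) (add_pow S p (h' z))"
    using Suc z(1) by (intro S.acong_mult_pow) blast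
   ultimately show "acong S (p ^ Suc (Suc n)) (h x) (h' x)"
    by (subst eq[OF assms(3)], subst eq[OF assms(4)])
     (rule S.acong_add, assumption, simp only: power_Suc[of p "Suc n"])
  qed
 qed
 then have "acong S (p ^ n) (h x) (h' x)" for n
  using assms(6) S.acong_le_power[of p "Suc n" "h x" "h' x" n] by auto
 then show ?thesis using hc assms(6) by (intro S.acong_eqI) auto
qed

lemma regular_algebra_simps [simp]:
 "carrier (regular_algebra S) = carrier S" "ring.add (regular_algebra S) = ring.add S"
 "ring.zero (regular_algebra S) = ring.zero S" "smult (regular_algebra S) = monoid.mult S"
 by (simp_all add: regular_algebra_def)

lemma finsum_regular_algebra [simp]: "finsum (regular_algebra S) = finsum S"
 by (intro ext) (simp add: finsum_def finprod_def)

lemma add_pow_regular_algebra [simp]: "add_pow (regular_algebra S) (n::nat) x = add_pow S n x"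
 by (simp add: add_pow_def nat_pow_def)

lemma acong_regular_algebra [simp]: "acong (regular_algebra S) = acong S"
 by (intro ext) (simp add: acong_def)

lemma a_inv_regular_algebra [simp]: "a_inv (regular_algebra S) = a_inv S"
 by (intro ext) (simp add: a_inv_def m_inv_def)

lemma abelian_group_regular_algebra:
 assumes "abelian_group S" shows "abelian_group (regular_algebra S)"
proof -
 interpret S: abelian_group S by fact
 show ?thesis
 proof (rule abelian_groupI)
  show "\<exists>y\<in>carrier (regular_algebra S). y \<oplus>\<^bsub>regular_algebra S\<^esub> x = \<zero>\<^bsub>regular_algebra S\<^esub>"
   if "x \<in> carrier (regular_algebra S)" for x
   using that by (auto intro!: bexI[of _ "\<ominus>\<^bsub>S\<^esub> x"] simp: S.l_neg)
 qed (auto simp: S.a_ac)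
qed

section \<open>Extensions of unramified rings\<close>

locale padic_extension = R: padic_ring R p + S: padic_ring S p
 for R :: "('s, 'c) ring_scheme" and S :: "('s, 'd) ring_scheme" (structure) and p +
 assumes subring: "is_subring_of R S"
begin

lemma subset: "x \<in> carrier R \<Longrightarrow> x \<in> carrier S"
 using subring by (auto simp: is_subring_of_def ring_hom_def)

lemma mult_R: "\<lbrakk>x \<in> carrier R; y \<in> carrier R\<rbrakk> \<Longrightarrow> x \<otimes>\<^bsub>R\<^esub> y = x \<otimes> y"
 using subring by (auto simp: is_subring_of_def ring_hom_def)

lemma add_R: "\<lbrakk>x \<in> carrier R; y \<in> carrier R\<rbrakk> \<Longrightarrow> x \<oplus>\<^bsub>R\<^esub> y = x \<oplus> y"
 using subring by (auto simp: is_subring_of_def ring_hom_def)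

lemma one_R: "\<one>\<^bsub>R\<^esub> = \<one>"
 using subring by (auto simp: is_subring_of_def ring_hom_def)

lemma incl_additive: "(\<lambda>x. x) \<in> add_hom R S"
 by (rule add_homI) (auto simp: subset add_R)

lemma zero_R: "\<zero>\<^bsub>R\<^esub> = \<zero>"
 using add_hom_zero[OF R.abelian_group_axioms S.abelian_group_axioms incl_additive] .

lemma add_pow_R: "x \<in> carrier R \<Longrightarrow> add_pow R (n::nat) x = add_pow S n x"
 using add_hom_add_pow[OF R.abelian_group_axioms S.abelian_group_axioms incl_additive] .

lemma uminus_R: "x \<in> carrier R \<Longrightarrow> \<ominus>\<^bsub>R\<^esub> x = \<ominus> x"
 using add_hom_minus[OF R.abelian_group_axioms S.abelian_group_axioms incl_additive] .

lemma pow_R: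
 assumes "x \<in> carrier R" shows "x [^]\<^bsub>R\<^esub> (n::nat) = x [^] n"
proof (induction n)
 case (Suc n)
 then show ?case using assms mult_R[of "x [^]\<^bsub>R\<^esub> n" x] R.nat_pow_closed[of x n] by simp
qed (simp add: one_R)

lemma acong_R: "acong R N x y \<Longrightarrow> acong S N x y"
 using R.acong_add_hom[OF _ S.abelian_group_axioms incl_additive] by simp

abbreviation S_mod :: "('s, 's) module" where "S_mod \<equiv> regular_algebra S"

lemma S_module: "left_module R S_mod"
proof (rule left_module.intro)
 show "ring R" by (rule R.ring_axioms)
 show "abelian_group S_mod" by (rule abelian_group_regular_algebra[OF S.abelian_group_axioms])
 show "left_module_axioms R S_mod"
  by (rule left_module_axioms.intro)
   (auto simp: subset add_R mult_R one_R S.l_distr S.r_distr S.m_assoc)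
qed

interpretation SM: left_module R S_mod by (rule S_module)

abbreviation lin :: "'s set \<Rightarrow> ('s \<Rightarrow> 's) \<Rightarrow> 's" where
 "lin B c \<equiv> lincomb S_mod B (\<lambda>b. b) c"

lemma S_basis:
 obtains B where "finite B" "B \<subseteq> carrier S"
  "\<And>x. x \<in> carrier S \<Longrightarrow> \<exists>c\<in>B \<rightarrow> carrier R. x = lin B c"
  "\<And>c. \<lbrakk>c \<in> B \<rightarrow> carrier R; lin B c = \<zero>\<rbrakk> \<Longrightarrow> \<forall>b\<in>B. c b = \<zero>\<^bsub>R\<^esub>"
proof -
 define spanning where "spanning B \<longleftrightarrow> finite B \<and> B \<subseteq> carrier S \<and>
   (\<forall>x\<in>carrier S. \<exists>c\<in>B \<rightarrow> carrier R. acong S p x (lin B c))" for B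
 obtain W where W: "finite W" "W \<subseteq> carrier S" "\<And>x. x \<in> carrier S \<Longrightarrow> \<exists>y\<in>W. acong S p x y"
  using S.finite_residue by metis
 have "spanning W"
  unfolding spanning_def
 proof (intro conjI ballI W)
  fix x assume "x \<in> carrier S"
  then obtain y where y: "y \<in> W" "acong S p x y" using W by blast
  have "lin W (\<lambda>j. if j = y then \<one>\<^bsub>R\<^esub> else \<zero>\<^bsub>R\<^esub>) = \<one>\<^bsub>R\<^esub> \<odot>\<^bsub>S_mod\<^esub> y"
   by (rule SM.lincomb_delta) (use W y in auto)
  then have "lin W (\<lambda>j. if j = y then \<one>\<^bsub>R\<^esub> else \<zero>\<^bsub>R\<^esub>) = y"
   using y W by (auto simp: one_R)
  then show "\<exists>c\<in>W \<rightarrow> carrier R. acong S p x (lin W c)"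
   using y by (intro bexI[of _ "\<lambda>j. if j = y then \<one>\<^bsub>R\<^esub> else \<zero>\<^bsub>R\<^esub>"]) auto
 qed
 then obtain B where B: "spanning B" "\<And>B'. spanning B' \<Longrightarrow> card B \<le> card B'"
  using ex_has_least_nat[of spanning W card] by blast
 have Bf: "finite B" "B \<subseteq> carrier S" and Bs: "\<And>x. x \<in> carrier S \<Longrightarrow> \<exists>c\<in>B \<rightarrow> carrier R. acong S p x (lin B c)"
  using B(1) unfolding spanning_def by auto
 have g: "(\<lambda>b. b) \<in> B \<rightarrow> carrier S_mod" using Bf by auto
 have lc: "lin B c \<in> carrier S" if "c \<in> B \<rightarrow> carrier R" for c
  using SM.lincomb_closed[OF g that] by simp
 have exact: "\<exists>c\<in>B \<rightarrow> carrier R. x = lin B c" if x: "x \<in> carrier S" for x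
 proof -
  have "\<exists>c y. c \<in> B \<rightarrow> carrier R \<and> y \<in> carrier S \<and> x = lin B c \<oplus> add_pow S p y" if "x \<in> carrier S" for x
   using Bs[OF that] unfolding acong_def by blast
  then obtain C Y where CY: "\<And>x. x \<in> carrier S \<Longrightarrow> C x \<in> B \<rightarrow> carrier R"
   "\<And>x. x \<in> carrier S \<Longrightarrow> Y x \<in> carrier S"
   "\<And>x. x \<in> carrier S \<Longrightarrow> x = lin B (C x) \<oplus> add_pow S p (Y x)" by metis
  \<comment> \<open>\<open>C (y n)\<close> is the \<open>n\<close>-th digit vector of
    \<open>x\<close> in base \<open>p\<close>, and \<open>y n\<close> the remainder still to be
    expanded.\<close>
  define y where "y n = (Y ^^ n) x" for n
  have y: "y n \<in> carrier S" for n unfolding y_def using x CY by (induction n) auto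
  define s where "s n = rec_nat (\<lambda>b. \<zero>\<^bsub>R\<^esub>) (\<lambda>n f b. f b \<oplus>\<^bsub>R\<^esub> add_pow R (p ^ n) (C (y n) b)) n" for n
  have s0: "s 0 = (\<lambda>b. \<zero>\<^bsub>R\<^esub>)" and sS: "s (Suc n) = (\<lambda>b. s n b \<oplus>\<^bsub>R\<^esub> add_pow R (p ^ n) (C (y n) b))" for n
   by (auto simp: s_def)
  have Cc: "C (y n) b \<in> carrier R" if "b \<in> B" for n b using CY(1)[OF y] that by auto
  have s: "s n \<in> B \<rightarrow> carrier R" for n
   by (induction n) (auto simp: s0 sS Cc)
  have eq: "x = lin B (s n) \<oplus> add_pow S (p ^ n) (y n)" for n
  proof (induction n)
   case 0
   have "lin B (s 0) = \<zero>" using SM.lincomb_zero[OF g, of "s 0"] by (simp add: s0)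
   then show ?case using x by (simp add: y_def)
  next
   case (Suc n)
   have pc: "(\<lambda>b. add_pow R (p ^ n) (C (y n) b)) \<in> B \<rightarrow> carrier R" using Cc by auto
   have CB: "C (y n) \<in> B \<rightarrow> carrier R" using CY(1)[OF y] .
   have "lin B (s (Suc n)) = lin B (s n) \<oplus> add_pow S (p ^ n) (lin B (C (y n)))"
    using SM.lincomb_add[OF g s pc] SM.lincomb_add_pow[OF g CB] by (simp add: sS)
   then have "lin B (s (Suc n)) \<oplus> add_pow S (p ^ Suc n) (y (Suc n)) =
     lin B (s n) \<oplus> (add_pow S (p ^ n) (lin B (C (y n))) \<oplus> add_pow S (p ^ n) (add_pow S p (y (Suc n))))"
    using lc[OF s] lc[OF CB] y[of "Suc n"] by (simp add: S.a_assoc S.add.nat_pow_pow mult.commute)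
   also have "\<dots> = lin B (s n) \<oplus> add_pow S (p ^ n) (lin B (C (y n)) \<oplus> add_pow S p (y (Suc n)))"
    using lc[OF CB] y[of "Suc n"] by (simp add: S.add.nat_pow_distrib)
   also have "lin B (C (y n)) \<oplus> add_pow S p (y (Suc n)) = y n"
    using CY(3)[OF y[of n]] by (simp add: y_def)
   finally show ?case using Suc by simp
  qed
  have "\<exists>l. \<forall>n. acong R (p ^ n) l (s n b)" if b: "b \<in> B" for b
  proof (rule R.complete)
   show "acong R (p ^ n) (s (Suc n) b) (s n b)" for n
    using Cc[OF b] funcset_mem[OF s b] funcset_mem[OF s b, of "Suc n"] unfolding acong_def sS by auto
  qed
  then obtain l where l: "\<And>b n. b \<in> B \<Longrightarrow> acong R (p ^ n) (l b) (s n b)" by metis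
  have lB: "l \<in> B \<rightarrow> carrier R" using l R.acong_carrier by blast
  have "x = lin B l"
  proof (rule S.acong_eqI[OF x lc[OF lB]])
   fix n
   have "acong S (p ^ n) (lin B l) (lin B (s n))"
    unfolding lincomb_def finsum_regular_algebra
   proof (rule S.acong_finsum)
    fix b assume b: "b \<in> B"
    show "acong S (p ^ n) (l b \<odot>\<^bsub>S_mod\<^esub> b) (s n b \<odot>\<^bsub>S_mod\<^esub> b)"
     using S.acong_mult[OF acong_R[OF l[OF b]] S.acong_refl[of b]] b Bf by auto
   qed
   moreover have "acong S (p ^ n) x (lin B (s n))"
    using eq[of n] y[of n] lc[OF s] x unfolding acong_def by blast
   ultimately show "acong S (p ^ n) x (lin B l)" using S.acong_join by blast
  qed
  then show ?thesis using lB by blast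
 qed
 have indep: "\<forall>b\<in>B. c b = \<zero>\<^bsub>R\<^esub>" if c: "c \<in> B \<rightarrow> carrier R" "lin B c = \<zero>" for c
 proof (rule ccontr)
  assume "\<not> (\<forall>b\<in>B. c b = \<zero>\<^bsub>R\<^esub>)"
  then obtain i0 where i0: "i0 \<in> B" "c i0 \<noteq> \<zero>\<^bsub>R\<^esub>" by blast
  obtain e d j where d: "j \<in> B" "d \<in> B \<rightarrow> carrier R" "d j \<in> Units R"
    "\<And>i. i \<in> B \<Longrightarrow> c i = add_pow R (p ^ e) (d i)"
   by (rule R.p_factorization_family[OF Bf(1) c(1) i0]; rule that; assumption)
  have "lin B c = lin B (\<lambda>i. add_pow R (p ^ e) (d i))"
   using d g by (intro SM.lincomb_cong) auto
  then have "add_pow S (p ^ e) (lin B d) = \<zero>" using SM.lincomb_add_pow[OF g d(2)] c by simp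
  then have d0: "lin B d = \<zero>" using S.p_torsion_free lc[OF d(2)] by blast
  let ?J = "B - {j}"
  define u where "u = inv\<^bsub>R\<^esub> d j"
  have u: "u \<in> carrier R" "u \<otimes>\<^bsub>R\<^esub> d j = \<one>\<^bsub>R\<^esub>" using d by (auto simp: u_def)
  \<comment> \<open>Since \<open>lin B d\<close> vanishes, a multiple of \<open>d\<close> may be
    subtracted from any coefficient vector; the multiple is chosen to cancel the coefficient at
    \<open>j\<close>, where \<open>d\<close> is a unit.\<close>
  have "spanning ?J"
   unfolding spanning_def
  proof (intro conjI ballI)
   fix x assume "x \<in> carrier S"
   then obtain c where c: "c \<in> B \<rightarrow> carrier R" "acong S p x (lin B c)" using Bs by blast
   have cj: "c j \<in> carrier R" using c d by auto
   let ?a = "\<ominus>\<^bsub>R\<^esub> (c j \<otimes>\<^bsub>R\<^esub> u)"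
   let ?c = "\<lambda>i. c i \<oplus>\<^bsub>R\<^esub> ?a \<otimes>\<^bsub>R\<^esub> d i"
   have a: "?a \<in> carrier R" using cj u by simp
   have ad: "(\<lambda>i. ?a \<otimes>\<^bsub>R\<^esub> d i) \<in> B \<rightarrow> carrier R" using a d(2) by auto
   have cB: "?c \<in> B \<rightarrow> carrier R" using c(1) ad by auto
   have "lin B ?c = lin B c"
    using SM.lincomb_add[OF g c(1) ad] SM.lincomb_smult[OF g d(2) a] d0 SM.smult_zero_right[OF a]
     lc[OF c(1)] by simp
   moreover have "lin B ?c = lin ?J ?c"
   proof -
    have "?c j = \<zero>\<^bsub>R\<^esub>"
    proof -
     have "?a \<otimes>\<^bsub>R\<^esub> d j = \<ominus>\<^bsub>R\<^esub> c j"
      using cj u R.Units_closed[OF d(3)] by (simp add: R.l_minus R.m_assoc)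
     then show ?thesis using cj by (simp add: R.r_neg)
    qed
    moreover have "lin (insert j ?J) ?c = ?c j \<odot>\<^bsub>S_mod\<^esub> j \<oplus>\<^bsub>S_mod\<^esub> lin ?J ?c"
     using Bf d(1) cB by (intro SM.lincomb_insert) auto
    moreover have "insert j ?J = B" using d(1) by auto
    moreover have "lin ?J ?c \<in> carrier S_mod" using cB Bf by (intro SM.lincomb_closed) auto
    moreover have "j \<in> carrier S" using d(1) Bf by auto
    ultimately show ?thesis by (simp add: zero_R)
   qed
   ultimately show "\<exists>c\<in>?J \<rightarrow> carrier R. acong S p x (lin ?J c)"
    using c(2) cB by (intro bexI[of _ ?c]) auto
  qed (use Bf in auto)
  then have "card B \<le> card ?J" by (rule B(2))
  then show False using d(1) Bf by (metis card_Diff1_less not_less)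
 qed
 show ?thesis by (rule that[OF Bf exact indep]; assumption)
qed

text \<open>A map on representatives that induces an endomorphism of the residue field of
  \<open>S\<close> over that of \<open>R\<close>. Laws modulo \<open>p\<close> on \<open>S\<close>
  itself treat the power map \<open>x \<mapsto> x ^ q\<close> and chosen representatives of a Galois
  automorphism alike.\<close>

definition residue_endo :: "('s \<Rightarrow> 's) \<Rightarrow> bool" where
 "residue_endo s \<longleftrightarrow>
   s \<in> carrier S \<rightarrow> carrier S \<and>
   (\<forall>x\<in>carrier S. \<forall>y\<in>carrier S. acong S p (s (x \<oplus> y)) (s x \<oplus> s y)) \<and>
   (\<forall>x\<in>carrier S. \<forall>y\<in>carrier S. acong S p (s (x \<otimes> y)) (s x \<otimes> s y)) \<and>
   (\<forall>r\<in>carrier R. acong S p (s r) r) \<and>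
   (\<forall>x y. acong S p x y \<longrightarrow> acong S p (s x) (s y))"

text \<open>Prescribe the values \<open>s b\<close> on a basis of \<open>S\<close> over
  \<open>R\<close> and extend linearly. The result is exactly additive and \<open>R\<close>-linear,
  but multiplicative only modulo \<open>p\<close>; \<open>lift_exists\<close> repairs this.\<close>

lemma residue_endo_approx:
 assumes s: "residue_endo s"
 obtains t where "t \<in> add_hom S S"
  "\<And>r x. \<lbrakk>r \<in> carrier R; x \<in> carrier S\<rbrakk> \<Longrightarrow> t (r \<otimes> x) = r \<otimes> t x"
  "\<And>x. x \<in> carrier S \<Longrightarrow> acong S p (t x) (s x)"
proof -
 have sc: "\<And>x. x \<in> carrier S \<Longrightarrow> s x \<in> carrier S"
  and sa: "\<And>x y. \<lbrakk>x \<in> carrier S; y \<in> carrier S\<rbrakk> \<Longrightarrow> acong S p (s (x \<oplus> y)) (s x \<oplus> s y)"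
  and sm: "\<And>x y. \<lbrakk>x \<in> carrier S; y \<in> carrier S\<rbrakk> \<Longrightarrow> acong S p (s (x \<otimes> y)) (s x \<otimes> s y)"
  and sr: "\<And>r. r \<in> carrier R \<Longrightarrow> acong S p (s r) r"
  using s by (auto simp: residue_endo_def)
 obtain B where B: "finite B" "B \<subseteq> carrier S"
  "\<And>x. x \<in> carrier S \<Longrightarrow> \<exists>c\<in>B \<rightarrow> carrier R. x = lin B c"
  "\<And>c. \<lbrakk>c \<in> B \<rightarrow> carrier R; lin B c = \<zero>\<rbrakk> \<Longrightarrow> \<forall>b\<in>B. c b = \<zero>\<^bsub>R\<^esub>"
  by (rule S_basis; rule that; assumption)
 have g: "(\<lambda>b. b) \<in> B \<rightarrow> carrier S_mod" and sg: "s \<in> B \<rightarrow> carrier S_mod" using B sc by auto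
 obtain c where c: "\<And>x. x \<in> carrier S \<Longrightarrow> c x \<in> B \<rightarrow> carrier R" "\<And>x. x \<in> carrier S \<Longrightarrow> x = lin B (c x)"
  using B(3) by metis
 define t where "t x = lincomb S_mod B s (c x)" for x
 have uniq: "lincomb S_mod B s (c x) = lincomb S_mod B s d"
  if x: "x \<in> carrier S" and d: "d \<in> B \<rightarrow> carrier R" "x = lin B d" for x d
 proof (rule SM.lincomb_cong[OF refl sg d(1) refl])
  fix b assume b: "b \<in> B"
  have md: "(\<lambda>i. \<ominus>\<^bsub>R\<^esub> d i) \<in> B \<rightarrow> carrier R" using d by auto
  have "lin B (\<lambda>i. c x i \<oplus>\<^bsub>R\<^esub> \<ominus>\<^bsub>R\<^esub> d i) = lin B (c x) \<oplus> \<ominus> lin B d"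
   using SM.lincomb_add[OF g c(1)[OF x] md] SM.lincomb_minus[OF g d(1)] by simp
  also have "\<dots> = \<zero>" using x c(2)[OF x, symmetric] d(2)[symmetric] by (simp add: S.r_neg)
  finally have "\<forall>b\<in>B. c x b \<oplus>\<^bsub>R\<^esub> \<ominus>\<^bsub>R\<^esub> d b = \<zero>\<^bsub>R\<^esub>"
   using c(1)[OF x] md by (intro B(4)) auto
  then have "c x b \<oplus>\<^bsub>R\<^esub> \<ominus>\<^bsub>R\<^esub> d b = \<zero>\<^bsub>R\<^esub>" using b by blast
  then show "c x b = d b"
   by (rule R.diff_zero_imp_eq[OF funcset_mem[OF c(1)[OF x] b] funcset_mem[OF d(1) b]])
 qed
 show ?thesis
 proof (rule that[of t])
  have tc: "t x \<in> carrier S" if "x \<in> carrier S" for x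
   unfolding t_def using SM.lincomb_closed[OF sg c(1)[OF that]] by simp
  show "t \<in> add_hom S S"
  proof (rule add_homI[OF tc])
   fix x y assume xy: "x \<in> carrier S" "y \<in> carrier S"
   let ?d = "\<lambda>i. c x i \<oplus>\<^bsub>R\<^esub> c y i"
   have d: "?d \<in> B \<rightarrow> carrier R" using c(1)[OF xy(1)] c(1)[OF xy(2)] by auto
   have "x \<oplus> y = lin B ?d"
    using SM.lincomb_add[OF g c(1)[OF xy(1)] c(1)[OF xy(2)]] c(2)[OF xy(1)] c(2)[OF xy(2)] by simp
   then show "t (x \<oplus> y) = t x \<oplus> t y"
    using uniq[OF S.a_closed[OF xy] d] SM.lincomb_add[OF sg c(1)[OF xy(1)] c(1)[OF xy(2)]]
    unfolding t_def regular_algebra_simps by metis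
  qed
  show "t (r \<otimes> x) = r \<otimes> t x" if r: "r \<in> carrier R" and x: "x \<in> carrier S" for r x
  proof -
   let ?d = "\<lambda>i. r \<otimes>\<^bsub>R\<^esub> c x i"
   have d: "?d \<in> B \<rightarrow> carrier R" using c(1)[OF x] r by auto
   have "r \<otimes> x = lin B ?d"
    using SM.lincomb_smult[OF g c(1)[OF x] r] c(2)[OF x] by simp
   then show ?thesis
    using uniq[OF S.m_closed[OF subset[OF r] x] d] SM.lincomb_smult[OF sg c(1)[OF x] r]
    unfolding t_def regular_algebra_simps by metis
  qed
  have s0: "acong S p (s \<zero>) \<zero>" using sr[OF R.zero_closed] unfolding zero_R .
  have fin: "acong S p (s (\<Oplus>i\<in>I. f i)) (\<Oplus>i\<in>I. s (f i))"
   if "finite I" "f \<in> I \<rightarrow> carrier S" for I and f :: "'s \<Rightarrow> 's"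
   using that
  proof (induction I)
   case empty
   then show ?case using s0 by simp
  next
   case (insert i I)
   have fi: "f i \<in> carrier S" "f \<in> I \<rightarrow> carrier S" "(\<lambda>i. s (f i)) \<in> I \<rightarrow> carrier S"
    using insert sc by auto
   have "acong S p (s (f i \<oplus> (\<Oplus>i\<in>I. f i))) (s (f i) \<oplus> s (\<Oplus>i\<in>I. f i))"
    using fi by (intro sa) (auto intro!: S.finsum_closed)
   also have "acong S p \<dots> (s (f i) \<oplus> (\<Oplus>i\<in>I. s (f i)))"
    using fi sc insert.IH by (intro S.acong_add S.acong_refl) auto
   finally show ?case using insert fi sc by (simp add: S.finsum_insert)
  qed
  show "acong S p (t x) (s x)" if x: "x \<in> carrier S" for x
  proof -
   have cb: "c x b \<in> carrier R" "c x b \<in> carrier S" "b \<in> carrier S" if "b \<in> B" for b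
    using funcset_mem[OF c(1)[OF x] that] subset B that by auto
   have "acong S p (s (lin B (c x))) (\<Oplus>b\<in>B. s (c x b \<otimes> b))"
    unfolding lincomb_def finsum_regular_algebra regular_algebra_simps using cb B
    by (intro fin) auto
   also have "acong S p \<dots> (\<Oplus>b\<in>B. c x b \<otimes> s b)"
   proof (rule S.acong_finsum)
    fix b assume b: "b \<in> B"
    have "acong S p (s (c x b \<otimes> b)) (s (c x b) \<otimes> s b)" using sm cb[OF b] by blast
    also have "acong S p \<dots> (c x b \<otimes> s b)"
     using cb[OF b] sc by (intro S.acong_mult sr S.acong_refl) auto
    finally show "acong S p (s (c x b \<otimes> b)) (c x b \<otimes> s b)" .
   qed
   finally show ?thesis
    using c(2)[OF x] S.acong_sym unfolding t_def lincomb_def by simp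
  qed
 qed
qed

text \<open>Let \<open>z\<close> be the primitive root of unity of \<open>S\<close>, with
  \<open>z ^ N = 1\<close>, and \<open>z'\<close> the Teichmueller lift of \<open>s z\<close>.
  Averaging the linear approximation \<open>t\<close> as \<open>\<Sum> z'^(-i) t (z^i x)\<close>
  over \<open>i < N\<close> forces exact compatibility with multiplication by \<open>z\<close>.
  After normalising the value at \<open>\<one>\<close>, the map is multiplicative on powers of
  \<open>z\<close>; these represent all nonzero residues, so multiplicativity spreads to
  \<open>S\<close> by approximation.\<close>

lemma lift_exists:
 assumes s: "residue_endo s"
 obtains h where "h \<in> ring_hom S S" "\<And>r. r \<in> carrier R \<Longrightarrow> h r = r"
  "\<And>x. x \<in> carrier S \<Longrightarrow> acong S p (h x) (s x)"
proof -
 have sc: "\<And>x. x \<in> carrier S \<Longrightarrow> s x \<in> carrier S"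
  and sm: "\<And>x y. \<lbrakk>x \<in> carrier S; y \<in> carrier S\<rbrakk> \<Longrightarrow> acong S p (s (x \<otimes> y)) (s x \<otimes> s y)"
  and sr: "\<And>r. r \<in> carrier R \<Longrightarrow> acong S p (s r) r"
  using s by (auto simp: residue_endo_def)
 have s1: "acong S p (s \<one>) \<one>" using sr[OF R.one_closed] unfolding one_R .
 obtain z where z: "z \<in> Units S" "z [^] (S.residue_card - 1) = \<one>"
  "z [^] S.residue_card = z"
  "\<And>x. x \<in> carrier S \<Longrightarrow> acong S p x \<zero> \<or> (\<exists>i::nat. acong S p x (z [^] i))"
  by (rule S.primitive_root_of_unity; rule that; assumption)
 have zc: "z \<in> carrier S" using z by auto
 obtain z' where z': "acong S p z' (s z)" "z' [^] S.residue_card = z'"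
  by (rule S.teichmuller[OF sc[OF zc]])
 have z'c: "z' \<in> carrier S" using z' S.acong_carrier by blast
 have "\<not> acong S p z' \<zero>"
 proof
  assume a: "acong S p z' \<zero>"
  have iz: "inv z \<in> carrier S" "inv z \<otimes> z = \<one>" using z by auto
  have "acong S p \<one> (s (inv z) \<otimes> s z)"
   using sm[OF iz(1) zc] iz(2) s1 S.acong_trans S.acong_sym by metis
  also have "acong S p \<dots> (s (inv z) \<otimes> \<zero>)"
   using S.acong_mult_left[OF S.acong_trans[OF S.acong_sym[OF z'(1)] a] sc[OF iz(1)]] .
  finally show False using S.one_not_p sc[OF iz(1)] by simp
 qed
 note ru = S.root_of_unity[OF z'c z'(2) this]
 define w where "w = inv z'"
 define N where "N = S.residue_card - 1"
 have w: "w \<in> carrier S" "w \<otimes> z' = \<one>" using ru by (auto simp: w_def)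
 have wz: "w [^] i \<otimes> z' [^] i = \<one>" for i :: nat
  using S.nat_pow_distrib[OF w(1) z'c, of i] w(2) by simp
 have wN: "w [^] N = \<one>" using wz[of N] ru(2) w(1) by (simp add: N_def)
 obtain t where t: "t \<in> add_hom S S"
  "\<And>r x. \<lbrakk>r \<in> carrier R; x \<in> carrier S\<rbrakk> \<Longrightarrow> t (r \<otimes> x) = r \<otimes> t x"
  "\<And>x. x \<in> carrier S \<Longrightarrow> acong S p (t x) (s x)"
  by (rule residue_endo_approx[OF s]; rule that; assumption)
 note tc = add_hom_closed[OF t(1)]
 define g where "g x i = w [^] i \<otimes> t (z [^] i \<otimes> x)" for x and i :: nat
 have gc: "g x i \<in> carrier S" if "x \<in> carrier S" for x i
  unfolding g_def using w zc that by (auto intro!: tc)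
 define t1 where "t1 x = (\<Oplus>i\<in>{..<N}. g x i)" for x
 have t1: "t1 \<in> add_hom S S"
  unfolding t1_def[abs_def]
 proof (rule add_hom_finsum_fun[OF S.abelian_group_axioms S.abelian_group_axioms])
  fix i :: nat
  have c: "w [^] i \<in> carrier S" "z [^] i \<in> carrier S" using w(1) zc by simp_all
  show "(\<lambda>x. g x i) \<in> add_hom S S"
   unfolding g_def
   using add_hom_comp[OF add_hom_comp[OF S.additive_mult_left[OF c(2)] t(1)]
     S.additive_mult_left[OF c(1)]] .
 qed
 note t1c = add_hom_closed[OF t1]
 \<comment> \<open>Multiplication by \<open>z\<close> shifts the index of the average, and the sum
   is cyclic because \<open>z\<close> and \<open>w\<close> are both \<open>N\<close>-th roots of
   unity.\<close>
 have t1z: "t1 (z \<otimes> x) = z' \<otimes> t1 x" if x: "x \<in> carrier S" for x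
 proof -
  have "t1 (z \<otimes> x) = (\<Oplus>i\<in>{..<N}. z' \<otimes> g x (Suc i))"
   unfolding t1_def
  proof (rule S.finsum_cong')
   fix i
   have zx: "z [^] i \<otimes> (z \<otimes> x) = z [^] Suc i \<otimes> x" using zc x by (simp add: S.m_assoc)
   have c: "t (z [^] Suc i \<otimes> x) \<in> carrier S" "w [^] i \<in> carrier S"
    using zc x w by (auto intro!: tc simp del: S.nat_pow_Suc)
   have "z' \<otimes> g x (Suc i) = w [^] i \<otimes> (w \<otimes> z') \<otimes> t (z [^] Suc i \<otimes> x)"
    unfolding g_def S.nat_pow_Suc[of w] using c w(1) z'c by (simp add: S.m_ac del: S.nat_pow_Suc)
   also have "\<dots> = g (z \<otimes> x) i" unfolding g_def zx w(2) using c by simp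
   finally show "g (z \<otimes> x) i = z' \<otimes> g x (Suc i)" by simp
  qed (use gc z'c x in auto)
  also have "\<dots> = z' \<otimes> (\<Oplus>i\<in>{..<N}. g x (Suc i))"
   using gc[OF x] z'c by (subst S.finsum_rdistr) auto
  also have "(\<Oplus>i\<in>{..<N}. g x (Suc i)) = t1 x"
   unfolding t1_def
  proof (rule S.finsum_cyclic_shift[OF gc[OF x]])
   show "g x N = g x 0" unfolding g_def wN using z(2) by (simp add: N_def)
  qed
  finally show ?thesis .
 qed
 have sz: "acong S p (s (z [^] i \<otimes> x)) (z' [^] i \<otimes> s x)" if x: "x \<in> carrier S" for x and i :: nat
 proof (induction i)
  case 0
  then show ?case using x sc S.acong_refl by simp
 next
  case (Suc i)
  have c: "z [^] i \<otimes> x \<in> carrier S" using zc x by simp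
  have "acong S p (s (z \<otimes> (z [^] i \<otimes> x))) (s z \<otimes> s (z [^] i \<otimes> x))"
   by (rule sm[OF zc c])
  also have "acong S p \<dots> (z' \<otimes> (z' [^] i \<otimes> s x))"
   by (rule S.acong_mult[OF S.acong_sym[OF z'(1)] Suc])
  finally show ?case using zc z'c x sc by (simp add: S.m_ac)
 qed
 have t1s: "acong S p (t1 x) (add_pow S N \<one> \<otimes> s x)" if x: "x \<in> carrier S" for x
 proof -
  have "acong S p (t1 x) (\<Oplus>i\<in>{..<N}. s x)"
   unfolding t1_def
  proof (rule S.acong_finsum)
   fix i :: nat
   have c: "w [^] i \<in> carrier S" "z [^] i \<otimes> x \<in> carrier S" using w zc x by auto
   have "acong S p (g x i) (w [^] i \<otimes> (z' [^] i \<otimes> s x))"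
    unfolding g_def by (rule S.acong_mult_left[OF S.acong_trans[OF t(3)[OF c(2)] sz[OF x]] c(1)])
   also have "w [^] i \<otimes> (z' [^] i \<otimes> s x) = s x"
    using wz[of i] c z'c sc[OF x] by (simp add: S.m_assoc[symmetric])
   finally show "acong S p (g x i) (s x)" .
  qed
  also have "(\<Oplus>i\<in>{..<N}. s x) = add_pow S N (s x)"
   using S.add.finprod_const[of "s x" "{..<N}"] sc[OF x] by simp
  also have "\<dots> = add_pow S N \<one> \<otimes> s x"
   using S.add_pow_mult[OF sc[OF x]] .
  finally show ?thesis .
 qed
 have t1u: "t1 \<one> \<in> Units S"
 proof (rule S.units_acong)
  show "add_pow S N \<one> \<in> Units S" unfolding N_def by (rule S.residue_card_minus_1_unit)
  have "acong S p (t1 \<one>) (add_pow S N \<one> \<otimes> s \<one>)" by (rule t1s) simp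
  also have "acong S p \<dots> (add_pow S N \<one> \<otimes> \<one>)" by (rule S.acong_mult_left[OF s1]) simp
  finally show "acong S p (t1 \<one>) (add_pow S N \<one>)" by simp
 qed
 \<comment> \<open>Modulo \<open>p\<close> the average is \<open>N\<close> times \<open>s\<close>,
   and \<open>N\<close> is a unit, so its value at \<open>\<one>\<close> can be divided out.\<close>
 define v where "v = inv (t1 \<one>)"
 have v: "v \<in> carrier S" "v \<otimes> t1 \<one> = \<one>" using t1u by (auto simp: v_def)
 define h where "h x = v \<otimes> t1 x" for x
 have h: "h \<in> add_hom S S"
  unfolding h_def[abs_def] by (rule add_hom_comp[OF t1 S.additive_mult_left[OF v(1)]])
 note hc = add_hom_closed[OF h]
 have h1: "h \<one> = \<one>" using v by (simp add: h_def)
 have hz: "h (z [^] i \<otimes> x) = z' [^] i \<otimes> h x" if x: "x \<in> carrier S" for x and i :: nat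
 proof (induction i)
  case 0
  then show ?case using x hc by simp
 next
  case (Suc i)
  have c: "z [^] i \<otimes> x \<in> carrier S" using zc x by simp
  have "h (z \<otimes> (z [^] i \<otimes> x)) = z' \<otimes> h (z [^] i \<otimes> x)"
   unfolding h_def t1z[OF c] using v(1) z'c t1c[OF c] by (simp add: S.m_ac)
  also have "\<dots> = z' \<otimes> (z' [^] i \<otimes> h x)" unfolding Suc ..
  finally show ?case using zc z'c x hc[OF x] by (simp add: S.m_ac)
 qed
 have hpow: "h (z [^] i) = z' [^] i" for i :: nat
  using hz[of "\<one>" i] h1 zc z'c by simp
 have h0: "h \<zero> = \<zero>" by (rule add_hom_zero[OF S.abelian_group_axioms S.abelian_group_axioms h])
 have hm: "\<forall>x\<in>carrier S. \<forall>y\<in>carrier S. acong S (p ^ n) (h (x \<otimes> y)) (h x \<otimes> h y)" for n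
 proof (induction n)
  case 0
  then show ?case using hc S.acong_one by simp
 next
  case (Suc n)
  show ?case
  proof (intro ballI)
   fix x y assume x: "x \<in> carrier S" and y: "y \<in> carrier S"
   \<comment> \<open>Replace \<open>x\<close> by zero or a power of \<open>z\<close> in the same
     residue class, where multiplicativity is exact; the difference carries a factor
     \<open>p\<close> and falls under the induction hypothesis.\<close>
   have "\<exists>c\<in>carrier S. acong S p x c \<and> h (c \<otimes> y) = h c \<otimes> h y"
   proof (cases "acong S p x \<zero>")
    case True
    then show ?thesis using y h0 hc by (intro bexI[of _ "\<zero>"]) auto
   next
    case False
    then obtain i :: nat where "acong S p x (z [^] i)" using z(4)[OF x] by blast
    then show ?thesis using hz[OF y] hpow zc by (intro bexI[of _ "z [^] i"]) auto
   qed
   then obtain c x1 where c: "c \<in> carrier S" "h (c \<otimes> y) = h c \<otimes> h y"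
    "x1 \<in> carrier S" "x = c \<oplus> add_pow S p x1"
    unfolding acong_def by blast
   note hp = add_hom_add_pow[OF S.abelian_group_axioms S.abelian_group_axioms h]
   have "x \<otimes> y = c \<otimes> y \<oplus> add_pow S p (x1 \<otimes> y)"
    unfolding c(4) using c(1,3) y by (simp add: S.l_distr S.add_pow_ldistr)
   then have e1: "h (x \<otimes> y) = h c \<otimes> h y \<oplus> add_pow S p (h (x1 \<otimes> y))"
    using add_hom_add[OF h, of "c \<otimes> y" "add_pow S p (x1 \<otimes> y)"] hp[of "x1 \<otimes> y" p] c(1-3) y by simp
   have "h x = h c \<oplus> add_pow S p (h x1)"
    unfolding c(4) using add_hom_add[OF h, of c "add_pow S p x1"] hp[of x1 p] c(1,3) by simp
   then have e2: "h x \<otimes> h y = h c \<otimes> h y \<oplus> add_pow S p (h x1 \<otimes> h y)"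
    using hc[OF c(1)] hc[OF c(3)] hc[OF y] by (simp add: S.l_distr S.add_pow_ldistr)
   have "acong S (p * p ^ n) (add_pow S p (h (x1 \<otimes> y))) (add_pow S p (h x1 \<otimes> h y))"
    using Suc c(3) y by (intro S.acong_mult_pow) blast
   then show "acong S (p ^ Suc n) (h (x \<otimes> y)) (h x \<otimes> h y)"
    unfolding e1 e2 power_Suc using hc[OF c(1)] hc[OF y] by (intro S.acong_add S.acong_refl) auto
  qed
 qed
 show ?thesis
 proof (rule that[of h])
  show "h \<in> ring_hom S S"
  proof (rule ring_hom_memI)
   fix x y assume xy: "x \<in> carrier S" "y \<in> carrier S"
   show "h (x \<otimes> y) = h x \<otimes> h y"
    using hm xy hc by (intro S.acong_eqI) auto
   show "h (x \<oplus> y) = h x \<oplus> h y" by (rule add_hom_add[OF h xy])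
  qed (use hc h1 in auto)
  show "h r = r" if r: "r \<in> carrier R" for r
  proof -
   have rS: "r \<in> carrier S" by (rule subset[OF r])
   have "t1 (r \<otimes> \<one>) = (\<Oplus>i\<in>{..<N}. r \<otimes> g \<one> i)"
    unfolding t1_def
   proof (rule S.finsum_cong')
    fix i :: nat
    have c: "z [^] i \<in> carrier S" "w [^] i \<in> carrier S" using zc w by auto
    have "t (z [^] i \<otimes> (r \<otimes> \<one>)) = r \<otimes> t (z [^] i \<otimes> \<one>)"
     using t(2)[OF r, of "z [^] i \<otimes> \<one>"] c rS by (simp add: S.m_comm)
    then show "g (r \<otimes> \<one>) i = r \<otimes> g \<one> i"
     unfolding g_def using c rS tc[of "z [^] i \<otimes> \<one>"] by (simp add: S.m_lcomm)
   qed (use gc rS in auto)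
   also have "\<dots> = r \<otimes> t1 \<one>"
    unfolding t1_def using gc[OF S.one_closed] rS by (subst S.finsum_rdistr) auto
   finally have "h r = v \<otimes> (r \<otimes> t1 \<one>)" using rS by (simp add: h_def)
   also have "\<dots> = r \<otimes> (v \<otimes> t1 \<one>)" using v(1) rS t1c by (simp add: S.m_lcomm)
   finally show ?thesis using v(2) rS by simp
  qed
  show "acong S p (h x) (s x)" if x: "x \<in> carrier S" for x
  proof -
   have N1: "acong S p (add_pow S N \<one>) (t1 \<one>)"
   proof -
    have "acong S p (t1 \<one>) (add_pow S N \<one> \<otimes> s \<one>)" by (rule t1s) simp
    also have "acong S p \<dots> (add_pow S N \<one> \<otimes> \<one>)" by (rule S.acong_mult_left[OF s1]) simp
    finally show ?thesis using S.acong_sym by simp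
   qed
   have "acong S p (h x) (v \<otimes> (add_pow S N \<one> \<otimes> s x))"
    unfolding h_def by (rule S.acong_mult_left[OF t1s[OF x] v(1)])
   also have "acong S p \<dots> (v \<otimes> (t1 \<one> \<otimes> s x))"
    by (rule S.acong_mult_left[OF S.acong_mult[OF N1 S.acong_refl[OF sc[OF x]]] v(1)])
   also have "v \<otimes> (t1 \<one> \<otimes> s x) = s x"
    using v t1c sc[OF x] by (simp add: S.m_assoc[symmetric])
   finally show ?thesis .
  qed
 qed
qed

text \<open>A unit of \<open>R\<close> stays a unit in \<open>S\<close>, hence is not divisible by
  \<open>p\<close> there: the \<open>p\<close>-adic valuation of an element of \<open>R\<close> does
  not change in \<open>S\<close>.\<close>

lemma acong_reflect:
 assumes xy: "x \<in> carrier R" "y \<in> carrier R" and cg: "acong S (p ^ k) x y"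
 shows "acong R (p ^ k) x y"
proof -
 define d where "d = x \<oplus>\<^bsub>R\<^esub> \<ominus>\<^bsub>R\<^esub> y"
 have d: "d \<in> carrier R" using xy by (simp add: d_def)
 have xd: "x = d \<oplus>\<^bsub>R\<^esub> y" using xy by (simp add: d_def R.a_assoc R.l_neg)
 have "acong S (p ^ k) (x \<oplus> \<ominus> y) (y \<oplus> \<ominus> y)"
  using cg xy subset by (intro S.acong_add S.acong_refl) auto
 moreover have "d = x \<oplus> \<ominus> y"
  using add_R[OF xy(1) R.a_inv_closed[OF xy(2)]] uminus_R[OF xy(2)] by (simp add: d_def)
 ultimately have dS: "acong S (p ^ k) d \<zero>"
  using subset[OF xy(2)] by (simp add: S.r_neg)
 have "acong R (p ^ k) d \<zero>\<^bsub>R\<^esub>"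
 proof (cases "d = \<zero>\<^bsub>R\<^esub>")
  case False
  then obtain e u where eu: "u \<in> Units R" "d = add_pow R (p ^ e) u" by (rule R.p_factorization[OF d])
  have uc: "u \<in> carrier R" "u \<in> carrier S" using eu subset by auto
  show ?thesis
  proof (cases "k \<le> e")
   case True
   then have "p ^ e = p ^ (e - k) * p ^ k" by (simp flip: power_add)
   then have "d = add_pow R (p ^ k) (add_pow R (p ^ (e - k)) u)"
    using eu uc by (simp add: R.add.nat_pow_pow)
   then show ?thesis using R.acong_add_pow uc by simp
  next
   case False
   obtain s where s: "s \<in> carrier S" "d = add_pow S (p ^ k) s" by (rule S.acong_zeroE[OF dS])
   have "p ^ k = p ^ (k - e) * p ^ e" using False by (simp flip: power_add)
   then have "add_pow S (p ^ e) u = add_pow S (p ^ e) (add_pow S (p ^ (k - e)) s)"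
    using eu s uc add_pow_R[OF uc(1)] by (simp add: S.add.nat_pow_pow)
   then have "u = add_pow S (p ^ (k - e)) s" using S.p_cancel uc(2) s(1) by blast
   then have "acong S (p ^ (k - e)) u \<zero>" using S.acong_add_pow[OF s(1)] by simp
   then have "acong S (p ^ 1) u \<zero>" by (rule S.acong_le_power) (use False in simp)
   then have "acong S p (inv\<^bsub>R\<^esub> u \<otimes> u) (inv\<^bsub>R\<^esub> u \<otimes> \<zero>)"
    using subset eu(1) by (intro S.acong_mult_left) auto
   moreover have "inv\<^bsub>R\<^esub> u \<otimes> u = \<one>"
    using eu(1) uc mult_R[of "inv\<^bsub>R\<^esub> u" u] one_R by simp
   moreover have "inv\<^bsub>R\<^esub> u \<in> carrier S" using subset eu(1) by simp
   ultimately show ?thesis using S.one_not_p by simp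
  qed
 qed (simp add: R.acong_refl)
 then have "acong R (p ^ k) (d \<oplus>\<^bsub>R\<^esub> y) (\<zero>\<^bsub>R\<^esub> \<oplus>\<^bsub>R\<^esub> y)"
  using xy by (intro R.acong_add R.acong_refl)
 then show ?thesis using xd xy by simp
qed

text \<open>With \<open>q\<close> the number of residues of \<open>R\<close>, nonzero residues
  satisfying \<open>x ^ q = x\<close> are roots of \<open>X ^ (q - 1) = 1\<close>. There are at most
  \<open>q - 1\<close> of them, and the nonzero residues of \<open>R\<close> already supply that
  many.\<close>

lemma frobenius_fixed_residue:
 assumes x: "x \<in> carrier S" "acong S p (x [^] R.residue_card) x"
 shows "\<exists>r\<in>carrier R. acong S p x r"
proof (cases "acong S p x \<zero>")
 case True
 then show ?thesis by (intro bexI[OF _ R.zero_closed]) (simp add: zero_R)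
next
 case False
 let ?q = "R.residue_card"
 interpret k: field S.residues by (rule S.residue_field_field)
 interpret kR: field R.residues by (rule R.residue_field_field)
 define A where "A = {y \<in> carrier S.residues. y [^]\<^bsub>S.residues\<^esub> (?q - 1) = \<one>\<^bsub>S.residues\<^esub>}"
 have q: "?q > 1" by (rule R.residue_card_gt_1)
 have A: "finite A" "card A \<le> ?q - 1"
  unfolding A_def using S.finite_residues k.num_roots_le_deg[OF S.finite_residues, of "?q - 1"] q by auto
 have inA: "S.residue y \<in> A" if y: "y \<in> carrier S" "acong S p (y [^] ?q) y" "\<not> acong S p y \<zero>" for y
 proof -
  have yk: "S.residue y \<in> carrier S.residues" "S.residue y \<noteq> \<zero>\<^bsub>S.residues\<^esub>"
   using y S.carrier_residues S.residue_zero_iff by auto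
  have "S.residue y [^]\<^bsub>S.residues\<^esub> ?q = S.residue y"
   using y S.residue_pow[OF y(1), of ?q] S.residue_eq_iff[of "y [^] ?q" y] by simp
  moreover have "?q = Suc (?q - 1)" using q by simp
  ultimately have "S.residue y [^]\<^bsub>S.residues\<^esub> (?q - 1) \<otimes>\<^bsub>S.residues\<^esub> S.residue y = \<one>\<^bsub>S.residues\<^esub> \<otimes>\<^bsub>S.residues\<^esub> S.residue y"
   using yk k.nat_pow_Suc[of "S.residue y" "?q - 1"] by simp
  then have "S.residue y [^]\<^bsub>S.residues\<^esub> (?q - 1) = \<one>\<^bsub>S.residues\<^esub>"
   using k.m_rcancel[OF yk(2,1) k.nat_pow_closed[OF yk(1)] k.one_closed] by blast
  then show ?thesis using yk by (simp add: A_def)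
 qed
 \<comment> \<open>The embedding of the residue field of \<open>R\<close> into that of
   \<open>S\<close>, through chosen representatives.\<close>
 define g where "g c = S.residue (SOME r. r \<in> carrier R \<and> R.residue r = c)" for c
 have g: "\<exists>r. r \<in> carrier R \<and> R.residue r = c \<and> g c = S.residue r" if c: "c \<in> carrier R.residues" for c
 proof -
  have "\<exists>r. r \<in> carrier R \<and> R.residue r = c" using c R.carrier_residues by auto
  then show ?thesis unfolding g_def by (metis (mono_tags, lifting) someI_ex)
 qed
 let ?U = "carrier R.residues - {\<zero>\<^bsub>R.residues\<^esub>}"
 have "g ` ?U \<subseteq> A"
 proof
  fix y assume "y \<in> g ` ?U"
  then obtain c where c: "c \<in> carrier R.residues" "c \<noteq> \<zero>\<^bsub>R.residues\<^esub>" "y = g c" by blast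
  then obtain r where r: "r \<in> carrier R" "R.residue r = c" "y = S.residue r" using g by blast
  have "\<not> acong R p r \<zero>\<^bsub>R\<^esub>" using c r R.residue_zero_iff by auto
  then have "\<not> acong S p r \<zero>" using acong_reflect[OF r(1) R.zero_closed, of 1] zero_R by auto
  moreover have "acong S p (r [^] ?q) r"
   using acong_R[OF R.residue_card_pow_cong[OF r(1)]] pow_R[OF r(1)] by simp
  ultimately show "y \<in> A" using inA[OF subset[OF r(1)]] r by simp
 qed
 moreover have "inj_on g ?U"
 proof (rule inj_onI)
  fix c c' assume c: "c \<in> ?U" "c' \<in> ?U" "g c = g c'"
  obtain r where r: "r \<in> carrier R" "R.residue r = c" "g c = S.residue r" using g c by blast
  obtain r' where r': "r' \<in> carrier R" "R.residue r' = c'" "g c' = S.residue r'" using g c by blast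
  have "acong S p r r'" using c r r' S.residue_eq_iff[OF subset[OF r(1)] subset[OF r'(1)]] by simp
  then have "acong R p r r'" using acong_reflect[OF r(1) r'(1), of 1] by simp
  then show "c = c'" using R.residue_eq_iff[OF r(1) r'(1)] r(2) r'(2) by simp
 qed
 then have "card (g ` ?U) = ?q - 1"
  using R.finite_residues by (simp add: card_image R.residue_card_def)
 ultimately have "g ` ?U = A" using A by (metis card_seteq)
 then have "S.residue x \<in> g ` ?U" using inA[OF x False] by simp
 then obtain c where "c \<in> carrier R.residues" "S.residue x = g c" by blast
 then obtain r where "r \<in> carrier R" "S.residue x = S.residue r" using g by metis
 then show ?thesis using S.residue_eq_iff[OF x(1)] subset by blast
qed

lemma ring_hom_funpow: "h \<in> ring_hom S S \<Longrightarrow> h ^^ n \<in> ring_hom S S"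
proof (induction n)
 case 0
 show ?case by (rule ring_hom_memI) auto
next
 case (Suc n)
 then show ?case using ring_hom_trans[of "h ^^ n" S S h S] by (simp only: funpow.simps)
qed

text \<open>The coordinates are \<open>a i = z^(-i) / N\<close> and \<open>b i = z^i\<close> for a
  primitive root of unity \<open>z\<close>. Then \<open>\<Sum> a i F^j (b i)\<close> is a geometric
  series in \<open>F^j z / z\<close>, an \<open>N\<close>-th root of unity different from
  \<open>\<one>\<close> for \<open>0 < j < m\<close>, and it vanishes because \<open>S\<close> is a
  domain.\<close>

lemma galois_generator:
 obtains F m N a b where "F \<in> ring_hom S S" "\<And>r. r \<in> carrier R \<Longrightarrow> F r = r"
  "\<And>x. x \<in> carrier S \<Longrightarrow> acong S p (F x) (x [^] R.residue_card)"
  "m > 0" "\<And>x. x \<in> carrier S \<Longrightarrow> (F ^^ m) x = x"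
  "a \<in> {..<N::nat} \<rightarrow> carrier S" "b \<in> {..<N} \<rightarrow> carrier S"
  "\<And>j. j < m \<Longrightarrow> (\<Oplus>i\<in>{..<N}. a i \<otimes> (F ^^ j) (b i)) = (if j = 0 then \<one> else \<zero>)"
  "\<And>x. \<lbrakk>x \<in> carrier S; F x = x\<rbrakk> \<Longrightarrow> x \<in> carrier R"
proof -
 let ?q = "R.residue_card"
 obtain f where f: "?q = p ^ f" using R.residue_card_prime_power by blast
 obtain e where e: "e > 0" "S.residue_card = p ^ e" using S.residue_card_prime_power by blast
 have "residue_endo (\<lambda>x. x [^] ?q)"
  unfolding residue_endo_def
 proof (intro conjI ballI allI impI)
  fix x y assume xy: "x \<in> carrier S" "y \<in> carrier S"
  show "acong S p ((x \<oplus> y) [^] ?q) (x [^] ?q \<oplus> y [^] ?q)"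
   unfolding f by (rule S.acong_frobenius_power[OF S.prime_p xy])
  show "acong S p ((x \<otimes> y) [^] ?q) (x [^] ?q \<otimes> y [^] ?q)"
   using xy by (simp add: S.nat_pow_distrib S.acong_refl)
 next
  fix r assume r: "r \<in> carrier R"
  show "acong S p (r [^] ?q) r"
   using acong_R[OF R.residue_card_pow_cong[OF r]] pow_R[OF r] by simp
 next
  fix x y assume "acong S p x y"
  then show "acong S p (x [^] ?q) (y [^] ?q)" by (rule S.acong_pow)
 qed auto
 then obtain F where F: "F \<in> ring_hom S S" "\<And>r. r \<in> carrier R \<Longrightarrow> F r = r"
  "\<And>x. x \<in> carrier S \<Longrightarrow> acong S p (F x) (x [^] ?q)" by (rule lift_exists; blast)
 note Fc = ring_hom_closed[OF F(1)]
 note Fp = ring_hom_funpow[OF F(1)]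
 note Fpc = ring_hom_closed[OF Fp]
 have idh: "(\<lambda>x. x) \<in> ring_hom S S" by (rule ring_hom_memI) auto
 note S_padic = S.padic_ring_axioms
 have Fpow: "acong S p ((F ^^ n) x) (x [^] (?q ^ n))" if x: "x \<in> carrier S" for n x
 proof (induction n)
  case 0
  then show ?case using x S.acong_refl by simp
 next
  case (Suc n)
  have "acong S p (F ((F ^^ n) x)) (((F ^^ n) x) [^] ?q)" by (rule F(3)[OF Fpc[OF x]])
  also have "acong S p \<dots> ((x [^] (?q ^ n)) [^] ?q)" by (rule S.acong_pow[OF Suc])
  finally show ?case using x by (simp add: S.nat_pow_pow mult.commute)
 qed
 define P where "P n \<longleftrightarrow> n > 0 \<and> (\<forall>x\<in>carrier S. (F ^^ n) x = x)" for n
 \<comment> \<open>\<open>q ^ e\<close> is a power of the number of residues of \<open>S\<close>, so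
   \<open>F ^^ e\<close> is trivial on residues and therefore trivial.\<close>
 have "P e"
  unfolding P_def
 proof (intro conjI ballI e)
  fix x assume x: "x \<in> carrier S"
  show "(F ^^ e) x = x"
  proof (rule ring_hom_eqI_residue[OF S_padic S_padic Fp idh _ x])
   fix y assume y: "y \<in> carrier S"
   have "?q ^ e = S.residue_card ^ f" unfolding f e(2) by (simp flip: power_mult add: mult.commute)
   then show "acong S p ((F ^^ e) y) y"
    using Fpow[OF y, of e] S.residue_card_power_pow_cong[OF y, of f] S.acong_trans by metis
  qed
 qed
 define m where "m = (LEAST n. P n)"
 have m: "P m" unfolding m_def by (rule LeastI[of P, OF \<open>P e\<close>])
 have mm: "\<not> P j" if "j < m" for j using that not_less_Least unfolding m_def by blast
 obtain z where z: "z \<in> Units S" "z [^] (S.residue_card - 1) = \<one>"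
  "z [^] S.residue_card = z"
  "\<And>x. x \<in> carrier S \<Longrightarrow> acong S p x \<zero> \<or> (\<exists>i::nat. acong S p x (z [^] i))"
  by (rule S.primitive_root_of_unity; rule that; assumption)
 define N where "N = S.residue_card - 1"
 define w where "w = inv z"
 define nu where "nu = inv (add_pow S N \<one>)"
 have zw: "z \<in> carrier S" "w \<in> carrier S" "w \<otimes> z = \<one>" using z by (auto simp: w_def)
 have nu: "nu \<in> carrier S" "nu \<otimes> add_pow S N \<one> = \<one>"
  using S.residue_card_minus_1_unit unfolding nu_def N_def by auto
 have wN: "w [^] N = \<one>"
  using S.nat_pow_distrib[OF zw(2,1), of N] zw(2,3) z(2)[folded N_def] by simp
 \<comment> \<open>The powers of \<open>z\<close> represent all nonzero residues; if
   \<open>F ^^ j\<close> fixed \<open>z\<close> it would be trivial, against the minimality of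
   \<open>m\<close>.\<close>
 have fixz: "(F ^^ j) z \<noteq> z" if j: "0 < j" "j < m" for j
 proof
  assume eq: "(F ^^ j) z = z"
  have "(F ^^ j) x = x" if x: "x \<in> carrier S" for x
  proof (rule ring_hom_eqI_residue[OF S_padic S_padic Fp idh _ x])
   fix y assume y: "y \<in> carrier S"
   note Fcong = S.acong_add_hom[OF _ S.abelian_group_axioms ring_hom_add_hom[OF Fp]]
   show "acong S p ((F ^^ j) y) y"
   proof (cases "acong S p y \<zero>")
    case True
    have "acong S p ((F ^^ j) y) ((F ^^ j) \<zero>)" by (rule Fcong[OF True])
    also have "(F ^^ j) \<zero> = \<zero>"
     by (rule add_hom_zero[OF S.abelian_group_axioms S.abelian_group_axioms ring_hom_add_hom[OF Fp]])
    finally show ?thesis using True S.acong_join by blast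
   next
    case False
    then obtain i :: nat where i: "acong S p y (z [^] i)" using z(4)[OF y] by blast
    have "acong S p ((F ^^ j) y) ((F ^^ j) (z [^] i))" by (rule Fcong[OF i])
    also have "(F ^^ j) (z [^] i) = z [^] i"
     using ring_hom_pow[OF S.ring_axioms Fp zw(1)] eq by simp
    finally show ?thesis using i S.acong_join by blast
   qed
  qed
  then have "P j" using j by (simp add: P_def)
  then show False using mm j by blast
 qed
 have coords: "(\<Oplus>i\<in>{..<N}. (nu \<otimes> w [^] i) \<otimes> (F ^^ j) (z [^] i)) = (if j = 0 then \<one> else \<zero>)"
  if j: "j < m" for j
 proof -
  define om where "om = w \<otimes> (F ^^ j) z"
  have Fz: "(F ^^ j) z \<in> carrier S" by (rule Fpc[OF zw(1)])
  have om: "om \<in> carrier S" using zw Fz by (simp add: om_def)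
  have "(\<Oplus>i\<in>{..<N}. (nu \<otimes> w [^] i) \<otimes> (F ^^ j) (z [^] i)) = (\<Oplus>i\<in>{..<N}. nu \<otimes> om [^] i)"
  proof (rule S.finsum_cong')
   fix i :: nat
   show "(nu \<otimes> w [^] i) \<otimes> (F ^^ j) (z [^] i) = nu \<otimes> om [^] i"
    unfolding om_def using S.nat_pow_distrib[OF zw(2) Fz, of i] ring_hom_pow[OF S.ring_axioms Fp zw(1), where n=i] nu(1) zw Fz
    by (simp add: S.m_assoc)
  qed (use nu om in auto)
  also have "\<dots> = nu \<otimes> (\<Oplus>i\<in>{..<N}. om [^] i)"
   using nu om by (subst S.finsum_rdistr) auto
  finally have eq: "(\<Oplus>i\<in>{..<N}. (nu \<otimes> w [^] i) \<otimes> (F ^^ j) (z [^] i)) =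
    nu \<otimes> (\<Oplus>i\<in>{..<N}. om [^] i)" .
  show ?thesis
  proof (cases "j = 0")
   case True
   then have "om = \<one>" using zw by (simp add: om_def)
   then have "(\<Oplus>i\<in>{..<N}. om [^] i) = add_pow S N \<one>"
    using S.add.finprod_const[of "\<one>" "{..<N}"] by simp
   then show ?thesis unfolding eq using nu True by simp
  next
   case False
   let ?s = "\<Oplus>i\<in>{..<N}. om [^] i"
   have sc: "?s \<in> carrier S" using om by (auto intro!: S.finsum_closed)
   have omN: "om [^] N = \<one>"
   proof -
    have "(F ^^ j) z [^] N = \<one>"
     using ring_hom_pow[OF S.ring_axioms Fp zw(1), of j N] z(2)[folded N_def] ring_hom_one[OF Fp, of j]
     by simp
    then show ?thesis unfolding om_def S.nat_pow_distrib[OF zw(2) Fz] wN by simp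
   qed
   have "om \<otimes> ?s = (\<Oplus>i\<in>{..<N}. om \<otimes> om [^] i)"
    using om by (intro S.finsum_rdistr) auto
   also have "\<dots> = (\<Oplus>i\<in>{..<N}. om [^] Suc i)"
    using om by (intro S.finsum_cong') (auto simp: S.m_comm)
   also have "\<dots> = ?s"
    by (rule S.finsum_cyclic_shift) (use om omN in auto)
   finally have "om \<otimes> ?s = \<one> \<otimes> ?s" using sc by simp
   moreover have "om \<noteq> \<one>"
   proof
    assume o1: "om = \<one>"
    have "z \<otimes> om = (w \<otimes> z) \<otimes> (F ^^ j) z"
     unfolding om_def using zw(1,2) Fz by (simp add: S.m_ac)
    then have "(F ^^ j) z = z" using o1 zw Fz by simp
    then show False using fixz[of j] False j by simp
   qed
   ultimately have "?s = \<zero>"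
    using S.m_rcancel[OF _ sc om S.one_closed] by blast
   then show ?thesis unfolding eq using nu False by simp
  qed
 qed
 \<comment> \<open>The residue of a fixed element comes from \<open>R\<close>. After subtracting a
   representative from \<open>R\<close> and dividing by \<open>p\<close>, which acts injectively,
   the quotient is fixed again; so the element is approximated by \<open>R\<close> to every order
   and lies in \<open>R\<close> by completeness.\<close>
 have fixR: "x \<in> carrier R" if x: "x \<in> carrier S" "F x = x" for x
 proof -
  have "\<forall>x\<in>carrier S. F x = x \<longrightarrow> (\<exists>r\<in>carrier R. acong S (p ^ n) x r)" for n
  proof (induction n)
   case 0
   then show ?case using S.acong_one subset R.zero_closed by (metis power_0)
  next
   case (Suc n)
   show ?case
   proof (intro ballI impI)
    fix x assume x: "x \<in> carrier S" "F x = x"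
    obtain r where r: "r \<in> carrier R" "acong S p x r"
     using frobenius_fixed_residue[OF x(1)] F(3)[OF x(1)] x(2) S.acong_sym by metis
    obtain y where y: "y \<in> carrier S" "x = r \<oplus> add_pow S p y" using r unfolding acong_def by blast
    have rS: "r \<in> carrier S" using subset r by blast
    have "F x = r \<oplus> add_pow S p (F y)"
     unfolding y(2) using y(1) rS F(2)[OF r(1)]
      add_hom_add_pow[OF S.abelian_group_axioms S.abelian_group_axioms ring_hom_add_hom[OF F(1)] y(1)]
     by (simp add: ring_hom_add[OF F(1)])
    then have "add_pow S (p ^ 1) (F y) = add_pow S (p ^ 1) y"
     using x(2) y rS Fc[OF y(1)] S.add.l_cancel[of r "add_pow S p (F y)" "add_pow S p y"] by simp
    then have "F y = y" using S.p_cancel Fc y(1) by blast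
    then obtain r' where r': "r' \<in> carrier R" "acong S (p ^ n) y r'" using Suc y(1) by blast
    have "acong S (p * p ^ n) (add_pow S p y) (add_pow S p r')" by (rule S.acong_mult_pow[OF r'(2)])
    then have "acong S (p ^ Suc n) x (r \<oplus> add_pow S p r')"
     unfolding y(2) power_Suc using rS by (intro S.acong_add S.acong_refl)
    moreover have "r \<oplus> add_pow S p r' = r \<oplus>\<^bsub>R\<^esub> add_pow R p r'"
     using r r' by (simp add: add_R add_pow_R[symmetric])
    ultimately show "\<exists>r\<in>carrier R. acong S (p ^ Suc n) x r" using r r' by (metis R.a_closed R.add.nat_pow_closed)
   qed
  qed
  then have "\<forall>n. \<exists>r. r \<in> carrier R \<and> acong S (p ^ n) x r" using x by blast
  then obtain r where r: "\<And>n. r n \<in> carrier R" "\<And>n. acong S (p ^ n) x (r n)" by metis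
  have "acong R (p ^ n) (r (Suc n)) (r n)" for n
  proof (rule acong_reflect[OF r(1) r(1)])
   have "acong S (p ^ n) x (r (Suc n))" by (rule S.acong_le_power[OF r(2)]) simp
   then show "acong S (p ^ n) (r (Suc n)) (r n)" using r(2)[of n] S.acong_sym S.acong_trans by blast
  qed
  then obtain l where l: "\<And>n. acong R (p ^ n) l (r n)" using R.complete[of r] by blast
  have lR: "l \<in> carrier R" using l R.acong_carrier by blast
  have "x = l"
   by (rule S.acong_eqI[OF x(1) subset[OF lR]]) (rule S.acong_join[OF r(2) acong_R[OF l]])
  then show ?thesis using lR by simp
 qed
 show ?thesis
  by (rule that[of F m "\<lambda>i. nu \<otimes> w [^] i" N "\<lambda>i. z [^] i"])
   (use F m coords fixR nu zw in \<open>auto simp: P_def\<close>)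
qed

end

section \<open>Norms in finite groups\<close>

lemma (in group) card_kernel_image:
 assumes "h \<in> hom G G" "finite (carrier G)"
 shows "card (kernel G G h) * card (h ` carrier G) = order G"
proof -
 interpret h: group_hom G G h using assms by unfold_locales
 interpret I: group_hom G "G\<lparr>carrier := h ` carrier G\<rparr>" h
  by (rule group_hom.intro[OF group_axioms subgroup_imp_group[OF h.img_is_subgroup]])
   (use assms(1) in \<open>auto simp: group_hom_axioms_def hom_def\<close>)
 have k: "kernel G (G\<lparr>carrier := h ` carrier G\<rparr>) h = kernel G G h" by (simp add: kernel_def)
 have "card (carrier (G Mod kernel G G h)) = card (h ` carrier G)"
  using iso_same_card[OF I.FactGroup_iso] k by simp
 then have "card (h ` carrier G) = card (rcosets (kernel G G h))"
  by (simp add: FactGroup_def)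
 then show ?thesis
  using lagrange[OF h.subgroup_kernel] by (simp add: mult.commute)
qed

text \<open>
 The norm \<open>u \<mapsto> (u f)\<^sup>m f\<^sup>-\<^sup>m\<close> of a finite abelian group \<open>Q\<close> normalised by \<open>f\<close> hits every element
 fixed under conjugation by \<open>f\<close>, provided that its kernel consists of coboundaries: kernel and image
 of the norm and of \<open>v \<mapsto> v f v\<^sup>-\<^sup>1 f\<^sup>-\<^sup>1\<close> are compared by counting.
\<close>

lemma (in group) twisted_power_one:
 assumes Q: "subgroup Q G" "finite Q"
  and comm: "\<And>x y. \<lbrakk>x \<in> Q; y \<in> Q\<rbrakk> \<Longrightarrow> x \<otimes> y = y \<otimes> x"
  and f: "f \<in> carrier G" "\<And>u. u \<in> Q \<Longrightarrow> f \<otimes> u \<otimes> inv f \<in> Q" "f [^] (m::nat) \<in> Q"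
  and h90: "\<And>u. \<lbrakk>u \<in> Q; (u \<otimes> f) [^] m = f [^] m\<rbrakk> \<Longrightarrow> \<exists>v\<in>Q. u \<otimes> f \<otimes> v = v \<otimes> f"
 shows "\<exists>u\<in>Q. (u \<otimes> f) [^] m = \<one>"
proof -
 let ?H = "G\<lparr>carrier := Q\<rparr>"
 have QG: "\<And>u. u \<in> Q \<Longrightarrow> u \<in> carrier G" using Q(1) subgroup.subset by blast
 note Qm = subgroup.m_closed[OF Q(1)] and Qi = subgroup.m_inv_closed[OF Q(1)]
 interpret H: group ?H using subgroup_imp_group[OF Q(1)] .
 \<comment> \<open>The product of the conjugates of \<open>u\<close> by \<open>f ^ i\<close> for
   \<open>i < n\<close>, in closed form; \<open>T m\<close> is the norm.\<close>
 define T where "T n u = (u \<otimes> f) [^] n \<otimes> inv (f [^] n)" for n :: nat and u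
 have T0: "T 0 u = \<one>" if "u \<in> Q" for u using that QG f by (simp add: T_def)
 have TS: "T (Suc n) u = u \<otimes> (f \<otimes> T n u \<otimes> inv f)" if u: "u \<in> Q" for n u
 proof -
  have c: "u \<in> carrier G" "(u \<otimes> f) [^] n \<in> carrier G" "f [^] n \<in> carrier G" using QG[OF u] f by auto
  have "inv (f [^] Suc n) = inv (f [^] n) \<otimes> inv f"
   unfolding nat_pow_Suc2[OF f(1)] using c f(1) by (simp add: inv_mult_group)
  moreover have "(u \<otimes> f) [^] Suc n = (u \<otimes> f) \<otimes> (u \<otimes> f) [^] n"
   using c f(1) by (intro nat_pow_Suc2) auto
  ultimately show ?thesis unfolding T_def using c f(1) by (simp add: m_assoc del: nat_pow_Suc)
 qed
 have TQ: "T n u \<in> Q" if "u \<in> Q" for n u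
  using that by (induction n) (auto simp: T0 TS Q(1) subgroup.one_closed intro!: Qm f(2))
 have conj: "f \<otimes> (x \<otimes> y) \<otimes> inv f = (f \<otimes> x \<otimes> inv f) \<otimes> (f \<otimes> y \<otimes> inv f)" if "x \<in> Q" "y \<in> Q" for x y
 proof -
  have "inv f \<otimes> (f \<otimes> z) = z" if "z \<in> carrier G" for z
   using that f(1) by (simp add: m_assoc[symmetric])
  then show ?thesis using that QG f(1) by (simp add: m_assoc)
 qed
 have Thom: "T n (u \<otimes> v) = T n u \<otimes> T n v" if "u \<in> Q" "v \<in> Q" for n u v
 proof (induction n)
  case 0
  then show ?case using that T0 Qm by simp
 next
  case (Suc n)
  let ?a = "f \<otimes> T n u \<otimes> inv f" and ?b = "f \<otimes> T n v \<otimes> inv f"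
  have ab: "?a \<in> Q" "?b \<in> Q" using f(2) TQ that by auto
  have "T (Suc n) (u \<otimes> v) = u \<otimes> v \<otimes> (?a \<otimes> ?b)"
   using TS[OF Qm[OF that]] Suc conj[OF TQ TQ] that by simp
  also have "\<dots> = u \<otimes> (v \<otimes> ?a) \<otimes> ?b" using ab that QG by (simp add: m_assoc)
  also have "v \<otimes> ?a = ?a \<otimes> v" by (rule comm[OF that(2) ab(1)])
  also have "u \<otimes> (?a \<otimes> v) \<otimes> ?b = (u \<otimes> ?a) \<otimes> (v \<otimes> ?b)"
   using QG[OF ab(1)] QG[OF ab(2)] that QG by (simp add: m_assoc)
  finally show ?case using TS that by simp
 qed
 define D where "D v = v \<otimes> inv (f \<otimes> v \<otimes> inv f)" for v
 have DQ: "D v \<in> Q" if "v \<in> Q" for v unfolding D_def using that Qm Qi f(2) by auto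
 have Dhom: "D (u \<otimes> v) = D u \<otimes> D v" if "u \<in> Q" "v \<in> Q" for u v
 proof -
  let ?a = "f \<otimes> u \<otimes> inv f" and ?b = "f \<otimes> v \<otimes> inv f"
  have ab: "?a \<in> Q" "?b \<in> Q" using f(2) that by auto
  have i: "inv ?a \<in> Q" "inv ?b \<in> Q" using ab Qi by auto
  have "D (u \<otimes> v) = u \<otimes> v \<otimes> (inv ?b \<otimes> inv ?a)"
   unfolding D_def conj[OF that] using ab QG by (simp add: inv_mult_group)
  also have "inv ?b \<otimes> inv ?a = inv ?a \<otimes> inv ?b" by (rule comm[OF i(2,1)])
  also have "u \<otimes> v \<otimes> (inv ?a \<otimes> inv ?b) = u \<otimes> (v \<otimes> inv ?a) \<otimes> inv ?b"
   using QG[OF i(1)] QG[OF i(2)] that QG by (simp add: m_assoc)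
  also have "v \<otimes> inv ?a = inv ?a \<otimes> v" by (rule comm[OF that(2) i(1)])
  also have "u \<otimes> (inv ?a \<otimes> v) \<otimes> inv ?b = D u \<otimes> D v"
   unfolding D_def using QG[OF i(1)] QG[OF i(2)] that QG by (simp add: m_assoc)
  finally show ?thesis .
 qed
 have hT: "T m \<in> hom ?H ?H" and hD: "D \<in> hom ?H ?H"
  by (auto intro!: homI TQ DQ Thom Dhom)
 have D1: "D v = \<one> \<longleftrightarrow> v \<otimes> f = f \<otimes> v" if v: "v \<in> Q" for v
 proof -
  have vc: "v \<in> carrier G" "f \<otimes> v \<otimes> inv f \<in> carrier G" using QG v f by auto
  have "D v = \<one> \<longleftrightarrow> v = f \<otimes> v \<otimes> inv f"
  proof
   assume "D v = \<one>"
   then show "v = f \<otimes> v \<otimes> inv f" unfolding D_def using vc inv_equality[of v "inv (f \<otimes> v \<otimes> inv f)"] by simp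
  next
   assume e: "v = f \<otimes> v \<otimes> inv f"
   show "D v = \<one>" unfolding D_def e[symmetric] using vc(1) by simp
  qed
  also have "\<dots> \<longleftrightarrow> v \<otimes> f = f \<otimes> v"
   using vc(1) f(1) inv_solve_right[of v "f \<otimes> v" f] by auto
  finally show ?thesis .
 qed
 \<comment> \<open>\<open>(u f) ^ m\<close> lies in the commutative group \<open>Q\<close>, so it
   commutes with \<open>u\<close>; it also commutes with \<open>u f\<close>, hence with
   \<open>f\<close>.\<close>
 have fT: "T m u \<otimes> f = f \<otimes> T m u" if u: "u \<in> Q" for u
 proof -
  let ?g = "u \<otimes> f" let ?t = "T m u" let ?c = "f [^] m"
  have c: "u \<in> carrier G" "?g \<in> carrier G" "?t \<in> carrier G" "?c \<in> carrier G" using QG u f TQ by auto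
  have gm: "?g [^] m = ?t \<otimes> ?c" unfolding T_def using c f(1) by (simp add: m_assoc)
  have "?g [^] m \<in> Q" unfolding gm using TQ[OF u] f(3) Qm by blast
  then have 1: "?g [^] m \<otimes> u = u \<otimes> ?g [^] m" using comm u by blast
  have 2: "?g [^] m \<otimes> ?g = ?g \<otimes> ?g [^] m" using c nat_pow_Suc2[of ?g m] by simp
  have "u \<otimes> (?g [^] m \<otimes> f) = u \<otimes> (f \<otimes> ?g [^] m)"
   using 1 2 c f(1) by (metis m_assoc nat_pow_closed)
  then have "?g [^] m \<otimes> f = f \<otimes> ?g [^] m" using c f(1) by simp
  then have "?t \<otimes> (?c \<otimes> f) = f \<otimes> ?t \<otimes> ?c" unfolding gm using c f(1) by (simp add: m_assoc)
  moreover have "?c \<otimes> f = f \<otimes> ?c" using f(1) nat_pow_Suc2[of f m] by simp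
  ultimately have "(?t \<otimes> f) \<otimes> ?c = (f \<otimes> ?t) \<otimes> ?c" using c f(1) by (simp add: m_assoc)
  then show ?thesis using c f(1) by simp
 qed
 have cardT: "card (kernel ?H ?H (T m)) * card (T m ` Q) = card Q"
  using H.card_kernel_image[OF hT] Q(2) by (simp add: order_def)
 have cardD: "card (kernel ?H ?H D) * card (D ` Q) = card Q"
  using H.card_kernel_image[OF hD] Q(2) by (simp add: order_def)
 have "kernel ?H ?H (T m) \<subseteq> D ` Q"
 proof
  fix u assume "u \<in> kernel ?H ?H (T m)"
  then have u: "u \<in> Q" "T m u = \<one>" by (auto simp: kernel_def)
  have uc: "u \<in> carrier G" using QG u by auto
  have "(u \<otimes> f) [^] m = f [^] m"
   using u(2) uc f(1) inv_equality[of "(u \<otimes> f) [^] m" "inv (f [^] m)"] unfolding T_def by simp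
  then obtain v where v: "v \<in> Q" "u \<otimes> f \<otimes> v = v \<otimes> f" using h90 u(1) by blast
  have vc: "v \<in> carrier G" using QG v by auto
  have "v = u \<otimes> (f \<otimes> v \<otimes> inv f)"
  proof -
   have "u \<otimes> (f \<otimes> v \<otimes> inv f) = u \<otimes> f \<otimes> v \<otimes> inv f" using uc vc f(1) by (simp add: m_assoc)
   then show ?thesis unfolding v(2) using vc f(1) by (simp add: m_assoc)
  qed
  then have "D v = u"
   unfolding D_def using uc vc f(1) inv_solve_right[of u v "f \<otimes> v \<otimes> inv f"] by simp
  then show "u \<in> D ` Q" using v by blast
 qed
 then have le: "card (kernel ?H ?H (T m)) \<le> card (D ` Q)" using Q(2) by (intro card_mono) auto
 have sub: "T m ` Q \<subseteq> kernel ?H ?H D"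
  using fT TQ D1 by (auto simp: kernel_def)
 have fin: "finite (kernel ?H ?H D)" "finite (kernel ?H ?H (T m))" using Q(2) by (auto simp: kernel_def)
 \<comment> \<open>For \<open>T m\<close> and for \<open>D\<close>, the sizes of kernel and image
   multiply to \<open>card Q\<close>. The kernel of the norm is no larger than the image of
   \<open>D\<close>, so the image of the norm is no smaller than the kernel of \<open>D\<close>,
   which contains it.\<close>
 have "card (kernel ?H ?H D) \<le> card (T m ` Q)"
 proof (rule ccontr)
  assume "\<not> card (kernel ?H ?H D) \<le> card (T m ` Q)"
  then have lt: "card (T m ` Q) < card (kernel ?H ?H D)" by simp
  have "card (D ` Q) > 0" using Q subgroup.one_closed by (fastforce simp: card_gt_0_iff)
  then have "card (kernel ?H ?H (T m)) * card (T m ` Q) < card (D ` Q) * card (kernel ?H ?H D)"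
   by (rule le_less_trans[OF mult_le_mono1[OF le] mult_less_mono2[OF lt]])
  then show False using cardT cardD by (simp add: mult.commute)
 qed
 then have eq: "T m ` Q = kernel ?H ?H D" using sub fin card_seteq by blast
 have fmc: "f [^] m \<in> carrier G" using f by simp
 have fi: "inv (f [^] m) \<in> Q" using f(3) Qi by blast
 \<comment> \<open>The inverse of \<open>f ^ m\<close> lies in \<open>Q\<close> and commutes with
   \<open>f\<close>, so it is a norm; an element \<open>u\<close> with this norm satisfies
   \<open>(u f) ^ m = 1\<close>.\<close>
 have "inv (f [^] m) \<otimes> f = f \<otimes> inv (f [^] m)"
 proof -
  have "f \<otimes> f [^] m = f [^] m \<otimes> f" using f(1) nat_pow_Suc2[of f m] by simp
  then show ?thesis using f(1) fmc by (metis inv_closed inv_comm inv_solve_left inv_solve_right m_assoc m_closed)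
 qed
 then have "inv (f [^] m) \<in> kernel ?H ?H D" using fi D1 by (simp add: kernel_def)
 then obtain u where u: "u \<in> Q" "T m u = inv (f [^] m)" using eq by (metis imageE)
 then have "(u \<otimes> f) [^] m \<otimes> inv (f [^] m) = \<one> \<otimes> inv (f [^] m)" using fmc by (simp add: T_def)
 then have "(u \<otimes> f) [^] m = \<one>" using u QG f fmc by simp
 then show ?thesis using u by blast
qed

section \<open>Semilinear operators\<close>

lemma funpow_inverse:
 assumes "\<And>x. x \<in> A \<Longrightarrow> g x \<in> A" "\<And>x. x \<in> A \<Longrightarrow> f (g x) = x" "x \<in> A"
 shows "(f ^^ n) ((g ^^ n) x) = x"
proof (induction n)
 case (Suc n)
 have "(g ^^ n) x \<in> A" using assms by (induction n) auto
 then have "(f ^^ Suc n) ((g ^^ Suc n) x) = (f ^^ n) ((g ^^ n) x)"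
  using assms(2) by (simp only: funpow_Suc_right[of n f] funpow.simps(2)[of n g] comp_apply)
 then show ?case using Suc by simp
qed simp

text \<open>\<open>Om\<close> collects the structure besides \<open>S\<close> that endomorphisms
  have to respect. Commuting with an additive operator is a condition that survives
  \<open>p\<close>-adic limits, so compactness applies to the maps commuting with
  \<open>Om\<close>.\<close>

locale operator_module = S: cring S + left_module S M + padic_group M p
 for S :: "('s, 'c) ring_scheme" and M :: "('s, 'm, 'd) module_scheme" (structure) and p +
 fixes Om :: "('m \<Rightarrow> 'm) set"
 assumes Om: "w \<in> Om \<Longrightarrow> w \<in> left_module_hom S M M"
begin

definition semi :: "('s \<Rightarrow> 's) \<Rightarrow> ('m \<Rightarrow> 'm) \<Rightarrow> bool" where
 "semi \<tau> f \<longleftrightarrow> f \<in> add_hom M M \<and>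
   (\<forall>s\<in>carrier S. \<forall>x\<in>carrier M. f (s \<odot> x) = \<tau> s \<odot> f x) \<and>
   (\<forall>w\<in>Om. \<forall>x\<in>carrier M. f (w x) = w (f x))"

abbreviation lin :: "('m \<Rightarrow> 'm) \<Rightarrow> bool" where "lin \<equiv> semi (\<lambda>s. s)"

abbreviation bij :: "('m \<Rightarrow> 'm) \<Rightarrow> bool" where "bij f \<equiv> bij_betw f (carrier M) (carrier M)"

lemma Om_additive: "w \<in> Om \<Longrightarrow> w \<in> add_hom M M"
 using Om by (auto simp: left_module_hom_def add_hom_def)

lemma Om_smult: "\<lbrakk>w \<in> Om; s \<in> carrier S; x \<in> carrier M\<rbrakk> \<Longrightarrow> w (s \<odot> x) = s \<odot> w x"
 using Om by (auto simp: left_module_hom_def)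

lemma Om_closed: "\<lbrakk>w \<in> Om; x \<in> carrier M\<rbrakk> \<Longrightarrow> w x \<in> carrier M"
 by (rule add_hom_closed[OF Om_additive])

lemma semi_additive: "semi \<tau> f \<Longrightarrow> f \<in> add_hom M M"
 and semi_smult: "\<lbrakk>semi \<tau> f; s \<in> carrier S; x \<in> carrier M\<rbrakk> \<Longrightarrow> f (s \<odot> x) = \<tau> s \<odot> f x"
 and semi_Om: "\<lbrakk>semi \<tau> f; w \<in> Om; x \<in> carrier M\<rbrakk> \<Longrightarrow> f (w x) = w (f x)"
 by (auto simp: semi_def)

lemma semi_closed: "\<lbrakk>semi \<tau> f; x \<in> carrier M\<rbrakk> \<Longrightarrow> f x \<in> carrier M"
 by (rule add_hom_closed[OF semi_additive])

lemma semi_add: "\<lbrakk>semi \<tau> f; x \<in> carrier M; y \<in> carrier M\<rbrakk> \<Longrightarrow> f (x \<oplus> y) = f x \<oplus> f y"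
 by (rule add_hom_add[OF semi_additive])

lemma semi_cong: "\<lbrakk>semi \<tau> f; \<And>s. s \<in> carrier S \<Longrightarrow> \<tau> s = \<tau>' s\<rbrakk> \<Longrightarrow> semi \<tau>' f"
 by (auto simp: semi_def)

lemma semi_acong: "\<lbrakk>semi \<tau> f; acong M n x y\<rbrakk> \<Longrightarrow> acong M n (f x) (f y)"
 using acong_add_hom[OF _ abelian_group_axioms semi_additive] .

lemma semi_comp:
 assumes f: "semi \<tau> f" and g: "semi \<tau>' g" and "\<And>s. s \<in> carrier S \<Longrightarrow> \<tau> s \<in> carrier S"
 shows "semi (\<lambda>s. \<tau>' (\<tau> s)) (\<lambda>x. g (f x))"
 unfolding semi_def
proof (intro conjI ballI)
 show "(\<lambda>x. g (f x)) \<in> add_hom M M"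
  by (rule add_hom_comp[OF semi_additive[OF f] semi_additive[OF g]])
qed (use assms in \<open>auto simp: semi_smult[OF f] semi_smult[OF g] semi_Om[OF f] semi_Om[OF g] semi_closed[OF f]\<close>)

lemma lin_id: "lin (\<lambda>x. x)"
 by (auto simp: semi_def add_hom_id)

lemma lin_comp: "\<lbrakk>lin f; lin g\<rbrakk> \<Longrightarrow> lin (\<lambda>x. g (f x))"
 by (rule semi_comp[of "\<lambda>s. s" f "\<lambda>s. s" g])

lemma lin_smult:
 assumes a: "a \<in> carrier S" shows "lin (\<lambda>x. a \<odot> x)"
 unfolding semi_def
proof (intro conjI ballI)
 show "(\<lambda>x. a \<odot> x) \<in> add_hom M M" by (rule additive_smult_right[OF a])
 fix s x assume sx: "s \<in> carrier S" "x \<in> carrier M"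
 have "a \<odot> (s \<odot> x) = (a \<otimes>\<^bsub>S\<^esub> s) \<odot> x" by (rule smult_assoc[OF a sx, symmetric])
 also have "\<dots> = s \<odot> (a \<odot> x)"
  unfolding S.m_comm[OF a sx(1)] by (rule smult_assoc[OF sx(1) a sx(2)])
 finally show "a \<odot> (s \<odot> x) = s \<odot> (a \<odot> x)" .
qed (use a Om_smult in auto)

lemma semi_funpow:
 assumes "semi \<tau> f" "\<And>s. s \<in> carrier S \<Longrightarrow> \<tau> s \<in> carrier S"
 shows "semi (\<tau> ^^ n) (f ^^ n)"
proof (induction n)
 case 0
 then show ?case using lin_id by (simp add: id_def)
next
 case (Suc n)
 have "(\<tau> ^^ n) s \<in> carrier S" if "s \<in> carrier S" for s using that assms(2) by (induction n) auto
 then show ?case using semi_comp[OF Suc assms(1)] by (simp add: comp_def)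
qed

lemma lin_funpow: "lin f \<Longrightarrow> lin (f ^^ n)"
proof (induction n)
 case 0
 then show ?case using lin_id by (simp add: id_def)
next
 case (Suc n)
 then show ?case using lin_comp[of "f ^^ n" f] by (simp add: comp_def)
qed

lemma lin_finsum:
 assumes "\<And>i. i \<in> I \<Longrightarrow> lin (f i)"
 shows "lin (\<lambda>x. \<Oplus>i\<in>I. f i x)"
 unfolding semi_def
proof (intro conjI ballI)
 show "(\<lambda>x. \<Oplus>i\<in>I. f i x) \<in> add_hom M M"
  by (rule add_hom_finsum_fun[OF abelian_group_axioms abelian_group_axioms semi_additive[OF assms]])
next
 fix s x assume sx: "s \<in> carrier S" "x \<in> carrier M"
 have cl: "(\<lambda>i. f i x) \<in> I \<rightarrow> carrier M" using semi_closed[OF assms sx(2)] by simp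
 have "s \<odot> (\<Oplus>i\<in>I. f i x) = (\<Oplus>i\<in>I. s \<odot> f i x)"
  using add_hom_finsum[OF abelian_group_axioms abelian_group_axioms additive_smult_right[OF sx(1)] cl] .
 also have "\<dots> = (\<Oplus>i\<in>I. f i (s \<odot> x))"
  using semi_closed[OF assms smult_closed[OF sx]] semi_smult[OF assms sx] by (intro finsum_cong') auto
 finally show "(\<Oplus>i\<in>I. f i (s \<odot> x)) = s \<odot> (\<Oplus>i\<in>I. f i x)" by simp
next
 fix w x assume wx: "w \<in> Om" "x \<in> carrier M"
 have cl: "(\<lambda>i. f i x) \<in> I \<rightarrow> carrier M" using semi_closed[OF assms wx(2)] by simp
 have "w (\<Oplus>i\<in>I. f i x) = (\<Oplus>i\<in>I. w (f i x))"
  using add_hom_finsum[OF abelian_group_axioms abelian_group_axioms Om_additive[OF wx(1)] cl] .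
 also have "\<dots> = (\<Oplus>i\<in>I. f i (w x))"
  using semi_closed[OF assms Om_closed[OF wx]] semi_Om[OF assms wx] by (intro finsum_cong') auto
 finally show "(\<Oplus>i\<in>I. f i (w x)) = w (\<Oplus>i\<in>I. f i x)" by simp
qed

lemma inv_into_semi:
 assumes f: "semi \<tau> f" "bij f"
  and \<tau>: "\<And>s. s \<in> carrier S \<Longrightarrow> \<tau>' s \<in> carrier S" "\<And>s. s \<in> carrier S \<Longrightarrow> \<tau> (\<tau>' s) = s"
 shows "semi \<tau>' (inv_into (carrier M) f)" (is "semi \<tau>' ?g")
proof -
 have g: "?g x \<in> carrier M" "f (?g x) = x" if "x \<in> carrier M" for x
  using f(2) that by (auto simp: bij_betw_inv_into_right bij_betw_def inv_into_into)
 have gf: "?g (f x) = x" if "x \<in> carrier M" for x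
  using f(2) that by (simp add: bij_betw_inv_into_left)
 show ?thesis
  unfolding semi_def
 proof (intro conjI ballI add_homI)
  fix x y assume xy: "x \<in> carrier M" "y \<in> carrier M"
  have "f (?g x \<oplus> ?g y) = x \<oplus> y"
   using semi_add[OF f(1) g(1)[OF xy(1)] g(1)[OF xy(2)]] g(2)[OF xy(1)] g(2)[OF xy(2)] by simp
  then show "?g (x \<oplus> y) = ?g x \<oplus> ?g y"
   using gf[OF a_closed[OF g(1)[OF xy(1)] g(1)[OF xy(2)]]] by simp
 next
  fix s x assume sx: "s \<in> carrier S" "x \<in> carrier M"
  have "f (\<tau>' s \<odot> ?g x) = s \<odot> x"
   using semi_smult[OF f(1) \<tau>(1)[OF sx(1)] g(1)[OF sx(2)]] \<tau>(2)[OF sx(1)] g(2)[OF sx(2)] by simp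
  then show "?g (s \<odot> x) = \<tau>' s \<odot> ?g x"
   using gf[OF smult_closed[OF \<tau>(1)[OF sx(1)] g(1)[OF sx(2)]]] by simp
 next
  fix w x assume wx: "w \<in> Om" "x \<in> carrier M"
  have "f (w (?g x)) = w x" using semi_Om[OF f(1) wx(1) g(1)[OF wx(2)]] g(2)[OF wx(2)] by simp
  then show "?g (w x) = w (?g x)" using gf[OF Om_closed[OF wx(1) g(1)[OF wx(2)]]] by simp
 qed (use g in auto)
qed

lemma inv_into_lin: "\<lbrakk>lin f; bij f\<rbrakk> \<Longrightarrow> lin (inv_into (carrier M) f)"
 by (rule inv_into_semi) auto

lemma semi_limit:
 assumes f: "\<And>n. semi \<tau> (f n)" and g: "g \<in> add_hom M M"
  and lim: "\<And>k n x. \<lbrakk>k \<le> n; x \<in> carrier M\<rbrakk> \<Longrightarrow> acong M (p ^ k) (g x) (f (r n) x)"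
  and \<tau>: "\<And>s. s \<in> carrier S \<Longrightarrow> \<tau> s \<in> carrier S"
 shows "semi \<tau> g"
 unfolding semi_def
proof (intro conjI ballI g)
 note gc = add_hom_closed[OF g]
 fix s x assume sx: "s \<in> carrier S" "x \<in> carrier M"
 show "g (s \<odot> x) = \<tau> s \<odot> g x"
 proof (rule acong_eqI)
  fix k
  have "acong M (p ^ k) (g (s \<odot> x)) (\<tau> s \<odot> f (r k) x)"
   using lim[of k k "s \<odot> x"] sx by (simp add: semi_smult[OF f] smult_closed)
  moreover have "acong M (p ^ k) (\<tau> s \<odot> g x) (\<tau> s \<odot> f (r k) x)"
   by (rule acong_add_hom[OF lim[OF order.refl sx(2)] abelian_group_axioms additive_smult_right[OF \<tau>[OF sx(1)]]])
  ultimately show "acong M (p ^ k) (g (s \<odot> x)) (\<tau> s \<odot> g x)" by (rule acong_join)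
 qed (use sx gc \<tau> smult_closed in auto)
next
 note gc = add_hom_closed[OF g]
 fix w x assume wx: "w \<in> Om" "x \<in> carrier M"
 show "g (w x) = w (g x)"
 proof (rule acong_eqI)
  fix k
  have "acong M (p ^ k) (g (w x)) (w (f (r k) x))"
   using lim[of k k "w x"] wx by (simp add: semi_Om[OF f] Om_closed)
  moreover have "acong M (p ^ k) (w (g x)) (w (f (r k) x))"
   by (rule acong_add_hom[OF lim[OF order.refl wx(2)] abelian_group_axioms Om_additive[OF wx(1)]])
  ultimately show "acong M (p ^ k) (g (w x)) (w (g x))" by (rule acong_join)
 qed (use wx gc Om_closed in auto)
qed

lemma semi_compact:
 assumes f: "\<And>n. semi \<tau> (f n)" and \<tau>: "\<And>s. s \<in> carrier S \<Longrightarrow> \<tau> s \<in> carrier S"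
 obtains r g where "strict_mono (r :: nat \<Rightarrow> nat)" "semi \<tau> g"
  "\<And>k n x. \<lbrakk>k \<le> n; x \<in> carrier M\<rbrakk> \<Longrightarrow> acong M (p ^ k) (g x) (f (r n) x)"
proof -
 obtain r g where rg: "strict_mono r" "g \<in> add_hom M M"
  "\<And>k n x. \<lbrakk>k \<le> n; x \<in> carrier M\<rbrakk> \<Longrightarrow> acong M (p ^ k) (g x) (f (r n) x)"
  by (rule add_hom_compact[of f, OF semi_additive[OF f]]; rule that; assumption)
 show ?thesis by (rule that[OF rg(1) semi_limit[of \<tau> f, OF f rg(2,3) \<tau>] rg(3)])
qed

end

section \<open>Fitting's lemma and locality of the endomorphism ring\<close>

lemma (in abelian_group) acong_funpow:
 assumes "f \<in> add_hom G G" "g \<in> add_hom G G"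
  and "\<And>x. x \<in> carrier G \<Longrightarrow> acong G N (f x) (g x)" "x \<in> carrier G"
 shows "acong G N ((f ^^ n) x) ((g ^^ n) x)"
proof (induction n)
 case 0
 then show ?case using assms acong_refl by simp
next
 case (Suc n)
 have "acong G N (f ((f ^^ n) x)) (f ((g ^^ n) x))"
  by (rule acong_add_hom[OF Suc abelian_group_axioms assms(1)])
 also have "acong G N \<dots> (g ((g ^^ n) x))"
  by (rule assms(3)[OF add_hom_closed[OF add_hom_funpow[OF assms(2)] assms(4)]])
 finally show ?case by simp
qed

locale indecomposable_operator_module = operator_module +
 assumes nontrivial: "carrier M \<noteq> {\<zero>}"
  and idempotent_trivial:
   "\<lbrakk>lin e; \<And>x. x \<in> carrier M \<Longrightarrow> e (e x) = e x\<rbrakk> \<Longrightarrow>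
    (\<forall>x\<in>carrier M. e x = \<zero>) \<or> (\<forall>x\<in>carrier M. e x = x)"
begin

text \<open>If \<open>M = p M\<close>, then every element is divisible by all powers of
  \<open>p\<close> and vanishes by separatedness. This is the form of Nakayama's lemma that sets
  nilpotency modulo \<open>p\<close> against nontriviality.\<close>

lemma not_p_divisible: "\<exists>x\<in>carrier M. \<not> acong M p x \<zero>"
proof (rule ccontr)
 assume "\<not> ?thesis"
 then have d: "\<exists>z\<in>carrier M. x = add_pow M p z" if "x \<in> carrier M" for x
  using that acong_zeroE by metis
 have "\<forall>x\<in>carrier M. \<exists>z\<in>carrier M. x = add_pow M (p ^ k) z" for k
 proof (induction k)
  case (Suc k)
  show ?case
  proof
   fix x assume "x \<in> carrier M"
   then obtain y where y: "y \<in> carrier M" "x = add_pow M p y" using d by blast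
   then obtain z where z: "z \<in> carrier M" "y = add_pow M (p ^ k) z" using Suc by blast
   then show "\<exists>z\<in>carrier M. x = add_pow M (p ^ Suc k) z"
    using y by (auto simp: add.nat_pow_pow mult.commute)
  qed
 qed auto
 then have "x = \<zero>" if "x \<in> carrier M" for x
  using separated[of x] acong_add_pow that by metis
 then show False using nontrivial by auto
qed

text \<open>
 Fitting's lemma. The powers \<open>f ^^ fact n\<close> are eventually constant and idempotent modulo every
 \<open>p ^ k\<close>, so they converge to an idempotent.
\<close>

lemma bij_or_nilpotent:
 assumes f: "lin f"
 shows "bij f \<or> (\<exists>n. \<forall>x\<in>carrier M. acong M p ((f ^^ n) x) \<zero>)"
proof -
 note fp = lin_funpow[OF f]
 note fpc = semi_closed[OF fp]
 obtain r e where re: "strict_mono r" "lin e"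
  "\<And>k n x. \<lbrakk>k \<le> n; x \<in> carrier M\<rbrakk> \<Longrightarrow> acong M (p ^ k) (e x) ((f ^^ fact (r n)) x)"
  by (rule semi_compact[of "\<lambda>s. s" "\<lambda>n. f ^^ fact n"]; (rule fp | rule that | assumption); assumption)
 have stable: "\<exists>N. \<forall>a b x. N \<le> a \<longrightarrow> N \<le> b \<longrightarrow> fact N dvd a \<longrightarrow> fact N dvd b \<longrightarrow> x \<in> carrier M \<longrightarrow>
   acong M (p ^ k) ((f ^^ a) x) ((f ^^ b) x)" for k
  by (rule funpow_stable[OF semi_additive[OF f], of k]) blast
 have dv: "(fact N :: nat) dvd fact n" if "N \<le> n" for N n using that by (rule fact_dvd)
 have ge: "N \<le> (fact n :: nat)" if "N \<le> n" for N n using that fact_ge_self[of n] by linarith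
 have lim: "\<exists>N. (\<forall>n\<ge>N. \<forall>x\<in>carrier M. acong M (p ^ k) (e x) ((f ^^ fact n) x)) \<and>
   (\<forall>a b x. N \<le> a \<longrightarrow> N \<le> b \<longrightarrow> fact N dvd a \<longrightarrow> fact N dvd b \<longrightarrow> x \<in> carrier M \<longrightarrow>
   acong M (p ^ k) ((f ^^ a) x) ((f ^^ b) x))" for k
 proof -
  obtain N where N: "\<And>a b x. \<lbrakk>N \<le> a; N \<le> b; fact N dvd a; fact N dvd b; x \<in> carrier M\<rbrakk> \<Longrightarrow>
   acong M (p ^ k) ((f ^^ a) x) ((f ^^ b) x)" using stable[of k] by blast
  have "acong M (p ^ k) (e x) ((f ^^ fact n) x)" if n: "n \<ge> N" and x: "x \<in> carrier M" for n x
  proof -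
   let ?j = "max k N"
   have rj: "N \<le> r ?j" using seq_suble[OF re(1), of ?j] by simp
   have "acong M (p ^ k) (e x) ((f ^^ fact (r ?j)) x)" by (rule re(3)) (use x in auto)
   also have "acong M (p ^ k) \<dots> ((f ^^ fact n) x)" by (rule N) (use rj n x dv ge in auto)
   finally show ?thesis .
  qed
  then show ?thesis using N by blast
 qed
 have "e (e x) = e x" if x: "x \<in> carrier M" for x
 proof (rule acong_eqI)
  fix k
  obtain N where N: "\<And>n x. \<lbrakk>N \<le> n; x \<in> carrier M\<rbrakk> \<Longrightarrow> acong M (p ^ k) (e x) ((f ^^ fact n) x)"
   "\<And>a b x. \<lbrakk>N \<le> a; N \<le> b; fact N dvd a; fact N dvd b; x \<in> carrier M\<rbrakk> \<Longrightarrow>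
    acong M (p ^ k) ((f ^^ a) x) ((f ^^ b) x)" using lim[of k] by blast
  have "acong M (p ^ k) (e (e x)) ((f ^^ fact N) (e x))" by (rule N(1)[OF order.refl semi_closed[OF re(2) x]])
  also have "acong M (p ^ k) \<dots> ((f ^^ fact N) ((f ^^ fact N) x))"
   by (rule semi_acong[OF fp N(1)[OF order.refl x]])
  also have "(f ^^ fact N) ((f ^^ fact N) x) = (f ^^ (fact N + fact N)) x"
   by (simp add: funpow_add)
  \<comment> \<open>Both \<open>fact N\<close> and \<open>fact N + fact N\<close> are multiples of
    \<open>fact N\<close>, so these powers agree in the stable range; this makes the limit
    idempotent.\<close>
  also have "acong M (p ^ k) \<dots> ((f ^^ fact N) x)"
   by (rule N(2)) (use x ge[of N N] in \<open>auto intro: trans_le_add1\<close>)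
  finally show "acong M (p ^ k) (e (e x)) (e x)"
   using acong_join N(1)[OF order.refl x] by blast
 qed (use re(2) x semi_closed in auto)
 then consider "\<forall>x\<in>carrier M. e x = \<zero>" | "\<forall>x\<in>carrier M. e x = x"
  using idempotent_trivial[OF re(2)] by blast
 then show ?thesis
 proof cases
  case 1
  obtain N where N: "\<forall>n\<ge>N. \<forall>x\<in>carrier M. acong M (p ^ 1) (e x) ((f ^^ fact n) x)" using lim[of 1] by blast
  then have "\<forall>x\<in>carrier M. acong M p ((f ^^ fact N) x) \<zero>"
   using 1 by (metis acong_sym order.refl power_one_right)
  then show ?thesis by blast
 next
  case 2
  \<comment> \<open>As the identity is the limit of the powers \<open>f ^^ fact n\<close>, a limit
    of the powers \<open>f ^^ (fact n - 1)\<close> is a two-sided inverse of \<open>f\<close>.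
    Factorials are positive, so the truncated subtraction is harmless.\<close>
  obtain r' g where g: "strict_mono r'" "lin g"
   "\<And>k n x. \<lbrakk>k \<le> n; x \<in> carrier M\<rbrakk> \<Longrightarrow> acong M (p ^ k) (g x) ((f ^^ (fact (r' n) - 1)) x)"
   by (rule semi_compact[of "\<lambda>s. s" "\<lambda>n. f ^^ (fact n - 1)"]; (rule fp | rule that | assumption); assumption)
  have fs: "f ((f ^^ (fact n - 1)) x) = (f ^^ fact n) x" "(f ^^ (fact n - 1)) (f x) = (f ^^ fact n) x" for n x
  proof -
   have "fact n = Suc (fact n - 1)" using fact_gt_zero[of n, where 'a=nat] by linarith
   then show "f ((f ^^ (fact n - 1)) x) = (f ^^ fact n) x" "(f ^^ (fact n - 1)) (f x) = (f ^^ fact n) x"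
    by (metis comp_apply funpow.simps(2), metis comp_apply funpow_Suc_right)
  qed
  have "f (g x) = x \<and> g (f x) = x" if x: "x \<in> carrier M" for x
  proof -
   have *: "acong M (p ^ k) (f (g x)) x \<and> acong M (p ^ k) (g (f x)) x" for k
   proof -
    obtain N where N: "\<forall>n\<ge>N. \<forall>x\<in>carrier M. acong M (p ^ k) (e x) ((f ^^ fact n) x)" using lim[of k] by blast
    let ?j = "max k N"
    have "N \<le> r' ?j" using seq_suble[OF g(1), of ?j] by simp
    then have ex: "acong M (p ^ k) x ((f ^^ fact (r' ?j)) x)" using N 2 x by force
    have "acong M (p ^ k) (f (g x)) (f ((f ^^ (fact (r' ?j) - 1)) x))"
     by (rule semi_acong[OF f g(3)[OF _ x]]) simp
    moreover have "acong M (p ^ k) (g (f x)) ((f ^^ (fact (r' ?j) - 1)) (f x))"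
     by (rule g(3)) (use semi_closed[OF f x] in auto)
    ultimately show ?thesis using ex acong_join unfolding fs by blast
   qed
   then show ?thesis
    using x semi_closed[OF f semi_closed[OF g(2) x]] semi_closed[OF g(2) semi_closed[OF f x]]
    by (intro conjI acong_eqI) auto
  qed
  then have "bij f"
   using semi_closed[OF f] semi_closed[OF g(2)]
   by (intro bij_betw_byWitness[where f' = g]) auto
  then show ?thesis by blast
 qed
qed

text \<open>After composing with the inverse of the sum one has \<open>f + g = 1\<close>; if neither
  map is bijective, both are nilpotent modulo \<open>p\<close>. Take the last iterate
  \<open>y\<close> of some \<open>x0\<close> under \<open>g\<close> that is nonzero modulo
  \<open>p\<close>: then \<open>g y = 0\<close> and \<open>f y = y\<close> modulo \<open>p\<close>,
  so no power of \<open>f\<close> kills \<open>y\<close>.\<close>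

lemma bij_summand:
 assumes f: "lin f" and g: "lin g" and fg: "bij (\<lambda>x. f x \<oplus> g x)"
 shows "bij f \<or> bij g"
proof (rule ccontr)
 assume n: "\<not> (bij f \<or> bij g)"
 define u where "u = (\<lambda>x. f x \<oplus> g x)"
 have u: "lin u" "bij u"
 proof -
  have "lin (\<lambda>x. \<Oplus>i\<in>{True, False}. (if i then f else g) x)" by (rule lin_finsum) (use f g in auto)
  moreover have "(\<Oplus>i\<in>{True, False}. (if i then f else g) x) = u x" if "x \<in> carrier M" for x
   using semi_closed[OF f that] semi_closed[OF g that] by (simp add: finsum_insert u_def)
  ultimately show "lin u"
   unfolding semi_def add_hom_def by (auto simp: Pi_iff smult_closed Om_closed)
 qed (use fg u_def in simp)
 define ui where "ui = inv_into (carrier M) u"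
 have ui: "lin ui" unfolding ui_def by (rule inv_into_lin[OF u])
 have uiu: "ui (u x) = x" "u (ui x) = x" if "x \<in> carrier M" for x
  using u(2) that by (simp_all add: ui_def bij_betw_inv_into_left bij_betw_inv_into_right)
 let ?f = "\<lambda>x. ui (f x)" and ?g = "\<lambda>x. ui (g x)"
 have lfg: "lin ?f" "lin ?g" using f g ui lin_comp by auto
 have transfer: "bij h" if h: "lin h" and b: "bij (\<lambda>x. ui (h x))" for h
 proof -
  have "bij (\<lambda>x. u (ui (h x)))" using bij_betw_trans[OF b u(2)] by (simp add: comp_def)
  then show ?thesis using uiu(2) semi_closed[OF h] by (subst (asm) bij_betw_cong[where g = h]) auto
 qed
 have "\<not> bij ?f" "\<not> bij ?g" using n transfer f g by blast+
 then obtain n1 n2 where n1: "\<forall>x\<in>carrier M. acong M p ((?f ^^ n1) x) \<zero>"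
  and n2: "\<forall>x\<in>carrier M. acong M p ((?g ^^ n2) x) \<zero>"
  using bij_or_nilpotent lfg by blast
 obtain x0 where x0: "x0 \<in> carrier M" "\<not> acong M p x0 \<zero>" using not_p_divisible by blast
 define n where "n = (LEAST n. acong M p ((?g ^^ n) x0) \<zero>)"
 have nz: "acong M p ((?g ^^ n) x0) \<zero>" unfolding n_def by (rule LeastI[of _ n2]) (use n2 x0 in blast)
 then have "n \<noteq> 0" using x0 by (metis funpow_0)
 then obtain n' where n': "n = Suc n'" by (cases n) auto
 define y where "y = (?g ^^ n') x0"
 have y: "y \<in> carrier M" unfolding y_def by (rule semi_closed[OF lin_funpow[OF lfg(2)] x0(1)])
 have y0: "\<not> acong M p y \<zero>"
  unfolding y_def using not_less_Least[of n' "\<lambda>n. acong M p ((?g ^^ n) x0) \<zero>"] n' n_def by auto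
 have gy: "acong M p (?g y) \<zero>" using nz unfolding n' y_def by simp
 have c: "?f y \<in> carrier M" "?g y \<in> carrier M" using y lfg semi_closed by auto
 have "?f y \<oplus> ?g y = y"
  using uiu(1)[OF y] semi_add[OF ui semi_closed[OF f y] semi_closed[OF g y]] by (simp add: u_def)
 moreover have "acong M p (?f y \<oplus> ?g y) (?f y \<oplus> \<zero>)" by (rule acong_add[OF acong_refl[OF c(1)] gy])
 ultimately have yf: "acong M p (?f y) y" using c acong_sym by simp
 have "acong M p ((?f ^^ j) y) y" for j
 proof (induction j)
  case 0
  then show ?case using y acong_refl by simp
 next
  case (Suc j)
  have "acong M p (?f ((?f ^^ j) y)) (?f y)" by (rule semi_acong[OF lfg(1) Suc])
  also have "acong M p (?f y) y" by (rule yf)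
  finally show ?case by simp
 qed
 then have "acong M p y ((?f ^^ n1) y)" by (rule acong_sym)
 also have "acong M p \<dots> \<zero>" using n1 y by blast
 finally show False using y0 by blast
qed

lemma bij_finite_summand:
 assumes "finite I" "\<And>i. i \<in> I \<Longrightarrow> lin (f i)" "bij (\<lambda>x. \<Oplus>i\<in>I. f i x)"
 shows "\<exists>i\<in>I. bij (f i)"
 using assms
proof (induction I)
 case empty
 \<comment> \<open>The empty sum is the zero map, which is not bijective on a nonzero
   module.\<close>
 then have "carrier M = (\<lambda>x. \<zero>) ` carrier M" by (auto simp: bij_betw_def)
 then show ?case using nontrivial by (metis empty_iff image_constant zero_closed)
next
 case (insert i I)
 have li: "lin (\<lambda>x. \<Oplus>i\<in>I. f i x)" by (rule lin_finsum) (use insert in auto)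
 have "(\<Oplus>j\<in>insert i I. f j x) = f i x \<oplus> (\<Oplus>i\<in>I. f i x)" if "x \<in> carrier M" for x
  using insert.hyps semi_closed[OF insert.prems(1) that] by (intro finsum_insert) auto
 then have "bij (\<lambda>x. f i x \<oplus> (\<Oplus>i\<in>I. f i x))"
  using insert.prems(2) by (subst (asm) bij_betw_cong) auto
 then consider "bij (f i)" | "bij (\<lambda>x. \<Oplus>i\<in>I. f i x)"
  using bij_summand[OF _ li] insert.prems(1) by blast
 then show ?case using insert by cases auto
qed

end

text \<open>\<open>coordinates\<close> is the criterion of Chase, Harrison and Rosenberg for a
  Galois extension, for the cyclic group generated by \<open>F\<close>: independence of the powers
  of \<open>F\<close>, made explicit by the elements \<open>a i\<close> and
  \<open>b i\<close>.\<close>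

locale galois_operator_module = indecomposable_operator_module +
 fixes F :: "'a \<Rightarrow> 'a" and m N :: nat and a b :: "nat \<Rightarrow> 'a"
 assumes F_hom: "F \<in> ring_hom S S"
  and m_pos: "m > 0"
  and F_order: "s \<in> carrier S \<Longrightarrow> (F ^^ m) s = s"
  and a: "a \<in> {..<N} \<rightarrow> carrier S"
  and b: "b \<in> {..<N} \<rightarrow> carrier S"
  and coordinates: "j < m \<Longrightarrow>
   (\<Oplus>\<^bsub>S\<^esub>i\<in>{..<N}. a i \<otimes>\<^bsub>S\<^esub> (F ^^ j) (b i)) = (if j = 0 then \<one>\<^bsub>S\<^esub> else \<zero>\<^bsub>S\<^esub>)"
begin

section \<open>Lagrange resolvents and Hilbert 90\<close>

lemma F_closed: "s \<in> carrier S \<Longrightarrow> F s \<in> carrier S"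
 by (rule ring_hom_closed[OF F_hom])

lemma F_pow_closed: "s \<in> carrier S \<Longrightarrow> (F ^^ n) s \<in> carrier S"
 by (induction n) (auto simp: F_closed)

definition Fi :: "'a \<Rightarrow> 'a" where "Fi = F ^^ (m - 1)"

lemma Fi: "s \<in> carrier S \<Longrightarrow> Fi s \<in> carrier S" "s \<in> carrier S \<Longrightarrow> F (Fi s) = s"
proof -
 assume s: "s \<in> carrier S"
 show "Fi s \<in> carrier S" using s by (simp add: Fi_def F_pow_closed)
 have "F (Fi s) = (F ^^ Suc (m - 1)) s" by (simp add: Fi_def)
 then show "F (Fi s) = s" using m_pos F_order[OF s] by simp
qed

lemma lin_conjugate:
 assumes f: "lin f" and g: "semi F g" "bij g"
 shows "lin (\<lambda>x. g (f (inv_into (carrier M) g x)))"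
  and "lin (\<lambda>x. inv_into (carrier M) g (f (g x)))"
proof -
 note gi = inv_into_semi[OF g Fi]
 have "semi Fi (\<lambda>x. f (inv_into (carrier M) g x))" by (rule semi_comp[OF gi f Fi(1)])
 from semi_comp[OF this g(1) Fi(1)] show "lin (\<lambda>x. g (f (inv_into (carrier M) g x)))"
  by (rule semi_cong) (simp_all add: Fi)
 have FiF: "Fi (F s) = s" if "s \<in> carrier S" for s
 proof -
  have "Fi (F s) = (F ^^ Suc (m - 1)) s" unfolding Fi_def funpow_Suc_right by simp
  then show ?thesis using m_pos F_order[OF that] by simp
 qed
 have "semi F (\<lambda>x. f (g x))" by (rule semi_comp[OF g(1) f F_closed])
 from semi_comp[OF this gi F_closed] show "lin (\<lambda>x. inv_into (carrier M) g (f (g x)))"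
  by (rule semi_cong) (simp_all add: FiF)
qed

text \<open>
 For semilinear automorphisms \<open>psi\<close> and \<open>phi\<close> this is the Lagrange resolvent of \<open>\<theta>\<close>. It
 intertwines \<open>phi\<close> and \<open>psi\<close> as soon as their \<open>m\<close>-th powers agree.
\<close>

definition resolvent :: "('c \<Rightarrow> 'c) \<Rightarrow> ('c \<Rightarrow> 'c) \<Rightarrow> 'a \<Rightarrow> 'c \<Rightarrow> 'c" where
 "resolvent psi phi \<theta> x =
   (\<Oplus>i\<in>{..<m}. (psi ^^ i) (\<theta> \<odot> (inv_into (carrier M) phi ^^ i) x))"

context
 fixes psi phi
 assumes psi: "semi F psi" and phi: "semi F phi" "bij phi"
begin

abbreviation phii where "phii \<equiv> inv_into (carrier M) phi"

lemma phii: "semi Fi phii" "x \<in> carrier M \<Longrightarrow> phii (phi x) = x" "x \<in> carrier M \<Longrightarrow> phi (phii x) = x"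
 using inv_into_semi[OF phi Fi] phi(2)
 by (auto simp: bij_betw_inv_into_left bij_betw_inv_into_right)

lemma psi_pow: "semi (F ^^ n) (psi ^^ n)" and phii_pow: "semi (Fi ^^ n) (phii ^^ n)"
 and phi_pow: "semi (F ^^ n) (phi ^^ n)"
 by (rule semi_funpow[OF psi F_closed] semi_funpow[OF phii(1) Fi(1)] semi_funpow[OF phi(1) F_closed];
   assumption)+

lemma term_lin:
 assumes "\<theta> \<in> carrier S" shows "lin (\<lambda>x. (psi ^^ i) (\<theta> \<odot> (phii ^^ i) x))"
proof -
 have c: "(Fi ^^ i) s \<in> carrier S" if "s \<in> carrier S" for s using that by (induction i) (auto simp: Fi)
 have "semi (Fi ^^ i) (\<lambda>x. \<theta> \<odot> (phii ^^ i) x)" by (rule semi_comp[OF phii_pow lin_smult[OF assms] c])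
 from semi_comp[OF this psi_pow[of i] c] show ?thesis
 proof (rule semi_cong)
  show "(F ^^ i) ((Fi ^^ i) s) = s" if "s \<in> carrier S" for s
   by (rule funpow_inverse[of "carrier S" Fi F s i, OF Fi that])
 qed
qed

lemma resolvent_lin: "\<theta> \<in> carrier S \<Longrightarrow> lin (resolvent psi phi \<theta>)"
 unfolding resolvent_def[abs_def] by (rule lin_finsum[OF term_lin])

text \<open>Interchanging the sums, the composite of \<open>phii ^^ i\<close> and
  \<open>psi ^^ i\<close> acquires the coefficient \<open>\<Sum> a k F^i (b k)\<close>, which is
  \<open>\<one>\<close> for \<open>i = 0\<close> and zero for the other
  \<open>i < m\<close>.\<close>

lemma resolvent_coordinates:
 assumes x: "x \<in> carrier M"
 shows "(\<Oplus>k\<in>{..<N}. a k \<odot> resolvent psi phi (b k) x) = x"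
proof -
 define z where "z i = (psi ^^ i) ((phii ^^ i) x)" for i
 have zc: "z i \<in> carrier M" for i
  unfolding z_def by (rule semi_closed[OF psi_pow semi_closed[OF phii_pow x]])
 have ak: "a k \<in> carrier S" and bk: "b k \<in> carrier S" if "k < N" for k using a b that by auto
 define c where "c k i = a k \<otimes>\<^bsub>S\<^esub> (F ^^ i) (b k)" for k i
 have cc: "c k i \<in> carrier S" if "k < N" for k i using ak[OF that] bk[OF that] F_pow_closed by (simp add: c_def)
 have cz: "c k i \<odot> z i \<in> carrier M" if "k < N" for k i by (rule smult_closed[OF cc[OF that] zc])
 have tm: "a k \<odot> (psi ^^ i) (b k \<odot> (phii ^^ i) x) = c k i \<odot> z i" if k: "k < N" for k i
  unfolding semi_smult[OF psi_pow bk[OF k] semi_closed[OF phii_pow x]] c_def z_def[symmetric]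
  by (rule smult_assoc[OF ak[OF k] F_pow_closed[OF bk[OF k]] zc, symmetric])
 have "(\<Oplus>k\<in>{..<N}. a k \<odot> resolvent psi phi (b k) x) = (\<Oplus>k\<in>{..<N}. \<Oplus>i\<in>{..<m}. c k i \<odot> z i)"
 proof (rule finsum_cong'[OF refl])
  fix k assume "k \<in> {..<N}"
  then have k: "k < N" by simp
  have cl: "(\<lambda>i. (psi ^^ i) (b k \<odot> (phii ^^ i) x)) \<in> {..<m} \<rightarrow> carrier M"
   by (rule Pi_I) (rule semi_closed[OF term_lin[OF bk[OF k]] x])
  have "a k \<odot> resolvent psi phi (b k) x =
   (\<Oplus>i\<in>{..<m}. a k \<odot> (psi ^^ i) (b k \<odot> (phii ^^ i) x))"
   unfolding resolvent_def
   by (rule add_hom_finsum[OF abelian_group_axioms abelian_group_axioms additive_smult_right[OF ak[OF k]] cl])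
  then show "a k \<odot> resolvent psi phi (b k) x = (\<Oplus>i\<in>{..<m}. c k i \<odot> z i)"
   unfolding tm[OF k] .
 qed (use cz in \<open>auto intro!: finsum_closed\<close>)
 also have "\<dots> = (\<Oplus>i\<in>{..<m}. \<Oplus>k\<in>{..<N}. c k i \<odot> z i)"
  by (rule finsum_swap) (use cz in auto)
 also have "\<dots> = x"
 proof (rule finsum_delta[where j = 0])
  fix i assume "i \<in> {..<m}"
  then have i: "i < m" by simp
  have "(\<Oplus>k\<in>{..<N}. c k i \<odot> z i) = (\<Oplus>\<^bsub>S\<^esub>k\<in>{..<N}. c k i) \<odot> z i"
   by (rule add_hom_finsum[OF S.abelian_group_axioms abelian_group_axioms additive_smult_left[OF zc], symmetric])
    (use cc in auto)
  also have "(\<Oplus>\<^bsub>S\<^esub>k\<in>{..<N}. c k i) = (if i = 0 then \<one>\<^bsub>S\<^esub> else \<zero>\<^bsub>S\<^esub>)"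
   unfolding c_def by (rule coordinates[OF i])
  finally show "(\<Oplus>k\<in>{..<N}. c k i \<odot> z i) = (if i = 0 then x else \<zero>)"
   using zc[of i] x by (auto simp: smult_one smult_zero_left z_def)
 qed (use m_pos x in auto)
 finally show ?thesis .
qed

text \<open>The identity is the sum of the maps \<open>a k\<close> times the resolvent of
  \<open>b k\<close>, so by locality one of them is bijective. Injectivity passes to the inner
  factor, the resolvent, and surjectivity follows because the scalar \<open>a k\<close> can be moved
  inside the linear resolvent.\<close>

lemma resolvent_bij: "\<exists>\<theta>\<in>carrier S. bij (resolvent psi phi \<theta>)"
proof -
 have ak: "a k \<in> carrier S" and bk: "b k \<in> carrier S" if "k < N" for k using a b that by auto
 let ?h = "\<lambda>k x. a k \<odot> resolvent psi phi (b k) x"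
 have lh: "lin (?h k)" if "k \<in> {..<N}" for k
  using lin_comp[OF resolvent_lin lin_smult] ak bk that by simp
 have "bij (\<lambda>x. \<Oplus>k\<in>{..<N}. ?h k x)"
  using bij_betw_id[of "carrier M"] by (subst bij_betw_cong[where g = id]) (auto simp: resolvent_coordinates)
 from bij_finite_summand[OF finite_lessThan lh this]
 obtain k where k: "k < N" "bij (?h k)" by auto
 let ?v = "resolvent psi phi (b k)"
 have v: "lin ?v" by (rule resolvent_lin[OF bk[OF k(1)]])
 have "inj_on ?v (carrier M)"
  using k(2) unfolding bij_betw_def inj_on_def by metis
 moreover have "?v ` carrier M = carrier M"
 proof
  show "?v ` carrier M \<subseteq> carrier M" using semi_closed[OF v] by auto
  show "carrier M \<subseteq> ?v ` carrier M"
  proof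
   fix y assume "y \<in> carrier M"
   then obtain x where x: "x \<in> carrier M" "y = ?h k x" using k(2) by (auto simp: bij_betw_def)
   have "?v (a k \<odot> x) = y" unfolding x(2) by (rule semi_smult[OF v ak[OF k(1)] x(1)])
   then show "y \<in> ?v ` carrier M" using smult_closed[OF ak[OF k(1)] x(1)] by blast
  qed
 qed
 ultimately show ?thesis using bk[OF k(1)] unfolding bij_betw_def by blast
qed

text \<open>Applying \<open>psi\<close> shifts the index of the resolvent by one, and precomposition
  with \<open>phi\<close> cancels one inverse, so both sides agree up to the boundary terms of index
  \<open>0\<close> and \<open>m\<close>. These compare only the \<open>m\<close>-th powers of
  \<open>psi\<close> and \<open>phi\<close>; the scalar passes through \<open>phi ^^ m\<close>
  because \<open>F ^^ m\<close> is trivial.\<close>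

lemma resolvent_intertwines:
 assumes pw: "\<And>y. y \<in> carrier M \<Longrightarrow> acong M n ((psi ^^ m) y) ((phi ^^ m) y)"
  and th: "\<theta> \<in> carrier S" and x: "x \<in> carrier M"
 shows "acong M n (psi (resolvent psi phi \<theta> x)) (resolvent psi phi \<theta> (phi x))"
proof -
 have px: "phi x \<in> carrier M" by (rule semi_closed[OF phi(1) x])
 define g where "g i = (psi ^^ i) (\<theta> \<odot> (phii ^^ i) (phi x))" for i
 have gc: "g i \<in> carrier M" for i unfolding g_def by (rule semi_closed[OF term_lin[OF th] px])
 have "psi (resolvent psi phi \<theta> x) = (\<Oplus>i\<in>{..<m}. psi ((psi ^^ i) (\<theta> \<odot> (phii ^^ i) x)))"
  unfolding resolvent_def
  by (rule add_hom_finsum[OF abelian_group_axioms abelian_group_axioms semi_additive[OF psi]])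
   (rule Pi_I, rule semi_closed[OF term_lin[OF th] x])
 also have "\<dots> = (\<Oplus>i\<in>{..<m}. g (Suc i))"
  unfolding g_def funpow_Suc_right[of _ phii] comp_apply phii(2)[OF x] by simp
 finally have 1: "psi (resolvent psi phi \<theta> x) = (\<Oplus>i\<in>{..<m}. g (Suc i))" .
 have 2: "resolvent psi phi \<theta> (phi x) = (\<Oplus>i\<in>{..<m}. g i)"
  by (simp add: resolvent_def g_def)
 let ?w = "(phii ^^ m) (phi x)"
 have wc: "?w \<in> carrier M" by (rule semi_closed[OF phii_pow px])
 have "acong M n (g m) ((phi ^^ m) (\<theta> \<odot> ?w))"
  unfolding g_def by (rule pw[OF smult_closed[OF th wc]])
 also have "(phi ^^ m) (\<theta> \<odot> ?w) = \<theta> \<odot> (phi ^^ m) ?w"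
  using semi_smult[OF phi_pow th wc] F_order[OF th] by simp
 also have "(phi ^^ m) ?w = phi x"
  by (rule funpow_inverse[OF semi_closed[OF phii(1)] phii(3) px]; assumption)
 finally have gm: "acong M n (g m) (g 0)" by (simp add: g_def)
 let ?A = "\<Oplus>i\<in>{..<m}. g (Suc i)" and ?B = "\<Oplus>i\<in>{..<m}. g i"
 have cl: "?A \<in> carrier M" "?B \<in> carrier M" using gc by (auto intro!: finsum_closed)
 have "acong M n (?A \<oplus> g 0) (?B \<oplus> g 0)"
  unfolding finsum_shift[of g m, OF gc] by (rule acong_add[OF acong_refl[OF cl(2)] gm])
 then have "acong M n (?A \<oplus> g 0 \<oplus> \<ominus> g 0) (?B \<oplus> g 0 \<oplus> \<ominus> g 0)"
  by (rule acong_add[OF _ acong_refl]) (use gc in simp)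
 then show ?thesis unfolding 1 2 using cl gc by (simp add: a_assoc r_neg)
qed

end

text \<open>Modulus zero turns the congruences for the resolvent into equations. The intertwiner
  \<open>v\<close> later becomes an isomorphism of descended complexes.\<close>

theorem descent_datum_unique:
 assumes psi: "semi F psi" and phi: "semi F phi" "bij phi"
  and "\<And>x. x \<in> carrier M \<Longrightarrow> (psi ^^ m) x = x" "\<And>x. x \<in> carrier M \<Longrightarrow> (phi ^^ m) x = x"
 shows "\<exists>v. lin v \<and> bij v \<and> (\<forall>x\<in>carrier M. psi (v x) = v (phi x))"
proof -
 obtain \<theta> where th: "\<theta> \<in> carrier S" "bij (resolvent psi phi \<theta>)"
  using resolvent_bij[OF psi phi] by blast
 have "acong M 0 (psi (resolvent psi phi \<theta> x)) (resolvent psi phi \<theta> (phi x))" if "x \<in> carrier M" for x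
  by (rule resolvent_intertwines[OF psi phi _ th(1) that]) (use assms in \<open>simp add: acong_zero_iff\<close>)
 then show ?thesis
  using th resolvent_lin[OF psi phi th(1)] unfolding acong_zero_iff by blast
qed

end

section \<open>Existence of a descent datum\<close>

context galois_operator_module
begin

text \<open>
 The bicommutant of \<open>c = phi ^^ m\<close> is commutative and stable under conjugation by \<open>phi\<close>, so its
 units act on \<open>M\<close> modulo \<open>p ^ k\<close> as a finite abelian group normalised by \<open>phi\<close>.
\<close>

lemma descent_datum_mod:
 assumes phi: "semi F phi" "bij phi"
 shows "\<exists>psi. semi F psi \<and> (\<forall>x\<in>carrier M. acong M (p ^ k) ((psi ^^ m) x) x)"
proof -
 let ?phii = "inv_into (carrier M) phi"
 note phii = phii[OF phi(1) phi]
 define c where "c = phi ^^ m"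
 have c: "lin c"
  using semi_cong[OF semi_funpow[OF phi(1) F_closed, of m] F_order] by (simp add: c_def)
 have c_phi: "c (phi x) = phi (c x)" for x by (simp add: c_def funpow_swap1)
 have bij_funpow: "bij (phi ^^ n)" for n
 proof (induction n)
  case 0
  then show ?case using bij_betw_id by (simp add: id_def)
 next
  case (Suc n)
  then show ?case using bij_betw_trans[OF Suc phi(2)] by (simp only: funpow.simps)
 qed
 have c_bij: "bij c" unfolding c_def by (rule bij_funpow)
 \<comment> \<open>\<open>C\<close> is the commutant of \<open>c\<close>, \<open>B\<close> the
   commutant of \<open>C\<close>, and \<open>U\<close> the units of \<open>B\<close>. As
   \<open>c\<close> itself lies in \<open>C\<close>, \<open>B\<close> is contained in
   \<open>C\<close>, and this makes \<open>B\<close> commutative.\<close>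
 define C where "C f \<longleftrightarrow> lin f \<and> (\<forall>x\<in>carrier M. f (c x) = c (f x))" for f
 define B where "B u \<longleftrightarrow> lin u \<and> (\<forall>f. C f \<longrightarrow> (\<forall>x\<in>carrier M. f (u x) = u (f x)))" for u
 define U where "U = {u. B u \<and> bij u}"
 have Cl: "lin f" if "C f" for f using that by (simp add: C_def)
 have Bl: "lin u" if "B u" for u using that by (simp add: B_def)
 have Bf: "f (u x) = u (f x)" if "B u" "C f" "x \<in> carrier M" for f u x using that by (simp add: B_def)
 have Cc: "C c" using c by (simp add: C_def)
 have BC: "C u" if "B u" for u
  using that Bf[OF that Cc] Bl[OF that] by (simp add: C_def)
 have B_comp: "B (\<lambda>x. u (v x))" if u: "B u" and v: "B v" for u v
 proof -
  have "f (u (v x)) = u (v (f x))" if f: "C f" and x: "x \<in> carrier M" for f x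
   using Bf[OF u f semi_closed[OF Bl[OF v] x]] Bf[OF v f x] by simp
  then show ?thesis using lin_comp[OF Bl[OF v] Bl[OF u]] by (simp add: B_def)
 qed
 have B_id: "B (\<lambda>x. x)" by (simp add: B_def lin_id)
 have B_c: "B c" using c by (simp add: B_def C_def)
 have B_smult: "B (\<lambda>x. s \<odot> x)" if s: "s \<in> carrier S" for s
  using lin_smult[OF s] semi_smult[OF Cl s] by (simp add: B_def)
 have B_finsum: "B (\<lambda>x. \<Oplus>i\<in>I. f i x)" if f: "\<And>i. i \<in> I \<Longrightarrow> B (f i)" for f and I :: "nat set"
 proof -
  have "g (\<Oplus>i\<in>I. f i x) = (\<Oplus>i\<in>I. f i (g x))" if g: "C g" and x: "x \<in> carrier M" for g x
  proof -
   have cl: "(\<lambda>i. f i x) \<in> I \<rightarrow> carrier M" by (rule Pi_I) (rule semi_closed[OF Bl[OF f] x])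
   have cl': "(\<lambda>i. f i (g x)) \<in> I \<rightarrow> carrier M"
    by (rule Pi_I) (rule semi_closed[OF Bl[OF f] semi_closed[OF Cl[OF g] x]])
   have "g (\<Oplus>i\<in>I. f i x) = (\<Oplus>i\<in>I. g (f i x))"
    by (rule add_hom_finsum[OF abelian_group_axioms abelian_group_axioms semi_additive[OF Cl[OF g]] cl])
   also have "\<dots> = (\<Oplus>i\<in>I. f i (g x))"
    by (rule finsum_cong'[OF refl cl']) (rule Bf[OF f g x])
   finally show ?thesis .
  qed
  then show ?thesis using lin_finsum[OF Bl[OF f]] by (simp add: B_def)
 qed
 \<comment> \<open>The commutant is stable under conjugation because \<open>phi\<close> commutes
   with \<open>c = phi ^^ m\<close>; the bicommutant inherits stability under the opposite
   conjugation.\<close>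
 have C_conj: "C (\<lambda>x. ?phii (f (phi x)))" if f: "C f" for f
  unfolding C_def
 proof (intro conjI ballI)
  show "lin (\<lambda>x. ?phii (f (phi x)))" by (rule lin_conjugate(2)[OF Cl[OF f] phi])
  fix x assume x: "x \<in> carrier M"
  have y: "phi x \<in> carrier M" "f (phi x) \<in> carrier M" "c (f (phi x)) \<in> carrier M"
   using x semi_closed[OF phi(1)] semi_closed[OF Cl[OF f]] semi_closed[OF c] by auto
  have fy: "?phii (f (phi x)) \<in> carrier M" by (rule semi_closed[OF phii(1) y(2)])
  have "f (phi (c x)) = c (f (phi x))" using f y(1) unfolding C_def c_phi[symmetric] by blast
  also have "\<dots> = phi (c (?phii (f (phi x))))" using c_phi[of "?phii (f (phi x))"] phii(3)[OF y(2)] by simp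
  finally show "?phii (f (phi (c x))) = c (?phii (f (phi x)))"
   using phii(2)[OF semi_closed[OF c fy]] by simp
 qed
 have B_conj: "B (\<lambda>x. phi (u (?phii x)))" if u: "B u" for u
  unfolding B_def
 proof (intro conjI allI impI ballI)
  show "lin (\<lambda>x. phi (u (?phii x)))" by (rule lin_conjugate(1)[OF Bl[OF u] phi])
  fix f x assume f: "C f" and x: "x \<in> carrier M"
  have ix: "?phii x \<in> carrier M" by (rule semi_closed[OF phii(1) x])
  have ux: "u (?phii x) \<in> carrier M" by (rule semi_closed[OF Bl[OF u] ix])
  have "?phii (f (phi (u (?phii x)))) = u (?phii (f (phi (?phii x))))"
   by (rule Bf[OF u C_conj[OF f] ix])
  then have "phi (?phii (f (phi (u (?phii x))))) = phi (u (?phii (f x)))"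
   unfolding phii(3)[OF x] by simp
  then show "f (phi (u (?phii x))) = phi (u (?phii (f x)))"
   using phii(3)[OF semi_closed[OF Cl[OF f] semi_closed[OF phi(1) ux]]] by simp
 qed
 have B_inv: "B (inv_into (carrier M) u)" if u: "B u" "bij u" for u
  unfolding B_def
 proof (intro conjI allI impI ballI)
  show li: "lin (inv_into (carrier M) u)" by (rule inv_into_lin[OF Bl[OF u(1)] u(2)])
  fix f x assume f: "C f" and x: "x \<in> carrier M"
  have ix: "inv_into (carrier M) u x \<in> carrier M" by (rule semi_closed[OF li x])
  have "u (f (inv_into (carrier M) u x)) = f x"
   using Bf[OF u(1) f ix] u(2) x by (simp add: bij_betw_inv_into_right)
  then show "f (inv_into (carrier M) u x) = inv_into (carrier M) u (f x)"
   using bij_betw_inv_into_left[OF u(2) semi_closed[OF Cl[OF f] ix]] by simp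
 qed

 obtain W \<rho> where W: "finite W" "W \<subseteq> carrier M" "\<And>x. x \<in> carrier M \<Longrightarrow> \<rho> x \<in> W"
  "\<And>x. x \<in> carrier M \<Longrightarrow> acong M (p ^ k) (\<rho> x) x" "\<And>x. x \<in> W \<Longrightarrow> \<rho> x = x"
  "\<And>x y. acong M (p ^ k) x y \<Longrightarrow> \<rho> x = \<rho> y"
  by (rule representatives[of k]; rule that; assumption)
 have Wc: "x \<in> carrier M" if "x \<in> W" for x using that W(2) by blast
 \<comment> \<open>The map induced on \<open>M / p ^ k M\<close>, transported to representatives.
   For maps with an additive inverse these are permutations, so the symmetric group on
   \<open>W\<close> is a finite group in which \<open>phi\<close>, though not linear, lives together
   with \<open>U\<close>.\<close>
 define \<pi> where "\<pi> f = (\<lambda>w\<in>W. \<rho> (f w))" for f :: "'c \<Rightarrow> 'c"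
 let ?G = "BijGroup W"
 interpret G: group ?G by (rule group_BijGroup)
 note add_cong = acong_add_hom[OF _ abelian_group_axioms]
 have \<rho>\<rho>: "\<rho> (f (\<rho> x)) = \<rho> (f x)" if "f \<in> add_hom M M" "x \<in> carrier M" for f x
  by (rule W(6)[OF add_cong[OF W(4)[OF that(2)] that(1)]])
 have \<pi>_compose: "compose W (\<pi> f) (\<pi> g) = \<pi> (\<lambda>x. f (g x))"
  if f: "f \<in> add_hom M M" and g: "g \<in> add_hom M M" for f g
 proof
  fix w
  show "compose W (\<pi> f) (\<pi> g) w = \<pi> (\<lambda>x. f (g x)) w"
   using W(3)[OF add_hom_closed[OF g Wc]] \<rho>\<rho>[OF f add_hom_closed[OF g Wc]]
   by (simp add: compose_def \<pi>_def)
 qed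
 have \<pi>_id: "\<pi> (\<lambda>x. x) = \<one>\<^bsub>?G\<^esub>"
  using W(5) by (auto simp: \<pi>_def BijGroup_def)
 have \<pi>_eqI: "\<pi> f = \<pi> g" if "\<And>x. x \<in> carrier M \<Longrightarrow> acong M (p ^ k) (f x) (g x)" for f g
 proof
  fix w show "\<pi> f w = \<pi> g w" using W(6)[OF that[OF Wc]] by (simp add: \<pi>_def)
 qed
 have \<pi>_eqD: "acong M (p ^ k) (f x) (g x)"
  if f: "f \<in> add_hom M M" and g: "g \<in> add_hom M M" and eq: "\<pi> f = \<pi> g"
   and x: "x \<in> carrier M" for f g x
 proof -
  have "\<pi> f (\<rho> x) = \<pi> g (\<rho> x)" using eq by simp
  then have e: "\<rho> (f x) = \<rho> (g x)"
   using W(3)[OF x] \<rho>\<rho>[OF f x] \<rho>\<rho>[OF g x] by (simp add: \<pi>_def)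
  have "acong M (p ^ k) (f x) (\<rho> (f x))" by (rule acong_sym[OF W(4)[OF add_hom_closed[OF f x]]])
  also have "acong M (p ^ k) (\<rho> (f x)) (g x)" unfolding e by (rule W(4)[OF add_hom_closed[OF g x]])
  finally show ?thesis .
 qed
 have \<pi>_Bij: "\<pi> f \<in> Bij W"
  if f: "f \<in> add_hom M M" and g: "g \<in> add_hom M M"
   and fg: "\<And>x. x \<in> carrier M \<Longrightarrow> f (g x) = x" "\<And>x. x \<in> carrier M \<Longrightarrow> g (f x) = x" for f g
 proof -
  have e: "\<pi> (\<lambda>x. f (g x)) = \<pi> (\<lambda>x. x)" "\<pi> (\<lambda>x. g (f x)) = \<pi> (\<lambda>x. x)"
   by (rule \<pi>_eqI, simp add: fg acong_refl)+
  have i: "\<pi> (\<lambda>x. x) w = w" if "w \<in> W" for w using that W(5) by (simp add: \<pi>_def)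
  have cl: "\<pi> f w \<in> W" "\<pi> g w \<in> W" if "w \<in> W" for w
   using W(3) add_hom_closed[OF f Wc[OF that]] add_hom_closed[OF g Wc[OF that]] that
   by (simp_all add: \<pi>_def)
  have "bij_betw (\<pi> f) W W"
  proof (rule bij_betw_byWitness[where f' = "\<pi> g"])
   show "\<forall>w\<in>W. \<pi> g (\<pi> f w) = w"
    using \<pi>_compose[OF g f] e(2) i by (metis compose_eq)
   show "\<forall>w\<in>W. \<pi> f (\<pi> g w) = w"
    using \<pi>_compose[OF f g] e(1) i by (metis compose_eq)
  qed (use cl in auto)
  then show ?thesis by (simp add: Bij_def \<pi>_def)
 qed
 have \<pi>_U: "\<pi> u \<in> Bij W" if "u \<in> U" for u
 proof -
  have u: "lin u" "bij u" using that Bl by (auto simp: U_def)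
  show ?thesis
   by (rule \<pi>_Bij[OF semi_additive[OF u(1)] semi_additive[OF inv_into_lin[OF u]]])
    (use u(2) in \<open>simp_all add: bij_betw_inv_into_left bij_betw_inv_into_right\<close>)
 qed
 have \<pi>_phi: "\<pi> phi \<in> Bij W"
  by (rule \<pi>_Bij[OF semi_additive[OF phi(1)] semi_additive[OF phii(1)]]) (simp_all add: phii)
 have \<pi>_mult: "\<pi> f \<otimes>\<^bsub>?G\<^esub> \<pi> g = \<pi> (\<lambda>x. f (g x))"
  if "f \<in> add_hom M M" "g \<in> add_hom M M" "\<pi> f \<in> Bij W" "\<pi> g \<in> Bij W" for f g
  using \<pi>_compose[OF that(1,2)] that(3,4) by (simp add: BijGroup_def)
 have carrier_G: "carrier ?G = Bij W" by (simp add: BijGroup_def)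
 have \<pi>_pow: "\<pi> f [^]\<^bsub>?G\<^esub> n = \<pi> (f ^^ n)"
  if f: "f \<in> add_hom M M" "\<pi> f \<in> Bij W" for f and n :: nat
 proof (induction n)
  case 0
  then show ?case using \<pi>_id by (simp add: id_def)
 next
  case (Suc n)
  have "\<pi> (f ^^ n) \<in> Bij W" using Suc G.nat_pow_closed[of "\<pi> f" n] f(2) carrier_G by simp
  then have "\<pi> (f ^^ n) \<otimes>\<^bsub>?G\<^esub> \<pi> f = \<pi> (\<lambda>x. (f ^^ n) (f x))"
   by (rule \<pi>_mult[OF add_hom_funpow[OF f(1)] f(1) _ f(2)])
  then show ?case using Suc by (simp add: funpow_Suc_right comp_def del: funpow.simps)
 qed
 have \<pi>_inv: "inv\<^bsub>?G\<^esub> (\<pi> f) = \<pi> g"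
  if f: "f \<in> add_hom M M" and g: "g \<in> add_hom M M"
   and fg: "\<And>x. x \<in> carrier M \<Longrightarrow> f (g x) = x" "\<And>x. x \<in> carrier M \<Longrightarrow> g (f x) = x" for f g
 proof (rule G.inv_equality)
  have b: "\<pi> f \<in> Bij W" "\<pi> g \<in> Bij W" by (rule \<pi>_Bij[OF f g fg] \<pi>_Bij[OF g f fg(2,1)]; assumption)+
  have "\<pi> (\<lambda>x. g (f x)) = \<pi> (\<lambda>x. x)" by (rule \<pi>_eqI) (simp add: fg acong_refl)
  then show "\<pi> g \<otimes>\<^bsub>?G\<^esub> \<pi> f = \<one>\<^bsub>?G\<^esub>" using \<pi>_mult[OF g f b(2,1)] \<pi>_id by simp
  show "\<pi> f \<in> carrier ?G" "\<pi> g \<in> carrier ?G" using b carrier_G by auto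
 qed
 have U_add: "u \<in> add_hom M M" and U_B: "B u" and U_bij: "bij u" if "u \<in> U" for u
  using that Bl semi_additive by (auto simp: U_def)
 have U_comp: "(\<lambda>x. u (v x)) \<in> U" if "u \<in> U" "v \<in> U" for u v
  using B_comp[OF U_B[OF that(1)] U_B[OF that(2)]] bij_betw_trans[OF U_bij[OF that(2)] U_bij[OF that(1)]]
  by (simp add: U_def comp_def)
 have U_inv: "inv_into (carrier M) u \<in> U" if "u \<in> U" for u
  using B_inv[OF U_B[OF that] U_bij[OF that]] bij_betw_inv_into[OF U_bij[OF that]] by (simp add: U_def)
 have U_conj: "(\<lambda>x. phi (u (?phii x))) \<in> U" if u: "u \<in> U" for u
 proof -
  have "bij (\<lambda>x. phi (u (?phii x)))"
   using bij_betw_trans[OF bij_betw_trans[OF bij_betw_inv_into[OF phi(2)] U_bij[OF u]] phi(2)]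
   by (simp add: comp_def)
  then show ?thesis using B_conj[OF U_B[OF u]] by (simp add: U_def)
 qed
 let ?Q = "\<pi> ` U"
 have sub: "subgroup ?Q ?G"
 proof (rule G.subgroupI)
  show "?Q \<subseteq> carrier ?G" using \<pi>_U carrier_G by auto
  have "(\<lambda>x. x) \<in> U" using B_id bij_betw_id[of "carrier M"] by (simp add: U_def id_def)
  then show "?Q \<noteq> {}" by blast
 next
  fix a assume "a \<in> ?Q"
  then obtain u where u: "u \<in> U" "a = \<pi> u" by blast
  have "inv\<^bsub>?G\<^esub> (\<pi> u) = \<pi> (inv_into (carrier M) u)"
   by (rule \<pi>_inv[OF U_add[OF u(1)] U_add[OF U_inv[OF u(1)]]])
    (use U_bij[OF u(1)] in \<open>simp_all add: bij_betw_inv_into_left bij_betw_inv_into_right\<close>)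
  then show "inv\<^bsub>?G\<^esub> a \<in> ?Q" using u U_inv by auto
 next
  fix a b assume "a \<in> ?Q" "b \<in> ?Q"
  then obtain u v where uv: "u \<in> U" "a = \<pi> u" "v \<in> U" "b = \<pi> v" by blast
  then show "a \<otimes>\<^bsub>?G\<^esub> b \<in> ?Q"
   using \<pi>_mult[OF U_add[OF uv(1)] U_add[OF uv(3)] \<pi>_U[OF uv(1)] \<pi>_U[OF uv(3)]] U_comp by auto
 qed
 have fin: "finite ?Q"
 proof (rule finite_subset)
  have "Bij W \<subseteq> W \<rightarrow>\<^sub>E W" using Bij_imp_funcset Bij_imp_extensional by (auto simp: PiE_def)
  then show "?Q \<subseteq> W \<rightarrow>\<^sub>E W" using \<pi>_U by blast
  show "finite (W \<rightarrow>\<^sub>E W)" by (rule finite_PiE[OF W(1)]) (rule W(1))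
 qed
 have phi_pow: "\<pi> phi [^]\<^bsub>?G\<^esub> m = \<pi> c"
  unfolding c_def by (rule \<pi>_pow[OF semi_additive[OF phi(1)] \<pi>_phi])
 have uphi: "\<pi> u \<otimes>\<^bsub>?G\<^esub> \<pi> phi = \<pi> (\<lambda>x. u (phi x))" "semi F (\<lambda>x. u (phi x))" "\<pi> (\<lambda>x. u (phi x)) \<in> Bij W"
  if u: "u \<in> U" for u
 proof -
  show e: "\<pi> u \<otimes>\<^bsub>?G\<^esub> \<pi> phi = \<pi> (\<lambda>x. u (phi x))"
   by (rule \<pi>_mult[OF U_add[OF u] semi_additive[OF phi(1)] \<pi>_U[OF u] \<pi>_phi])
  show "semi F (\<lambda>x. u (phi x))"
   by (rule semi_comp[OF phi(1) Bl[OF U_B[OF u]] F_closed])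
  show "\<pi> (\<lambda>x. u (phi x)) \<in> Bij W"
   using G.m_closed[of "\<pi> u" "\<pi> phi"] \<pi>_U[OF u] \<pi>_phi carrier_G unfolding e by simp
 qed
 \<comment> \<open>The kernel condition on norms is supplied by a bijective resolvent comparing
   \<open>u phi\<close> with \<open>phi\<close>: if their \<open>m\<close>-th powers agree modulo
   \<open>p ^ k\<close>, it intertwines them modulo \<open>p ^ k\<close>.\<close>
 have "\<exists>a\<in>?Q. (a \<otimes>\<^bsub>?G\<^esub> \<pi> phi) [^]\<^bsub>?G\<^esub> m = \<one>\<^bsub>?G\<^esub>"
 proof (rule G.twisted_power_one[OF sub fin])
  fix a b assume "a \<in> ?Q" "b \<in> ?Q"
  then obtain u v where uv: "u \<in> U" "a = \<pi> u" "v \<in> U" "b = \<pi> v" by blast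
  have "\<pi> (\<lambda>x. u (v x)) = \<pi> (\<lambda>x. v (u x))"
  proof (rule \<pi>_eqI)
   fix x assume x: "x \<in> carrier M"
   have "u (v x) = v (u x)" by (rule Bf[OF U_B[OF uv(3)] BC[OF U_B[OF uv(1)]] x])
   moreover have "u (v x) \<in> carrier M" by (rule add_hom_closed[OF U_add[OF U_comp[OF uv(1,3)]] x])
   ultimately show "acong M (p ^ k) (u (v x)) (v (u x))" using acong_refl by simp
  qed
  then show "a \<otimes>\<^bsub>?G\<^esub> b = b \<otimes>\<^bsub>?G\<^esub> a"
   unfolding uv(2,4) \<pi>_mult[OF U_add[OF uv(1)] U_add[OF uv(3)] \<pi>_U[OF uv(1)] \<pi>_U[OF uv(3)]]
    \<pi>_mult[OF U_add[OF uv(3)] U_add[OF uv(1)] \<pi>_U[OF uv(3)] \<pi>_U[OF uv(1)]] .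
 next
  show "\<pi> phi \<in> carrier ?G" using \<pi>_phi carrier_G by simp
 next
  fix a assume "a \<in> ?Q"
  then obtain u where u: "u \<in> U" "a = \<pi> u" by blast
  have i: "inv\<^bsub>?G\<^esub> (\<pi> phi) = \<pi> ?phii"
   by (rule \<pi>_inv[OF semi_additive[OF phi(1)] semi_additive[OF phii(1)]]) (simp_all add: phii)
  have ib: "\<pi> ?phii \<in> Bij W"
   by (rule \<pi>_Bij[OF semi_additive[OF phii(1)] semi_additive[OF phi(1)]]) (simp_all add: phii)
  have pb: "\<pi> (\<lambda>x. phi (u x)) \<in> Bij W"
   using G.m_closed[of "\<pi> phi" "\<pi> u"] \<pi>_U[OF u(1)] \<pi>_phi carrier_G
    \<pi>_mult[OF semi_additive[OF phi(1)] U_add[OF u(1)] \<pi>_phi \<pi>_U[OF u(1)]] by simp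
  have "\<pi> phi \<otimes>\<^bsub>?G\<^esub> \<pi> u \<otimes>\<^bsub>?G\<^esub> \<pi> ?phii = \<pi> (\<lambda>x. phi (u (?phii x)))"
   unfolding \<pi>_mult[OF semi_additive[OF phi(1)] U_add[OF u(1)] \<pi>_phi \<pi>_U[OF u(1)]]
   by (rule \<pi>_mult[OF add_hom_comp[OF U_add[OF u(1)] semi_additive[OF phi(1)]] semi_additive[OF phii(1)] pb ib])
  then show "\<pi> phi \<otimes>\<^bsub>?G\<^esub> a \<otimes>\<^bsub>?G\<^esub> inv\<^bsub>?G\<^esub> (\<pi> phi) \<in> ?Q"
   unfolding i u(2) using U_conj[OF u(1)] by simp
 next
  have "c \<in> U" using B_c c_bij by (simp add: U_def)
  then show "\<pi> phi [^]\<^bsub>?G\<^esub> m \<in> ?Q" unfolding phi_pow by blast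
 next
  fix a assume a: "a \<in> ?Q" "(a \<otimes>\<^bsub>?G\<^esub> \<pi> phi) [^]\<^bsub>?G\<^esub> m = \<pi> phi [^]\<^bsub>?G\<^esub> m"
  then obtain u where u: "u \<in> U" "a = \<pi> u" by blast
  let ?psi = "\<lambda>x. u (phi x)"
  note psi = uphi[OF u(1)]
  have "\<pi> (?psi ^^ m) = \<pi> c"
   using a(2) \<pi>_pow[OF semi_additive[OF psi(2)] psi(3), of m] unfolding u(2) psi(1) phi_pow by simp
  then have pw: "acong M (p ^ k) ((?psi ^^ m) y) ((phi ^^ m) y)" if "y \<in> carrier M" for y
   using \<pi>_eqD[OF add_hom_funpow[OF semi_additive[OF psi(2)]] semi_additive[OF c] _ that]
   unfolding c_def by simp
  obtain \<theta> where th: "\<theta> \<in> carrier S" "bij (resolvent ?psi phi \<theta>)"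
   using resolvent_bij[OF psi(2) phi] by blast
  let ?v = "resolvent ?psi phi \<theta>"
  \<comment> \<open>The term of index \<open>i + 1\<close> is \<open>u\<close> times the conjugate
    by \<open>phi\<close> of the term of index \<open>i\<close>, so all terms stay in the
    bicommutant.\<close>
  have "B ?v"
   unfolding resolvent_def[abs_def]
  proof (rule B_finsum)
   fix i
   have "B (\<lambda>x. (?psi ^^ i) (\<theta> \<odot> (?phii ^^ i) x))"
   proof (induction i)
    case 0
    then show ?case using B_smult[OF th(1)] by simp
   next
    case (Suc i)
    have "B (\<lambda>x. u (phi ((?psi ^^ i) (\<theta> \<odot> (?phii ^^ i) (?phii x)))))"
     by (rule B_comp[OF U_B[OF u(1)] B_conj[OF Suc]])
    then show ?case
     unfolding funpow_Suc_right[of i ?phii] funpow.simps(2)[of i ?psi] comp_apply .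
   qed
   then show "B (\<lambda>x. (?psi ^^ i) (\<theta> \<odot> (?phii ^^ i) x))" .
  qed
  then have vU: "?v \<in> U" using th(2) by (simp add: U_def)
  have "\<pi> (\<lambda>x. ?psi (?v x)) = \<pi> (\<lambda>x. ?v (phi x))"
   by (rule \<pi>_eqI) (rule resolvent_intertwines[OF psi(2) phi pw th(1)]; assumption)
  then have "\<pi> ?psi \<otimes>\<^bsub>?G\<^esub> \<pi> ?v = \<pi> ?v \<otimes>\<^bsub>?G\<^esub> \<pi> phi"
   using \<pi>_mult[OF semi_additive[OF psi(2)] U_add[OF vU] psi(3) \<pi>_U[OF vU]]
    \<pi>_mult[OF U_add[OF vU] semi_additive[OF phi(1)] \<pi>_U[OF vU] \<pi>_phi] by simp
  then show "\<exists>v\<in>?Q. a \<otimes>\<^bsub>?G\<^esub> \<pi> phi \<otimes>\<^bsub>?G\<^esub> v = v \<otimes>\<^bsub>?G\<^esub> \<pi> phi"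
   unfolding u(2) psi(1) using vU by blast
 qed
 then obtain u where u: "u \<in> U" "(\<pi> u \<otimes>\<^bsub>?G\<^esub> \<pi> phi) [^]\<^bsub>?G\<^esub> m = \<one>\<^bsub>?G\<^esub>" by blast
 let ?psi = "\<lambda>x. u (phi x)"
 note psi = uphi[OF u(1)]
 have "\<pi> (?psi ^^ m) = \<pi> (\<lambda>x. x)"
  using u(2) \<pi>_pow[OF semi_additive[OF psi(2)] psi(3), of m] unfolding psi(1) \<pi>_id by simp
 then have "acong M (p ^ k) ((?psi ^^ m) x) x" if "x \<in> carrier M" for x
  by (rule \<pi>_eqD[OF add_hom_funpow[OF semi_additive[OF psi(2)]] add_hom_id _ that])
 then show ?thesis using psi(2) by blast
qed

text \<open>A subsequence of the solutions modulo \<open>p ^ k\<close> converges by compactness. Its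
  member at index \<open>k\<close> solves the equation modulo \<open>p ^ r k\<close>, and
  \<open>r k \<ge> k\<close>.\<close>

theorem descent_datum_exists:
 assumes "semi F phi" "bij phi"
 shows "\<exists>psi. semi F psi \<and> (\<forall>x\<in>carrier M. (psi ^^ m) x = x)"
proof -
 have "\<forall>k. \<exists>psi. semi F psi \<and> (\<forall>x\<in>carrier M. acong M (p ^ k) ((psi ^^ m) x) x)"
  using descent_datum_mod[OF assms] by blast
 then obtain f where f: "\<And>k. semi F (f k)" "\<And>k x. x \<in> carrier M \<Longrightarrow> acong M (p ^ k) ((f k ^^ m) x) x"
  by metis
 obtain r psi where psi: "strict_mono (r :: nat \<Rightarrow> nat)" "semi F psi"
  "\<And>k n x. \<lbrakk>k \<le> n; x \<in> carrier M\<rbrakk> \<Longrightarrow> acong M (p ^ k) (psi x) (f (r n) x)"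
  by (rule semi_compact[of F f, OF f(1) F_closed]; (rule that | assumption); assumption)
 have "(psi ^^ m) x = x" if x: "x \<in> carrier M" for x
 proof (rule acong_eqI)
  fix k
  have "acong M (p ^ k) ((psi ^^ m) x) ((f (r k) ^^ m) x)"
   by (rule acong_funpow[OF semi_additive[OF psi(2)] semi_additive[OF f(1)] psi(3)[OF order.refl] x])
  also have "acong M (p ^ k) ((f (r k) ^^ m) x) x"
   by (rule acong_le_power[OF f(2)[OF x]]) (rule seq_suble[OF psi(1)])
  finally show "acong M (p ^ k) ((psi ^^ m) x) x" .
 qed (use x add_hom_closed[OF add_hom_funpow[OF semi_additive[OF psi(2)]]] in auto)
 then show ?thesis using psi(2) by blast
qed

end

section \<open>Tensor products\<close>

lemma frag_extend_fun_diff: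
 "frag_extend (\<lambda>k. f k - g k) u = frag_extend f u - frag_extend g u"
proof -
 have "Poly_Mapping.keys u \<subseteq> UNIV" by simp
 then show ?thesis
  by (induction u rule: frag_induction) (simp_all add: frag_extend_diff)
qed

lemma keys_frag_extend_subset:
 assumes "Poly_Mapping.keys u \<subseteq> S" "\<And>k. k \<in> S \<Longrightarrow> Poly_Mapping.keys (f k) \<subseteq> S'"
 shows "Poly_Mapping.keys (frag_extend f u) \<subseteq> S'"
 using keys_frag_extend[of f u] assms by blast

lemma keys_frag_diff2:
 assumes "x \<in> S" "y \<in> S"
 shows "Poly_Mapping.keys (frag_of x - frag_of y) \<subseteq> S"
 using keys_diff[of "frag_of x" "frag_of y"] assms by auto

lemma keys_frag_diff3:
 assumes "x \<in> S" "y \<in> S" "z \<in> S"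
 shows "Poly_Mapping.keys (frag_of x - frag_of y - frag_of z) \<subseteq> S"
 using keys_diff[of "frag_of x - frag_of y" "frag_of z"] keys_frag_diff2[OF assms(1,2)] assms(3) by auto

text \<open>The tensor product as a ring record of which only the additive part is meaningful, so
  that \<open>add_hom\<close>, \<open>abelian_group\<close> and \<open>finsum\<close> apply;
  \<open>tensor_group\<close> is written multiplicatively.\<close>

definition tensor_ab ::
  "('r, 'c) ring_scheme \<Rightarrow> ('r, 'm, 'd) module_scheme \<Rightarrow> ('r, 'n, 'e) module_scheme \<Rightarrow>
   ('m \<times> 'n \<Rightarrow>\<^sub>0 int) set ring" where
 "tensor_ab R M N =
   \<lparr>carrier = carrier (tensor_group R M N), monoid.mult = undefined, monoid.one = undefined,
   ring.zero = monoid.one (tensor_group R M N), ring.add = monoid.mult (tensor_group R M N)\<rparr>"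

definition pure_tensor ::
  "('r, 'c) ring_scheme \<Rightarrow> ('r, 'm, 'd) module_scheme \<Rightarrow> ('r, 'n, 'e) module_scheme \<Rightarrow>
   'm \<Rightarrow> 'n \<Rightarrow> ('m \<times> 'n \<Rightarrow>\<^sub>0 int) set" where
 "pure_tensor R M N x y = tensor_class R M N (frag_of (x, y))"

locale tensor_pair = M: abelian_group M + N: abelian_group N
 for R :: "('r, 'c) ring_scheme" and M :: "('r, 'm, 'd) module_scheme"
  and N :: "('r, 'n, 'e) module_scheme" +
 assumes M_smult: "\<lbrakk>r \<in> carrier R; x \<in> carrier M\<rbrakk> \<Longrightarrow> r \<odot>\<^bsub>M\<^esub> x \<in> carrier M"
  and N_smult: "\<lbrakk>r \<in> carrier R; y \<in> carrier N\<rbrakk> \<Longrightarrow> r \<odot>\<^bsub>N\<^esub> y \<in> carrier N"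
begin

abbreviation "G \<equiv> free_Abelian_group (carrier M \<times> carrier N)"
abbreviation "K \<equiv> tensor_relations R M N"
abbreviation "cls \<equiv> tensor_class R M N"
abbreviation "T \<equiv> tensor_ab R M N"
abbreviation "t \<equiv> pure_tensor R M N"
abbreviation in_free :: "('m \<times> 'n \<Rightarrow>\<^sub>0 int) \<Rightarrow> bool" where
 "in_free u \<equiv> Poly_Mapping.keys u \<subseteq> carrier M \<times> carrier N"

lemma in_free_add: "\<lbrakk>in_free u; in_free v\<rbrakk> \<Longrightarrow> in_free (u + v)"
 using keys_add[of u v] by blast

lemma K_subgroup: "subgroup K G"
 unfolding tensor_relations_def
proof (rule group.generate_is_subgroup[OF group_free_Abelian_group], rule subsetI)
 fix u assume "u \<in> {frag_of (x \<oplus>\<^bsub>M\<^esub> x', y) - frag_of (x, y) - frag_of (x', y) | x x' y.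
     x \<in> carrier M \<and> x' \<in> carrier M \<and> y \<in> carrier N} \<union>
    {frag_of (x, y \<oplus>\<^bsub>N\<^esub> y') - frag_of (x, y) - frag_of (x, y') | x y y'.
     x \<in> carrier M \<and> y \<in> carrier N \<and> y' \<in> carrier N} \<union>
    {frag_of (r \<odot>\<^bsub>M\<^esub> x, y) - frag_of (x, r \<odot>\<^bsub>N\<^esub> y) | r x y.
     r \<in> carrier R \<and> x \<in> carrier M \<and> y \<in> carrier N}"
 then have "in_free u"
  by (elim UnE CollectE exE conjE; hypsubst)
   ((rule keys_frag_diff3 keys_frag_diff2; simp add: M_smult N_smult)+)
 then show "u \<in> carrier G" by simp
qed

lemma K_in_free: "u \<in> K \<Longrightarrow> in_free u"
 using subgroup.mem_carrier[OF K_subgroup] by (simp only: carrier_free_Abelian_group_iff)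

lemma K_zero: "0 \<in> K"
 using subgroup.one_closed[OF K_subgroup] by simp

lemma K_add: "\<lbrakk>u \<in> K; v \<in> K\<rbrakk> \<Longrightarrow> u + v \<in> K"
 using subgroup.m_closed[OF K_subgroup] by simp

lemma K_minus: "u \<in> K \<Longrightarrow> - u \<in> K"
 using subgroup.m_inv_closed[OF K_subgroup] K_in_free by fastforce

lemma K_diff: "\<lbrakk>u \<in> K; v \<in> K\<rbrakk> \<Longrightarrow> u - v \<in> K"
 using K_add[OF _ K_minus, of u v] by simp

lemma K_gen:
 "\<lbrakk>x \<in> carrier M; x' \<in> carrier M; y \<in> carrier N\<rbrakk> \<Longrightarrow>
  frag_of (x \<oplus>\<^bsub>M\<^esub> x', y) - frag_of (x, y) - frag_of (x', y) \<in> K"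
 "\<lbrakk>x \<in> carrier M; y \<in> carrier N; y' \<in> carrier N\<rbrakk> \<Longrightarrow>
  frag_of (x, y \<oplus>\<^bsub>N\<^esub> y') - frag_of (x, y) - frag_of (x, y') \<in> K"
 "\<lbrakk>r \<in> carrier R; x \<in> carrier M; y \<in> carrier N\<rbrakk> \<Longrightarrow>
  frag_of (r \<odot>\<^bsub>M\<^esub> x, y) - frag_of (x, r \<odot>\<^bsub>N\<^esub> y) \<in> K"
proof -
 show "frag_of (x \<oplus>\<^bsub>M\<^esub> x', y) - frag_of (x, y) - frag_of (x', y) \<in> K"
  if "x \<in> carrier M" "x' \<in> carrier M" "y \<in> carrier N"
  unfolding tensor_relations_def by (rule generate.incl, rule UnI1, rule UnI1, rule CollectI, rule exI[of _ x], rule exI[of _ x'], rule exI[of _ y])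
   (use that in simp)
 show "frag_of (x, y \<oplus>\<^bsub>N\<^esub> y') - frag_of (x, y) - frag_of (x, y') \<in> K"
  if "x \<in> carrier M" "y \<in> carrier N" "y' \<in> carrier N"
  unfolding tensor_relations_def by (rule generate.incl, rule UnI1, rule UnI2, rule CollectI, rule exI[of _ x], rule exI[of _ y], rule exI[of _ y'])
   (use that in simp)
 show "frag_of (r \<odot>\<^bsub>M\<^esub> x, y) - frag_of (x, r \<odot>\<^bsub>N\<^esub> y) \<in> K"
  if "r \<in> carrier R" "x \<in> carrier M" "y \<in> carrier N"
  unfolding tensor_relations_def by (rule generate.incl, rule UnI2, rule CollectI, rule exI[of _ r], rule exI[of _ x], rule exI[of _ y])
   (use that in simp)
qed

lemma K_induct:
 assumes u: "u \<in> K"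
  and zero: "P 0" and add: "\<And>u v. \<lbrakk>P u; P v\<rbrakk> \<Longrightarrow> P (u + v)" and minus: "\<And>u. P u \<Longrightarrow> P (- u)"
  and gen: "\<And>x x' y. \<lbrakk>x \<in> carrier M; x' \<in> carrier M; y \<in> carrier N\<rbrakk> \<Longrightarrow>
    P (frag_of (x \<oplus>\<^bsub>M\<^esub> x', y) - frag_of (x, y) - frag_of (x', y))"
   "\<And>x y y'. \<lbrakk>x \<in> carrier M; y \<in> carrier N; y' \<in> carrier N\<rbrakk> \<Longrightarrow>
    P (frag_of (x, y \<oplus>\<^bsub>N\<^esub> y') - frag_of (x, y) - frag_of (x, y'))"
   "\<And>r x y. \<lbrakk>r \<in> carrier R; x \<in> carrier M; y \<in> carrier N\<rbrakk> \<Longrightarrow>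
    P (frag_of (r \<odot>\<^bsub>M\<^esub> x, y) - frag_of (x, r \<odot>\<^bsub>N\<^esub> y))"
 shows "P u"
proof -
 have "in_free u \<and> P u"
  using u unfolding tensor_relations_def
 proof (induction u rule: generate.induct)
  case one
  then show ?case using zero by simp
 next
  case (incl h)
  then have "h \<in> K" unfolding tensor_relations_def by (rule generate.incl)
  then have "in_free h" by (rule K_in_free)
  moreover from incl have "P h"
   by (elim UnE CollectE exE conjE) (hypsubst, rule gen; assumption)+
  ultimately show ?case by blast
 next
  case (inv h)
  then have "h \<in> K" unfolding tensor_relations_def by (rule generate.incl)
  then have "in_free h" by (rule K_in_free)
  moreover from inv have "P h"
   by (elim UnE CollectE exE conjE) (hypsubst, rule gen; assumption)+
  ultimately show ?case using minus by simp
 next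
  case (eng h1 h2)
  then show ?case using add in_free_add by simp
 qed
 then show ?thesis by simp
qed

lemma cls_def': "cls u = (\<lambda>h. h + u) ` K"
 by (auto simp: tensor_class_def r_coset_def)

lemma in_cls_iff: "v \<in> cls u \<longleftrightarrow> v - u \<in> K"
proof
 assume "v \<in> cls u" then show "v - u \<in> K" by (auto simp: cls_def')
next
 assume "v - u \<in> K"
 moreover have "v = (v - u) + u" by simp
 ultimately show "v \<in> cls u" unfolding cls_def' by blast
qed

lemma cls_eq_iff: "cls u = cls v \<longleftrightarrow> u - v \<in> K"
proof
 assume "cls u = cls v"
 moreover have "u \<in> cls u" by (simp add: in_cls_iff K_zero)
 ultimately show "u - v \<in> K" using in_cls_iff by blast
next
 assume uv: "u - v \<in> K"
 have "w - u \<in> K \<longleftrightarrow> w - v \<in> K" for w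
 proof
  assume "w - u \<in> K"
  from K_add[OF this uv] show "w - v \<in> K" by simp
 next
  assume "w - v \<in> K"
  from K_diff[OF this uv] show "w - u \<in> K" by simp
 qed
 then show "cls u = cls v" using in_cls_iff by blast
qed

lemma normal_K: "K \<lhd> G"
 by (rule comm_group.subgroup_imp_normal[OF abelian_free_Abelian_group K_subgroup])

lemma carrier_T: "carrier T = cls ` {u. in_free u}"
 by (auto simp: tensor_ab_def tensor_group_def FactGroup_def RCOSETS_def tensor_class_def)

lemma zero_T: "\<zero>\<^bsub>T\<^esub> = cls 0"
proof -
 have "\<zero>\<^bsub>T\<^esub> = K" by (simp add: tensor_ab_def tensor_group_def FactGroup_def)
 then show ?thesis by (simp add: cls_def')
qed

lemma add_T: "\<lbrakk>in_free u; in_free v\<rbrakk> \<Longrightarrow> cls u \<oplus>\<^bsub>T\<^esub> cls v = cls (u + v)"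
 using normal.rcos_sum[OF normal_K, of u v]
 by (simp add: tensor_ab_def tensor_group_def FactGroup_def tensor_class_def)

lemma cls_closed: "in_free u \<Longrightarrow> cls u \<in> carrier T"
 by (auto simp: carrier_T)

lemma abelian_group_T: "abelian_group T"
proof (rule abelian_groupI)
 show "\<zero>\<^bsub>T\<^esub> \<in> carrier T" by (auto simp: zero_T carrier_T)
next
 fix x assume "x \<in> carrier T"
 then obtain u where u: "in_free u" "x = cls u" by (auto simp: carrier_T)
 then show "\<zero>\<^bsub>T\<^esub> \<oplus>\<^bsub>T\<^esub> x = x" by (simp add: zero_T add_T)
 show "\<exists>y\<in>carrier T. y \<oplus>\<^bsub>T\<^esub> x = \<zero>\<^bsub>T\<^esub>"
  using u by (intro bexI[of _ "cls (- u)"]) (auto simp: zero_T add_T cls_closed)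
next
 fix x y assume "x \<in> carrier T" "y \<in> carrier T"
 then obtain u v where u: "in_free u" "x = cls u" "in_free v" "y = cls v" by (auto simp: carrier_T)
 then show "x \<oplus>\<^bsub>T\<^esub> y \<in> carrier T" "x \<oplus>\<^bsub>T\<^esub> y = y \<oplus>\<^bsub>T\<^esub> x"
  by (simp_all add: add_T add.commute cls_closed in_free_add)
 fix z assume "z \<in> carrier T"
 then obtain w where "in_free w" "z = cls w" by (auto simp: carrier_T)
 then show "x \<oplus>\<^bsub>T\<^esub> y \<oplus>\<^bsub>T\<^esub> z = x \<oplus>\<^bsub>T\<^esub> (y \<oplus>\<^bsub>T\<^esub> z)"
  using u by (simp add: add_T in_free_add add.assoc)
qed

sublocale T: abelian_group T by (rule abelian_group_T)

lemma t_closed: "\<lbrakk>x \<in> carrier M; y \<in> carrier N\<rbrakk> \<Longrightarrow> t x y \<in> carrier T"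
 by (auto simp: pure_tensor_def intro!: cls_closed)

lemma t_add_left: "\<lbrakk>x \<in> carrier M; x' \<in> carrier M; y \<in> carrier N\<rbrakk> \<Longrightarrow> t (x \<oplus>\<^bsub>M\<^esub> x') y = t x y \<oplus>\<^bsub>T\<^esub> t x' y"
 using K_gen(1)[of x x' y] by (simp add: pure_tensor_def add_T cls_eq_iff diff_diff_eq)

lemma t_add_right: "\<lbrakk>x \<in> carrier M; y \<in> carrier N; y' \<in> carrier N\<rbrakk> \<Longrightarrow> t x (y \<oplus>\<^bsub>N\<^esub> y') = t x y \<oplus>\<^bsub>T\<^esub> t x y'"
 using K_gen(2)[of x y y'] by (simp add: pure_tensor_def add_T cls_eq_iff diff_diff_eq)

lemma t_balanced: "\<lbrakk>r \<in> carrier R; x \<in> carrier M; y \<in> carrier N\<rbrakk> \<Longrightarrow> t (r \<odot>\<^bsub>M\<^esub> x) y = t x (r \<odot>\<^bsub>N\<^esub> y)"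
 using K_gen(3)[of r x y] by (simp add: pure_tensor_def cls_eq_iff)

lemma additive_t_left: "y \<in> carrier N \<Longrightarrow> (\<lambda>x. t x y) \<in> add_hom M T"
 by (rule add_homI) (auto simp: t_closed t_add_left)

lemma additive_t_right: "x \<in> carrier M \<Longrightarrow> (\<lambda>y. t x y) \<in> add_hom N T"
 by (rule add_homI) (auto simp: t_closed t_add_right)

text \<open>Differences rather than sums, because pure tensors are only known to generate the tensor
  product as a group.\<close>

lemma tensor_induct:
 assumes z: "z \<in> carrier T"
  and tens: "\<And>x y. \<lbrakk>x \<in> carrier M; y \<in> carrier N\<rbrakk> \<Longrightarrow> P (t x y)"
  and zero: "P \<zero>\<^bsub>T\<^esub>"
  and diff: "\<And>z w. \<lbrakk>z \<in> carrier T; w \<in> carrier T; P z; P w\<rbrakk> \<Longrightarrow> P (z \<oplus>\<^bsub>T\<^esub> \<ominus>\<^bsub>T\<^esub> w)"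
 shows "P z"
proof -
 obtain u where u: "in_free u" "z = cls u" using z by (auto simp: carrier_T)
 have "in_free u \<and> P (cls u)" using u(1)
 proof (induction u rule: frag_induction)
  case zero
  then show ?case using \<open>P \<zero>\<^bsub>T\<^esub>\<close> by (simp add: zero_T)
 next
  case (one k)
  then show ?case using tens by (auto simp: pure_tensor_def)
 next
  case (diff v w)
  have "\<ominus>\<^bsub>T\<^esub> cls w = cls (- w)"
   using diff.IH(2) by (intro T.minus_equality) (simp_all add: add_T zero_T cls_closed)
  then have "cls v \<oplus>\<^bsub>T\<^esub> \<ominus>\<^bsub>T\<^esub> cls w = cls (v - w)" using diff.IH by (simp add: add_T)
  moreover have "in_free (v - w)" using in_free_add[of v "- w"] diff.IH by simp
  ultimately show ?case
   using \<open>\<And>z w. \<lbrakk>z \<in> carrier T; w \<in> carrier T; P z; P w\<rbrakk> \<Longrightarrow> P (z \<oplus>\<^bsub>T\<^esub> \<ominus>\<^bsub>T\<^esub> w)\<close>[of "cls v" "cls w"]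
    diff.IH cls_closed by simp
 qed
 then show ?thesis using u by simp
qed

lemma additive_eqI:
 assumes H: "abelian_group H" and f: "f \<in> add_hom T H" and g: "g \<in> add_hom T H"
  and eq: "\<And>x y. \<lbrakk>x \<in> carrier M; y \<in> carrier N\<rbrakk> \<Longrightarrow> f (t x y) = g (t x y)"
  and z: "z \<in> carrier T"
 shows "f z = g z"
 using z
proof (rule tensor_induct)
 show "f \<zero>\<^bsub>T\<^esub> = g \<zero>\<^bsub>T\<^esub>"
  using add_hom_zero[OF abelian_group_T H f] add_hom_zero[OF abelian_group_T H g] by simp
next
 fix z w assume "z \<in> carrier T" "w \<in> carrier T" "f z = g z" "f w = g w"
 then show "f (z \<oplus>\<^bsub>T\<^esub> \<ominus>\<^bsub>T\<^esub> w) = g (z \<oplus>\<^bsub>T\<^esub> \<ominus>\<^bsub>T\<^esub> w)"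
  using add_hom_minus[OF abelian_group_T H f] add_hom_minus[OF abelian_group_T H g]
  by (simp add: add_hom_add[OF f] add_hom_add[OF g])
qed (rule eq)

lemma tensor_universal:
 assumes H: "abelian_group H"
  and h: "\<And>x y. \<lbrakk>x \<in> carrier M; y \<in> carrier N\<rbrakk> \<Longrightarrow> h x y \<in> carrier H"
   "\<And>x x' y. \<lbrakk>x \<in> carrier M; x' \<in> carrier M; y \<in> carrier N\<rbrakk> \<Longrightarrow> h (x \<oplus>\<^bsub>M\<^esub> x') y = h x y \<oplus>\<^bsub>H\<^esub> h x' y"
   "\<And>x y y'. \<lbrakk>x \<in> carrier M; y \<in> carrier N; y' \<in> carrier N\<rbrakk> \<Longrightarrow> h x (y \<oplus>\<^bsub>N\<^esub> y') = h x y \<oplus>\<^bsub>H\<^esub> h x y'"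
   "\<And>r x y. \<lbrakk>r \<in> carrier R; x \<in> carrier M; y \<in> carrier N\<rbrakk> \<Longrightarrow> h (r \<odot>\<^bsub>M\<^esub> x) y = h x (r \<odot>\<^bsub>N\<^esub> y)"
 obtains g where "g \<in> add_hom T H" "\<And>x y. \<lbrakk>x \<in> carrier M; y \<in> carrier N\<rbrakk> \<Longrightarrow> g (t x y) = h x y"
proof -
 interpret H: abelian_group H by fact
 obtain h' where h': "h' \<in> hom G (add_monoid H)" "\<And>x. x \<in> carrier M \<times> carrier N \<Longrightarrow> h' (frag_of x) = case_prod h x"
 proof (rule comm_group.free_Abelian_group_universal[OF H.a_comm_group, of "case_prod h" "carrier M \<times> carrier N"])
  show "case_prod h ` (carrier M \<times> carrier N) \<subseteq> carrier (add_monoid H)" using h(1) by auto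
 qed (rule that; assumption)
 have add: "h' (u + v) = h' u \<oplus>\<^bsub>H\<^esub> h' v" if "in_free u" "in_free v" for u v
  using hom_mult[OF h'(1), of u v] that by simp
 have cl: "h' u \<in> carrier H" if "in_free u" for u using hom_in_carrier[OF h'(1), of u] that by simp
 have zero: "h' 0 = \<zero>\<^bsub>H\<^esub>" using add[of 0 0] cl[of 0] by (metis H.add.r_cancel_one add.right_neutral keys_zero empty_subsetI)
 have minus: "h' (- u) = \<ominus>\<^bsub>H\<^esub> h' u" if "in_free u" for u
  using add[of "- u" u] that zero cl by (intro H.minus_equality[symmetric]) auto
 have frag: "h' (frag_of (x, y)) = h x y" "in_free (frag_of (x, y))" if "x \<in> carrier M" "y \<in> carrier N" for x y
  using h'(2)[of "(x, y)"] that by auto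
 have diff: "h' (u - v) = h' u \<oplus>\<^bsub>H\<^esub> \<ominus>\<^bsub>H\<^esub> h' v" if "in_free u" "in_free v" for u v
  using add[of u "- v"] minus that by simp
 have idiff: "in_free (u - v)" if "in_free u" "in_free v" for u v using in_free_add[of u "- v"] that by simp
 have kills: "in_free u \<and> h' u = \<zero>\<^bsub>H\<^esub>" if "u \<in> K" for u
  using that
 proof (rule K_induct)
  fix x x' y assume *: "x \<in> carrier M" "x' \<in> carrier M" "y \<in> carrier N"
  have c: "h x y \<in> carrier H" "h x' y \<in> carrier H" using h(1) * by auto
  have "h' (frag_of (x \<oplus>\<^bsub>M\<^esub> x', y) - frag_of (x, y) - frag_of (x', y)) = h x y \<oplus>\<^bsub>H\<^esub> h x' y \<oplus>\<^bsub>H\<^esub> \<ominus>\<^bsub>H\<^esub> h x y \<oplus>\<^bsub>H\<^esub> \<ominus>\<^bsub>H\<^esub> h x' y"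
   using * frag h(2) by (simp add: diff idiff)
  also have "\<dots> = \<zero>\<^bsub>H\<^esub>" using c by (simp add: H.a_ac H.r_neg H.r_neg1 H.r_neg2)
  finally show "in_free (frag_of (x \<oplus>\<^bsub>M\<^esub> x', y) - frag_of (x, y) - frag_of (x', y)) \<and>
   h' (frag_of (x \<oplus>\<^bsub>M\<^esub> x', y) - frag_of (x, y) - frag_of (x', y)) = \<zero>\<^bsub>H\<^esub>"
   using * frag(2) idiff by simp
 next
  fix x y y' assume *: "x \<in> carrier M" "y \<in> carrier N" "y' \<in> carrier N"
  have c: "h x y \<in> carrier H" "h x y' \<in> carrier H" using h(1) * by auto
  have "h' (frag_of (x, y \<oplus>\<^bsub>N\<^esub> y') - frag_of (x, y) - frag_of (x, y')) = h x y \<oplus>\<^bsub>H\<^esub> h x y' \<oplus>\<^bsub>H\<^esub> \<ominus>\<^bsub>H\<^esub> h x y \<oplus>\<^bsub>H\<^esub> \<ominus>\<^bsub>H\<^esub> h x y'"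
   using * frag h(3) by (simp add: diff idiff)
  also have "\<dots> = \<zero>\<^bsub>H\<^esub>" using c by (simp add: H.a_ac H.r_neg H.r_neg1 H.r_neg2)
  finally show "in_free (frag_of (x, y \<oplus>\<^bsub>N\<^esub> y') - frag_of (x, y) - frag_of (x, y')) \<and>
   h' (frag_of (x, y \<oplus>\<^bsub>N\<^esub> y') - frag_of (x, y) - frag_of (x, y')) = \<zero>\<^bsub>H\<^esub>"
   using * frag(2) idiff by simp
 next
  fix r x y assume *: "r \<in> carrier R" "x \<in> carrier M" "y \<in> carrier N"
  then show "in_free (frag_of (r \<odot>\<^bsub>M\<^esub> x, y) - frag_of (x, r \<odot>\<^bsub>N\<^esub> y)) \<and>
   h' (frag_of (r \<odot>\<^bsub>M\<^esub> x, y) - frag_of (x, r \<odot>\<^bsub>N\<^esub> y)) = \<zero>\<^bsub>H\<^esub>"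
   using frag M_smult N_smult h(1,4) idiff by (simp add: diff H.r_neg)
 qed (auto simp: zero add minus in_free_add)
 \<comment> \<open>Elements of the tensor product are cosets, so the value is read off an arbitrary
   representative; any two differ by a relation, which \<open>h'\<close> kills.\<close>
 define g where "g P = h' (SOME u. u \<in> P)" for P
 have g: "g (cls u) = h' u" if u: "in_free u" for u
 proof -
  have "u \<in> cls u" by (simp add: in_cls_iff K_zero)
  then have s: "(SOME v. v \<in> cls u) - u \<in> K" using someI[of "\<lambda>v. v \<in> cls u" u] in_cls_iff by blast
  have "h' (((SOME v. v \<in> cls u) - u) + u) = h' u"
   using kills[OF s] add[of "(SOME v. v \<in> cls u) - u" u] u cl by simp
  then show ?thesis by (simp add: g_def)
 qed
 show ?thesis
 proof (rule that[of g])
  show "g \<in> add_hom T H"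
   by (rule add_homI) (auto simp: carrier_T g cl add_T in_free_add add)
  show "g (t x y) = h x y" if "x \<in> carrier M" "y \<in> carrier N" for x y
   using that frag by (simp add: pure_tensor_def g)
 qed
qed

end

lemma left_module_hom_add: "\<lbrakk>f \<in> left_module_hom R M N; x \<in> carrier M; y \<in> carrier M\<rbrakk> \<Longrightarrow> f (x \<oplus>\<^bsub>M\<^esub> y) = f x \<oplus>\<^bsub>N\<^esub> f y"
 and left_module_hom_smult: "\<lbrakk>f \<in> left_module_hom R M N; r \<in> carrier R; x \<in> carrier M\<rbrakk> \<Longrightarrow> f (r \<odot>\<^bsub>M\<^esub> x) = r \<odot>\<^bsub>N\<^esub> f x"
 and left_module_hom_closed: "\<lbrakk>f \<in> left_module_hom R M N; x \<in> carrier M\<rbrakk> \<Longrightarrow> f x \<in> carrier N"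
 and left_module_hom_additive: "f \<in> left_module_hom R M N \<Longrightarrow> f \<in> add_hom M N"
 by (auto simp: left_module_hom_def add_hom_def)

lemma left_module_homI:
 assumes "f \<in> add_hom M N" "\<And>r x. \<lbrakk>r \<in> carrier R; x \<in> carrier M\<rbrakk> \<Longrightarrow> f (r \<odot>\<^bsub>M\<^esub> x) = r \<odot>\<^bsub>N\<^esub> f x"
 shows "f \<in> left_module_hom R M N"
 using assms by (auto simp: left_module_hom_def add_hom_def)

section \<open>Functoriality of tensor products\<close>

context
 fixes R :: "('r, 'c) ring_scheme"
  and M :: "('r, 'm, 'd) module_scheme" and N :: "('r, 'n, 'e) module_scheme"
  and M' :: "('r, 'u, 'f) module_scheme" and N' :: "('r, 'v, 'g) module_scheme"
 assumes MN: "tensor_pair R M N" and MN': "tensor_pair R M' N'"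
begin

interpretation MN: tensor_pair R M N by (rule MN)
interpretation MN': tensor_pair R M' N' by (rule MN')

lemma frag_pair_free:
 assumes "f \<in> left_module_hom R M' M" "g \<in> left_module_hom R N' N" "MN'.in_free u"
 shows "MN.in_free (frag_extend (\<lambda>(x, y). frag_of (f x, g y)) u)"
 by (rule keys_frag_extend_subset[OF assms(3)])
  (auto simp: left_module_hom_closed[OF assms(1)] left_module_hom_closed[OF assms(2)])

lemma frag_pair_relations:
 assumes f: "f \<in> left_module_hom R M' M" and g: "g \<in> left_module_hom R N' N" and u: "u \<in> MN'.K"
 shows "frag_extend (\<lambda>(x, y). frag_of (f x, g y)) u \<in> MN.K"
 using u
proof (rule MN'.K_induct)
 fix x x' y assume "x \<in> carrier M'" "x' \<in> carrier M'" "y \<in> carrier N'"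
 then show "frag_extend (\<lambda>(x, y). frag_of (f x, g y))
   (frag_of (x \<oplus>\<^bsub>M'\<^esub> x', y) - frag_of (x, y) - frag_of (x', y)) \<in> MN.K"
  using MN.K_gen(1)[of "f x" "f x'" "g y"]
  by (simp add: frag_extend_diff left_module_hom_closed[OF f] left_module_hom_closed[OF g] left_module_hom_add[OF f])
next
 fix x y y' assume "x \<in> carrier M'" "y \<in> carrier N'" "y' \<in> carrier N'"
 then show "frag_extend (\<lambda>(x, y). frag_of (f x, g y))
   (frag_of (x, y \<oplus>\<^bsub>N'\<^esub> y') - frag_of (x, y) - frag_of (x, y')) \<in> MN.K"
  using MN.K_gen(2)[of "f x" "g y" "g y'"]
  by (simp add: frag_extend_diff left_module_hom_closed[OF f] left_module_hom_closed[OF g] left_module_hom_add[OF g])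
next
 fix r x y assume "r \<in> carrier R" "x \<in> carrier M'" "y \<in> carrier N'"
 then show "frag_extend (\<lambda>(x, y). frag_of (f x, g y))
   (frag_of (r \<odot>\<^bsub>M'\<^esub> x, y) - frag_of (x, r \<odot>\<^bsub>N'\<^esub> y)) \<in> MN.K"
  using MN.K_gen(3)[of r "f x" "g y"]
  by (simp add: frag_extend_diff left_module_hom_closed[OF f] left_module_hom_closed[OF g]
    left_module_hom_smult[OF f] left_module_hom_smult[OF g])
qed (auto simp: frag_extend_add frag_extend_minus MN.K_zero MN.K_add MN.K_minus)

text \<open>The union in \<open>tensor_map\<close> runs over all representatives of a coset. Two of
  them differ by a relation, which goes to a relation, so the union is over copies of one
  class.\<close>

lemma tensor_map_cls:
 assumes f: "f \<in> left_module_hom R M' M" and g: "g \<in> left_module_hom R N' N" and u: "MN'.in_free u"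
 shows "tensor_map R M N f g (MN'.cls u) = MN.cls (frag_extend (\<lambda>(x, y). frag_of (f x, g y)) u)"
proof -
 let ?e = "frag_extend (\<lambda>(x, y). frag_of (f x, g y))"
 have "MN.cls (?e v) = MN.cls (?e u)" if "v \<in> MN'.cls u" for v
  using frag_pair_relations[OF f g, of "v - u"] that
  by (simp add: MN'.in_cls_iff MN.cls_eq_iff frag_extend_diff)
 moreover have "u \<in> MN'.cls u" by (simp add: MN'.in_cls_iff MN'.K_zero)
 ultimately show ?thesis unfolding tensor_map_def by blast
qed

lemma tensor_map_additive:
 assumes f: "f \<in> left_module_hom R M' M" and g: "g \<in> left_module_hom R N' N"
 shows "tensor_map R M N f g \<in> add_hom MN'.T MN.T"
proof (rule add_homI)
 note cl = MN.cls_closed[OF frag_pair_free[OF f g]]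
 fix P assume "P \<in> carrier MN'.T"
 then obtain u where u: "MN'.in_free u" "P = MN'.cls u" by (auto simp: MN'.carrier_T)
 show "tensor_map R M N f g P \<in> carrier MN.T"
  unfolding u(2) tensor_map_cls[OF f g u(1)] by (rule cl[OF u(1)])
 fix Q assume "Q \<in> carrier MN'.T"
 then obtain v where v: "MN'.in_free v" "Q = MN'.cls v" by (auto simp: MN'.carrier_T)
 show "tensor_map R M N f g (P \<oplus>\<^bsub>MN'.T\<^esub> Q) = tensor_map R M N f g P \<oplus>\<^bsub>MN.T\<^esub> tensor_map R M N f g Q"
  unfolding u(2) v(2) MN'.add_T[OF u(1) v(1)] tensor_map_cls[OF f g u(1)] tensor_map_cls[OF f g v(1)]
   tensor_map_cls[OF f g MN'.in_free_add[OF u(1) v(1)]] frag_extend_add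
  by (rule MN.add_T[symmetric, OF frag_pair_free[OF f g u(1)] frag_pair_free[OF f g v(1)]])
qed

lemma tensor_map_pure:
 assumes f: "f \<in> left_module_hom R M' M" and g: "g \<in> left_module_hom R N' N"
  and "x \<in> carrier M'" "y \<in> carrier N'"
 shows "tensor_map R M N f g (MN'.t x y) = MN.t (f x) (g y)"
 using assms(3,4) tensor_map_cls[OF f g, of "frag_of (x, y)"] by (simp add: pure_tensor_def)

end

section \<open>Biadditive actions on tensor products\<close>

context
 fixes R :: "('r, 'c) ring_scheme"
  and M :: "('r, 'm, 'd) module_scheme" and N :: "('r, 'n, 'e) module_scheme"
  and A :: "('r, 'u, 'f) module_scheme" and B :: "('r, 'v, 'g) module_scheme"
  and f :: "'u \<Rightarrow> 'm \<Rightarrow> 'm" and g :: "'v \<Rightarrow> 'n \<Rightarrow> 'n"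
 assumes MN: "tensor_pair R M N" and AB: "tensor_pair R A B"
  and f1: "\<And>a. a \<in> carrier A \<Longrightarrow> f a \<in> left_module_hom R M M"
  and f2: "\<And>x. x \<in> carrier M \<Longrightarrow> (\<lambda>a. f a x) \<in> left_module_hom R A M"
  and g1: "\<And>b. b \<in> carrier B \<Longrightarrow> g b \<in> left_module_hom R N N"
  and g2: "\<And>y. y \<in> carrier N \<Longrightarrow> (\<lambda>b. g b y) \<in> left_module_hom R B N"
begin

interpretation MN: tensor_pair R M N by (rule MN)
interpretation AB: tensor_pair R A B by (rule AB)

abbreviation frag_act :: "('u \<times> 'v \<Rightarrow>\<^sub>0 int) \<Rightarrow> ('m \<times> 'n \<Rightarrow>\<^sub>0 int) \<Rightarrow> ('m \<times> 'n \<Rightarrow>\<^sub>0 int)" where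
 "frag_act u v \<equiv> frag_extend (\<lambda>(a, b). frag_extend (\<lambda>(x, y). frag_of (f a x, g b y)) v) u"

lemma frag_act_diff_left: "frag_act (u - u') v = frag_act u v - frag_act u' v"
 by (rule frag_extend_diff)

lemma frag_act_diff_right: "frag_act u (v - v') = frag_act u v - frag_act u v'"
 by (simp add: frag_extend_diff split_def frag_extend_fun_diff)

lemma frag_act_free:
 assumes "AB.in_free u" "MN.in_free v" shows "MN.in_free (frag_act u v)"
proof (rule keys_frag_extend_subset[OF assms(1)])
 fix k assume "k \<in> carrier A \<times> carrier B"
 then obtain a b where k: "k = (a, b)" "a \<in> carrier A" "b \<in> carrier B" by blast
 show "MN.in_free (case k of (a, b) \<Rightarrow> frag_extend (\<lambda>(x, y). frag_of (f a x, g b y)) v)"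
  unfolding k prod.case by (rule frag_pair_free[OF MN MN f1[OF k(2)] g1[OF k(3)] assms(2)])
qed

lemma frag_act_K_left:
 assumes u: "u \<in> AB.K" and v: "MN.in_free v" shows "frag_act u v \<in> MN.K"
 using v
proof (induction v rule: frag_induction)
 case zero
 have "frag_act u (0 - 0) = frag_act u 0 - frag_act u 0" by (rule frag_act_diff_right)
 then have "frag_act u 0 = 0" by (simp only: diff_self)
 then show ?case using MN.K_zero by (simp only:)
next
 case (diff v w)
 then show ?case by (simp only: frag_act_diff_right MN.K_diff)
next
 case (one k)
 then obtain x y where k: "k = (x, y)" "x \<in> carrier M" "y \<in> carrier N" by blast
 show ?case
  unfolding k using frag_pair_relations[OF MN AB f2[OF k(2)] g2[OF k(3)] u] by simp
qed

lemma frag_act_K_right: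
 assumes v: "v \<in> MN.K" and u: "AB.in_free u" shows "frag_act u v \<in> MN.K"
 using u
proof (induction u rule: frag_induction)
 case zero
 show ?case by (simp add: MN.K_zero)
next
 case (diff u w)
 then show ?case by (simp only: frag_act_diff_left MN.K_diff)
next
 case (one k)
 then obtain a b where k: "k = (a, b)" "a \<in> carrier A" "b \<in> carrier B" by blast
 show ?case
  unfolding k using frag_pair_relations[OF MN MN f1[OF k(2)] g1[OF k(3)] v] by simp
qed

lemma tensor_action_cls:
 assumes u: "AB.in_free u" and v: "MN.in_free v"
 shows "tensor_action R M N f g (AB.cls u) (MN.cls v) = MN.cls (frag_act u v)"
proof -
 have eq: "MN.cls (frag_act u' v') = MN.cls (frag_act u v)" if "u' \<in> AB.cls u" "v' \<in> MN.cls v" for u' v'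
 proof -
  have ku: "u' - u \<in> AB.K" and kv: "v' - v \<in> MN.K" using that by (auto simp: AB.in_cls_iff MN.in_cls_iff)
  have v': "MN.in_free v'" using MN.in_free_add[OF MN.K_in_free[OF kv] v] by simp
  \<comment> \<open>Change one argument at a time: the first summand varies \<open>u\<close> for
    fixed \<open>v'\<close>, the second varies \<open>v\<close> for fixed \<open>u\<close>.\<close>
  have "frag_act (u' - u) v' + frag_act u (v' - v) \<in> MN.K"
   by (rule MN.K_add[OF frag_act_K_left[OF ku v'] frag_act_K_right[OF kv u]])
  moreover have "frag_act (u' - u) v' + frag_act u (v' - v) = frag_act u' v' - frag_act u v"
   unfolding frag_act_diff_left frag_act_diff_right by simp
  ultimately show ?thesis unfolding MN.cls_eq_iff by simp
 qed
 have "u \<in> AB.cls u" "v \<in> MN.cls v" by (simp_all add: AB.in_cls_iff AB.K_zero MN.in_cls_iff MN.K_zero)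
 then show ?thesis unfolding tensor_action_def using eq by blast
qed

lemma tensor_action_additive_right:
 assumes "P \<in> carrier AB.T" shows "tensor_action R M N f g P \<in> add_hom MN.T MN.T"
proof -
 obtain u where u: "AB.in_free u" "P = AB.cls u" using assms by (auto simp: AB.carrier_T)
 have add: "frag_act u (v + w) = frag_act u v + frag_act u w" for v w
  using frag_act_diff_right[where u = u and v = "v + w" and v' = w] by simp
 note cl = MN.cls_closed[OF frag_act_free[OF u(1)]]
 show ?thesis
 proof (rule add_homI)
  fix Q assume "Q \<in> carrier MN.T"
  then obtain v where v: "MN.in_free v" "Q = MN.cls v" by (auto simp: MN.carrier_T)
  show "tensor_action R M N f g P Q \<in> carrier MN.T"
   unfolding u(2) v(2) tensor_action_cls[OF u(1) v(1)] by (rule cl[OF v(1)])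
  fix Q' assume "Q' \<in> carrier MN.T"
  then obtain w where w: "MN.in_free w" "Q' = MN.cls w" by (auto simp: MN.carrier_T)
  show "tensor_action R M N f g P (Q \<oplus>\<^bsub>MN.T\<^esub> Q') =
    tensor_action R M N f g P Q \<oplus>\<^bsub>MN.T\<^esub> tensor_action R M N f g P Q'"
   unfolding u(2) v(2) w(2) MN.add_T[OF v(1) w(1)] tensor_action_cls[OF u(1) v(1)]
    tensor_action_cls[OF u(1) w(1)] tensor_action_cls[OF u(1) MN.in_free_add[OF v(1) w(1)]] add
   by (rule MN.add_T[symmetric, OF frag_act_free[OF u(1) v(1)] frag_act_free[OF u(1) w(1)]])
 qed
qed

lemma tensor_action_additive_left:
 assumes "Q \<in> carrier MN.T" shows "(\<lambda>P. tensor_action R M N f g P Q) \<in> add_hom AB.T MN.T"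
proof -
 obtain v where v: "MN.in_free v" "Q = MN.cls v" using assms by (auto simp: MN.carrier_T)
 show ?thesis
 proof (rule add_homI)
  fix P assume "P \<in> carrier AB.T"
  then obtain u where u: "AB.in_free u" "P = AB.cls u" by (auto simp: AB.carrier_T)
  show "tensor_action R M N f g P Q \<in> carrier MN.T"
   unfolding u(2) v(2) tensor_action_cls[OF u(1) v(1)] by (rule MN.cls_closed[OF frag_act_free[OF u(1) v(1)]])
  fix P' assume "P' \<in> carrier AB.T"
  then obtain w where w: "AB.in_free w" "P' = AB.cls w" by (auto simp: AB.carrier_T)
  show "tensor_action R M N f g (P \<oplus>\<^bsub>AB.T\<^esub> P') Q =
    tensor_action R M N f g P Q \<oplus>\<^bsub>MN.T\<^esub> tensor_action R M N f g P' Q"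
   unfolding u(2) v(2) w(2) AB.add_T[OF u(1) w(1)] tensor_action_cls[OF u(1) v(1)]
    tensor_action_cls[OF w(1) v(1)] tensor_action_cls[OF AB.in_free_add[OF u(1) w(1)] v(1)] frag_extend_add
   by (rule MN.add_T[symmetric, OF frag_act_free[OF u(1) v(1)] frag_act_free[OF w(1) v(1)]])
 qed
qed

lemma tensor_action_pure:
 assumes "a \<in> carrier A" "b \<in> carrier B" "x \<in> carrier M" "y \<in> carrier N"
 shows "tensor_action R M N f g (AB.t a b) (MN.t x y) = MN.t (f a x) (g b y)"
 using assms tensor_action_cls[of "frag_of (a, b)" "frag_of (x, y)"] by (simp add: pure_tensor_def)

end

section \<open>Base change of modules\<close>

lemma abelian_group_transfer:
 assumes "abelian_group G" "carrier H = carrier G" "ring.add H = ring.add G" "ring.zero H = ring.zero G"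
 shows "abelian_group H"
proof -
 interpret G: abelian_group G by fact
 show ?thesis
 proof (rule abelian_groupI)
  show "\<exists>y\<in>carrier H. y \<oplus>\<^bsub>H\<^esub> x = \<zero>\<^bsub>H\<^esub>" if "x \<in> carrier H" for x
   using that by (auto intro!: bexI[of _ "\<ominus>\<^bsub>G\<^esub> x"] simp: G.l_neg assms)
 qed (auto simp: assms G.a_ac)
qed

lemma add_hom_transfer:
 assumes "carrier H = carrier G" "ring.add H = ring.add G"
 shows "add_hom H L = add_hom G L" "add_hom L H = add_hom L G"
 by (simp_all add: add_hom_def assms)

lemma restrict_scalars_simps [simp]:
 "carrier (restrict_scalars A M) = carrier M" "ring.add (restrict_scalars A M) = ring.add M"
 "ring.zero (restrict_scalars A M) = ring.zero M"
 "smult (restrict_scalars A M) = (\<lambda>r x. (r \<odot>\<^bsub>A\<^esub> \<one>\<^bsub>A\<^esub>) \<odot>\<^bsub>M\<^esub> x)"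
 by (simp_all add: restrict_scalars_def)

lemma galois_twist_simps [simp]:
 "carrier (galois_twist R S A \<tau> U) = carrier U" "ring.add (galois_twist R S A \<tau> U) = ring.add U"
 "ring.zero (galois_twist R S A \<tau> U) = ring.zero U"
 by (simp_all add: galois_twist_def)

lemma galois_twist_smult:
 "P \<odot>\<^bsub>galois_twist R S A \<tau> U\<^esub> x =
   tensor_map R (regular_algebra S) A (inv_into (carrier S) \<tau>) (\<lambda>a. a) P \<odot>\<^bsub>U\<^esub> x"
 by (simp add: galois_twist_def)

locale base_change = padic_extension R S p + A: associative_algebra R A
 for R :: "'s ring" and S :: "'s ring" (structure) and p and A :: "('s, 'a) module"
begin

abbreviation A' :: "('s \<times> 'a \<Rightarrow>\<^sub>0 int) set ring" where "A' \<equiv> base_change_algebra R S A"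
abbreviation BM :: "('a, 'm) module \<Rightarrow> (('s \<times> 'a \<Rightarrow>\<^sub>0 int) set, ('s \<times> 'm \<Rightarrow>\<^sub>0 int) set) module"
 where "BM M \<equiv> base_change_module R S A M"
abbreviation "tA \<equiv> pure_tensor R S_mod A"
abbreviation "tM M \<equiv> pure_tensor R S_mod (restrict_scalars A M)"

abbreviation "inS s \<equiv> tA s \<one>\<^bsub>A\<^esub>"
abbreviation "inA a \<equiv> tA \<one> a"

lemma A_left_module: "left_module R A"
 by (rule A.left_module)

lemma pair_A: "tensor_pair R S_mod A"
 by (rule tensor_pair.intro[OF abelian_group_regular_algebra[OF S.abelian_group_axioms] A.abelian_group_axioms])
  (rule tensor_pair_axioms.intro, auto simp: subset)

interpretation TA: tensor_pair R S_mod A by (rule pair_A)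

lemma S_hom1: "s \<in> carrier S \<Longrightarrow> monoid.mult S s \<in> left_module_hom R S_mod S_mod"
 by (auto simp: left_module_hom_def S.r_distr S.m_lcomm subset)

lemma S_hom2: "s \<in> carrier S \<Longrightarrow> (\<lambda>s'. s' \<otimes> s) \<in> left_module_hom R S_mod S_mod"
 by (auto simp: left_module_hom_def S.l_distr S.m_assoc subset)

lemma A_hom1: "a \<in> carrier A \<Longrightarrow> monoid.mult A a \<in> left_module_hom R A A"
 by (auto simp: left_module_hom_def A.r_distr A.smult_mult_right)

lemma A_hom2: "a \<in> carrier A \<Longrightarrow> (\<lambda>a'. a' \<otimes>\<^bsub>A\<^esub> a) \<in> left_module_hom R A A"
 by (auto simp: left_module_hom_def A.l_distr A.smult_mult_left)

lemma A'_simps: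
 "carrier A' = carrier TA.T" "ring.add A' = ring.add TA.T" "ring.zero A' = ring.zero TA.T"
 "monoid.one A' = inA \<one>\<^bsub>A\<^esub>"
 "monoid.mult A' = tensor_action R S_mod A (monoid.mult S) (monoid.mult A)"
 by (simp_all add: base_change_algebra_def tensor_algebra_def tensor_ab_def pure_tensor_def)
  (simp_all add: regular_algebra_def)

lemma additive_A': "add_hom A' L = add_hom TA.T L" "add_hom L A' = add_hom L TA.T"
 by (rule add_hom_transfer[OF A'_simps(1,2)])+

lemma tA_closed: "\<lbrakk>s \<in> carrier S; a \<in> carrier A\<rbrakk> \<Longrightarrow> tA s a \<in> carrier A'"
 using TA.t_closed by (simp add: A'_simps)

lemma tA_mult:
 assumes "s \<in> carrier S" "a \<in> carrier A" "s' \<in> carrier S" "a' \<in> carrier A"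
 shows "tA s a \<otimes>\<^bsub>A'\<^esub> tA s' a' = tA (s \<otimes> s') (a \<otimes>\<^bsub>A\<^esub> a')"
 unfolding A'_simps
 by (rule tensor_action_pure[OF pair_A pair_A S_hom1 _ A_hom1])
  (use assms S_hom2 A_hom2 in auto)

lemma additive_tA_left: "a \<in> carrier A \<Longrightarrow> (\<lambda>s. tA s a) \<in> add_hom S A'"
 using TA.additive_t_left[of a] unfolding additive_A' add_hom_def by (simp add: A'_simps)

lemma additive_tA_right: "s \<in> carrier S \<Longrightarrow> (\<lambda>a. tA s a) \<in> add_hom A A'"
 using TA.additive_t_right[of s] unfolding additive_A' by simp

lemma tA_balanced: "\<lbrakk>r \<in> carrier R; s \<in> carrier S; a \<in> carrier A\<rbrakk> \<Longrightarrow> tA (r \<otimes> s) a = tA s (r \<odot>\<^bsub>A\<^esub> a)"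
 using TA.t_balanced[of r s a] by simp

lemma tA_scalar: "r \<in> carrier R \<Longrightarrow> inS r = inA (r \<odot>\<^bsub>A\<^esub> \<one>\<^bsub>A\<^esub>)"
 using tA_balanced[of r "\<one>" "\<one>\<^bsub>A\<^esub>"] subset by simp

text \<open>
 What is needed of an \<open>A'\<close>-module: its action is determined by the commuting actions of
 \<open>S \<otimes> 1\<close> and \<open>1 \<otimes> A\<close>.
\<close>

definition tensor_module :: "(('s \<times> 'a \<Rightarrow>\<^sub>0 int) set, 'm) module \<Rightarrow> bool" where
 "tensor_module U \<longleftrightarrow> abelian_group U \<and>
   (\<forall>x\<in>carrier U. (\<lambda>P. P \<odot>\<^bsub>U\<^esub> x) \<in> add_hom A' U) \<and>
   (\<forall>s\<in>carrier S. \<forall>a\<in>carrier A. \<forall>x\<in>carrier U.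
    tA s a \<odot>\<^bsub>U\<^esub> x = inS s \<odot>\<^bsub>U\<^esub> (inA a \<odot>\<^bsub>U\<^esub> x))"

lemma tensor_moduleD:
 assumes "tensor_module U"
 shows "abelian_group U" "x \<in> carrier U \<Longrightarrow> (\<lambda>P. P \<odot>\<^bsub>U\<^esub> x) \<in> add_hom A' U"
  "\<lbrakk>s \<in> carrier S; a \<in> carrier A; x \<in> carrier U\<rbrakk> \<Longrightarrow>
    tA s a \<odot>\<^bsub>U\<^esub> x = inS s \<odot>\<^bsub>U\<^esub> (inA a \<odot>\<^bsub>U\<^esub> x)"
  "\<lbrakk>P \<in> carrier A'; x \<in> carrier U\<rbrakk> \<Longrightarrow> P \<odot>\<^bsub>U\<^esub> x \<in> carrier U"
proof -
 show "abelian_group U" using assms by (simp add: tensor_module_def)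
 show 2: "(\<lambda>P. P \<odot>\<^bsub>U\<^esub> x) \<in> add_hom A' U" if "x \<in> carrier U" for x
  using assms that by (simp only: tensor_module_def)
 show "P \<odot>\<^bsub>U\<^esub> x \<in> carrier U" if "P \<in> carrier A'" "x \<in> carrier U"
  by (rule add_hom_closed[OF 2[OF that(2)] that(1)])
 show "tA s a \<odot>\<^bsub>U\<^esub> x = inS s \<odot>\<^bsub>U\<^esub> (inA a \<odot>\<^bsub>U\<^esub> x)"
  if "s \<in> carrier S" "a \<in> carrier A" "x \<in> carrier U"
  using assms that by (simp only: tensor_module_def)
qed

lemma left_module_tensor_module:
 assumes "left_module A' U" shows "tensor_module U"
proof -
 interpret U: left_module A' U by fact
 show ?thesis
  unfolding tensor_module_def
 proof (intro conjI ballI)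
  fix s a x assume *: "s \<in> carrier S" "a \<in> carrier A" "x \<in> carrier U"
  have "tA s a = inS s \<otimes>\<^bsub>A'\<^esub> inA a" using * by (simp add: tA_mult)
  then show "tA s a \<odot>\<^bsub>U\<^esub> x = inS s \<odot>\<^bsub>U\<^esub> (inA a \<odot>\<^bsub>U\<^esub> x)"
   using * by (simp add: U.smult_assoc tA_closed)
 qed (auto intro: U.abelian_group_axioms U.additive_smult_left)
qed

text \<open>\<open>A'\<close> is additively generated by the products of \<open>inS s\<close> and
  \<open>inA a\<close>, and both sides are additive in the scalar; linearity therefore reduces to
  these two actions.\<close>

lemma tensor_module_homI:
 assumes U: "tensor_module U" and V: "tensor_module V" and h: "h \<in> add_hom U V"
  and hs: "\<And>s x. \<lbrakk>s \<in> carrier S; x \<in> carrier U\<rbrakk> \<Longrightarrow> h (inS s \<odot>\<^bsub>U\<^esub> x) = inS s \<odot>\<^bsub>V\<^esub> h x"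
  and ha: "\<And>a x. \<lbrakk>a \<in> carrier A; x \<in> carrier U\<rbrakk> \<Longrightarrow> h (inA a \<odot>\<^bsub>U\<^esub> x) = inA a \<odot>\<^bsub>V\<^esub> h x"
 shows "h \<in> left_module_hom A' U V"
proof (rule left_module_homI[OF h])
 fix P x assume P: "P \<in> carrier A'" and x: "x \<in> carrier U"
 have hx: "h x \<in> carrier V" by (rule add_hom_closed[OF h x])
 show "h (P \<odot>\<^bsub>U\<^esub> x) = P \<odot>\<^bsub>V\<^esub> h x"
 proof (rule TA.additive_eqI[OF tensor_moduleD(1)[OF V]])
  show "(\<lambda>P. h (P \<odot>\<^bsub>U\<^esub> x)) \<in> add_hom TA.T V"
   using add_hom_comp[OF tensor_moduleD(2)[OF U x] h] unfolding additive_A' .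
  show "(\<lambda>P. P \<odot>\<^bsub>V\<^esub> h x) \<in> add_hom TA.T V"
   using tensor_moduleD(2)[OF V hx] unfolding additive_A' .
  show "P \<in> carrier TA.T" using P by (simp add: A'_simps)
  fix s a assume "s \<in> carrier S_mod" and a: "a \<in> carrier A"
  then have s: "s \<in> carrier S" by simp
  have ax: "inA a \<odot>\<^bsub>U\<^esub> x \<in> carrier U"
   by (rule tensor_moduleD(4)[OF U tA_closed[OF S.one_closed a] x])
  show "h (tA s a \<odot>\<^bsub>U\<^esub> x) = tA s a \<odot>\<^bsub>V\<^esub> h x"
   unfolding tensor_moduleD(3)[OF U s a x] tensor_moduleD(3)[OF V s a hx] hs[OF s ax] ha[OF a x] ..
 qed
qed

section \<open>Base change of one module\<close>

context
 fixes M :: "('a, 'm) module"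
 assumes M: "left_module A M"
begin

interpretation M: left_module A M by (rule M)

lemma restrict_left_module: "left_module R (restrict_scalars A M)"
proof (rule left_module.intro[OF R.ring_axioms])
 show "abelian_group (restrict_scalars A M)" by (rule abelian_group_transfer[OF M.abelian_group_axioms]) auto
 show "left_module_axioms R (restrict_scalars A M)"
 proof (rule left_module_axioms.intro)
  fix r r' x assume r: "r \<in> carrier R" "r' \<in> carrier R" "x \<in> carrier (restrict_scalars A M)"
  have "(r \<otimes>\<^bsub>R\<^esub> r') \<odot>\<^bsub>A\<^esub> \<one>\<^bsub>A\<^esub> = (r \<odot>\<^bsub>A\<^esub> \<one>\<^bsub>A\<^esub>) \<otimes>\<^bsub>A\<^esub> (r' \<odot>\<^bsub>A\<^esub> \<one>\<^bsub>A\<^esub>)"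
   using r by (simp add: A.smult_mult_left A.smult_assoc1)
  then show "(r \<otimes>\<^bsub>R\<^esub> r') \<odot>\<^bsub>restrict_scalars A M\<^esub> x = r \<odot>\<^bsub>restrict_scalars A M\<^esub> (r' \<odot>\<^bsub>restrict_scalars A M\<^esub> x)"
   using r by (simp add: M.smult_assoc)
 qed (auto simp: M.smult_closed A.smult_l_distr M.smult_l_distr M.smult_r_distr M.smult_one)
qed

lemma pair_M: "tensor_pair R S_mod (restrict_scalars A M)"
 by (rule tensor_pair.intro[OF abelian_group_regular_algebra[OF S.abelian_group_axioms]
    left_module.axioms(2)[OF restrict_left_module]])
  (rule tensor_pair_axioms.intro, auto simp: subset M.smult_closed)

interpretation TM: tensor_pair R S_mod "restrict_scalars A M" by (rule pair_M)

text \<open>The multiples \<open>r 1\<close> of the unit are central in the \<open>R\<close>-algebra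
  \<open>A\<close>.\<close>

lemma scalar_commute:
 assumes "r \<in> carrier R" "a \<in> carrier A" "x \<in> carrier M"
 shows "a \<odot>\<^bsub>M\<^esub> ((r \<odot>\<^bsub>A\<^esub> \<one>\<^bsub>A\<^esub>) \<odot>\<^bsub>M\<^esub> x) = (r \<odot>\<^bsub>A\<^esub> \<one>\<^bsub>A\<^esub>) \<odot>\<^bsub>M\<^esub> (a \<odot>\<^bsub>M\<^esub> x)"
  and "(r \<odot>\<^bsub>A\<^esub> a) \<odot>\<^bsub>M\<^esub> x = (r \<odot>\<^bsub>A\<^esub> \<one>\<^bsub>A\<^esub>) \<odot>\<^bsub>M\<^esub> (a \<odot>\<^bsub>M\<^esub> x)"
proof -
 have "a \<otimes>\<^bsub>A\<^esub> (r \<odot>\<^bsub>A\<^esub> \<one>\<^bsub>A\<^esub>) = r \<odot>\<^bsub>A\<^esub> a" "(r \<odot>\<^bsub>A\<^esub> \<one>\<^bsub>A\<^esub>) \<otimes>\<^bsub>A\<^esub> a = r \<odot>\<^bsub>A\<^esub> a"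
  using assms by (simp_all add: A.smult_mult_right A.smult_mult_left)
 then show "a \<odot>\<^bsub>M\<^esub> ((r \<odot>\<^bsub>A\<^esub> \<one>\<^bsub>A\<^esub>) \<odot>\<^bsub>M\<^esub> x) = (r \<odot>\<^bsub>A\<^esub> \<one>\<^bsub>A\<^esub>) \<odot>\<^bsub>M\<^esub> (a \<odot>\<^bsub>M\<^esub> x)"
  "(r \<odot>\<^bsub>A\<^esub> a) \<odot>\<^bsub>M\<^esub> x = (r \<odot>\<^bsub>A\<^esub> \<one>\<^bsub>A\<^esub>) \<odot>\<^bsub>M\<^esub> (a \<odot>\<^bsub>M\<^esub> x)"
  using assms by (simp_all flip: M.smult_assoc)
qed

lemma M_hom1: "a \<in> carrier A \<Longrightarrow> smult M a \<in> left_module_hom R (restrict_scalars A M) (restrict_scalars A M)"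
 by (auto simp: left_module_hom_def M.smult_closed M.smult_r_distr scalar_commute(1))

lemma M_hom2: "x \<in> carrier M \<Longrightarrow> (\<lambda>a. a \<odot>\<^bsub>M\<^esub> x) \<in> left_module_hom R A (restrict_scalars A M)"
 by (auto simp: left_module_hom_def M.smult_closed M.smult_l_distr scalar_commute(2))

lemma BM_simps:
 "carrier (BM M) = carrier TM.T" "ring.add (BM M) = ring.add TM.T" "ring.zero (BM M) = ring.zero TM.T"
 "smult (BM M) = tensor_action R S_mod (restrict_scalars A M) (monoid.mult S) (smult M)"
 by (simp_all add: base_change_module_def tensor_ab_def Let_def)

lemma BM_abelian: "abelian_group (BM M)"
 by (rule abelian_group_transfer[OF TM.abelian_group_T BM_simps(1-3)])

lemma additive_BM: "add_hom (BM M) L = add_hom TM.T L" "add_hom L (BM M) = add_hom L TM.T"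
 by (rule add_hom_transfer[OF BM_simps(1,2)])+

lemma tM_closed: "\<lbrakk>s \<in> carrier S; x \<in> carrier M\<rbrakk> \<Longrightarrow> tM M s x \<in> carrier (BM M)"
 using TM.t_closed by (simp add: BM_simps)

lemma additive_tM_left: "x \<in> carrier M \<Longrightarrow> (\<lambda>s. tM M s x) \<in> add_hom S (BM M)"
 using TM.additive_t_left[of x] unfolding additive_BM add_hom_def by (simp add: BM_simps)

lemma additive_tM_right: "s \<in> carrier S \<Longrightarrow> (\<lambda>x. tM M s x) \<in> add_hom M (BM M)"
 using TM.additive_t_right[of s] unfolding additive_BM add_hom_def by (simp add: BM_simps)

lemma tM_balanced:
 "\<lbrakk>r \<in> carrier R; s \<in> carrier S; x \<in> carrier M\<rbrakk> \<Longrightarrow> tM M (r \<otimes> s) x = tM M s ((r \<odot>\<^bsub>A\<^esub> \<one>\<^bsub>A\<^esub>) \<odot>\<^bsub>M\<^esub> x)"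
 using TM.t_balanced[of r s x] by simp

lemma BM_smult_pure:
 assumes "s \<in> carrier S" "a \<in> carrier A" "s' \<in> carrier S" "x \<in> carrier M"
 shows "tA s a \<odot>\<^bsub>BM M\<^esub> tM M s' x = tM M (s \<otimes> s') (a \<odot>\<^bsub>M\<^esub> x)"
 unfolding BM_simps
 by (rule tensor_action_pure[OF pair_M pair_A S_hom1 _ M_hom1])
  (use assms S_hom2 M_hom2 in auto)

lemma BM_additive_left: "Q \<in> carrier (BM M) \<Longrightarrow> (\<lambda>P. P \<odot>\<^bsub>BM M\<^esub> Q) \<in> add_hom A' (BM M)"
 unfolding BM_simps additive_A' additive_BM
 by (rule tensor_action_additive_left[OF pair_M pair_A S_hom1 _ M_hom1])
  (use S_hom2 M_hom2 in auto)

lemma BM_additive_right: "P \<in> carrier A' \<Longrightarrow> (\<lambda>Q. P \<odot>\<^bsub>BM M\<^esub> Q) \<in> add_hom (BM M) (BM M)"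
 unfolding BM_simps additive_BM A'_simps
 by (rule tensor_action_additive_right[OF pair_M pair_A S_hom1 _ M_hom1])
  (use S_hom2 M_hom2 in auto)

lemma BM_eqI:
 assumes "abelian_group H" "f \<in> add_hom (BM M) H" "g \<in> add_hom (BM M) H"
  "\<And>s x. \<lbrakk>s \<in> carrier S; x \<in> carrier M\<rbrakk> \<Longrightarrow> f (tM M s x) = g (tM M s x)"
  "z \<in> carrier (BM M)"
 shows "f z = g z"
 by (rule TM.additive_eqI[OF assms(1)]) (use assms(2-5) in \<open>auto simp: additive_BM BM_simps\<close>)

lemma BM_universal:
 assumes H: "abelian_group H"
  and h: "\<And>s x. \<lbrakk>s \<in> carrier S; x \<in> carrier M\<rbrakk> \<Longrightarrow> h s x \<in> carrier H"
   "\<And>x. x \<in> carrier M \<Longrightarrow> (\<lambda>s. h s x) \<in> add_hom S H"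
   "\<And>s. s \<in> carrier S \<Longrightarrow> (\<lambda>x. h s x) \<in> add_hom M H"
   "\<And>r s x. \<lbrakk>r \<in> carrier R; s \<in> carrier S; x \<in> carrier M\<rbrakk> \<Longrightarrow>
     h (r \<otimes> s) x = h s ((r \<odot>\<^bsub>A\<^esub> \<one>\<^bsub>A\<^esub>) \<odot>\<^bsub>M\<^esub> x)"
 obtains g where "g \<in> add_hom (BM M) H"
  "\<And>s x. \<lbrakk>s \<in> carrier S; x \<in> carrier M\<rbrakk> \<Longrightarrow> g (tM M s x) = h s x"
proof -
 obtain g where g: "g \<in> add_hom TM.T H" "\<And>s x. \<lbrakk>s \<in> carrier S_mod; x \<in> carrier (restrict_scalars A M)\<rbrakk> \<Longrightarrow> g (tM M s x) = h s x"
 proof (rule TM.tensor_universal[OF H, of h])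
  fix s s' x assume "s \<in> carrier S_mod" "s' \<in> carrier S_mod" "x \<in> carrier (restrict_scalars A M)"
  then show "h (s \<oplus>\<^bsub>S_mod\<^esub> s') x = h s x \<oplus>\<^bsub>H\<^esub> h s' x" using add_hom_add[OF h(2)] by simp
 next
  fix s x y assume "s \<in> carrier S_mod" "x \<in> carrier (restrict_scalars A M)" "y \<in> carrier (restrict_scalars A M)"
  then show "h s (x \<oplus>\<^bsub>restrict_scalars A M\<^esub> y) = h s x \<oplus>\<^bsub>H\<^esub> h s y" using add_hom_add[OF h(3)] by simp
 qed (use h(1,4) in auto)
 show ?thesis by (rule that[of g]) (use g in \<open>auto simp: additive_BM\<close>)
qed

lemma BM_tensor_module: "tensor_module (BM M)"
 unfolding tensor_module_def
proof (intro conjI ballI)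
 fix s a z assume s: "s \<in> carrier S" and a: "a \<in> carrier A" and z: "z \<in> carrier (BM M)"
 show "tA s a \<odot>\<^bsub>BM M\<^esub> z = inS s \<odot>\<^bsub>BM M\<^esub> (inA a \<odot>\<^bsub>BM M\<^esub> z)"
 proof (rule BM_eqI[OF BM_abelian _ _ _ z, of "\<lambda>z. tA s a \<odot>\<^bsub>BM M\<^esub> z"
    "\<lambda>z. inS s \<odot>\<^bsub>BM M\<^esub> (inA a \<odot>\<^bsub>BM M\<^esub> z)"])
  show "(\<lambda>z. tA s a \<odot>\<^bsub>BM M\<^esub> z) \<in> add_hom (BM M) (BM M)"
   by (rule BM_additive_right[OF tA_closed[OF s a]])
  show "(\<lambda>z. inS s \<odot>\<^bsub>BM M\<^esub> (inA a \<odot>\<^bsub>BM M\<^esub> z)) \<in> add_hom (BM M) (BM M)"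
   by (rule add_hom_comp[OF BM_additive_right[OF tA_closed[OF S.one_closed a]]
      BM_additive_right[OF tA_closed[OF s A.one_closed]]])
  fix s' x assume "s' \<in> carrier S" "x \<in> carrier M"
  then show "tA s a \<odot>\<^bsub>BM M\<^esub> tM M s' x = inS s \<odot>\<^bsub>BM M\<^esub> (inA a \<odot>\<^bsub>BM M\<^esub> tM M s' x)"
   using s a by (simp add: BM_smult_pure M.smult_closed M.smult_one)
 qed
qed (auto intro: BM_abelian BM_additive_left)

end

text \<open>Automorphisms of the ring \<open>S\<close> over \<open>R\<close>; the linearity in the
  name is that of the \<open>R\<close>-module \<open>S_mod\<close>.\<close>

definition S_linear_auto :: "('s \<Rightarrow> 's) \<Rightarrow> bool" where
 "S_linear_auto h \<longleftrightarrow> h \<in> ring_hom S S \<and> bij_betw h (carrier S) (carrier S) \<and> (\<forall>r\<in>carrier R. h r = r)"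

lemma S_linear_auto_hom: "S_linear_auto h \<Longrightarrow> h \<in> left_module_hom R S_mod S_mod"
 by (auto simp: S_linear_auto_def left_module_hom_def ring_hom_closed ring_hom_add ring_hom_mult subset)

lemma S_linear_auto_inv: "S_linear_auto h \<Longrightarrow> S_linear_auto (inv_into (carrier S) h)"
proof -
 assume h: "S_linear_auto h"
 have hh: "h \<in> ring_iso S S" using h by (simp add: S_linear_auto_def ring_iso_def)
 have "inv_into (carrier S) h \<in> ring_iso S S" by (rule ring_iso_set_sym[OF S.ring_axioms hh])
 moreover have "inv_into (carrier S) h r = r" if "r \<in> carrier R" for r
  using h that subset[OF that] bij_betw_inv_into_left[of h "carrier S" "carrier S" r]
  by (simp add: S_linear_auto_def)
 ultimately show ?thesis by (simp add: S_linear_auto_def ring_iso_def)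
qed

lemma id_hom: "(\<lambda>x. x) \<in> left_module_hom L M M"
 by (simp add: left_module_hom_def)

lemma twist_smult_pure:
 assumes "S_linear_auto h" "s \<in> carrier S" "a \<in> carrier A"
 shows "tA s a \<odot>\<^bsub>galois_twist R S A h U\<^esub> x = tA (inv_into (carrier S) h s) a \<odot>\<^bsub>U\<^esub> x"
 using tensor_map_pure[OF pair_A pair_A S_linear_auto_hom[OF S_linear_auto_inv[OF assms(1)]] id_hom, of s a] assms
 by (simp add: galois_twist_smult)

text \<open>The inverse of \<open>h\<close> fixes \<open>\<one>\<close>, so the twist leaves the
  action of \<open>inA a\<close> untouched and only replaces \<open>inS s\<close>.\<close>

lemma twist_tensor_module:
 assumes h: "S_linear_auto h" and U: "tensor_module U"
 shows "tensor_module (galois_twist R S A h U)"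
proof -
 let ?V = "galois_twist R S A h U"
 have V: "abelian_group ?V" by (rule abelian_group_transfer[OF tensor_moduleD(1)[OF U]]) auto
 have adV: "add_hom L ?V = add_hom L U" for L by (rule add_hom_transfer) auto
 have i1: "inv_into (carrier S) h \<one> = \<one>"
  using S_linear_auto_inv[OF h] ring_hom_one by (auto simp: S_linear_auto_def)
 have ic: "inv_into (carrier S) h s \<in> carrier S" if "s \<in> carrier S" for s
  using S_linear_auto_inv[OF h] ring_hom_closed that by (fastforce simp: S_linear_auto_def)
 show ?thesis
  unfolding tensor_module_def
 proof (intro conjI ballI V)
  fix x assume "x \<in> carrier ?V"
  then have x: "x \<in> carrier U" by simp
  have "tensor_map R S_mod A (inv_into (carrier S) h) (\<lambda>a. a) \<in> add_hom A' A'"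
   using tensor_map_additive[OF pair_A pair_A S_linear_auto_hom[OF S_linear_auto_inv[OF h]] id_hom]
   unfolding additive_A' .
  from add_hom_comp[OF this tensor_moduleD(2)[OF U x]]
  show "(\<lambda>P. P \<odot>\<^bsub>?V\<^esub> x) \<in> add_hom A' ?V" unfolding adV galois_twist_smult by simp
 next
  fix s a x assume *: "s \<in> carrier S" "a \<in> carrier A" "x \<in> carrier ?V"
  then show "tA s a \<odot>\<^bsub>?V\<^esub> x = inS s \<odot>\<^bsub>?V\<^esub> (inA a \<odot>\<^bsub>?V\<^esub> x)"
   using tensor_moduleD(3)[OF U ic[OF *(1)] *(2), of x]
   by (simp only: twist_smult_pure[OF h] A.one_closed S.one_closed i1 galois_twist_simps)
 qed
qed

context
 fixes M :: "('a, 'm) module" and L :: "('a, 'n) module"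
 assumes M: "left_module A M" and L: "left_module A L"
begin

lemma restrict_hom: "d \<in> left_module_hom A M L \<Longrightarrow> d \<in> left_module_hom R (restrict_scalars A M) (restrict_scalars A L)"
 by (auto simp: left_module_hom_def)

lemma base_change_map:
 assumes "h \<in> left_module_hom R S_mod S_mod" "d \<in> left_module_hom A M L"
 shows "tensor_map R S_mod (restrict_scalars A L) h d \<in> add_hom (BM M) (BM L)"
  and "\<lbrakk>s \<in> carrier S; x \<in> carrier M\<rbrakk> \<Longrightarrow>
   tensor_map R S_mod (restrict_scalars A L) h d (tM M s x) = tM L (h s) (d x)"
proof -
 show "tensor_map R S_mod (restrict_scalars A L) h d \<in> add_hom (BM M) (BM L)"
  using tensor_map_additive[OF pair_M[OF L] pair_M[OF M] assms(1) restrict_hom[OF assms(2)]]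
  by (simp add: additive_BM[OF M] additive_BM[OF L])
 show "tensor_map R S_mod (restrict_scalars A L) h d (tM M s x) = tM L (h s) (d x)"
  if "s \<in> carrier S" "x \<in> carrier M"
  using tensor_map_pure[OF pair_M[OF L] pair_M[OF M] assms(1) restrict_hom[OF assms(2)], of s x] that by simp
qed

end

lemma base_change_map_smult:
 assumes h: "S_linear_auto h" and M: "left_module A M"
  and s: "s \<in> carrier S" and a: "a \<in> carrier A" and z: "z \<in> carrier (BM M)"
 defines "w \<equiv> tensor_map R S_mod (restrict_scalars A M) h (\<lambda>x. x)"
 shows "w (tA s a \<odot>\<^bsub>BM M\<^esub> z) = tA (h s) a \<odot>\<^bsub>BM M\<^esub> w z"
proof (rule BM_eqI[OF M BM_abelian[OF M] _ _ _ z])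
 have hh: "h \<in> ring_hom S S" using h by (simp add: S_linear_auto_def)
 note hc = ring_hom_closed[OF hh]
 note w = base_change_map[OF M M S_linear_auto_hom[OF h] id_hom, folded w_def]
 show "(\<lambda>z. w (tA s a \<odot>\<^bsub>BM M\<^esub> z)) \<in> add_hom (BM M) (BM M)"
  by (rule add_hom_comp[OF BM_additive_right[OF M tA_closed[OF s a]] w(1)])
 show "(\<lambda>z. tA (h s) a \<odot>\<^bsub>BM M\<^esub> w z) \<in> add_hom (BM M) (BM M)"
  by (rule add_hom_comp[OF w(1) BM_additive_right[OF M tA_closed[OF hc[OF s] a]]])
 fix s' x assume "s' \<in> carrier S" "x \<in> carrier M"
 then show "w (tA s a \<odot>\<^bsub>BM M\<^esub> tM M s' x) = tA (h s) a \<odot>\<^bsub>BM M\<^esub> w (tM M s' x)"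
  using s a hc by (simp add: BM_smult_pure[OF M] w(2) left_module.smult_closed[OF M] ring_hom_mult[OF hh])
qed

text \<open>\<open>h \<otimes> 1\<close> is \<open>h\<close>-semilinear on the base change, and the
  twist acts through the inverse of \<open>h\<close>, so \<open>h \<otimes> 1\<close> becomes linear
  on the twisted module. The same construction for the inverse of \<open>h\<close> inverts
  it.\<close>

lemma base_change_twist_iso:
 assumes h: "S_linear_auto h" and M: "left_module A M"
 defines "w \<equiv> tensor_map R S_mod (restrict_scalars A M) h (\<lambda>x. x)"
 shows "w \<in> left_module_hom A' (galois_twist R S A h (BM M)) (BM M)"
  and "bij_betw w (carrier (BM M)) (carrier (BM M))"
proof -
 let ?i = "inv_into (carrier S) h"
 let ?w' = "tensor_map R S_mod (restrict_scalars A M) ?i (\<lambda>x. x)"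
 let ?V = "galois_twist R S A h (BM M)"
 note hi = S_linear_auto_inv[OF h]
 have hc: "h s \<in> carrier S" and ic: "?i s \<in> carrier S" if "s \<in> carrier S" for s
  using h hi that by (auto simp: S_linear_auto_def ring_hom_closed)
 have h_i: "h (?i s) = s" "?i (h s) = s" if "s \<in> carrier S" for s
  using h that by (auto simp: S_linear_auto_def bij_betw_inv_into_left bij_betw_inv_into_right)
 note wa = base_change_map(1)[OF M M S_linear_auto_hom[OF h] id_hom, folded w_def]
 note wp = base_change_map(2)[OF M M S_linear_auto_hom[OF h] id_hom, folded w_def]
 note wa' = base_change_map(1)[OF M M S_linear_auto_hom[OF hi] id_hom]
 note wp' = base_change_map(2)[OF M M S_linear_auto_hom[OF hi] id_hom]
 note ab = BM_abelian[OF M]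
 have "w (?w' z) = z \<and> ?w' (w z) = z" if z: "z \<in> carrier (BM M)" for z
  using BM_eqI[OF M ab add_hom_comp[OF wa' wa] add_hom_id _ z]
   BM_eqI[OF M ab add_hom_comp[OF wa wa'] add_hom_id _ z]
  by (simp add: wp wp' hc ic h_i)
 then show "bij_betw w (carrier (BM M)) (carrier (BM M))"
  by (intro bij_betw_byWitness[where f' = ?w'])
   (auto intro: add_hom_closed[OF wa] add_hom_closed[OF wa'])
 have V: "add_hom ?V L = add_hom (BM M) L" for L :: "(('s \<times> 'm \<Rightarrow>\<^sub>0 int) set) ring"
  by (rule add_hom_transfer) auto
 show "w \<in> left_module_hom A' ?V (BM M)"
 proof (rule tensor_module_homI[OF twist_tensor_module[OF h BM_tensor_module[OF M]] BM_tensor_module[OF M]])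
  show "w \<in> add_hom ?V (BM M)" using wa by (simp add: add_hom_def)
  have w_act: "w (tA (?i s) a \<odot>\<^bsub>BM M\<^esub> z) = tA s a \<odot>\<^bsub>BM M\<^esub> w z"
   if s: "s \<in> carrier S" and a: "a \<in> carrier A" and z: "z \<in> carrier (BM M)" for s a z
   using base_change_map_smult[OF h M ic[OF s] a z] by (simp add: h_i(1)[OF s] w_def)
  show "w (inS s \<odot>\<^bsub>?V\<^esub> z) = inS s \<odot>\<^bsub>BM M\<^esub> w z"
   if "s \<in> carrier S" "z \<in> carrier ?V" for s z
   using w_act[OF that(1) A.one_closed, of z] that
   by (simp only: twist_smult_pure[OF h that(1) A.one_closed] galois_twist_simps)
  show "w (inA a \<odot>\<^bsub>?V\<^esub> z) = inA a \<odot>\<^bsub>BM M\<^esub> w z"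
   if "a \<in> carrier A" "z \<in> carrier ?V" for a z
   using w_act[OF S.one_closed that(1), of z] that
   by (simp only: twist_smult_pure[OF h S.one_closed that(1)] galois_twist_simps)
 qed
qed

text \<open>\<open>h \<otimes> 1\<close> and the differential \<open>1 \<otimes> d\<close> act on
  different tensor factors and commute.\<close>

lemma base_change_twist_complex_iso:
 assumes h: "S_linear_auto h" and D: "is_chain_complex A D"
 shows "complex_isomorphic A' (galois_twist_complex R S A h (base_change_complex R S A D)) (base_change_complex R S A D)"
proof -
 have M: "left_module A (chain_obj D n)" and d: "chain_diff D n \<in> left_module_hom A (chain_obj D n) (chain_obj D (n - 1))" for n
  using D by (auto simp: is_chain_complex_def)
 let ?w = "\<lambda>n. tensor_map R S_mod (restrict_scalars A (chain_obj D n)) h (\<lambda>x. x)"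
 note hh = S_linear_auto_hom[OF h]
 have "?w (n - 1) (chain_diff (base_change_complex R S A D) n z) = chain_diff (base_change_complex R S A D) n (?w n z)"
  if z: "z \<in> carrier (BM (chain_obj D n))" for n z
 proof -
  note di = base_change_map[OF M M id_hom d[of n]]
  note w0 = base_change_map[OF M[of n] M[of n] hh id_hom] and w1 = base_change_map[OF M[of "n - 1"] M[of "n - 1"] hh id_hom]
  show ?thesis
   unfolding base_change_complex_def chain_complex.simps
  proof (rule BM_eqI[OF M BM_abelian[OF M] _ _ _ z])
   show "(\<lambda>z. ?w (n - 1) (tensor_map R S_mod (restrict_scalars A (chain_obj D (n - 1))) (\<lambda>s. s) (chain_diff D n) z))
     \<in> add_hom (BM (chain_obj D n)) (BM (chain_obj D (n - 1)))"
    by (rule add_hom_comp[OF di(1) w1(1)])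
   show "(\<lambda>z. tensor_map R S_mod (restrict_scalars A (chain_obj D (n - 1))) (\<lambda>s. s) (chain_diff D n) (?w n z))
     \<in> add_hom (BM (chain_obj D n)) (BM (chain_obj D (n - 1)))"
    by (rule add_hom_comp[OF w0(1) di(1)])
  qed (simp add: di(2) w0(2) w1(2) left_module_hom_closed[OF d] left_module_hom_closed[OF hh, simplified])
 qed
 then show ?thesis
  unfolding complex_isomorphic_def
  using base_change_twist_iso[OF h M]
  by (intro exI[of _ ?w]) (auto simp: galois_twist_complex_def base_change_complex_def)
qed

end

section \<open>Absolutely unramified discrete valuation rings\<close>

lemma (in abelian_group) acong_diff_iff:
 assumes "x \<in> carrier G" "y \<in> carrier G"
 shows "acong G N (x \<ominus> y) \<zero> \<longleftrightarrow> acong G N x y"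
proof
 assume "acong G N (x \<ominus> y) \<zero>"
 from acong_add[OF this acong_refl[OF assms(2)]] show "acong G N x y"
  using assms by (simp add: minus_eq a_assoc l_neg)
next
 assume "acong G N x y"
 from acong_add[OF this acong_refl[of "\<ominus> y"]] show "acong G N (x \<ominus> y) \<zero>"
  using assms by (simp add: minus_eq r_neg)
qed

lemma (in cring) mem_PIdl_add_pow_iff:
 "x \<in> PIdl (add_pow R (N :: nat) \<one>) \<longleftrightarrow> acong R N x \<zero>"
proof
 assume "x \<in> PIdl (add_pow R N \<one>)"
 then obtain y where "y \<in> carrier R" "x = y \<otimes> add_pow R N \<one>" by (auto simp: cgenideal_def)
 then have "x = add_pow R N y" using add_pow_rdistr[of y \<one> N] by simp
 then show "acong R N x \<zero>" using acong_add_pow \<open>y \<in> carrier R\<close> by simp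
next
 assume "acong R N x \<zero>"
 then obtain y where "y \<in> carrier R" "x = add_pow R N y" by (rule acong_zeroE)
 then show "x \<in> PIdl (add_pow R N \<one>)"
  using add_pow_rdistr[of y \<one> N] by (force simp: cgenideal_def)
qed

lemma (in cring) mem_ideal_power_iff:
 assumes "\<And>x. x \<in> I \<longleftrightarrow> acong R p x \<zero>"
 shows "x \<in> ideal_power R I n \<longleftrightarrow> acong R (p ^ n) x \<zero>"
proof (induction n arbitrary: x)
 case 0
 show ?case using acong_one[of x \<zero>] acong_carrier(1)[of 1 x \<zero>] by auto
next
 case (Suc n)
 show ?case
 proof
  assume "x \<in> ideal_power R I (Suc n)"
  then have "x \<in> ideal_prod R I (ideal_power R I n)" by simp
  then show "acong R (p ^ Suc n) x \<zero>"
  proof (induction rule: ideal_prod.induct)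
   case (prod i j)
   obtain y where y: "y \<in> carrier R" "i = add_pow R p y" using prod assms acong_zeroE by metis
   obtain z where z: "z \<in> carrier R" "j = add_pow R (p ^ n) z" using prod Suc acong_zeroE by metis
   have "i \<otimes> j = add_pow R (p ^ Suc n) (y \<otimes> z)"
    using y z by (simp add: add_pow_ldistr add_pow_rdistr add.nat_pow_pow mult.commute)
   then show ?case using acong_add_pow y z by simp
  next
   case (sum s1 s2)
   then show ?case using acong_add[of "p ^ Suc n" s1 \<zero> s2 \<zero>] by simp
  qed
 next
  assume "acong R (p ^ Suc n) x \<zero>"
  then obtain y where y: "y \<in> carrier R" "x = add_pow R (p ^ Suc n) y" by (rule acong_zeroE)
  have "add_pow R p \<one> \<in> I" using assms acong_add_pow by simp
  moreover have "add_pow R (p ^ n) y \<in> ideal_power R I n" using Suc acong_add_pow y by simp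
  ultimately have "add_pow R p \<one> \<otimes> add_pow R (p ^ n) y \<in> ideal_prod R I (ideal_power R I n)"
   by (rule ideal_prod.prod)
  moreover have "add_pow R p \<one> \<otimes> add_pow R (p ^ n) y = x"
   using y by (simp add: add_pow_ldistr add.nat_pow_pow mult.commute)
  ultimately show "x \<in> ideal_power R I (Suc n)" by simp
 qed
qed

text \<open>The unique maximal ideal is the Jacobson radical, which is \<open>p R\<close> by
  hypothesis. Membership in its \<open>n\<close>-th power is congruence to zero modulo
  \<open>p ^ n\<close>, so adic completeness translates into congruences.\<close>

lemma unramified_dvr_padic_ring:
 fixes R :: "('a, 'c) ring_scheme"
 assumes dvr: "complete_discrete_valuation_ring R" and p: "Factorial_Ring.prime p"
  and fin: "finite (carrier (residue_field R))" and unram: "absolutely_unramified p R"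
 shows "padic_ring R p" "jacobson_radical R = padic_ring.residue_ideal R p"
proof -
 interpret complete_discrete_valuation_ring R by (rule dvr)
 define J where "J = jacobson_radical R"
 have J_iff: "x \<in> J \<longleftrightarrow> acong R p x \<zero>\<^bsub>R\<^esub>" for x
  using unram mem_PIdl_add_pow_iff[of x p] by (simp add: J_def absolutely_unramified_def)
 obtain M where M: "maximalideal M R" "\<And>M'. maximalideal M' R \<Longrightarrow> M' = M"
  using unique_maximalideal by auto
 interpret M: maximalideal M R by (rule M)
 have JM: "J = M"
 proof (intro equalityI subsetI)
  show "x \<in> M" if "x \<in> J" for x
   using that M(1) unfolding J_def jacobson_radical_def by blast
  show "x \<in> J" if x: "x \<in> M" for x
   unfolding J_def jacobson_radical_def
  proof (intro IntI InterI)
   show "x \<in> carrier R" by (rule M.Icarr[OF x])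
   show "x \<in> M'" if "M' \<in> {M. maximalideal M R}" for M'
    using x M(2)[of M'] that by blast
  qed
 qed
 have pow_iff: "x \<in> ideal_power R J n \<longleftrightarrow> acong R (p ^ n) x \<zero>\<^bsub>R\<^esub>" for x n
  by (rule mem_ideal_power_iff[OF J_iff])
 have ac: "adically_complete R J" using complete by (simp add: J_def)
 show "padic_ring R p"
 proof (intro padic_ring.intro padic_group.intro padic_group_axioms.intro padic_ring_axioms.intro)
  show "domain R" "abelian_group R" "Factorial_Ring.prime p"
   by (simp_all add: p domain_axioms abelian_group_axioms)
  show "x = \<zero>\<^bsub>R\<^esub>" if "x \<in> carrier R" "\<And>k. acong R (p ^ k) x \<zero>\<^bsub>R\<^esub>" for x
  proof -
   have "x \<in> (\<Inter>n. ideal_power R J n)" using that(2) pow_iff by auto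
   also have "\<dots> = {\<zero>\<^bsub>R\<^esub>}" using ac unfolding adically_complete_def by (rule conjunct1)
   finally show ?thesis by simp
  qed
  show "\<exists>l. \<forall>n. acong R (p ^ n) l (f n)" if f: "\<And>n. acong R (p ^ n) (f (Suc n)) (f n)" for f
  proof -
   have fc: "f n \<in> carrier R" for n using f[of n] by (rule acong_carrier)
   have fi: "acong R (p ^ n) (f (n + i)) (f n)" for n i
   proof (induction i)
    case (Suc i)
    have "acong R (p ^ n) (f (Suc (n + i))) (f (n + i))" by (rule acong_le_power[OF f]) simp
    from acong_trans[OF this Suc] show ?case by simp
   qed (simp add: acong_refl fc)
   have fN: "acong R (p ^ n) (f i) (f n)" if "i \<ge> n" for i n
    using fi[of n "i - n"] that by simp
   have "\<exists>l\<in>carrier R. \<forall>n. \<exists>N. \<forall>i\<ge>N. f i \<ominus>\<^bsub>R\<^esub> l \<in> ideal_power R J n"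
   proof (rule conjunct2[OF ac[unfolded adically_complete_def], rule_format])
    show "(\<forall>i. f i \<in> carrier R) \<and> (\<forall>n. \<exists>N. \<forall>i\<ge>N. \<forall>j\<ge>N. f i \<ominus>\<^bsub>R\<^esub> f j \<in> ideal_power R J n)"
    proof (intro conjI allI exI impI)
     show "f i \<ominus>\<^bsub>R\<^esub> f j \<in> ideal_power R J n" if "i \<ge> n" "j \<ge> n" for i j n
      unfolding pow_iff acong_diff_iff[OF fc fc] by (rule acong_join[OF fN[OF that(1)] fN[OF that(2)]])
    qed (rule fc)
   qed
   then obtain l where l: "l \<in> carrier R" "\<And>n. \<exists>N. \<forall>i\<ge>N. f i \<ominus>\<^bsub>R\<^esub> l \<in> ideal_power R J n" by blast
   \<comment> \<open>Adic convergence comes without a rate. Comparing \<open>l\<close> and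
     \<open>f n\<close> with one sufficiently late term restores the rate
     \<open>p ^ n\<close>.\<close>
   have "acong R (p ^ n) l (f n)" for n
   proof -
    obtain N where N: "\<forall>i\<ge>N. acong R (p ^ n) (f i) l"
     using l(2)[of n] unfolding pow_iff acong_diff_iff[OF fc l(1)] by blast
    have 1: "acong R (p ^ n) (f (max N n)) l" using N by simp
    have 2: "acong R (p ^ n) (f (max N n)) (f n)" by (rule fN) simp
    show ?thesis by (rule acong_trans[OF acong_sym[OF 1] 2])
   qed
   then show ?thesis by blast
  qed
  show "\<exists>W. finite W \<and> W \<subseteq> carrier R \<and> (\<forall>x\<in>carrier R. \<exists>y\<in>W. acong R p x y)"
  proof -
   have car: "carrier (residue_field R) = (\<lambda>x. J +>\<^bsub>R\<^esub> x) ` carrier R"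
    by (auto simp: residue_field_def FactRing_def A_RCOSETS_def' J_def)
   then obtain W where W: "W \<subseteq> carrier R" "finite W" "carrier (residue_field R) = (\<lambda>x. J +>\<^bsub>R\<^esub> x) ` W"
    using finite_subset_image[OF fin, of "\<lambda>x. J +>\<^bsub>R\<^esub> x" "carrier R"] by auto
   have "\<exists>y\<in>W. acong R p x y" if x: "x \<in> carrier R" for x
   proof -
    have "J +>\<^bsub>R\<^esub> x \<in> (\<lambda>x. J +>\<^bsub>R\<^esub> x) ` W" unfolding W(3)[symmetric] car using x by (rule imageI)
    then obtain y where y: "y \<in> W" "J +>\<^bsub>R\<^esub> x = J +>\<^bsub>R\<^esub> y" by blast
    then have "x \<ominus>\<^bsub>R\<^esub> y \<in> J"
     using quotient_eq_iff_same_a_r_cos[OF M.ideal_axioms x, of y] W(1) JM by blast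
    then show ?thesis using y W(1) x J_iff acong_diff_iff by blast
   qed
   then show ?thesis using W by blast
  qed
  \<comment> \<open>If \<open>p\<close> were zero, the maximal ideal \<open>p R\<close> would be
    zero and \<open>R\<close> a field.\<close>
  show "add_pow R p \<one>\<^bsub>R\<^esub> \<noteq> \<zero>\<^bsub>R\<^esub>"
  proof
   assume P0: "add_pow R p \<one>\<^bsub>R\<^esub> = \<zero>\<^bsub>R\<^esub>"
   have "J = PIdl\<^bsub>R\<^esub> \<zero>\<^bsub>R\<^esub>" using unram P0 by (simp add: J_def absolutely_unramified_def)
   also have "\<dots> = {\<zero>\<^bsub>R\<^esub>}" by (auto simp: cgenideal_def intro!: exI[of _ "\<zero>\<^bsub>R\<^esub>"])
   finally show False using zeromaximalideal_fieldI M(1) JM not_field by simp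
  qed
  show "\<not> acong R p \<one>\<^bsub>R\<^esub> \<zero>\<^bsub>R\<^esub>"
   using J_iff JM M.one_imp_carrier M.I_notcarr by blast
  \<comment> \<open>A nonzero nonunit has an irreducible divisor, which in a principal domain
    generates a maximal ideal, hence the unique one, \<open>p R\<close>.\<close>
  show "x \<in> Units R \<or> acong R p x \<zero>\<^bsub>R\<^esub>" if x: "x \<in> carrier R" for x
  proof (cases "x = \<zero>\<^bsub>R\<^esub> \<or> x \<in> Units R")
   case True
   then show ?thesis using acong_refl[of "\<zero>\<^bsub>R\<^esub>"] by auto
  next
   case False
   then obtain b where b: "b \<in> carrier R" "ring_irreducible\<^bsub>R\<^esub> b" "b divides\<^bsub>R\<^esub> x"
    using exists_irreducible_divisor[of x] x by blast
   have "PIdl\<^bsub>R\<^esub> b = M" by (rule M(2)[OF irreducible_imp_maximalideal[OF b(1,2)]])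
   moreover have "x \<in> PIdl\<^bsub>R\<^esub> b" using b m_comm by (auto simp: cgenideal_def factor_def)
   ultimately show ?thesis using JM J_iff by blast
  qed
 qed
 then show "jacobson_radical R = padic_ring.residue_ideal R p"
  using J_iff by (auto simp: padic_ring.residue_ideal_def J_def)
qed

section \<open>Lifting residue field automorphisms\<close>

context padic_extension
begin

context
 assumes radical: "jacobson_radical S = S.residue_ideal"
begin

lemma residue_field_S: "residue_field S = S.residues" "jacobson_radical S +> x = S.residue x"
 by (simp_all add: residue_field_def radical S.residue_def)

text \<open>Representatives of the values of \<open>\<sigma>\<close> form a
  \<open>residue_endo\<close>, to which \<open>lift_exists\<close> applies.\<close>

lemma residue_galois_lift:
 assumes "\<sigma> \<in> residue_galois_group R S"
 obtains h where "h \<in> ring_hom S S" "\<And>r. r \<in> carrier R \<Longrightarrow> h r = r"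
  "\<And>x. x \<in> carrier S \<Longrightarrow> \<sigma> (S.residue x) = S.residue (h x)"
proof -
 have iso: "\<sigma> \<in> ring_iso S.residues S.residues"
  and fix_R: "\<And>r. r \<in> carrier R \<Longrightarrow> \<sigma> (S.residue r) = S.residue r"
  using assms by (auto simp: residue_galois_group_def residue_field_S)
 have hom: "\<sigma> \<in> ring_hom S.residues S.residues" using iso by (simp add: ring_iso_def)
 have "\<exists>y\<in>carrier S. \<sigma> (S.residue x) = S.residue y" if "x \<in> carrier S" for x
 proof -
  have "\<sigma> (S.residue x) \<in> carrier S.residues"
   by (rule ring_hom_closed[OF hom]) (use that S.carrier_residues in auto)
  then show ?thesis by (auto simp: S.carrier_residues)
 qed
 then obtain s where s: "\<And>x. x \<in> carrier S \<Longrightarrow> s x \<in> carrier S \<and> \<sigma> (S.residue x) = S.residue (s x)" by metis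
 have res: "S.residue x \<in> carrier S.residues" if "x \<in> carrier S" for x using that S.carrier_residues by auto
 have endo: "residue_endo s"
  unfolding residue_endo_def
 proof (intro conjI ballI allI impI)
  show "s \<in> carrier S \<rightarrow> carrier S" using s by auto
 next
  fix x y assume x: "x \<in> carrier S" and y: "y \<in> carrier S"
  have "S.residue (s (x \<oplus> y)) = S.residue (s x \<oplus> s y)"
   using s x y res ring_hom_add[OF S.residue_hom] ring_hom_add[OF hom] by (metis S.add.m_closed)
  then show "acong S p (s (x \<oplus> y)) (s x \<oplus> s y)" using s x y by (simp add: S.residue_eq_iff)
  have "S.residue (s (x \<otimes> y)) = S.residue (s x \<otimes> s y)"
   using s x y res ring_hom_mult[OF S.residue_hom] ring_hom_mult[OF hom] by (metis S.m_closed)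
  then show "acong S p (s (x \<otimes> y)) (s x \<otimes> s y)" using s x y by (simp add: S.residue_eq_iff)
 next
  fix r assume r: "r \<in> carrier R"
  then have "S.residue (s r) = S.residue r" using s[OF subset[OF r]] fix_R[OF r] by simp
  then show "acong S p (s r) r" using s[OF subset[OF r]] subset[OF r] by (simp add: S.residue_eq_iff)
 next
  fix x y assume c: "acong S p x y"
  have xy: "x \<in> carrier S" "y \<in> carrier S" using S.acong_carrier[OF c] by auto
  then have "S.residue x = S.residue y" using c by (simp add: S.residue_eq_iff)
  then have "S.residue (s x) = S.residue (s y)" using s xy by metis
  then show "acong S p (s x) (s y)" using s xy by (simp add: S.residue_eq_iff)
 qed
 obtain h where h: "h \<in> ring_hom S S" "\<And>r. r \<in> carrier R \<Longrightarrow> h r = r"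
  "\<And>x. x \<in> carrier S \<Longrightarrow> acong S p (h x) (s x)"
  by (rule lift_exists[OF endo]; rule that; assumption)
 show ?thesis
 proof (rule that[OF h(1,2)])
  fix x assume x: "x \<in> carrier S"
  have "S.residue (h x) = S.residue (s x)"
   using h(3)[OF x] S.residue_eq_iff[of "h x" "s x"] s[OF x] ring_hom_closed[OF h(1) x] by blast
  then show "\<sigma> (S.residue x) = S.residue (h x)" using s[OF x] by simp
 qed
qed

text \<open>The definite description in \<open>residue_lift\<close> is resolved by uniqueness of
  lifts, \<open>ring_hom_eqI_residue\<close>; the restriction accounts for its
  extensionality.\<close>

lemma residue_lift_eqI:
 assumes h: "h \<in> ring_hom S S" and c: "\<And>x. x \<in> carrier S \<Longrightarrow> \<sigma> (S.residue x) = S.residue (h x)"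
 shows "residue_lift S \<sigma> = restrict h (carrier S)"
 unfolding residue_lift_def residue_field_S
proof (rule the_equality)
 have "restrict h (carrier S) \<in> ring_hom S S"
  using ring_hom_closed[OF h] ring_hom_mult[OF h] ring_hom_add[OF h] ring_hom_one[OF h]
  by (intro ring_hom_memI) auto
 then show "restrict h (carrier S) \<in> ring_hom S S \<and> restrict h (carrier S) \<in> extensional (carrier S) \<and>
   (\<forall>x\<in>carrier S. \<sigma> (S.residue x) = S.residue (restrict h (carrier S) x))"
  using c by auto
next
 fix \<tau> assume t: "\<tau> \<in> ring_hom S S \<and> \<tau> \<in> extensional (carrier S) \<and>
   (\<forall>x\<in>carrier S. \<sigma> (S.residue x) = S.residue (\<tau> x))"
 show "\<tau> = restrict h (carrier S)"
 proof (rule extensionalityI[of _ "carrier S"])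
  fix x assume x: "x \<in> carrier S"
  have "\<tau> x = h x"
  proof (rule ring_hom_eqI_residue[OF S.padic_ring_axioms S.padic_ring_axioms conjunct1[OF t] h _ x])
   fix y assume y: "y \<in> carrier S"
   have "S.residue (\<tau> y) = S.residue (h y)" using t c[OF y] y by simp
   then show "acong S p (\<tau> y) (h y)"
    using S.residue_eq_iff[of "\<tau> y" "h y"] ring_hom_closed[OF h y] ring_hom_closed[OF conjunct1[OF t] y] by blast
  qed
  then show "\<tau> x = restrict h (carrier S) x" using x by simp
 qed (use t in auto)
qed

text \<open>A lift of the inverse of \<open>\<sigma>\<close> composes with a lift of
  \<open>\<sigma>\<close>, on either side, to a lift of the identity, hence to the identity.\<close>

lemma residue_lift_automorphism:
 assumes "\<sigma> \<in> residue_galois_group R S"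
 shows "residue_lift S \<sigma> \<in> ring_hom S S" "bij_betw (residue_lift S \<sigma>) (carrier S) (carrier S)"
  "\<And>r. r \<in> carrier R \<Longrightarrow> residue_lift S \<sigma> r = r"
proof -
 let ?i = "inv_into (carrier S.residues) \<sigma>"
 have iso: "\<sigma> \<in> ring_iso S.residues S.residues"
  and fix_R: "\<And>r. r \<in> carrier R \<Longrightarrow> \<sigma> (S.residue r) = S.residue r"
  using assms by (auto simp: residue_galois_group_def residue_field_S)
 have bij: "bij_betw \<sigma> (carrier S.residues) (carrier S.residues)" using iso by (simp add: ring_iso_def)
 have res: "S.residue x \<in> carrier S.residues" if "x \<in> carrier S" for x using that S.carrier_residues by auto
 interpret k: field S.residues by (rule S.residue_field_field)
 have i_fix: "?i (S.residue r) = S.residue r" if "r \<in> carrier R" for r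
  using bij_betw_inv_into_left[OF bij res[OF subset[OF that]]] fix_R[OF that] by simp
 have i_gal: "?i \<in> residue_galois_group R S"
  unfolding residue_galois_group_def residue_field_S
  using ring_iso_set_sym[OF k.ring_axioms iso] i_fix by simp
 obtain h where h: "h \<in> ring_hom S S" "\<And>r. r \<in> carrier R \<Longrightarrow> h r = r"
  "\<And>x. x \<in> carrier S \<Longrightarrow> \<sigma> (S.residue x) = S.residue (h x)"
  by (rule residue_galois_lift[OF assms]; rule that; assumption)
 obtain h' where h': "h' \<in> ring_hom S S" "\<And>r. r \<in> carrier R \<Longrightarrow> h' r = r"
  "\<And>x. x \<in> carrier S \<Longrightarrow> ?i (S.residue x) = S.residue (h' x)"
  by (rule residue_galois_lift[OF i_gal]; rule that; assumption)
 note hc = ring_hom_closed[OF h(1)] and hc' = ring_hom_closed[OF h'(1)]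
 have inv: "f (g x) = x"
  if fg: "f \<in> ring_hom S S" "g \<in> ring_hom S S" and x: "x \<in> carrier S"
   and eq: "\<And>y. y \<in> carrier S \<Longrightarrow> S.residue (f (g y)) = S.residue y" for f g x
 proof -
  have "(f \<circ> g) x = id x"
  proof (rule ring_hom_eqI_residue[OF S.padic_ring_axioms S.padic_ring_axioms ring_hom_trans[OF fg(2,1)] id_ring_hom _ x])
   fix y assume y: "y \<in> carrier S"
   show "acong S p ((f \<circ> g) y) (id y)"
    using eq[OF y] S.residue_eq_iff[of "f (g y)" y] ring_hom_closed[OF fg(1)] ring_hom_closed[OF fg(2)] y by simp
  qed
  then show ?thesis by simp
 qed
 have inv1: "h (h' x) = x" if "x \<in> carrier S" for x
  by (rule inv[OF h(1) h'(1) that])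
   (metis h(3) h'(3) hc' bij_betw_inv_into_right[OF bij res])
 have inv2: "h' (h x) = x" if "x \<in> carrier S" for x
  by (rule inv[OF h'(1) h(1) that])
   (metis h(3) h'(3) hc bij_betw_inv_into_left[OF bij res])
 have eq: "residue_lift S \<sigma> = restrict h (carrier S)" by (rule residue_lift_eqI[OF h(1,3)])
 show "residue_lift S \<sigma> \<in> ring_hom S S" unfolding eq
  using hc ring_hom_mult[OF h(1)] ring_hom_add[OF h(1)] ring_hom_one[OF h(1)] by (intro ring_hom_memI) auto
 show "residue_lift S \<sigma> r = r" if "r \<in> carrier R" for r using that subset[OF that] h(2) eq by simp
 have "bij_betw h (carrier S) (carrier S)"
  by (rule bij_betw_byWitness[where f' = h']) (use inv1 inv2 hc hc' in auto)
 then show "bij_betw (residue_lift S \<sigma>) (carrier S) (carrier S)" using bij_betw_cong eq by force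
qed

text \<open>This recognises the lifted Frobenius as the lift of a Galois element, so that Galois
  stability can be applied to it. The induced residue map is onto because
  \<open>h ^^ (m - 1)\<close> is a right inverse of \<open>h\<close>, and then bijective by
  finiteness.\<close>

lemma residue_galois_of_automorphism:
 assumes h: "h \<in> ring_hom S S" "\<And>r. r \<in> carrier R \<Longrightarrow> h r = r"
  and m: "m > 0" "\<And>x. x \<in> carrier S \<Longrightarrow> (h ^^ m) x = x"
 obtains \<sigma> where "\<sigma> \<in> residue_galois_group R S" "residue_lift S \<sigma> = restrict h (carrier S)"
proof -
 define \<sigma> where "\<sigma> c = S.residue (h (SOME x. x \<in> carrier S \<and> S.residue x = c))" for c
 note hc = ring_hom_closed[OF h(1)]
 note ha = ring_hom_add_hom[OF h(1)]
 have cong: "acong S p (h x) (h y)" if "acong S p x y" for x y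
  by (rule S.acong_add_hom[OF that S.abelian_group_axioms ha])
 have \<sigma>: "\<sigma> (S.residue x) = S.residue (h x)" if x: "x \<in> carrier S" for x
 proof -
  let ?y = "SOME y. y \<in> carrier S \<and> S.residue y = S.residue x"
  have y: "?y \<in> carrier S \<and> S.residue ?y = S.residue x" by (rule someI[of _ x]) (use x in auto)
  then have "acong S p ?y x" using S.residue_eq_iff x by blast
  then have "acong S p (h ?y) (h x)" by (rule cong)
  then show ?thesis unfolding \<sigma>_def using S.residue_eq_iff[of "h ?y" "h x"] hc x y by blast
 qed
 have res: "S.residue x \<in> carrier S.residues" if "x \<in> carrier S" for x using that S.carrier_residues by auto
 have surj: "\<sigma> ` carrier S.residues = carrier S.residues"
 proof
  show "\<sigma> ` carrier S.residues \<subseteq> carrier S.residues"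
   using \<sigma> hc by (auto simp: S.carrier_residues)
  show "carrier S.residues \<subseteq> \<sigma> ` carrier S.residues"
  proof
   fix c assume "c \<in> carrier S.residues"
   then obtain x where x: "x \<in> carrier S" "c = S.residue x" by (auto simp: S.carrier_residues)
   define y where "y = (h ^^ (m - 1)) x"
   have y: "y \<in> carrier S" unfolding y_def by (rule ring_hom_closed[OF ring_hom_funpow[OF h(1)] x(1)])
   have "h y = (h ^^ m) x" using m(1) by (cases m) (auto simp: y_def)
   then have "\<sigma> (S.residue y) = c" using \<sigma>[OF y] x m(2) by simp
   then show "c \<in> \<sigma> ` carrier S.residues" using res[OF y] by blast
  qed
 qed
 have bij: "bij_betw \<sigma> (carrier S.residues) (carrier S.residues)"
  using eq_card_imp_inj_on[OF S.finite_residues, of \<sigma>] surj by (simp add: bij_betw_def)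
 have "\<sigma> \<in> ring_iso S.residues S.residues"
 proof (rule ring_iso_memI)
  fix c c' assume "c \<in> carrier S.residues" "c' \<in> carrier S.residues"
  then obtain x y where xy: "x \<in> carrier S" "c = S.residue x" "y \<in> carrier S" "c' = S.residue y"
   by (auto simp: S.carrier_residues)
  show "\<sigma> c \<in> carrier S.residues" using xy \<sigma> hc res by simp
  have e: "c \<otimes>\<^bsub>S.residues\<^esub> c' = S.residue (x \<otimes> y)" "c \<oplus>\<^bsub>S.residues\<^esub> c' = S.residue (x \<oplus> y)"
   using xy by (simp_all add: ring_hom_mult[OF S.residue_hom] ring_hom_add[OF S.residue_hom])
  show "\<sigma> (c \<otimes>\<^bsub>S.residues\<^esub> c') = \<sigma> c \<otimes>\<^bsub>S.residues\<^esub> \<sigma> c'"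
   "\<sigma> (c \<oplus>\<^bsub>S.residues\<^esub> c') = \<sigma> c \<oplus>\<^bsub>S.residues\<^esub> \<sigma> c'"
   unfolding e using \<sigma>[of "x \<otimes> y"] \<sigma>[of "x \<oplus> y"] \<sigma>[of x] \<sigma>[of y] xy hc[of x] hc[of y]
    ring_hom_mult[OF S.residue_hom, of "h x" "h y"] ring_hom_add[OF S.residue_hom, of "h x" "h y"]
    ring_hom_mult[OF h(1), of x y] ring_hom_add[OF h(1), of x y]
   by simp_all
 next
  show "\<sigma> \<one>\<^bsub>S.residues\<^esub> = \<one>\<^bsub>S.residues\<^esub>"
   using \<sigma>[of "\<one>"] ring_hom_one[OF S.residue_hom] ring_hom_one[OF h(1)] by simp
 qed (rule bij)
 then have "\<sigma> \<in> residue_galois_group R S"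
  using \<sigma> h(2) subset by (simp add: residue_galois_group_def residue_field_S)
 moreover have "residue_lift S \<sigma> = restrict h (carrier S)" by (rule residue_lift_eqI[OF h(1) \<sigma>])
 ultimately show ?thesis by (rule that)
qed

end

end

section \<open>Change of scalars and products of modules\<close>

definition change_scalars :: "('l \<Rightarrow> 'r) \<Rightarrow> ('r, 'm) module \<Rightarrow> ('l, 'm) module" where
 "change_scalars \<iota> U = \<lparr>carrier = carrier U, monoid.mult = monoid.mult U, monoid.one = monoid.one U,
   ring.zero = ring.zero U, ring.add = ring.add U, smult = (\<lambda>r x. \<iota> r \<odot>\<^bsub>U\<^esub> x)\<rparr>"

lemma change_scalars_simps [simp]:
 "carrier (change_scalars \<iota> U) = carrier U" "ring.add (change_scalars \<iota> U) = ring.add U"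
 "ring.zero (change_scalars \<iota> U) = ring.zero U"
 "smult (change_scalars \<iota> U) = (\<lambda>r x. \<iota> r \<odot>\<^bsub>U\<^esub> x)"
 by (simp_all add: change_scalars_def)

lemma left_module_change_scalars:
 assumes "ring L" "\<iota> \<in> ring_hom L Q" "left_module Q U"
 shows "left_module L (change_scalars \<iota> U)"
proof (rule left_module.intro[OF assms(1)])
 interpret U: left_module Q U by fact
 show "abelian_group (change_scalars \<iota> U)" by (rule abelian_group_transfer[OF U.abelian_group_axioms]) auto
 show "left_module_axioms L (change_scalars \<iota> U)"
  by (rule left_module_axioms.intro)
   (use ring_hom_closed[OF assms(2)] ring_hom_add[OF assms(2)] ring_hom_mult[OF assms(2)] ring_hom_one[OF assms(2)]
    in \<open>auto simp: U.smult_closed U.smult_l_distr U.smult_r_distr U.smult_assoc U.smult_one\<close>)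
qed

lemma left_module_regular: "ring Q \<Longrightarrow> left_module Q (regular_algebra Q)"
proof -
 assume "ring Q"
 then interpret ring Q .
 show ?thesis
  by (rule left_module.intro[OF ring_axioms abelian_group_regular_algebra[OF abelian_group_axioms]],
    rule left_module_axioms.intro) (auto simp: l_distr r_distr m_assoc)
qed

text \<open>The products of the generators \<open>e y\<close> of \<open>Q\<close> over
  \<open>L\<close> with generators of \<open>U\<close> over \<open>Q\<close> generate
  \<open>U\<close> over \<open>L\<close>.\<close>

lemma finitely_generated_change_scalars:
 assumes L: "ring L" and \<iota>: "\<iota> \<in> ring_hom L Q" and U: "left_module Q U"
  and fg: "finitely_generated_module Q U"
  and Y: "finite Y" "e \<in> Y \<rightarrow> carrier Q"
  and span: "\<And>q. q \<in> carrier Q \<Longrightarrow> q \<in> left_module.span_family L (change_scalars \<iota> (regular_algebra Q)) Y e"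
 shows "finitely_generated_module L (change_scalars \<iota> U)"
proof -
 interpret U: left_module Q U by (rule U)
 let ?V = "change_scalars \<iota> U" and ?W = "change_scalars \<iota> (regular_algebra Q)"
 interpret V: left_module L ?V by (rule left_module_change_scalars[OF L \<iota> U])
 interpret W: left_module L ?W
  by (rule left_module_change_scalars[OF L \<iota> left_module_regular[OF U.R.ring_axioms]])
 note \<iota>c = ring_hom_closed[OF \<iota>]
 obtain T where T: "finite T" "T \<subseteq> carrier U"
  "\<And>x. x \<in> carrier U \<Longrightarrow> \<exists>c\<in>T \<rightarrow> carrier Q. x = lincomb U T (\<lambda>t. t) c"
  by (rule U.finitely_generatedE[OF fg]; rule that; assumption)
 define g where "g = (\<lambda>(y, t). e y \<odot>\<^bsub>U\<^esub> t)"
 have g: "g \<in> Y \<times> T \<rightarrow> carrier ?V" using Y T(2) by (auto simp: g_def intro!: U.smult_closed)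
 have qt: "q \<odot>\<^bsub>U\<^esub> t \<in> V.span_family (Y \<times> T) g" if q: "q \<in> carrier Q" and t: "t \<in> T" for q t
 proof -
  obtain c where c: "c \<in> Y \<rightarrow> carrier L" "q = lincomb ?W Y e c"
   using span[OF q] unfolding W.span_family_def by blast
  have tU: "t \<in> carrier U" using t T(2) by blast
  have add: "(\<lambda>q. q \<odot>\<^bsub>U\<^esub> t) \<in> add_hom ?W ?V"
   by (rule add_homI) (auto simp: tU U.smult_closed U.smult_l_distr)
  have "q \<odot>\<^bsub>U\<^esub> t = (\<Oplus>\<^bsub>?V\<^esub>y\<in>Y. (c y \<odot>\<^bsub>?W\<^esub> e y) \<odot>\<^bsub>U\<^esub> t)"
   unfolding c(2) lincomb_def
   by (rule add_hom_finsum[OF W.M.abelian_group_axioms V.M.abelian_group_axioms add])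
    (use Y(2) c(1) \<iota>c in \<open>auto intro!: U.R.m_closed\<close>)
  also have "\<dots> \<in> V.span_family (Y \<times> T) g"
  proof (rule V.span_family_finsum[OF g])
   fix y assume y: "y \<in> Y"
   have "c y \<odot>\<^bsub>?V\<^esub> g (y, t) \<in> V.span_family (Y \<times> T) g"
    by (rule V.span_family_gen[OF _ g]) (use Y(1) T(1) y t c(1) in auto)
   moreover have "c y \<odot>\<^bsub>?V\<^esub> g (y, t) = (c y \<odot>\<^bsub>?W\<^esub> e y) \<odot>\<^bsub>U\<^esub> t"
    using U.smult_assoc[OF \<iota>c[OF funcset_mem[OF c(1) y]] funcset_mem[OF Y(2) y] tU] by (simp add: g_def)
   ultimately show "(c y \<odot>\<^bsub>?W\<^esub> e y) \<odot>\<^bsub>U\<^esub> t \<in> V.span_family (Y \<times> T) g" by simp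
  qed
  finally show ?thesis .
 qed
 show ?thesis
 proof (rule V.finitely_generated_spanI[OF _ g])
  show "finite (Y \<times> T)" using Y(1) T(1) by simp
  fix x assume "x \<in> carrier ?V"
  then obtain c where c: "c \<in> T \<rightarrow> carrier Q" "x = lincomb U T (\<lambda>t. t) c" using T(3)[of x] by auto
  have "x = (\<Oplus>\<^bsub>?V\<^esub>t\<in>T. c t \<odot>\<^bsub>U\<^esub> t)"
   unfolding c(2) lincomb_def
   by (rule add_hom_finsum[OF U.M.abelian_group_axioms V.M.abelian_group_axioms, where f = "\<lambda>x. x"])
    (use c(1) T(2) in \<open>auto simp: add_hom_def intro!: U.smult_closed\<close>)
  also have "\<dots> \<in> V.span_family (Y \<times> T) g"
   by (rule V.span_family_finsum[OF g], rule qt) (use c(1) in auto)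
  finally show "x \<in> V.span_family (Y \<times> T) g" .
 qed
qed

text \<open>The full product over all indices, so that no range of nonzero degrees enters the type
  or the operators; for a bounded complex it is also the direct sum.\<close>

definition product_module :: "('i \<Rightarrow> ('s, 'm) module) \<Rightarrow> ('s, 'i \<Rightarrow> 'm) module" where
 "product_module M = \<lparr>carrier = {x. \<forall>n. x n \<in> carrier (M n)}, monoid.mult = undefined, monoid.one = undefined,
   ring.zero = (\<lambda>n. \<zero>\<^bsub>M n\<^esub>), ring.add = (\<lambda>x y n. x n \<oplus>\<^bsub>M n\<^esub> y n), smult = (\<lambda>s x n. s \<odot>\<^bsub>M n\<^esub> x n)\<rparr>"

lemma product_module_simps [simp]:
 "carrier (product_module M) = {x. \<forall>n. x n \<in> carrier (M n)}"
 "ring.zero (product_module M) = (\<lambda>n. \<zero>\<^bsub>M n\<^esub>)"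
 "ring.add (product_module M) = (\<lambda>x y n. x n \<oplus>\<^bsub>M n\<^esub> y n)"
 "smult (product_module M) = (\<lambda>s x n. s \<odot>\<^bsub>M n\<^esub> x n)"
 by (simp_all add: product_module_def)

context
 fixes S :: "('s, 'c) ring_scheme" and M :: "'i \<Rightarrow> ('s, 'm) module"
 assumes S: "ring S" and M: "\<And>n. left_module S (M n)"
begin

lemma product_left_module: "left_module S (product_module M)"
proof (rule left_module.intro[OF S])
 interpret M: left_module S "M n" for n by (rule M)
 show "abelian_group (product_module M)"
 proof (rule abelian_groupI)
  show "\<exists>y\<in>carrier (product_module M). y \<oplus>\<^bsub>product_module M\<^esub> x = \<zero>\<^bsub>product_module M\<^esub>"
   if "x \<in> carrier (product_module M)" for x
   using that by (intro bexI[of _ "\<lambda>n. \<ominus>\<^bsub>M n\<^esub> x n"]) (auto simp: M.M.l_neg)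
 qed (auto simp: M.M.a_ac)
 show "left_module_axioms S (product_module M)"
  by (rule left_module_axioms.intro)
   (auto simp: M.smult_closed M.smult_l_distr M.smult_r_distr M.smult_assoc M.smult_one)
qed

lemma acong_product_iff:
 "acong (product_module M) k x y \<longleftrightarrow> (\<forall>n. acong (M n) k (x n) (y n))"
proof
 interpret M: left_module S "M n" for n by (rule M)
 interpret P: left_module S "product_module M" by (rule product_left_module)
 have proj: "(\<lambda>x. x n) \<in> add_hom (product_module M) (M n)" for n by (rule add_homI) auto
 show "acong (product_module M) k x y \<Longrightarrow> \<forall>n. acong (M n) k (x n) (y n)"
  using P.M.acong_add_hom[OF _ M.M.abelian_group_axioms proj] by blast
 assume c: "\<forall>n. acong (M n) k (x n) (y n)"
 then obtain z where z: "\<And>n. z n \<in> carrier (M n) \<and> x n = y n \<oplus>\<^bsub>M n\<^esub> add_pow (M n) k (z n)"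
  unfolding acong_def by metis
 then have zP: "z \<in> carrier (product_module M)" by simp
 have "add_pow (product_module M) k z = (\<lambda>n. add_pow (M n) k (z n))"
  by (rule ext) (rule add_hom_add_pow[OF P.M.abelian_group_axioms M.M.abelian_group_axioms proj zP])
 then have "x = y \<oplus>\<^bsub>product_module M\<^esub> add_pow (product_module M) k z" using z by auto
 then show "acong (product_module M) k x y" using c zP unfolding acong_def by auto
qed

lemma product_padic_group:
 assumes p: "\<And>n. padic_group (M n) p" and N: "finite N" "\<And>n. n \<notin> N \<Longrightarrow> carrier (M n) = {\<zero>\<^bsub>M n\<^esub>}"
 shows "padic_group (product_module M) p"
proof (rule padic_group.intro)
 interpret M: padic_group "M n" p for n by (rule p)
 interpret P: left_module S "product_module M" by (rule product_left_module)
 show "abelian_group (product_module M)" by (rule P.M.abelian_group_axioms)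
 show "padic_group_axioms (product_module M) p"
 proof (rule padic_group_axioms.intro)
  show "x = \<zero>\<^bsub>product_module M\<^esub>"
   if "x \<in> carrier (product_module M)" "\<And>k. acong (product_module M) (p ^ k) x \<zero>\<^bsub>product_module M\<^esub>" for x
  proof
   fix n show "x n = \<zero>\<^bsub>product_module M\<^esub> n"
    using M.separated[of "x n" n] that unfolding acong_product_iff by simp
  qed
  show "\<exists>l. \<forall>n. acong (product_module M) (p ^ n) l (f n)"
   if "\<And>n. acong (product_module M) (p ^ n) (f (Suc n)) (f n)" for f
  proof -
   have "\<exists>l. \<forall>k. acong (M n) (p ^ k) l (f k n)" for n
    using M.complete[of n "\<lambda>k. f k n"] that unfolding acong_product_iff by blast
   then obtain l where "\<And>n k. acong (M n) (p ^ k) (l n) (f k n)" by metis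
   then show ?thesis unfolding acong_product_iff by blast
  qed
  have "\<forall>n. \<exists>W. finite W \<and> W \<subseteq> carrier (M n) \<and> (\<forall>x\<in>carrier (M n). \<exists>y\<in>W. acong (M n) p x y)"
   using M.finite_residue by blast
  then obtain W where W: "\<And>n. finite (W n)" "\<And>n. W n \<subseteq> carrier (M n)"
   "\<And>n x. x \<in> carrier (M n) \<Longrightarrow> \<exists>y\<in>W n. acong (M n) p x y" by metis
  let ?W = "{x. \<forall>n. x n \<in> W n}"
  have sub: "?W \<subseteq> carrier (product_module M)" using W(2) by auto
  \<comment> \<open>Outside \<open>N\<close> the modules are zero, so a family of representatives is
    determined by finitely many components; this makes the residue set finite.\<close>
  have "inj_on (\<lambda>x. restrict x N) ?W"
  proof (rule inj_onI)
   fix x y assume xy: "x \<in> ?W" "y \<in> ?W" "restrict x N = restrict y N"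
   show "x = y"
   proof
    fix n
    show "x n = y n"
    proof (cases "n \<in> N")
     case True
     then show ?thesis using fun_cong[OF xy(3), of n] by simp
    next
     case False
     have "x n \<in> carrier (M n)" "y n \<in> carrier (M n)" using sub xy(1,2) by auto
     then show ?thesis using N(2)[OF False] by simp
    qed
   qed
  qed
  moreover have "(\<lambda>x. restrict x N) ` ?W \<subseteq> PiE N W" by auto
  moreover have "finite (PiE N W)" by (rule finite_PiE[OF N(1) W(1)])
  ultimately have "finite ?W" by (rule inj_on_finite)
  moreover have "\<exists>y\<in>?W. acong (product_module M) p x y" if "x \<in> carrier (product_module M)" for x
  proof -
   have "\<forall>n. \<exists>y\<in>W n. acong (M n) p (x n) y" using that W(3) by auto
   then obtain y where "\<And>n. y n \<in> W n" "\<And>n. acong (M n) p (x n) (y n)" by metis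
   then show ?thesis unfolding acong_product_iff by blast
  qed
  ultimately show "\<exists>W. finite W \<and> W \<subseteq> carrier (product_module M) \<and>
    (\<forall>x\<in>carrier (product_module M). \<exists>y\<in>W. acong (product_module M) p x y)"
   using sub by blast
 qed
qed

end

section \<open>Modules over the base change algebra\<close>

context base_change
begin

interpretation TA: tensor_pair R S_mod A by (rule pair_A)

abbreviation over_S :: "(('s \<times> 'a \<Rightarrow>\<^sub>0 int) set, 'm) module \<Rightarrow> ('s, 'm) module" where
 "over_S \<equiv> change_scalars (\<lambda>s. inS s)"
abbreviation over_A :: "(('s \<times> 'a \<Rightarrow>\<^sub>0 int) set, 'm) module \<Rightarrow> ('a, 'm) module" where
 "over_A \<equiv> change_scalars (\<lambda>a. inA a)"

lemma hom_S_A': "(\<lambda>s. inS s) \<in> ring_hom S A'"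
 by (rule ring_hom_memI)
  (simp_all add: tA_closed tA_mult add_hom_add[OF additive_tA_left] A'_simps(4))

lemma hom_A_A': "(\<lambda>a. inA a) \<in> ring_hom A A'"
 by (rule ring_hom_memI)
  (simp_all add: tA_closed tA_mult add_hom_add[OF additive_tA_right] A'_simps(4))

lemma tA_commute:
 assumes U: "left_module A' U" and s: "s \<in> carrier S" and a: "a \<in> carrier A" and x: "x \<in> carrier U"
 shows "inA a \<odot>\<^bsub>U\<^esub> (inS s \<odot>\<^bsub>U\<^esub> x) = inS s \<odot>\<^bsub>U\<^esub> (inA a \<odot>\<^bsub>U\<^esub> x)"
proof -
 interpret U: left_module A' U by (rule U)
 show ?thesis using s a x by (simp add: tA_closed tA_mult flip: U.smult_assoc)
qed

lemma A'_span:
 assumes W: "left_module L (change_scalars \<iota> (regular_algebra A'))" and g: "g \<in> I \<rightarrow> carrier A'"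
  and pure: "\<And>s a. \<lbrakk>s \<in> carrier S; a \<in> carrier A\<rbrakk> \<Longrightarrow>
   tA s a \<in> left_module.span_family L (change_scalars \<iota> (regular_algebra A')) I g"
  and q: "q \<in> carrier A'"
 shows "q \<in> left_module.span_family L (change_scalars \<iota> (regular_algebra A')) I g"
proof -
 let ?W = "change_scalars \<iota> (regular_algebra A')"
 interpret W: left_module L ?W by (rule W)
 have g': "g \<in> I \<rightarrow> carrier ?W" using g by simp
 have same: "carrier ?W = carrier TA.T" "ring.add ?W = ring.add TA.T" "ring.zero ?W = ring.zero TA.T"
  by (simp_all add: A'_simps)
 interpret T: abelian_group TA.T by (rule TA.abelian_group_T)
 have sub: "W.span_family I g \<subseteq> carrier ?W"
  unfolding W.span_family_def using W.lincomb_closed[OF g'] by auto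
 have "q \<in> carrier TA.T" using q by (simp add: A'_simps)
 then show ?thesis
 proof (rule TA.tensor_induct)
  show "\<zero>\<^bsub>TA.T\<^esub> \<in> W.span_family I g" using W.span_family_zero[OF g'] unfolding same .
  fix z w assume zw: "z \<in> carrier TA.T" "w \<in> carrier TA.T" "z \<in> W.span_family I g" "w \<in> W.span_family I g"
  have "\<ominus>\<^bsub>?W\<^esub> w = \<ominus>\<^bsub>TA.T\<^esub> w"
   using add_hom_minus[OF TA.abelian_group_T W.M.abelian_group_axioms, of "\<lambda>x. x" w] zw(2)
   by (simp add: add_hom_def A'_simps)
  then show "z \<oplus>\<^bsub>TA.T\<^esub> \<ominus>\<^bsub>TA.T\<^esub> w \<in> W.span_family I g"
   using W.span_family_add[OF g' zw(3) W.span_family_minus[OF g' zw(4)]] unfolding same by simp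
 qed (use pure in auto)
qed

context
 fixes U :: "(('s \<times> 'a \<Rightarrow>\<^sub>0 int) set, 'm) module"
 assumes U: "left_module A' U" and fg: "finitely_generated_module A' U"
begin

interpretation U: left_module A' U by (rule U)

text \<open>\<open>A'\<close> is generated over \<open>S\<close> by \<open>inA y\<close> for
  generators \<open>y\<close> of \<open>A\<close> over \<open>R\<close>. Finite generation over
  \<open>S\<close> is what makes the terms of the complex compact.\<close>

lemma finitely_generated_over_S:
 assumes fgA: "finitely_generated_module R A"
 shows "finitely_generated_module S (over_S U)"
proof -
 let ?W = "over_S (regular_algebra A')"
 have W: "left_module S ?W"
  by (rule left_module_change_scalars[OF S.ring_axioms hom_S_A' left_module_regular[OF U.R.ring_axioms]])
 interpret W: left_module S ?W by (rule W)
 interpret lA: left_module R A by (rule A_left_module)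
 obtain Y where Y: "finite Y" "Y \<subseteq> carrier A" "\<And>x. x \<in> carrier A \<Longrightarrow> \<exists>c\<in>Y \<rightarrow> carrier R. x = lincomb A Y (\<lambda>t. t) c"
  by (rule lA.finitely_generatedE[OF fgA]; rule that; assumption)
 have g: "(\<lambda>y. inA y) \<in> Y \<rightarrow> carrier A'" using Y(2) by (auto intro!: tA_closed)
 then have g': "(\<lambda>y. inA y) \<in> Y \<rightarrow> carrier ?W" by simp
 show ?thesis
 proof (rule finitely_generated_change_scalars[OF S.ring_axioms hom_S_A' U fg Y(1) g A'_span[OF W g]])
  fix s a assume s: "s \<in> carrier S" and a: "a \<in> carrier A"
  obtain c where c: "c \<in> Y \<rightarrow> carrier R" "a = lincomb A Y (\<lambda>t. t) c" using Y(3)[OF a] by blast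
  have "tA s a = (\<Oplus>\<^bsub>?W\<^esub>y\<in>Y. tA s (c y \<odot>\<^bsub>A\<^esub> y))"
   unfolding c(2) lincomb_def
   by (rule add_hom_finsum[OF A.abelian_group_axioms W.M.abelian_group_axioms])
    (use additive_tA_right[OF s] c(1) Y(2) in \<open>auto simp: add_hom_def\<close>)
  also have "\<dots> \<in> W.span_family Y (\<lambda>y. inA y)"
  proof (rule W.span_family_finsum[OF g'])
   fix y assume y: "y \<in> Y"
   have y': "y \<in> carrier A" "c y \<in> carrier R" using y Y(2) c(1) by auto
   have "(c y \<otimes> s) \<odot>\<^bsub>?W\<^esub> inA y \<in> W.span_family Y (\<lambda>y. inA y)"
    by (rule W.span_family_gen[OF Y(1) g' y]) (use subset[OF y'(2)] s in simp)
   then show "tA s (c y \<odot>\<^bsub>A\<^esub> y) \<in> W.span_family Y (\<lambda>y. inA y)"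
    using y' s subset[OF y'(2)] by (simp add: tA_mult tA_balanced A.smult_mult_left)
  qed
  finally show "tA s a \<in> W.span_family Y (\<lambda>y. inA y)" .
 qed
qed

text \<open>\<open>A'\<close> is generated over \<open>A\<close> by \<open>inS b\<close> for a basis
  of \<open>S\<close> over \<open>R\<close>. Finite generation of the descended module rests on
  this, since that module is an \<open>A\<close>-linear image of \<open>U\<close>.\<close>

lemma finitely_generated_over_A: "finitely_generated_module A (over_A U)"
proof -
 let ?W = "over_A (regular_algebra A')"
 have W: "left_module A ?W"
  by (rule left_module_change_scalars[OF A.ring_axioms hom_A_A' left_module_regular[OF U.R.ring_axioms]])
 interpret W: left_module A ?W by (rule W)
 obtain B where B: "finite B" "B \<subseteq> carrier S" "\<And>x. x \<in> carrier S \<Longrightarrow> \<exists>c\<in>B \<rightarrow> carrier R. x = lin B c"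
  by (rule S_basis; rule that; assumption)
 have g: "(\<lambda>b. inS b) \<in> B \<rightarrow> carrier A'" using B(2) by (auto intro!: tA_closed)
 then have g': "(\<lambda>b. inS b) \<in> B \<rightarrow> carrier ?W" by simp
 show ?thesis
 proof (rule finitely_generated_change_scalars[OF A.ring_axioms hom_A_A' U fg B(1) g A'_span[OF W g]])
  fix s a assume s: "s \<in> carrier S" and a: "a \<in> carrier A"
  obtain c where c: "c \<in> B \<rightarrow> carrier R" "s = lin B c" using B(3)[OF s] by blast
  have "tA s a = (\<Oplus>\<^bsub>?W\<^esub>b\<in>B. tA (c b \<odot>\<^bsub>S_mod\<^esub> b) a)"
   unfolding c(2) lincomb_def
   by (rule add_hom_finsum[OF left_module.axioms(2)[OF S_module] W.M.abelian_group_axioms])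
    (use additive_tA_left[OF a] c(1) B(2) subset in \<open>auto simp: add_hom_def intro!: S.m_closed\<close>)
  also have "\<dots> \<in> W.span_family B (\<lambda>b. inS b)"
  proof (rule W.span_family_finsum[OF g'])
   fix b assume b: "b \<in> B"
   have b': "b \<in> carrier S" "c b \<in> carrier R" using b B(2) c(1) by auto
   have "(c b \<odot>\<^bsub>A\<^esub> a) \<odot>\<^bsub>?W\<^esub> inS b \<in> W.span_family B (\<lambda>b. inS b)"
    by (rule W.span_family_gen[OF B(1) g' b]) (use b' a in simp)
   then show "tA (c b \<odot>\<^bsub>S_mod\<^esub> b) a \<in> W.span_family B (\<lambda>b. inS b)"
    using b' a by (simp add: tA_mult tA_balanced)
  qed
  finally show "tA s a \<in> W.span_family B (\<lambda>b. inS b)" .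
 qed
qed

lemma left_module_over_S: "left_module S (over_S U)"
 by (rule left_module_change_scalars[OF S.ring_axioms hom_S_A' U])

lemma padic_group_over_S:
 assumes "finitely_generated_module R A"
 shows "padic_group (over_S U) p"
proof -
 interpret V: left_module S "over_S U" by (rule left_module_over_S)
 have "module S (over_S U)"
  by (rule moduleI[OF S.is_cring V.M.abelian_group_axioms])
   (auto simp: V.smult_closed V.smult_l_distr V.smult_r_distr V.smult_assoc V.smult_one simp del: change_scalars_simps)
 then interpret padic_module S p "over_S U"
  by (intro padic_module.intro S.padic_ring_axioms padic_module_axioms.intro finitely_generated_over_S assms)
 show ?thesis by (rule padic_group_module)
qed

end

end

section \<open>The total module of a complex\<close>

locale bounded_base_change_complex = base_change R S p A
 for R :: "'s ring" and S :: "'s ring" (structure) and p and A :: "('s, 'a) module" +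
 fixes C :: "(('s \<times> 'a \<Rightarrow>\<^sub>0 int) set, 'm) chain_complex"
 assumes fg_A: "finitely_generated_module R A"
  and complex: "is_bounded_fg_complex A' C"
begin

abbreviation "Cn \<equiv> chain_obj C"
abbreviation "d \<equiv> chain_diff C"
abbreviation Tot :: "('s, int \<Rightarrow> 'm) module" where "Tot \<equiv> product_module (\<lambda>n. over_S (Cn n))"
abbreviation act_S where "act_S n s x \<equiv> inS s \<odot>\<^bsub>Cn n\<^esub> x"
abbreviation act_A where "act_A n a x \<equiv> inA a \<odot>\<^bsub>Cn n\<^esub> x"

lemma Cn_module: "left_module A' (Cn n)"
 and Cn_fg: "finitely_generated_module A' (Cn n)"
 and d_hom: "d n \<in> left_module_hom A' (Cn n) (Cn (n - 1))"
 using complex by (auto simp: is_bounded_fg_complex_def is_chain_complex_def)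

lemma Cn_abelian: "abelian_group (Cn n)"
 by (rule left_module.axioms(2)[OF Cn_module])

interpretation Cn: left_module A' "Cn n" for n by (rule Cn_module)

lemma act_A_closed: "\<lbrakk>a \<in> carrier A; x \<in> carrier (Cn n)\<rbrakk> \<Longrightarrow> act_A n a x \<in> carrier (Cn n)"
 by (rule Cn.smult_closed[OF tA_closed]) auto

lemma d_additive: "d n \<in> add_hom (Cn n) (Cn (n - 1))"
 by (rule left_module_hom_additive[OF d_hom])

lemma d_closed: "x \<in> carrier (Cn n) \<Longrightarrow> d n x \<in> carrier (Cn (n - 1))"
 by (rule left_module_hom_closed[OF d_hom])

lemma d_act_S: "\<lbrakk>s \<in> carrier S; x \<in> carrier (Cn n)\<rbrakk> \<Longrightarrow> d n (act_S n s x) = act_S (n - 1) s (d n x)"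
 by (rule left_module_hom_smult[OF d_hom tA_closed]) auto

lemma d_act_A: "\<lbrakk>a \<in> carrier A; x \<in> carrier (Cn n)\<rbrakk> \<Longrightarrow> d n (act_A n a x) = act_A (n - 1) a (d n x)"
 by (rule left_module_hom_smult[OF d_hom tA_closed]) auto

lemma d_zero: "d n \<zero>\<^bsub>Cn n\<^esub> = \<zero>\<^bsub>Cn (n - 1)\<^esub>"
 by (rule add_hom_zero[OF Cn_abelian Cn_abelian d_additive])

definition single :: "int \<Rightarrow> 'm \<Rightarrow> int \<Rightarrow> 'm" where
 "single n y = (\<lambda>k. if k = n then y else \<zero>\<^bsub>Cn k\<^esub>)"

text \<open>
 Commuting with the projections, the differential and the action of \<open>A\<close> characterises the
 endomorphisms of the total module that come from chain maps.
\<close>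

definition total_operators :: "((int \<Rightarrow> 'm) \<Rightarrow> (int \<Rightarrow> 'm)) set" where
 "total_operators = {\<lambda>x n. d (n + 1) (x (n + 1))} \<union> range (\<lambda>n x. single n (x n)) \<union>
   (\<lambda>a x n. act_A n a (x n)) ` carrier A"

lemma Tot_padic: "padic_group Tot p"
proof -
 have "bounded_complex C" using complex by (simp add: is_bounded_fg_complex_def)
 then obtain u v where uv: "\<And>n. n < u \<or> v < n \<Longrightarrow> carrier (Cn n) = {\<zero>\<^bsub>Cn n\<^esub>}"
  unfolding bounded_complex_def by blast
 show ?thesis
 proof (rule product_padic_group[OF S.ring_axioms, where N = "{u..v}"])
  show "left_module S (over_S (Cn n))" for n by (rule left_module_over_S[OF Cn_module Cn_fg])
  show "padic_group (over_S (Cn n)) p" for n by (rule padic_group_over_S[OF Cn_module Cn_fg fg_A])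
  show "carrier (over_S (Cn n)) = {\<zero>\<^bsub>over_S (Cn n)\<^esub>}" if "n \<notin> {u..v}" for n
   using uv[of n] that by force
 qed simp
qed

lemma Tot_left_module: "left_module S Tot"
 by (rule product_left_module[OF S.ring_axioms left_module_over_S[OF Cn_module Cn_fg]])

lemma single_closed: "y \<in> carrier (Cn n) \<Longrightarrow> single n y \<in> carrier Tot"
 by (auto simp: single_def)

lemma single_add: "\<lbrakk>x \<in> carrier (Cn n); y \<in> carrier (Cn n)\<rbrakk> \<Longrightarrow>
  single n (x \<oplus>\<^bsub>Cn n\<^esub> y) = single n x \<oplus>\<^bsub>Tot\<^esub> single n y"
 by (auto simp: single_def)

lemma single_smult: "s \<in> carrier S \<Longrightarrow> single n (act_S n s y) = s \<odot>\<^bsub>Tot\<^esub> single n y"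
 using Cn.smult_zero_right[OF tA_closed[OF _ A.one_closed]] by (auto simp: single_def)

lemma Tot_operators: "w \<in> total_operators \<Longrightarrow> w \<in> left_module_hom S Tot Tot"
proof -
 assume w: "w \<in> total_operators"
 have "(\<lambda>x n. d (n + 1) (x (n + 1))) \<in> left_module_hom S Tot Tot"
 proof (rule left_module_homI, rule add_homI)
  show "(\<lambda>n. d (n + 1) (x (n + 1))) \<in> carrier Tot" if "x \<in> carrier Tot" for x
   using that d_closed[of "x (n + 1)" "n + 1" for n] by simp
  show "(\<lambda>n. d (n + 1) ((x \<oplus>\<^bsub>Tot\<^esub> y) (n + 1))) = (\<lambda>n. d (n + 1) (x (n + 1))) \<oplus>\<^bsub>Tot\<^esub> (\<lambda>n. d (n + 1) (y (n + 1)))"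
   if "x \<in> carrier Tot" "y \<in> carrier Tot" for x y
   using that add_hom_add[OF d_additive, of "x (n + 1)" "n + 1" "y (n + 1)" for n] by simp
  show "(\<lambda>n. d (n + 1) ((s \<odot>\<^bsub>Tot\<^esub> x) (n + 1))) = s \<odot>\<^bsub>Tot\<^esub> (\<lambda>n. d (n + 1) (x (n + 1)))"
   if "s \<in> carrier S" "x \<in> carrier Tot" for s x
   using that d_act_S[of s "x (n + 1)" "n + 1" for n] by simp
 qed
 moreover have "(\<lambda>x. single n (x n)) \<in> left_module_hom S Tot Tot" for n
 proof (rule left_module_homI, rule add_homI)
  show "single n (x n) \<in> carrier Tot" if "x \<in> carrier Tot" for x using single_closed that by simp
  show "single n ((x \<oplus>\<^bsub>Tot\<^esub> y) n) = single n (x n) \<oplus>\<^bsub>Tot\<^esub> single n (y n)"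
   if "x \<in> carrier Tot" "y \<in> carrier Tot" for x y using single_add that by simp
  show "single n ((s \<odot>\<^bsub>Tot\<^esub> x) n) = s \<odot>\<^bsub>Tot\<^esub> single n (x n)"
   if "s \<in> carrier S" "x \<in> carrier Tot" for s x using single_smult that by simp
 qed
 moreover have "(\<lambda>x n. act_A n a (x n)) \<in> left_module_hom S Tot Tot" if a: "a \<in> carrier A" for a
 proof (rule left_module_homI, rule add_homI)
  show "(\<lambda>n. act_A n a (x n)) \<in> carrier Tot" if "x \<in> carrier Tot" for x
   using that act_A_closed[OF a] by simp
  show "(\<lambda>n. act_A n a ((x \<oplus>\<^bsub>Tot\<^esub> y) n)) = (\<lambda>n. act_A n a (x n)) \<oplus>\<^bsub>Tot\<^esub> (\<lambda>n. act_A n a (y n))"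
   if "x \<in> carrier Tot" "y \<in> carrier Tot" for x y
   using that Cn.smult_r_distr[OF tA_closed[OF S.one_closed a]] by simp
  show "(\<lambda>n. act_A n a ((s \<odot>\<^bsub>Tot\<^esub> x) n)) = s \<odot>\<^bsub>Tot\<^esub> (\<lambda>n. act_A n a (x n))"
   if "s \<in> carrier S" "x \<in> carrier Tot" for s x
   using that tA_commute[OF Cn_module _ a] by simp
 qed
 ultimately show ?thesis using w unfolding total_operators_def by blast
qed

sublocale total: operator_module S Tot p total_operators
 by (intro operator_module.intro S.is_cring Tot_left_module Tot_padic operator_module_axioms.intro Tot_operators)

definition semi_chain :: "('s \<Rightarrow> 's) \<Rightarrow> (int \<Rightarrow> 'm \<Rightarrow> 'm) \<Rightarrow> bool" where
 "semi_chain \<tau> g \<longleftrightarrow> (\<forall>n. g n \<in> add_hom (Cn n) (Cn n) \<and>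
   (\<forall>s\<in>carrier S. \<forall>x\<in>carrier (Cn n). g n (act_S n s x) = act_S n (\<tau> s) (g n x)) \<and>
   (\<forall>a\<in>carrier A. \<forall>x\<in>carrier (Cn n). g n (act_A n a x) = act_A n a (g n x)) \<and>
   (\<forall>x\<in>carrier (Cn n). g (n - 1) (d n x) = d n (g n x)))"

lemma semi_chainD:
 assumes "semi_chain \<tau> g"
 shows "g n \<in> add_hom (Cn n) (Cn n)"
  "\<lbrakk>s \<in> carrier S; x \<in> carrier (Cn n)\<rbrakk> \<Longrightarrow> g n (act_S n s x) = act_S n (\<tau> s) (g n x)"
  "\<lbrakk>a \<in> carrier A; x \<in> carrier (Cn n)\<rbrakk> \<Longrightarrow> g n (act_A n a x) = act_A n a (g n x)"
  "x \<in> carrier (Cn n) \<Longrightarrow> g (n - 1) (d n x) = d n (g n x)"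
  "x \<in> carrier (Cn n) \<Longrightarrow> g n x \<in> carrier (Cn n)"
proof -
 show "g n \<in> add_hom (Cn n) (Cn n)" using assms unfolding semi_chain_def by blast
 from add_hom_closed[OF this] show "x \<in> carrier (Cn n) \<Longrightarrow> g n x \<in> carrier (Cn n)" .
qed (use assms in \<open>simp_all add: semi_chain_def\<close>)

abbreviation assemble :: "(int \<Rightarrow> 'm \<Rightarrow> 'm) \<Rightarrow> (int \<Rightarrow> 'm) \<Rightarrow> int \<Rightarrow> 'm" where
 "assemble g \<equiv> \<lambda>x n. g n (x n)"

lemma assemble_semi:
 assumes g: "semi_chain \<tau> g" shows "total.semi \<tau> (assemble g)"
 unfolding total.semi_def
proof (intro conjI ballI)
 show "assemble g \<in> add_hom Tot Tot"
  by (rule add_homI) (use semi_chainD(5)[OF g] add_hom_add[OF semi_chainD(1)[OF g]] in auto)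
 fix s x assume "s \<in> carrier S" "x \<in> carrier Tot"
 then show "assemble g (s \<odot>\<^bsub>Tot\<^esub> x) = \<tau> s \<odot>\<^bsub>Tot\<^esub> assemble g x" using semi_chainD(2)[OF g] by simp
next
 fix w x assume w: "w \<in> total_operators" and "x \<in> carrier Tot"
 then have x: "x n \<in> carrier (Cn n)" for n by simp
 have "g n (d (n + 1) (x (n + 1))) = d (n + 1) (g (n + 1) (x (n + 1)))" for n
  using semi_chainD(4)[OF g x[of "n + 1"]] by simp
 moreover have "assemble g (single n (x n)) = single n (g n (x n))" for n
  using add_hom_zero[OF Cn_abelian Cn_abelian semi_chainD(1)[OF g]] by (auto simp: single_def)
 moreover have "g n (act_A n a (x n)) = act_A n a (g n (x n))" if "a \<in> carrier A" for a n
  by (rule semi_chainD(3)[OF g that x])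
 ultimately show "assemble g (w x) = w (assemble g x)" using w unfolding total_operators_def by auto
qed

definition component :: "((int \<Rightarrow> 'm) \<Rightarrow> (int \<Rightarrow> 'm)) \<Rightarrow> int \<Rightarrow> 'm \<Rightarrow> 'm" where
 "component f n y = f (single n y) n"

context
 fixes \<tau> f assumes f: "total.semi \<tau> f"
begin

text \<open>Commuting with the operators that keep only one component forces \<open>f\<close> to act
  in each degree separately.\<close>

lemma semi_component: "x \<in> carrier Tot \<Longrightarrow> f x n = component f n (x n)"
proof -
 assume x: "x \<in> carrier Tot"
 have "f (single n (x n)) = single n (f x n)"
  using total.semi_Om[OF f _ x, of "\<lambda>x. single n (x n)"] unfolding total_operators_def by auto
 then show ?thesis by (simp add: component_def single_def)
qed

lemma component_semi_chain: "semi_chain \<tau> (component f)"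
 unfolding semi_chain_def
proof (intro allI conjI ballI)
 fix n
 show "component f n \<in> add_hom (Cn n) (Cn n)"
 proof (rule add_homI)
  fix x y assume x: "x \<in> carrier (Cn n)" and y: "y \<in> carrier (Cn n)"
  show "component f n x \<in> carrier (Cn n)"
   using total.semi_closed[OF f single_closed[OF x]] by (simp add: component_def)
  show "component f n (x \<oplus>\<^bsub>Cn n\<^esub> y) = component f n x \<oplus>\<^bsub>Cn n\<^esub> component f n y"
   using total.semi_add[OF f single_closed[OF x] single_closed[OF y]] single_add[OF x y]
   by (simp add: component_def)
 qed
 fix x assume x: "x \<in> carrier (Cn n)"
 note sx = single_closed[OF x]
 show "component f n (act_S n s x) = act_S n (\<tau> s) (component f n x)" if s: "s \<in> carrier S" for s
  using total.semi_smult[OF f s sx] single_smult[OF s, of n x] by (simp add: component_def)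
 show "component f n (act_A n a x) = act_A n a (component f n x)" if a: "a \<in> carrier A" for a
 proof -
  have "single n (act_A n a x) = (\<lambda>k. act_A k a (single n x k))"
   using Cn.smult_zero_right[OF tA_closed[OF S.one_closed a]] by (auto simp: single_def)
  moreover have "f (\<lambda>k. act_A k a (single n x k)) = (\<lambda>k. act_A k a (f (single n x) k))"
   by (rule total.semi_Om[OF f _ sx]) (use a in \<open>auto simp: total_operators_def\<close>)
  ultimately show ?thesis by (simp add: component_def)
 qed
 \<comment> \<open>The differential of the total module reads its input one degree higher, so it
   sends \<open>single n x\<close> to \<open>single (n - 1) (d n x)\<close>; in all other degrees
   \<open>d\<close> is applied to zero.\<close>
 have "single (n - 1) (d n x) = (\<lambda>k. d (k + 1) (single n x (k + 1)))"
  using d_zero[of "k + 1" for k] by (auto simp: single_def)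
 moreover have "f (\<lambda>k. d (k + 1) (single n x (k + 1))) = (\<lambda>k. d (k + 1) (f (single n x) (k + 1)))"
  by (rule total.semi_Om[OF f _ sx]) (auto simp: total_operators_def)
 ultimately show "component f (n - 1) (d n x) = d n (component f n x)" by (simp add: component_def)
qed

lemma component_funpow:
 assumes y: "y \<in> carrier (Cn n)"
 shows "(component f n ^^ k) y = (f ^^ k) (single n y) n"
proof (induction k)
 case 0
 then show ?case by (simp add: single_def)
next
 case (Suc k)
 have "(f ^^ k) (single n y) \<in> carrier Tot"
  by (rule add_hom_closed[OF add_hom_funpow[OF total.semi_additive[OF f]] single_closed[OF y]])
 from semi_component[OF this, of n] Suc show ?case by simp
qed

lemma component_bij:
 assumes b: "total.bij f"
 shows "bij_betw (component f n) (carrier (Cn n)) (carrier (Cn n))"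
proof (rule bij_betwI')
 note cc = semi_chainD(5)[OF component_semi_chain]
 show "component f n y \<in> carrier (Cn n)" if "y \<in> carrier (Cn n)" for y by (rule cc[OF that])
 have single_f: "f (single n y) = single n (component f n y)" if y: "y \<in> carrier (Cn n)" for y
  using semi_component[OF single_closed[OF y]]
   add_hom_zero[OF Cn_abelian Cn_abelian semi_chainD(1)[OF component_semi_chain]]
  by (intro ext) (auto simp: single_def)
 show "(component f n x = component f n y) = (x = y)" if "x \<in> carrier (Cn n)" "y \<in> carrier (Cn n)" for x y
 proof
  assume "component f n x = component f n y"
  then have "f (single n x) = f (single n y)" using single_f that by simp
  then have "single n x = single n y"
   using b single_closed[OF that(1)] single_closed[OF that(2)] unfolding bij_betw_def inj_on_def by blast
  then show "x = y" unfolding single_def by metis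
 qed simp
 show "\<exists>x\<in>carrier (Cn n). y = component f n x" if y: "y \<in> carrier (Cn n)" for y
 proof -
  have "single n y \<in> f ` carrier Tot" unfolding bij_betw_imp_surj_on[OF b] by (rule single_closed[OF y])
  then obtain x where x: "single n y = f x" "x \<in> carrier Tot" by (rule imageE)
  have "component f n (x n) = f x n" by (rule semi_component[OF x(2), symmetric])
  also have "\<dots> = y" unfolding x(1)[symmetric] by (simp add: single_def)
  finally have "y = component f n (x n)" by (rule sym)
  moreover have "x n \<in> carrier (Cn n)" using x(2) by simp
  ultimately show ?thesis by (rule bexI)
 qed
qed

end

lemma assemble_bij:
 assumes "\<And>n. bij_betw (g n) (carrier (Cn n)) (carrier (Cn n))"
 shows "total.bij (assemble g)"
proof -
 let ?i = "\<lambda>n. inv_into (carrier (Cn n)) (g n)"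
 have i: "?i n y \<in> carrier (Cn n)" "g n (?i n y) = y" "?i n (g n y) = y" "g n y \<in> carrier (Cn n)"
  if "y \<in> carrier (Cn n)" for n y
  by (rule bij_betw_apply[OF bij_betw_inv_into[OF assms] that] bij_betw_inv_into_right[OF assms that]
    bij_betw_inv_into_left[OF assms that] bij_betw_apply[OF assms that])+
 show ?thesis by (rule bij_betw_byWitness[where f' = "assemble ?i"]) (use i in auto)
qed

lemma semi_chain_hom:
 assumes "semi_chain (\<lambda>s. s) g" shows "g n \<in> left_module_hom A' (Cn n) (Cn n)"
 by (rule tensor_module_homI[OF left_module_tensor_module[OF Cn_module] left_module_tensor_module[OF Cn_module]
    semi_chainD(1)[OF assms]]) (auto intro: semi_chainD(2,3)[OF assms])

lemma idempotent_subcomplexes: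
 assumes g: "semi_chain (\<lambda>s. s) g"
 shows "is_subcomplex A' C (\<lambda>n. {x \<in> carrier (Cn n). g n x = x})"
  and "is_subcomplex A' C (\<lambda>n. {x \<in> carrier (Cn n). g n x = \<zero>\<^bsub>Cn n\<^esub>})"
proof -
 note ga = semi_chainD(1)[OF g] and gh = semi_chain_hom[OF g]
 note g0 = add_hom_zero[OF Cn_abelian Cn_abelian ga]
 note gm = add_hom_minus[OF Cn_abelian Cn_abelian ga]
 note ginv = a_inv_def[symmetric]
 show "is_subcomplex A' C (\<lambda>n. {x \<in> carrier (Cn n). g n x = x})"
  unfolding is_subcomplex_def
 proof (intro allI conjI submodule.intro subgroup.intro submodule_axioms.intro)
  fix n
  show "d n ` {x \<in> carrier (Cn n). g n x = x} \<subseteq> {x \<in> carrier (Cn (n - 1)). g (n - 1) x = x}"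
   using d_closed semi_chainD(4)[OF g] by auto
 qed (auto simp: g0 gm add_hom_add[OF ga] left_module_hom_smult[OF gh] Cn.smult_closed ginv)
 show "is_subcomplex A' C (\<lambda>n. {x \<in> carrier (Cn n). g n x = \<zero>\<^bsub>Cn n\<^esub>})"
  unfolding is_subcomplex_def
 proof (intro allI conjI submodule.intro subgroup.intro submodule_axioms.intro)
  fix n
  show "d n ` {x \<in> carrier (Cn n). g n x = \<zero>\<^bsub>Cn n\<^esub>} \<subseteq> {x \<in> carrier (Cn (n - 1)). g (n - 1) x = \<zero>\<^bsub>Cn (n - 1)\<^esub>}"
   using d_closed semi_chainD(4)[OF g] d_zero by auto
 qed (auto simp: g0 gm add_hom_add[OF ga] left_module_hom_smult[OF gh] Cn.smult_closed Cn.smult_zero_right ginv)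
qed

text \<open>An idempotent chain map splits the complex into its fixed points and its kernel by
  \<open>x = g x + (x - g x)\<close>, and indecomposability makes one of these subcomplexes
  zero.\<close>

lemma idempotent_chain_trivial:
 assumes indec: "indecomposable_complex A' C" and g: "semi_chain (\<lambda>s. s) g"
  and idem: "\<And>n x. x \<in> carrier (Cn n) \<Longrightarrow> g n (g n x) = g n x"
 shows "(\<forall>n. \<forall>x\<in>carrier (Cn n). g n x = \<zero>\<^bsub>Cn n\<^esub>) \<or> (\<forall>n. \<forall>x\<in>carrier (Cn n). g n x = x)"
proof -
 note ga = semi_chainD(1)[OF g] and gc = semi_chainD(5)[OF g]
 note g0 = add_hom_zero[OF Cn_abelian Cn_abelian ga]
 let ?D = "\<lambda>n. {x \<in> carrier (Cn n). g n x = x}" and ?E = "\<lambda>n. {x \<in> carrier (Cn n). g n x = \<zero>\<^bsub>Cn n\<^esub>}"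
 define r where "r n x = \<ominus>\<^bsub>Cn n\<^esub> g n x \<oplus>\<^bsub>Cn n\<^esub> x" for n x
 have r: "r n x \<in> ?E n" "x = g n x \<oplus>\<^bsub>Cn n\<^esub> r n x" if x: "x \<in> carrier (Cn n)" for n x
 proof -
  have "g n (r n x) = \<ominus>\<^bsub>Cn n\<^esub> g n (g n x) \<oplus>\<^bsub>Cn n\<^esub> g n x"
   unfolding r_def using x gc[OF x]
   by (simp add: add_hom_add[OF ga] add_hom_minus[OF Cn_abelian Cn_abelian ga])
  then show "r n x \<in> ?E n" using x gc[OF x] idem[OF x] by (simp add: r_def Cn.M.l_neg)
  show "x = g n x \<oplus>\<^bsub>Cn n\<^esub> r n x" unfolding r_def by (rule Cn.M.r_neg2[OF gc[OF x] x, symmetric])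
 qed
 have "(\<forall>n. ?D n = {\<zero>\<^bsub>Cn n\<^esub>}) \<or> (\<forall>n. ?E n = {\<zero>\<^bsub>Cn n\<^esub>})"
 proof (rule conjunct2[OF indec[unfolded indecomposable_complex_def], rule_format, of ?D ?E, OF conjI[OF _ conjI[OF _ conjI]]])
  show "is_subcomplex A' C ?D" "is_subcomplex A' C ?E" by (rule idempotent_subcomplexes[OF g])+
  show "\<forall>n. ?D n <+>\<^bsub>Cn n\<^esub> ?E n = carrier (Cn n)"
  proof (intro allI equalityI subsetI)
   fix n x assume "x \<in> carrier (Cn n)"
   then show "x \<in> ?D n <+>\<^bsub>Cn n\<^esub> ?E n"
    using r[of x n] gc[of x n] idem[of x n] unfolding set_add_def' by blast
  qed (auto simp: set_add_def')
  show "\<forall>n. ?D n \<inter> ?E n = {\<zero>\<^bsub>Cn n\<^esub>}" using g0 by auto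
 qed
 then show ?thesis
 proof
  assume D: "\<forall>n. ?D n = {\<zero>\<^bsub>Cn n\<^esub>}"
  have "g n x = \<zero>\<^bsub>Cn n\<^esub>" if x: "x \<in> carrier (Cn n)" for n x
   using D[rule_format, of n] gc[OF x] idem[OF x] by blast
  then show ?thesis by blast
 next
  assume E: "\<forall>n. ?E n = {\<zero>\<^bsub>Cn n\<^esub>}"
  have "g n x = x" if x: "x \<in> carrier (Cn n)" for n x
  proof -
   have "r n x = \<zero>\<^bsub>Cn n\<^esub>" using E[rule_format, of n] r(1)[OF x] by blast
   then show ?thesis using r(2)[OF x] gc[OF x] by simp
  qed
  then show ?thesis by blast
 qed
qed

lemma total_indecomposable:
 assumes indec: "indecomposable_complex A' C"
 shows "indecomposable_operator_module S Tot p total_operators"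
proof (intro indecomposable_operator_module.intro total.operator_module_axioms indecomposable_operator_module_axioms.intro)
 obtain n where "carrier (Cn n) \<noteq> {\<zero>\<^bsub>Cn n\<^esub>}" using indec by (auto simp: indecomposable_complex_def)
 moreover have "\<zero>\<^bsub>Cn n\<^esub> \<in> carrier (Cn n)" by (rule Cn.M.zero_closed)
 ultimately obtain y where y: "y \<in> carrier (Cn n)" "y \<noteq> \<zero>\<^bsub>Cn n\<^esub>" by blast
 have ne: "single n y n \<noteq> \<zero>\<^bsub>Tot\<^esub> n" using y(2) by (simp add: single_def)
 show "carrier Tot \<noteq> {\<zero>\<^bsub>Tot\<^esub>}"
 proof
  assume "carrier Tot = {\<zero>\<^bsub>Tot\<^esub>}"
  then have "single n y = \<zero>\<^bsub>Tot\<^esub>" using single_closed[OF y(1)] by (simp only: singleton_iff)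
  then show False using ne by simp
 qed
next
 fix e assume e: "total.lin e" and idem: "\<And>x. x \<in> carrier Tot \<Longrightarrow> e (e x) = e x"
 have "component e n (component e n y) = component e n y" if y: "y \<in> carrier (Cn n)" for n y
  using semi_component[OF e total.semi_closed[OF e single_closed[OF y]], of n] idem[OF single_closed[OF y]]
  by (simp add: component_def)
 note tr = idempotent_chain_trivial[OF indec component_semi_chain[OF e] this]
 from tr show "(\<forall>x\<in>carrier Tot. e x = \<zero>\<^bsub>Tot\<^esub>) \<or> (\<forall>x\<in>carrier Tot. e x = x)"
 proof
  assume z: "\<forall>n. \<forall>x\<in>carrier (Cn n). component e n x = \<zero>\<^bsub>Cn n\<^esub>"
  have "e x = \<zero>\<^bsub>Tot\<^esub>" if x: "x \<in> carrier Tot" for x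
  proof
   fix n show "e x n = \<zero>\<^bsub>Tot\<^esub> n" using semi_component[OF e x, of n] z x by simp
  qed
  then show ?thesis by blast
 next
  assume z: "\<forall>n. \<forall>x\<in>carrier (Cn n). component e n x = x"
  have "e x = x" if x: "x \<in> carrier Tot" for x
  proof
   fix n show "e x n = x n" using semi_component[OF e x, of n] z x by simp
  qed
  then show ?thesis by blast
 qed
qed

end

section \<open>Galois descent data on complexes\<close>

locale galois_base_change = base_change R S p A
 for R :: "'s ring" and S :: "'s ring" (structure) and p and A :: "('s, 'a) module" +
 fixes F :: "'s \<Rightarrow> 's" and m N :: nat and a b :: "nat \<Rightarrow> 's"
 assumes F_hom: "F \<in> ring_hom S S"
  and F_fix: "r \<in> carrier R \<Longrightarrow> F r = r"
  and F_fixed: "\<lbrakk>s \<in> carrier S; F s = s\<rbrakk> \<Longrightarrow> s \<in> carrier R"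
  and m_pos: "m > 0"
  and F_order: "s \<in> carrier S \<Longrightarrow> (F ^^ m) s = s"
  and a: "a \<in> {..<N} \<rightarrow> carrier S"
  and b: "b \<in> {..<N} \<rightarrow> carrier S"
  and coordinates: "j < m \<Longrightarrow>
   (\<Oplus>i\<in>{..<N}. a i \<otimes> (F ^^ j) (b i)) = (if j = 0 then \<one> else \<zero>)"

locale galois_complex = bounded_base_change_complex R S p A C + galois_base_change R S p A F m N a b
 for R :: "'s ring" and S :: "'s ring" (structure) and p and A :: "('s, 'a) module"
  and C :: "(('s \<times> 'a \<Rightarrow>\<^sub>0 int) set, 'm) chain_complex"
  and F :: "'s \<Rightarrow> 's" and m N :: nat and a b :: "nat \<Rightarrow> 's" +
 assumes indecomposable: "indecomposable_complex A' C"
begin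

sublocale galois_total: galois_operator_module S Tot p total_operators F m N a b
 by (intro galois_operator_module.intro total_indecomposable indecomposable galois_operator_module_axioms.intro
   F_hom m_pos F_order a b coordinates)

lemma descent_chain_exists:
 assumes phi: "semi_chain F phi" "\<And>n. bij_betw (phi n) (carrier (Cn n)) (carrier (Cn n))"
 obtains psi where "semi_chain F psi" "\<And>n x. x \<in> carrier (Cn n) \<Longrightarrow> (psi n ^^ m) x = x"
proof -
 obtain f where f: "total.semi F f" "\<And>x. x \<in> carrier Tot \<Longrightarrow> (f ^^ m) x = x"
  using galois_total.descent_datum_exists[OF assemble_semi[OF phi(1)] assemble_bij[OF phi(2)]] by blast
 show ?thesis
 proof (rule that[OF component_semi_chain[OF f(1)]])
  fix n x assume x: "x \<in> carrier (Cn n)"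
  show "(component f n ^^ m) x = x"
   using component_funpow[OF f(1) x, of m] f(2)[OF single_closed[OF x]] by (simp add: single_def)
 qed
qed

lemma assemble_funpow: "(assemble g ^^ k) x = (\<lambda>n. (g n ^^ k) (x n))"
 by (induction k) auto

lemma descent_chain_unique:
 assumes psi: "semi_chain F psi" "\<And>n x. x \<in> carrier (Cn n) \<Longrightarrow> (psi n ^^ m) x = x"
  and phi: "semi_chain F phi" "\<And>n x. x \<in> carrier (Cn n) \<Longrightarrow> (phi n ^^ m) x = x"
  and bij: "\<And>n. bij_betw (phi n) (carrier (Cn n)) (carrier (Cn n))"
 obtains v where "semi_chain (\<lambda>s. s) v" "\<And>n. bij_betw (v n) (carrier (Cn n)) (carrier (Cn n))"
  "\<And>n x. x \<in> carrier (Cn n) \<Longrightarrow> psi n (v n x) = v n (phi n x)"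
proof -
 have "\<exists>v. total.lin v \<and> total.bij v \<and> (\<forall>x\<in>carrier Tot. assemble psi (v x) = v (assemble phi x))"
  by (rule galois_total.descent_datum_unique[OF assemble_semi[OF psi(1)] assemble_semi[OF phi(1)] assemble_bij[OF bij]])
   (use psi(2) phi(2) in \<open>auto simp: assemble_funpow\<close>)
 then obtain v where v: "total.lin v" "total.bij v" "\<And>x. x \<in> carrier Tot \<Longrightarrow> assemble psi (v x) = v (assemble phi x)"
  by blast
 show ?thesis
 proof (rule that[OF component_semi_chain[OF v(1)] component_bij[OF v(1,2)]])
  fix n x assume x: "x \<in> carrier (Cn n)"
  have s: "assemble phi (single n x) = single n (phi n x)"
   using add_hom_zero[OF Cn_abelian Cn_abelian semi_chainD(1)[OF phi(1)]] by (auto simp: single_def)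
  have "psi n (v (single n x) n) = v (single n (phi n x)) n"
   using fun_cong[OF v(3)[OF single_closed[OF x]], of n] unfolding s by simp
  then show "psi n (component v n x) = component v n (phi n x)" by (simp add: component_def)
 qed
qed

end

section \<open>Descent of modules\<close>

lemma funpow_id_bij:
 assumes f: "\<And>x. x \<in> B \<Longrightarrow> f x \<in> B" and m: "m > 0" "\<And>x. x \<in> B \<Longrightarrow> (f ^^ m) x = x"
 shows "bij_betw f B B"
proof -
 have c: "(f ^^ k) x \<in> B" if "x \<in> B" for x k using that f by (induction k) auto
 obtain k where k: "m = Suc k" using m(1) gr0_conv_Suc by blast
 show ?thesis
 proof (rule bij_betw_byWitness[where f' = "f ^^ k"])
  show "\<forall>x\<in>B. (f ^^ k) (f x) = x" using m(2) by (simp add: k funpow_swap1)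
  show "\<forall>x\<in>B. f ((f ^^ k) x) = x" using m(2) by (simp add: k)
 qed (use c f in auto)
qed

lemma finitely_generated_image:
 assumes "left_module L V" "left_module L W" "h \<in> left_module_hom L V W"
  and surj: "\<And>y. y \<in> carrier W \<Longrightarrow> \<exists>x\<in>carrier V. y = h x" and fg: "finitely_generated_module L V"
 shows "finitely_generated_module L W"
proof -
 interpret V: left_module L V by fact
 interpret W: left_module L W by fact
 obtain T where T: "finite T" "T \<subseteq> carrier V"
  "\<And>x. x \<in> carrier V \<Longrightarrow> \<exists>c\<in>T \<rightarrow> carrier L. x = lincomb V T (\<lambda>t. t) c"
  by (rule V.finitely_generatedE[OF fg]; rule that; assumption)
 show ?thesis
 proof (rule W.finitely_generated_familyI[OF T(1), of h])
  show hT: "h \<in> T \<rightarrow> carrier W" using T(2) left_module_hom_closed[OF assms(3)] by auto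
  fix y assume "y \<in> carrier W"
  then obtain x where x: "x \<in> carrier V" "y = h x" using surj by blast
  obtain c where c: "c \<in> T \<rightarrow> carrier L" "x = lincomb V T (\<lambda>t. t) c" using T(3)[OF x(1)] by blast
  have "y = (\<Oplus>\<^bsub>W\<^esub>t\<in>T. h (c t \<odot>\<^bsub>V\<^esub> t))"
   unfolding x(2) c(2) lincomb_def
   by (rule add_hom_finsum[OF V.M.abelian_group_axioms W.M.abelian_group_axioms left_module_hom_additive[OF assms(3)]])
    (use c(1) T(2) in \<open>auto intro!: V.smult_closed\<close>)
  also have "\<dots> = lincomb W T h c"
   unfolding lincomb_def
   by (rule W.M.finsum_cong'[OF refl])
    (use hT funcset_mem[OF c(1)] left_module_hom_smult[OF assms(3) funcset_mem[OF c(1)] subsetD[OF T(2)]]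
     in \<open>auto intro!: W.smult_closed\<close>)
  finally show "\<exists>c\<in>T \<rightarrow> carrier L. y = lincomb W T h c" using c(1) by blast
 qed
qed

section \<open>Trace and dual bases\<close>

context galois_base_change
begin

lemma F_pow_hom: "F ^^ j \<in> ring_hom S S"
 by (rule ring_hom_funpow[OF F_hom])

lemma F_pow_closed: "s \<in> carrier S \<Longrightarrow> (F ^^ j) s \<in> carrier S"
 by (rule ring_hom_closed[OF F_pow_hom])

lemma F_pow_fix: "r \<in> carrier R \<Longrightarrow> (F ^^ j) r = r"
 by (induction j) (auto simp: F_fix)

lemma F_linear_auto: "S_linear_auto F"
 unfolding S_linear_auto_def
 by (intro conjI F_hom ballI F_fix funpow_id_bij[OF ring_hom_closed[OF F_hom] m_pos F_order])

text \<open>The coordinate relations say that \<open>a\<close> and \<open>b\<close> are dual with respect to the trace form.\<close>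

lemma semilinear_expansion:
 assumes V: "left_module S V" and psi: "psi \<in> add_hom V V"
  and semi: "\<And>s x. \<lbrakk>s \<in> carrier S; x \<in> carrier V\<rbrakk> \<Longrightarrow> psi (s \<odot>\<^bsub>V\<^esub> x) = F s \<odot>\<^bsub>V\<^esub> psi x"
  and x: "x \<in> carrier V"
 shows "(\<Oplus>\<^bsub>V\<^esub>i\<in>{..<N}. a i \<odot>\<^bsub>V\<^esub> (\<Oplus>\<^bsub>V\<^esub>j\<in>{..<m}. (psi ^^ j) (b i \<odot>\<^bsub>V\<^esub> x))) = x"
proof -
 interpret V: left_module S V by (rule V)
 have pc: "(psi ^^ j) y \<in> carrier V" if "y \<in> carrier V" for j y
  by (rule add_hom_closed[OF add_hom_funpow[OF psi] that])
 have ps: "(psi ^^ j) (s \<odot>\<^bsub>V\<^esub> y) = (F ^^ j) s \<odot>\<^bsub>V\<^esub> (psi ^^ j) y" if "s \<in> carrier S" "y \<in> carrier V" for j s y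
  using that by (induction j) (auto simp: semi F_pow_closed pc)
 have ai: "a i \<in> carrier S" and bi: "b i \<in> carrier S" if "i < N" for i using a b that by auto
 define e where "e i j = a i \<otimes> (F ^^ j) (b i)" for i j
 have e: "e i j \<in> carrier S" if "i < N" for i j using ai bi that F_pow_closed by (simp add: e_def)
 have "a i \<odot>\<^bsub>V\<^esub> (\<Oplus>\<^bsub>V\<^esub>j\<in>{..<m}. (psi ^^ j) (b i \<odot>\<^bsub>V\<^esub> x)) = (\<Oplus>\<^bsub>V\<^esub>j\<in>{..<m}. e i j \<odot>\<^bsub>V\<^esub> (psi ^^ j) x)" if i: "i < N" for i
 proof -
  have "a i \<odot>\<^bsub>V\<^esub> (\<Oplus>\<^bsub>V\<^esub>j\<in>{..<m}. (psi ^^ j) (b i \<odot>\<^bsub>V\<^esub> x)) = (\<Oplus>\<^bsub>V\<^esub>j\<in>{..<m}. a i \<odot>\<^bsub>V\<^esub> (psi ^^ j) (b i \<odot>\<^bsub>V\<^esub> x))"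
   by (rule add_hom_finsum[OF V.M.abelian_group_axioms V.M.abelian_group_axioms V.additive_smult_right[OF ai[OF i]]])
    (use pc V.smult_closed[OF bi[OF i] x] in auto)
  also have "\<dots> = (\<Oplus>\<^bsub>V\<^esub>j\<in>{..<m}. e i j \<odot>\<^bsub>V\<^esub> (psi ^^ j) x)"
   by (rule V.M.finsum_cong')
    (use ps[OF bi[OF i] x] V.smult_assoc[OF ai[OF i] F_pow_closed[OF bi[OF i]] pc[OF x]] ai[OF i] F_pow_closed[OF bi[OF i]] pc[OF x]
     in \<open>auto simp: e_def intro!: V.smult_closed\<close>)
  finally show ?thesis .
 qed
 then have "(\<Oplus>\<^bsub>V\<^esub>i\<in>{..<N}. a i \<odot>\<^bsub>V\<^esub> (\<Oplus>\<^bsub>V\<^esub>j\<in>{..<m}. (psi ^^ j) (b i \<odot>\<^bsub>V\<^esub> x))) =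
   (\<Oplus>\<^bsub>V\<^esub>i\<in>{..<N}. \<Oplus>\<^bsub>V\<^esub>j\<in>{..<m}. e i j \<odot>\<^bsub>V\<^esub> (psi ^^ j) x)"
  using e pc[OF x] by (intro V.M.finsum_cong') (auto intro!: V.M.finsum_closed V.smult_closed)
 also have "\<dots> = (\<Oplus>\<^bsub>V\<^esub>j\<in>{..<m}. \<Oplus>\<^bsub>V\<^esub>i\<in>{..<N}. e i j \<odot>\<^bsub>V\<^esub> (psi ^^ j) x)"
  by (rule V.M.finsum_swap) (use e pc[OF x] in \<open>auto intro!: V.smult_closed\<close>)
 also have "\<dots> = x"
 proof (rule V.M.finsum_delta[of _ 0])
  fix j assume "j \<in> {..<m}"
  then have j: "j < m" by simp
  have "(\<Oplus>\<^bsub>V\<^esub>i\<in>{..<N}. e i j \<odot>\<^bsub>V\<^esub> (psi ^^ j) x) = (\<Oplus>i\<in>{..<N}. e i j) \<odot>\<^bsub>V\<^esub> (psi ^^ j) x"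
   by (rule add_hom_finsum[OF S.abelian_group_axioms V.M.abelian_group_axioms V.additive_smult_left[OF pc[OF x]], symmetric])
    (use e in auto)
  then show "(\<Oplus>\<^bsub>V\<^esub>i\<in>{..<N}. e i j \<odot>\<^bsub>V\<^esub> (psi ^^ j) x) = (if j = 0 then x else \<zero>\<^bsub>V\<^esub>)"
   using coordinates[OF j] V.smult_one[OF x] V.smult_zero_left[OF pc[OF x]] by (auto simp: e_def)
 qed (use m_pos x in auto)
 finally show ?thesis .
qed

lemma orbit_sum_fixed:
 assumes V: "abelian_group V" and psi: "psi \<in> add_hom V V"
  and x: "x \<in> carrier V" "(psi ^^ m) x = x"
 shows "psi (\<Oplus>\<^bsub>V\<^esub>j\<in>{..<m}. (psi ^^ j) x) = (\<Oplus>\<^bsub>V\<^esub>j\<in>{..<m}. (psi ^^ j) x)"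
proof -
 interpret V: abelian_group V by (rule V)
 have pc: "(psi ^^ j) x \<in> carrier V" for j
  by (rule add_hom_closed[OF add_hom_funpow[OF psi] x(1)])
 have "psi (\<Oplus>\<^bsub>V\<^esub>j\<in>{..<m}. (psi ^^ j) x) = (\<Oplus>\<^bsub>V\<^esub>j\<in>{..<m}. (psi ^^ Suc j) x)"
  using add_hom_finsum[OF V V psi, of "\<lambda>j. (psi ^^ j) x" "{..<m}"] pc by auto
 also have "\<dots> = (\<Oplus>\<^bsub>V\<^esub>j\<in>{..<m}. (psi ^^ j) x)"
  by (rule V.finsum_cyclic_shift[of "\<lambda>j. (psi ^^ j) x"]) (use pc x(2) in auto)
 finally show ?thesis .
qed

definition tr :: "'s \<Rightarrow> 's" where "tr s = (\<Oplus>j\<in>{..<m}. (F ^^ j) s)"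

lemma tr_additive: "tr \<in> add_hom S S"
 unfolding tr_def[abs_def]
 by (rule add_hom_finsum_fun[OF S.abelian_group_axioms S.abelian_group_axioms])
  (rule ring_hom_add_hom[OF F_pow_hom])

lemma tr_closed: "s \<in> carrier S \<Longrightarrow> tr s \<in> carrier S"
 by (rule add_hom_closed[OF tr_additive])

text \<open>A trace is fixed by \<open>F\<close>, and the fixed points of \<open>F\<close> lie in
  \<open>R\<close>.\<close>

lemma tr_R: "s \<in> carrier S \<Longrightarrow> tr s \<in> carrier R"
 using orbit_sum_fixed[OF S.abelian_group_axioms ring_hom_add_hom[OF F_hom] _ F_order]
 by (intro F_fixed tr_closed) (simp_all add: tr_def)

lemma tr_R_mult: "\<lbrakk>r \<in> carrier R; s \<in> carrier S\<rbrakk> \<Longrightarrow> tr (r \<otimes> s) = r \<otimes> tr s"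
 unfolding tr_def using F_pow_closed subset
 by (simp add: S.finsum_rdistr ring_hom_mult[OF F_pow_hom] F_pow_fix Pi_iff)

text \<open>The case of \<open>semilinear_expansion\<close> where \<open>S\<close> is the module and
  \<open>F\<close> the operator, so that the inner sums are traces.\<close>

lemma tr_expansion:
 assumes s: "s \<in> carrier S" shows "(\<Oplus>i\<in>{..<N}. a i \<otimes> tr (b i \<otimes> s)) = s"
proof -
 let ?V = "regular_algebra S"
 interpret V: left_module S ?V by (rule left_module_regular[OF S.ring_axioms])
 have sum: "finsum ?V f I = finsum S f I" if "f \<in> I \<rightarrow> carrier S" for f :: "nat \<Rightarrow> 's" and I
  using add_hom_finsum[OF S.abelian_group_axioms V.M.abelian_group_axioms, of "\<lambda>x. x" f I] that
  by (simp add: add_hom_def)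
 have bs: "b i \<otimes> s \<in> carrier S" if "i < N" for i using b s that by auto
 have inner: "(\<Oplus>\<^bsub>?V\<^esub>j\<in>{..<m}. (F ^^ j) y) = tr y" if "y \<in> carrier S" for y
  unfolding tr_def by (rule sum) (use F_pow_closed that in auto)
 have "s = (\<Oplus>\<^bsub>?V\<^esub>i\<in>{..<N}. a i \<odot>\<^bsub>?V\<^esub> (\<Oplus>\<^bsub>?V\<^esub>j\<in>{..<m}. (F ^^ j) (b i \<odot>\<^bsub>?V\<^esub> s)))"
  by (rule semilinear_expansion[OF V.left_module_axioms _ _, symmetric])
   (use s ring_hom_add_hom[OF F_hom] ring_hom_mult[OF F_hom] in \<open>auto simp: add_hom_def\<close>)
 also have "\<dots> = (\<Oplus>\<^bsub>?V\<^esub>i\<in>{..<N}. a i \<otimes> tr (b i \<otimes> s))"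
  by (rule V.M.finsum_cong') (use a bs inner tr_closed in auto)
 also have "\<dots> = (\<Oplus>i\<in>{..<N}. a i \<otimes> tr (b i \<otimes> s))"
  by (rule sum) (use a bs tr_closed in auto)
 finally show ?thesis by (rule sym)
qed

text \<open>If all traces of the \<open>b i\<close> were divisible by \<open>p\<close>, the
  expansion of \<open>\<one>\<close> would be as well. So some trace is a unit of \<open>R\<close>
  and can be scaled to \<open>\<one>\<close>. An element of trace \<open>\<one>\<close> gives
  retractions onto fixed points without division by \<open>m\<close>, which \<open>p\<close> may
  divide.\<close>

lemma tr_surjective: obtains \<theta> where "\<theta> \<in> carrier S" "tr \<theta> = \<one>"
proof -
 have bi: "b i \<in> carrier S" and ai: "a i \<in> carrier S" if "i < N" for i using a b that by auto
 have "\<exists>i<N. \<not> acong S p (tr (b i)) \<zero>"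
 proof (rule ccontr)
  assume "\<not> ?thesis"
  then have c: "acong S p (tr (b i)) \<zero>" if "i < N" for i using that by blast
  have "acong S p (\<Oplus>i\<in>{..<N}. a i \<otimes> tr (b i \<otimes> \<one>)) (\<Oplus>i\<in>{..<N}. a i \<otimes> \<zero>)"
  proof (rule S.acong_finsum)
   fix i assume "i \<in> {..<N}"
   then have i: "i < N" by simp
   show "acong S p (a i \<otimes> tr (b i \<otimes> \<one>)) (a i \<otimes> \<zero>)"
    using S.acong_mult_left[OF c[OF i] ai[OF i]] bi[OF i] by simp
  qed
  moreover have "(\<Oplus>i\<in>{..<N}. a i \<otimes> \<zero>) = (\<Oplus>i\<in>{..<N}. \<zero>)"
   by (rule S.finsum_cong') (use ai in auto)
  ultimately show False using tr_expansion[OF S.one_closed] S.one_not_p by simp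
 qed
 then obtain i where i: "i < N" "\<not> acong S p (tr (b i)) \<zero>" by blast
 have "tr (b i) \<in> Units R"
  using R.unit_or_p[OF tr_R[OF bi[OF i(1)]]] i(2) acong_R zero_R by metis
 then have u: "inv\<^bsub>R\<^esub> tr (b i) \<in> carrier R" "inv\<^bsub>R\<^esub> tr (b i) \<otimes>\<^bsub>R\<^esub> tr (b i) = \<one>\<^bsub>R\<^esub>" by auto
 show ?thesis
  by (rule that[of "inv\<^bsub>R\<^esub> tr (b i) \<otimes> b i"])
   (use u bi[OF i(1)] subset[OF u(1)] mult_R[OF u(1) tr_R[OF bi[OF i(1)]]] in \<open>auto simp: tr_R_mult one_R\<close>)
qed

end

definition fixed_module :: "('l, 'm) module \<Rightarrow> ('m \<Rightarrow> 'm) \<Rightarrow> ('l, 'm) module" where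
 "fixed_module V f = V\<lparr>carrier := {x \<in> carrier V. f x = x}\<rparr>"

lemma fixed_module_simps [simp]:
 "carrier (fixed_module V f) = {x \<in> carrier V. f x = x}" "ring.add (fixed_module V f) = ring.add V"
 "ring.zero (fixed_module V f) = ring.zero V" "smult (fixed_module V f) = smult V"
 by (simp_all add: fixed_module_def)

lemma left_module_fixed_module:
 assumes "left_module L V" "f \<in> left_module_hom L V V" shows "left_module L (fixed_module V f)"
proof -
 interpret V: left_module L V by fact
 note fa = left_module_hom_additive[OF assms(2)]
 note ab = V.M.abelian_group_axioms
 show ?thesis
 proof (rule left_module.intro[OF V.R.ring_axioms])
  show "abelian_group (fixed_module V f)"
  proof (rule abelian_groupI)
   show "\<exists>y\<in>carrier (fixed_module V f). y \<oplus>\<^bsub>fixed_module V f\<^esub> x = \<zero>\<^bsub>fixed_module V f\<^esub>"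
    if "x \<in> carrier (fixed_module V f)" for x
    using that by (intro bexI[of _ "\<ominus>\<^bsub>V\<^esub> x"]) (auto simp: V.M.l_neg add_hom_minus[OF ab ab fa])
  qed (auto simp: V.M.a_ac add_hom_add[OF fa] add_hom_zero[OF ab ab fa])
  show "left_module_axioms L (fixed_module V f)"
   by (rule left_module_axioms.intro)
    (auto simp: V.smult_closed V.smult_l_distr V.smult_r_distr V.smult_assoc V.smult_one left_module_hom_smult[OF assms(2)])
 qed
qed

section \<open>Fixed points of a descent datum\<close>

context galois_base_change
begin

context
 fixes U :: "(('s \<times> 'a \<Rightarrow>\<^sub>0 int) set, 'm) module" and psi
 assumes U: "left_module A' U"
  and psi: "psi \<in> add_hom U U"
  and psi_S: "\<And>s x. \<lbrakk>s \<in> carrier S; x \<in> carrier U\<rbrakk> \<Longrightarrow> psi (inS s \<odot>\<^bsub>U\<^esub> x) = inS (F s) \<odot>\<^bsub>U\<^esub> psi x"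
  and psi_A: "\<And>c x. \<lbrakk>c \<in> carrier A; x \<in> carrier U\<rbrakk> \<Longrightarrow> psi (inA c \<odot>\<^bsub>U\<^esub> x) = inA c \<odot>\<^bsub>U\<^esub> psi x"
  and psi_order: "\<And>x. x \<in> carrier U \<Longrightarrow> (psi ^^ m) x = x"
begin

interpretation U: left_module A' U by (rule U)
interpretation V: left_module S "over_S U"
 by (rule left_module_change_scalars[OF S.ring_axioms hom_S_A' U])

abbreviation "fixed \<equiv> fixed_module (over_A U) psi"

lemma psi_additive_over_S: "psi \<in> add_hom (over_S U) (over_S U)"
 using psi by (simp add: add_hom_def)

lemma psi_pow_closed: "x \<in> carrier U \<Longrightarrow> (psi ^^ j) x \<in> carrier U"
 by (rule add_hom_closed[OF add_hom_funpow[OF psi]])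

lemma psi_pow_A: "\<lbrakk>c \<in> carrier A; x \<in> carrier U\<rbrakk> \<Longrightarrow> (psi ^^ j) (inA c \<odot>\<^bsub>U\<^esub> x) = inA c \<odot>\<^bsub>U\<^esub> (psi ^^ j) x"
 by (induction j) (auto simp: psi_A psi_pow_closed)

lemma psi_pow_S: "\<lbrakk>s \<in> carrier S; x \<in> carrier U\<rbrakk> \<Longrightarrow>
  (psi ^^ j) (inS s \<odot>\<^bsub>U\<^esub> x) = inS ((F ^^ j) s) \<odot>\<^bsub>U\<^esub> (psi ^^ j) x"
 by (induction j) (auto simp: psi_S psi_pow_closed F_pow_closed)

lemma act_closed: "\<lbrakk>s \<in> carrier S; x \<in> carrier U\<rbrakk> \<Longrightarrow> inS s \<odot>\<^bsub>U\<^esub> x \<in> carrier U"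
 "\<lbrakk>c \<in> carrier A; x \<in> carrier U\<rbrakk> \<Longrightarrow> inA c \<odot>\<^bsub>U\<^esub> x \<in> carrier U"
 by (auto intro!: U.smult_closed tA_closed)

definition orbit_sum :: "'m \<Rightarrow> 'm" where "orbit_sum x = (\<Oplus>\<^bsub>over_S U\<^esub>j\<in>{..<m}. (psi ^^ j) x)"

lemma orbit_sum_additive: "orbit_sum \<in> add_hom (over_S U) (over_S U)"
 unfolding orbit_sum_def[abs_def]
 by (rule add_hom_finsum_fun[OF V.M.abelian_group_axioms V.M.abelian_group_axioms add_hom_funpow[OF psi_additive_over_S]])

lemma orbit_sum_in_fixed: "x \<in> carrier U \<Longrightarrow> orbit_sum x \<in> carrier fixed"
 using add_hom_closed[OF orbit_sum_additive, of x]
  orbit_sum_fixed[OF V.M.abelian_group_axioms psi_additive_over_S, of x] psi_order[of x]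
 by (simp add: orbit_sum_def)

lemma orbit_sum_A:
 assumes c: "c \<in> carrier A" and x: "x \<in> carrier U"
 shows "orbit_sum (inA c \<odot>\<^bsub>U\<^esub> x) = inA c \<odot>\<^bsub>U\<^esub> orbit_sum x"
proof -
 have add: "(\<lambda>x. inA c \<odot>\<^bsub>U\<^esub> x) \<in> add_hom (over_S U) (over_S U)"
  using U.additive_smult_right[OF tA_closed[OF S.one_closed c]] by (simp add: add_hom_def)
 have "inA c \<odot>\<^bsub>U\<^esub> orbit_sum x = (\<Oplus>\<^bsub>over_S U\<^esub>j\<in>{..<m}. inA c \<odot>\<^bsub>U\<^esub> (psi ^^ j) x)"
  unfolding orbit_sum_def
  by (rule add_hom_finsum[OF V.M.abelian_group_axioms V.M.abelian_group_axioms add]) (use psi_pow_closed x in auto)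
 then show ?thesis unfolding orbit_sum_def by (simp only: psi_pow_A[OF c x])
qed

lemma orbit_sum_S:
 assumes s: "s \<in> carrier S" and x: "x \<in> carrier fixed"
 shows "orbit_sum (inS s \<odot>\<^bsub>U\<^esub> x) = inS (tr s) \<odot>\<^bsub>U\<^esub> x"
proof -
 have x': "x \<in> carrier U" "(psi ^^ j) x = x" for j using x by (simp, induction j) auto
 have "tr s \<odot>\<^bsub>over_S U\<^esub> x = (\<Oplus>\<^bsub>over_S U\<^esub>j\<in>{..<m}. (F ^^ j) s \<odot>\<^bsub>over_S U\<^esub> x)"
  unfolding tr_def
  by (rule add_hom_finsum[OF S.abelian_group_axioms V.M.abelian_group_axioms V.additive_smult_left])
   (use x'(1) F_pow_closed s in auto)
 then show ?thesis unfolding orbit_sum_def using psi_pow_S[OF s x'(1)] x'(2) by simp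
qed

lemma fixed_left_module: "left_module A fixed"
proof (rule left_module_fixed_module[OF left_module_change_scalars[OF A.ring_axioms hom_A_A' U]])
 show "psi \<in> left_module_hom A (over_A U) (over_A U)"
  by (rule left_module_homI) (use psi psi_A in \<open>auto simp: add_hom_def\<close>)
qed

text \<open>For \<open>tr \<theta> = 1\<close> the map
  \<open>x \<mapsto> \<Sum> psi^j (\<theta> x)\<close> is an \<open>A\<close>-linear retraction of
  \<open>U\<close> onto the fixed points. Exhibiting this submodule as a quotient avoids Noetherian
  arguments.\<close>

lemma fixed_finitely_generated:
 assumes fg: "finitely_generated_module A' U" shows "finitely_generated_module A fixed"
proof -
 obtain \<theta> where th: "\<theta> \<in> carrier S" "tr \<theta> = \<one>" by (rule tr_surjective)
 let ?h = "\<lambda>x. orbit_sum (tA \<theta> \<one>\<^bsub>A\<^esub> \<odot>\<^bsub>U\<^esub> x)"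
 show ?thesis
 proof (rule finitely_generated_image[OF left_module_change_scalars[OF A.ring_axioms hom_A_A' U] fixed_left_module _ _
    finitely_generated_over_A[OF U fg]])
  show "?h \<in> left_module_hom A (over_A U) fixed"
  proof (rule left_module_homI, rule add_homI)
   show "?h x \<in> carrier fixed" if "x \<in> carrier (over_A U)" for x
    by (rule orbit_sum_in_fixed[OF act_closed(1)[OF th(1)]]) (use that in simp)
   show "?h (x \<oplus>\<^bsub>over_A U\<^esub> y) = ?h x \<oplus>\<^bsub>fixed\<^esub> ?h y" if "x \<in> carrier (over_A U)" "y \<in> carrier (over_A U)" for x y
    using that add_hom_add[OF orbit_sum_additive, of "tA \<theta> \<one>\<^bsub>A\<^esub> \<odot>\<^bsub>U\<^esub> x" "tA \<theta> \<one>\<^bsub>A\<^esub> \<odot>\<^bsub>U\<^esub> y"]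
     act_closed(1)[OF th(1)] by (simp add: U.smult_r_distr tA_closed th(1))
   show "?h (c \<odot>\<^bsub>over_A U\<^esub> x) = c \<odot>\<^bsub>fixed\<^esub> ?h x" if "c \<in> carrier A" "x \<in> carrier (over_A U)" for c x
    using that orbit_sum_A[OF that(1) act_closed(1)[OF th(1)], of x] tA_commute[OF U th(1) that(1), of x] by simp
  qed
  fix y assume y: "y \<in> carrier fixed"
  have "?h y = y" using orbit_sum_S[OF th(1) y] th(2) y V.smult_one[of y] by simp
  then show "\<exists>x\<in>carrier (over_A U). y = ?h x" using y by (intro bexI[of _ y]) auto
 qed
qed

text \<open>The map \<open>s \<otimes> x \<mapsto> s x\<close> has the inverse
  \<open>x \<mapsto> \<Sum> a i \<otimes> y i\<close>, where \<open>y i\<close> is the orbit sum of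
  \<open>b i x\<close>. One composite is \<open>semilinear_expansion\<close>. In the other, the
  scalars \<open>tr (b i s)\<close> lie in \<open>R\<close>, move across the tensor sign and
  recombine to \<open>s\<close> by \<open>tr_expansion\<close>.\<close>

lemma fixed_base_change:
 obtains g where "g \<in> left_module_hom A' (BM fixed) U" "bij_betw g (carrier (BM fixed)) (carrier U)"
  "\<And>s x. \<lbrakk>s \<in> carrier S; x \<in> carrier fixed\<rbrakk> \<Longrightarrow> g (tM fixed s x) = inS s \<odot>\<^bsub>U\<^esub> x"
proof -
 note M = fixed_left_module
 have fU: "x \<in> carrier U" if "x \<in> carrier fixed" for x using that by simp
 have scal: "inS r \<odot>\<^bsub>U\<^esub> x = (r \<odot>\<^bsub>A\<^esub> \<one>\<^bsub>A\<^esub>) \<odot>\<^bsub>fixed\<^esub> x" if "r \<in> carrier R" for r x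
  using tA_scalar[OF that] by simp
 obtain g where g: "g \<in> add_hom (BM fixed) U"
  "\<And>s x. \<lbrakk>s \<in> carrier S; x \<in> carrier fixed\<rbrakk> \<Longrightarrow> g (tM fixed s x) = inS s \<odot>\<^bsub>U\<^esub> x"
 proof (rule BM_universal[OF M U.M.abelian_group_axioms, of "\<lambda>s x. inS s \<odot>\<^bsub>U\<^esub> x"])
  show "inS s \<odot>\<^bsub>U\<^esub> x \<in> carrier U" if "s \<in> carrier S" "x \<in> carrier fixed" for s x
   by (rule act_closed(1)[OF that(1) fU[OF that(2)]])
  show "(\<lambda>s. inS s \<odot>\<^bsub>U\<^esub> x) \<in> add_hom S U" if "x \<in> carrier fixed" for x
   using V.additive_smult_left[of x] fU[OF that] by (simp add: add_hom_def)
  show "(\<lambda>x. inS s \<odot>\<^bsub>U\<^esub> x) \<in> add_hom fixed U" if "s \<in> carrier S" for s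
   using V.additive_smult_right[OF that] by (simp add: add_hom_def Pi_iff)
  show "inS (r \<otimes> s) \<odot>\<^bsub>U\<^esub> x = inS s \<odot>\<^bsub>U\<^esub> ((r \<odot>\<^bsub>A\<^esub> \<one>\<^bsub>A\<^esub>) \<odot>\<^bsub>fixed\<^esub> x)"
   if "r \<in> carrier R" "s \<in> carrier S" "x \<in> carrier fixed" for r s x
   using that V.smult_assoc[OF that(2) subset[OF that(1)] , of x] fU[OF that(3)]
   by (simp add: S.m_comm[OF subset[OF that(1)] that(2)] tA_scalar)
 qed (rule that; assumption)
 have ga: "g \<in> add_hom (BM fixed) (over_S U)" using g(1) by (simp add: add_hom_def)
 have act: "g (tA s c \<odot>\<^bsub>BM fixed\<^esub> z) = tA s c \<odot>\<^bsub>U\<^esub> g z"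
  if s: "s \<in> carrier S" and c: "c \<in> carrier A" and z: "z \<in> carrier (BM fixed)" for s c z
 proof (rule BM_eqI[OF M U.M.abelian_group_axioms _ _ _ z])
  show "(\<lambda>z. g (tA s c \<odot>\<^bsub>BM fixed\<^esub> z)) \<in> add_hom (BM fixed) U"
   by (rule add_hom_comp[OF BM_additive_right[OF M tA_closed[OF s c]] g(1)])
  show "(\<lambda>z. tA s c \<odot>\<^bsub>U\<^esub> g z) \<in> add_hom (BM fixed) U"
   by (rule add_hom_comp[OF g(1) U.additive_smult_right[OF tA_closed[OF s c]]])
  fix s' x assume s': "s' \<in> carrier S" and x: "x \<in> carrier fixed"
  note tc = tA_closed[OF _ A.one_closed] and tc' = tA_closed[OF S.one_closed]
  show "g (tA s c \<odot>\<^bsub>BM fixed\<^esub> tM fixed s' x) = tA s c \<odot>\<^bsub>U\<^esub> g (tM fixed s' x)"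
   unfolding BM_smult_pure[OF M s c s' x] g(2)[OF s' x]
    g(2)[OF S.m_closed[OF s s'] left_module.smult_closed[OF M c x]]
   using U.smult_assoc[OF tA_closed[OF s c] tc[OF s'] fU[OF x]]
    U.smult_assoc[OF tc[OF S.m_closed[OF s s']] tc'[OF c] fU[OF x]]
   by (simp add: tA_mult s s' c)
 qed
 have ai: "a i \<in> carrier S" and bi: "b i \<in> carrier S" if "i < N" for i using a b that by auto
 define H where "H x = (\<Oplus>\<^bsub>BM fixed\<^esub>i\<in>{..<N}. tM fixed (a i) (orbit_sum (inS (b i) \<odot>\<^bsub>U\<^esub> x)))" for x
 have os: "orbit_sum (inS (b i) \<odot>\<^bsub>U\<^esub> x) \<in> carrier fixed" if "i < N" "x \<in> carrier U" for i x
  by (rule orbit_sum_in_fixed[OF act_closed(1)[OF bi[OF that(1)] that(2)]])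
 have H_add: "H \<in> add_hom (over_S U) (BM fixed)"
  unfolding H_def[abs_def]
 proof (rule add_hom_finsum_fun[OF V.M.abelian_group_axioms BM_abelian[OF M]])
  fix i assume "i \<in> {..<N}"
  then have i: "i < N" by simp
  have "orbit_sum \<in> add_hom (over_S U) fixed"
   using orbit_sum_additive orbit_sum_in_fixed by (simp add: add_hom_def Pi_iff)
  from add_hom_comp[OF add_hom_comp[OF V.additive_smult_right[OF bi[OF i]] this] additive_tM_right[OF M ai[OF i]]]
  show "(\<lambda>x. tM fixed (a i) (orbit_sum (inS (b i) \<odot>\<^bsub>U\<^esub> x))) \<in> add_hom (over_S U) (BM fixed)" by simp
 qed
 have gH: "g (H x) = x" if x: "x \<in> carrier U" for x
 proof -
  have "g (H x) = (\<Oplus>\<^bsub>over_S U\<^esub>i\<in>{..<N}. g (tM fixed (a i) (orbit_sum (inS (b i) \<odot>\<^bsub>U\<^esub> x))))"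
   unfolding H_def
   by (rule add_hom_finsum[OF BM_abelian[OF M] V.M.abelian_group_axioms ga])
    (use tM_closed[OF M ai os[OF _ x]] in auto)
  also have "\<dots> = (\<Oplus>\<^bsub>over_S U\<^esub>i\<in>{..<N}. a i \<odot>\<^bsub>over_S U\<^esub> (\<Oplus>\<^bsub>over_S U\<^esub>j\<in>{..<m}. (psi ^^ j) (b i \<odot>\<^bsub>over_S U\<^esub> x)))"
  proof (rule V.M.finsum_cong'[OF refl])
   fix i assume "i \<in> {..<N}"
   then have i: "i < N" by simp
   show "g (tM fixed (a i) (orbit_sum (inS (b i) \<odot>\<^bsub>U\<^esub> x))) =
     a i \<odot>\<^bsub>over_S U\<^esub> (\<Oplus>\<^bsub>over_S U\<^esub>j\<in>{..<m}. (psi ^^ j) (b i \<odot>\<^bsub>over_S U\<^esub> x))"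
    unfolding g(2)[OF ai[OF i] os[OF i x]] by (simp add: orbit_sum_def)
  next
   show "(\<lambda>i. a i \<odot>\<^bsub>over_S U\<^esub> (\<Oplus>\<^bsub>over_S U\<^esub>j\<in>{..<m}. (psi ^^ j) (b i \<odot>\<^bsub>over_S U\<^esub> x))) \<in> {..<N} \<rightarrow> carrier (over_S U)"
    using fU[OF os[OF _ x]] act_closed(1)[OF ai] by (auto simp: orbit_sum_def)
  qed
  also have "\<dots> = x"
   by (rule semilinear_expansion[OF V.left_module_axioms psi_additive_over_S]) (use psi_S x in auto)
  finally show ?thesis .
 qed
 have Hg: "H (g z) = z" if z: "z \<in> carrier (BM fixed)" for z
 proof (rule BM_eqI[OF M BM_abelian[OF M] add_hom_comp[OF ga H_add] add_hom_id _ z])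
  fix s x assume s: "s \<in> carrier S" and x: "x \<in> carrier fixed"
  have "H (g (tM fixed s x)) = (\<Oplus>\<^bsub>BM fixed\<^esub>i\<in>{..<N}. tM fixed (a i \<otimes> tr (b i \<otimes> s)) x)"
   unfolding H_def g(2)[OF s x]
  proof (rule abelian_monoid.finsum_cong'[OF abelian_group.axioms(1)[OF BM_abelian[OF M]] refl])
   fix i assume "i \<in> {..<N}"
   then have i: "i < N" by simp
   have bs: "b i \<otimes> s \<in> carrier S" using bi[OF i] s by simp
   have "inS (b i) \<odot>\<^bsub>U\<^esub> (inS s \<odot>\<^bsub>U\<^esub> x) = inS (b i \<otimes> s) \<odot>\<^bsub>U\<^esub> x"
    using V.smult_assoc[OF bi[OF i] s, of x] fU[OF x] by simp
   then have "orbit_sum (inS (b i) \<odot>\<^bsub>U\<^esub> (inS s \<odot>\<^bsub>U\<^esub> x)) =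
     (tr (b i \<otimes> s) \<odot>\<^bsub>A\<^esub> \<one>\<^bsub>A\<^esub>) \<odot>\<^bsub>fixed\<^esub> x"
    using orbit_sum_S[OF bs x] scal[OF tr_R[OF bs]] by simp
   then have "tM fixed (a i) (orbit_sum (inS (b i) \<odot>\<^bsub>U\<^esub> (inS s \<odot>\<^bsub>U\<^esub> x))) =
     tM fixed (tr (b i \<otimes> s) \<otimes> a i) x"
    unfolding tM_balanced[OF M tr_R[OF bs] ai[OF i] x] by (rule arg_cong)
   also have "\<dots> = tM fixed (a i \<otimes> tr (b i \<otimes> s)) x"
    using S.m_comm[OF tr_closed[OF bs] ai[OF i]] by simp
   finally show "tM fixed (a i) (orbit_sum (inS (b i) \<odot>\<^bsub>U\<^esub> (inS s \<odot>\<^bsub>U\<^esub> x))) =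
     tM fixed (a i \<otimes> tr (b i \<otimes> s)) x" .
  qed (use tM_closed[OF M _ x] ai bi s tr_closed in auto)
  also have "\<dots> = tM fixed (\<Oplus>i\<in>{..<N}. a i \<otimes> tr (b i \<otimes> s)) x"
   by (rule add_hom_finsum[OF S.abelian_group_axioms BM_abelian[OF M] additive_tM_left[OF M x], symmetric])
    (use ai bi s tr_closed in auto)
  finally show "H (g (tM fixed s x)) = tM fixed s x" unfolding tr_expansion[OF s] .
 qed
 show ?thesis
 proof (rule that[OF _ _ g(2)])
  show "g \<in> left_module_hom A' (BM fixed) U"
   by (rule tensor_module_homI[OF BM_tensor_module[OF M] left_module_tensor_module[OF U] g(1) act[OF _ A.one_closed] act[OF S.one_closed]])
  show "bij_betw g (carrier (BM fixed)) (carrier U)"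
   by (rule bij_betw_byWitness[where f' = H])
    (use gH Hg add_hom_closed[OF g(1)] add_hom_closed[OF H_add] in auto)
 qed
qed

end

end

section \<open>Descent of complexes\<close>

context galois_complex
begin

text \<open>Stability is applied to a single Galois element, the one whose lift is
  \<open>F\<close>.\<close>

lemma descent_exists:
 assumes stable: "galois_stable R S A C" and radical: "jacobson_radical S = S.residue_ideal"
 shows "\<exists>D :: ('a, 'm) chain_complex. is_bounded_fg_complex A D \<and>
  complex_isomorphic A' (base_change_complex R S A D) C"
proof -
 obtain \<sigma> where \<sigma>: "\<sigma> \<in> residue_galois_group R S" "residue_lift S \<sigma> = restrict F (carrier S)"
  by (rule residue_galois_of_automorphism[OF radical F_hom F_fix m_pos F_order])
 let ?F = "restrict F (carrier S)"
 have auto: "S_linear_auto ?F"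
  using residue_lift_automorphism[OF radical \<sigma>(1)] unfolding \<sigma>(2) S_linear_auto_def by blast
 then have bijF: "bij_betw ?F (carrier S) (carrier S)" by (simp add: S_linear_auto_def)
 have invF: "inv_into (carrier S) ?F (F s) = s" if "s \<in> carrier S" for s
  using bij_betw_inv_into_left[OF bijF that] that by simp
 have "complex_isomorphic A' (galois_twist_complex R S A ?F C) C"
  using stable \<sigma> unfolding galois_stable_def by metis
 then obtain phi where phi: "\<And>n. phi n \<in> left_module_hom A' (galois_twist R S A ?F (Cn n)) (Cn n)"
   "\<And>n. bij_betw (phi n) (carrier (Cn n)) (carrier (Cn n))"
   "\<And>n x. x \<in> carrier (Cn n) \<Longrightarrow> phi (n - 1) (d n x) = d n (phi n x)"
  by (auto simp: complex_isomorphic_def galois_twist_complex_def)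
 \<comment> \<open>The twist acts through the inverse of \<open>F\<close>; using linearity at the
   scalar \<open>F s\<close> in place of \<open>s\<close> turns it into
   \<open>F\<close>-semilinearity.\<close>
 have pure: "phi n (tA s c \<odot>\<^bsub>Cn n\<^esub> x) = tA (F s) c \<odot>\<^bsub>Cn n\<^esub> phi n x"
  if s: "s \<in> carrier S" and c: "c \<in> carrier A" and x: "x \<in> carrier (Cn n)" for n s c x
  using left_module_hom_smult[OF phi(1) tA_closed[OF ring_hom_closed[OF F_hom s] c], of x n] x
  by (simp add: twist_smult_pure[OF auto ring_hom_closed[OF F_hom s] c] invF[OF s])
 have phi_semi: "semi_chain F phi"
  unfolding semi_chain_def
  using left_module_hom_additive[OF phi(1)] phi(3) pure[OF _ A.one_closed] pure[OF S.one_closed] ring_hom_one[OF F_hom]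
  by (simp add: add_hom_def)
 obtain psi where psi: "semi_chain F psi" "\<And>n x. x \<in> carrier (Cn n) \<Longrightarrow> (psi n ^^ m) x = x"
  by (rule descent_chain_exists[OF phi_semi phi(2)]; rule that; assumption)
 note psiD = semi_chainD[OF psi(1)]
 define D :: "('a, 'm) chain_complex" where
  "D = \<lparr>chain_obj = \<lambda>n. fixed_module (over_A (Cn n)) (psi n), chain_diff = d\<rparr>"
 have D_obj: "chain_obj D n = fixed_module (over_A (Cn n)) (psi n)" and D_diff: "chain_diff D n = d n" for n
  by (simp_all add: D_def)
 have M: "left_module A (chain_obj D n)" for n
  unfolding D_obj by (rule fixed_left_module[OF Cn_module psiD(1,2,3) psi(2)])
 have dD: "d n \<in> left_module_hom A (chain_obj D n) (chain_obj D (n - 1))" for n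
  unfolding D_obj
  by (rule left_module_homI, rule add_homI)
   (auto simp: d_closed psiD(4) add_hom_add[OF d_additive] d_act_A)
 have "is_chain_complex A D"
  unfolding is_chain_complex_def
  using M dD complex by (auto simp: D_obj D_diff is_bounded_fg_complex_def is_chain_complex_def)
 moreover have "bounded_complex D"
 proof -
  have z: "psi n \<zero>\<^bsub>Cn n\<^esub> = \<zero>\<^bsub>Cn n\<^esub>" for n by (rule add_hom_zero[OF Cn_abelian Cn_abelian psiD(1)])
  have "bounded_complex C" using complex by (simp add: is_bounded_fg_complex_def)
  then obtain u v where uv: "\<And>n. n < u \<or> v < n \<Longrightarrow> carrier (Cn n) = {\<zero>\<^bsub>Cn n\<^esub>}"
   unfolding bounded_complex_def by blast
  have "carrier (chain_obj D n) = {\<zero>\<^bsub>chain_obj D n\<^esub>}" if "n < u \<or> v < n" for n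
   unfolding D_obj fixed_module_simps change_scalars_simps uv[OF that] using z[of n] by auto
  then show ?thesis unfolding bounded_complex_def by blast
 qed
 moreover have "finitely_generated_module A (chain_obj D n)" for n
  unfolding D_obj by (rule fixed_finitely_generated[OF Cn_module psiD(1,2,3) psi(2) Cn_fg])
 ultimately have "is_bounded_fg_complex A D" unfolding is_bounded_fg_complex_def by blast
 moreover have "complex_isomorphic A' (base_change_complex R S A D) C"
 proof -
  have "\<forall>n. \<exists>g. g \<in> left_module_hom A' (BM (chain_obj D n)) (Cn n) \<and>
    bij_betw g (carrier (BM (chain_obj D n))) (carrier (Cn n)) \<and>
    (\<forall>s\<in>carrier S. \<forall>x\<in>carrier (chain_obj D n). g (tM (chain_obj D n) s x) = act_S n s x)"
  proof
   fix n
   let ?M = "fixed_module (over_A (Cn n)) (psi n)"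
   obtain g where "g \<in> left_module_hom A' (BM ?M) (Cn n)"
    "bij_betw g (carrier (BM ?M)) (carrier (Cn n))"
    "\<And>s x. \<lbrakk>s \<in> carrier S; x \<in> carrier ?M\<rbrakk> \<Longrightarrow> g (tM ?M s x) = act_S n s x"
    by (rule fixed_base_change[of "Cn n" "psi n", OF Cn_module psiD(1,2,3) psi(2)]; (rule that | assumption); assumption)
   then show "\<exists>g. g \<in> left_module_hom A' (BM (chain_obj D n)) (Cn n) \<and>
    bij_betw g (carrier (BM (chain_obj D n))) (carrier (Cn n)) \<and>
    (\<forall>s\<in>carrier S. \<forall>x\<in>carrier (chain_obj D n). g (tM (chain_obj D n) s x) = act_S n s x)"
    unfolding D_obj by blast
  qed
  then obtain g where g: "\<And>n. g n \<in> left_module_hom A' (BM (chain_obj D n)) (Cn n)"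
    "\<And>n. bij_betw (g n) (carrier (BM (chain_obj D n))) (carrier (Cn n))"
    "\<And>n s x. \<lbrakk>s \<in> carrier S; x \<in> carrier (chain_obj D n)\<rbrakk> \<Longrightarrow> g n (tM (chain_obj D n) s x) = act_S n s x"
   by metis
  have "g (n - 1) (tensor_map R S_mod (restrict_scalars A (chain_obj D (n - 1))) (\<lambda>s. s) (d n) z) = d n (g n z)"
   if z: "z \<in> carrier (BM (chain_obj D n))" for n z
  proof (rule BM_eqI[OF M Cn_abelian _ _ _ z])
   note D = base_change_map[OF M M id_hom dD]
   show "(\<lambda>z. g (n - 1) (tensor_map R S_mod (restrict_scalars A (chain_obj D (n - 1))) (\<lambda>s. s) (d n) z))
     \<in> add_hom (BM (chain_obj D n)) (Cn (n - 1))"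
    by (rule add_hom_comp[OF D(1) left_module_hom_additive[OF g(1)]])
   show "(\<lambda>z. d n (g n z)) \<in> add_hom (BM (chain_obj D n)) (Cn (n - 1))"
    by (rule add_hom_comp[OF left_module_hom_additive[OF g(1)] d_additive])
   fix s x assume s: "s \<in> carrier S" and x: "x \<in> carrier (chain_obj D n)"
   have x': "x \<in> carrier (Cn n)" using x by (simp add: D_obj)
   show "g (n - 1) (tensor_map R S_mod (restrict_scalars A (chain_obj D (n - 1))) (\<lambda>s. s) (d n) (tM (chain_obj D n) s x)) =
     d n (g n (tM (chain_obj D n) s x))"
    unfolding D(2)[OF s x] g(3)[OF s x] g(3)[OF s left_module_hom_closed[OF dD x]] d_act_S[OF s x'] ..
  qed
  then show ?thesis
   unfolding complex_isomorphic_def using g(1,2)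
   by (intro exI[of _ g]) (simp add: base_change_complex_def D_diff)
 qed
 ultimately show ?thesis by blast
qed

end

section \<open>Recovering a module from its base change\<close>

context galois_base_change
begin

abbreviation twist :: "('a, 'n) module \<Rightarrow> ('s \<times> 'n \<Rightarrow>\<^sub>0 int) set \<Rightarrow> ('s \<times> 'n \<Rightarrow>\<^sub>0 int) set" where
 "twist M \<equiv> tensor_map R S_mod (restrict_scalars A M) F (\<lambda>x. x)"

context
 fixes M :: "('a, 'n) module"
 assumes M: "left_module A M"
begin

lemmas twist_additive = base_change_map(1)[OF M M S_linear_auto_hom[OF F_linear_auto] id_hom]
lemmas twist_pure = base_change_map(2)[OF M M S_linear_auto_hom[OF F_linear_auto] id_hom]

lemmas twist_smult = base_change_map_smult[OF F_linear_auto M]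

lemma twist_pow_pure: "\<lbrakk>s \<in> carrier S; x \<in> carrier M\<rbrakk> \<Longrightarrow> (twist M ^^ j) (tM M s x) = tM M ((F ^^ j) s) x"
 by (induction j) (auto simp: twist_pure F_pow_closed)

lemma twist_order: "z \<in> carrier (BM M) \<Longrightarrow> (twist M ^^ m) z = z"
 by (rule BM_eqI[OF M BM_abelian[OF M] add_hom_funpow[OF twist_additive] add_hom_id])
  (auto simp: twist_pow_pure F_order)

lemma BM_one: "z \<in> carrier (BM M) \<Longrightarrow> inA \<one>\<^bsub>A\<^esub> \<odot>\<^bsub>BM M\<^esub> z = z"
 by (rule BM_eqI[OF M BM_abelian[OF M] BM_additive_right[OF M tA_closed[OF S.one_closed A.one_closed]] add_hom_id])
  (auto simp: BM_smult_pure[OF M] left_module.smult_one[OF M])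

text \<open>
 \<open>s \<otimes> x \<mapsto> tr (\<theta> s) x\<close>, where \<open>tr \<theta> = 1\<close>, retracts \<open>S \<otimes> M\<close> onto \<open>M\<close>.
\<close>

lemma twist_fixed_points:
 obtains \<rho> where "\<And>z. z \<in> carrier (BM M) \<Longrightarrow> \<rho> z \<in> carrier M"
  "\<And>x. x \<in> carrier M \<Longrightarrow> \<rho> (tM M \<one> x) = x"
  "\<And>z. \<lbrakk>z \<in> carrier (BM M); twist M z = z\<rbrakk> \<Longrightarrow> tM M \<one> (\<rho> z) = z"
proof -
 obtain \<theta> where th: "\<theta> \<in> carrier S" "tr \<theta> = \<one>" by (rule tr_surjective)
 let ?M = "restrict_scalars A M"
 interpret M: left_module A M by (rule M)
 interpret rM: left_module R ?M by (rule restrict_left_module[OF M])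
 have th_add: "(\<lambda>s. tr (\<theta> \<otimes> s)) \<in> add_hom S R"
  by (rule add_homI)
   (use th(1) in \<open>auto simp: S.r_distr add_hom_add[OF tr_additive] tr_R add_R\<close>)
 have thR: "tr (\<theta> \<otimes> s) \<in> carrier R" if "s \<in> carrier S" for s using that th(1) by (simp add: tr_R)
 obtain \<rho> where \<rho>: "\<rho> \<in> add_hom (BM M) M"
  "\<And>s x. \<lbrakk>s \<in> carrier S; x \<in> carrier M\<rbrakk> \<Longrightarrow> \<rho> (tM M s x) = tr (\<theta> \<otimes> s) \<odot>\<^bsub>?M\<^esub> x"
 proof (rule BM_universal[OF M M.M.abelian_group_axioms, of "\<lambda>s x. tr (\<theta> \<otimes> s) \<odot>\<^bsub>?M\<^esub> x"])
  show "tr (\<theta> \<otimes> s) \<odot>\<^bsub>?M\<^esub> x \<in> carrier M" if "s \<in> carrier S" "x \<in> carrier M" for s x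
   using rM.smult_closed[OF thR[OF that(1)], of x] that(2) by simp
  show "(\<lambda>s. tr (\<theta> \<otimes> s) \<odot>\<^bsub>?M\<^esub> x) \<in> add_hom S M" if "x \<in> carrier M" for x
   using add_hom_comp[OF th_add rM.additive_smult_left[of x]] that by (simp add: add_hom_def)
  show "(\<lambda>x. tr (\<theta> \<otimes> s) \<odot>\<^bsub>?M\<^esub> x) \<in> add_hom M M" if "s \<in> carrier S" for s
   using rM.additive_smult_right[OF thR[OF that]] by (simp add: add_hom_def)
  show "tr (\<theta> \<otimes> (r \<otimes> s)) \<odot>\<^bsub>?M\<^esub> x = tr (\<theta> \<otimes> s) \<odot>\<^bsub>?M\<^esub> ((r \<odot>\<^bsub>A\<^esub> \<one>\<^bsub>A\<^esub>) \<odot>\<^bsub>M\<^esub> x)"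
   if r: "r \<in> carrier R" and s: "s \<in> carrier S" and x: "x \<in> carrier M" for r s x
  proof -
   have "tr (\<theta> \<otimes> (r \<otimes> s)) = tr (\<theta> \<otimes> s) \<otimes>\<^bsub>R\<^esub> r"
    using tr_R_mult[OF r, of "\<theta> \<otimes> s"] th(1) s subset[OF r] S.m_lcomm[OF th(1) subset[OF r] s]
     mult_R[OF thR[OF s] r] S.m_comm[OF subset[OF r] subset[OF thR[OF s]]] by simp
   then show ?thesis using rM.smult_assoc[OF thR[OF s] r, of x] x by simp
  qed
 qed (rule that; assumption)
 \<comment> \<open>Both sides are additive in \<open>z\<close>, so pure tensors suffice. On a fixed
   point the left side collapses to \<open>tr \<theta>\<close> times \<open>z\<close>, that is to
   \<open>z\<close>.\<close>
 have average: "(\<Oplus>\<^bsub>BM M\<^esub>j\<in>{..<m}. (twist M ^^ j) (tA \<theta> \<one>\<^bsub>A\<^esub> \<odot>\<^bsub>BM M\<^esub> z)) = tM M \<one> (\<rho> z)"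
  if z: "z \<in> carrier (BM M)" for z
 proof (rule BM_eqI[OF M BM_abelian[OF M] _ _ _ z])
  show "(\<lambda>z. \<Oplus>\<^bsub>BM M\<^esub>j\<in>{..<m}. (twist M ^^ j) (tA \<theta> \<one>\<^bsub>A\<^esub> \<odot>\<^bsub>BM M\<^esub> z)) \<in> add_hom (BM M) (BM M)"
   by (rule add_hom_finsum_fun[OF BM_abelian[OF M] BM_abelian[OF M]
      add_hom_comp[OF BM_additive_right[OF M tA_closed[OF th(1) A.one_closed]] add_hom_funpow[OF twist_additive]]])
  show "(\<lambda>z. tM M \<one> (\<rho> z)) \<in> add_hom (BM M) (BM M)"
   by (rule add_hom_comp[OF \<rho>(1) additive_tM_right[OF M S.one_closed]])
  fix s x assume s: "s \<in> carrier S" and x: "x \<in> carrier M"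
  have ts: "\<theta> \<otimes> s \<in> carrier S" using th(1) s by simp
  have "tM M (tr (\<theta> \<otimes> s)) x = (\<Oplus>\<^bsub>BM M\<^esub>j\<in>{..<m}. tM M ((F ^^ j) (\<theta> \<otimes> s)) x)"
   unfolding tr_def
   by (rule add_hom_finsum[OF S.abelian_group_axioms BM_abelian[OF M] additive_tM_left[OF M x]])
    (use F_pow_closed ts in auto)
  moreover have "tM M (tr (\<theta> \<otimes> s)) x = tM M \<one> (\<rho> (tM M s x))"
   using tM_balanced[OF M thR[OF s] S.one_closed x] tr_closed[OF ts] by (simp add: \<rho>(2)[OF s x])
  ultimately show "(\<Oplus>\<^bsub>BM M\<^esub>j\<in>{..<m}. (twist M ^^ j) (tA \<theta> \<one>\<^bsub>A\<^esub> \<odot>\<^bsub>BM M\<^esub> tM M s x)) = tM M \<one> (\<rho> (tM M s x))"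
   by (simp add: BM_smult_pure[OF M th(1) A.one_closed s x] M.smult_one[OF x] twist_pow_pure[OF ts x])
 qed
 show ?thesis
 proof (rule that)
  show "\<rho> z \<in> carrier M" if "z \<in> carrier (BM M)" for z by (rule add_hom_closed[OF \<rho>(1) that])
  show "\<rho> (tM M \<one> x) = x" if "x \<in> carrier M" for x
   using \<rho>(2)[OF S.one_closed that] th rM.smult_one[of x] that one_R by simp
  fix z assume z: "z \<in> carrier (BM M)" "twist M z = z"
  have pow: "(twist M ^^ j) (tA \<theta> \<one>\<^bsub>A\<^esub> \<odot>\<^bsub>BM M\<^esub> z) = inS ((F ^^ j) \<theta>) \<odot>\<^bsub>BM M\<^esub> z" for j
   by (induction j) (auto simp: twist_smult[OF F_pow_closed[OF th(1)] A.one_closed z(1)] z(2))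
  have sm: "(\<lambda>s. inS s \<odot>\<^bsub>BM M\<^esub> z) \<in> add_hom S (BM M)"
   by (rule add_hom_comp[OF additive_tA_left[OF A.one_closed] BM_additive_left[OF M z(1)]])
  have "(\<Oplus>\<^bsub>BM M\<^esub>j\<in>{..<m}. inS ((F ^^ j) \<theta>) \<odot>\<^bsub>BM M\<^esub> z) = inS (tr \<theta>) \<odot>\<^bsub>BM M\<^esub> z"
   unfolding tr_def
   by (rule add_hom_finsum[OF S.abelian_group_axioms BM_abelian[OF M] sm, symmetric])
    (use F_pow_closed th(1) in auto)
  then show "tM M \<one> (\<rho> z) = z"
   using average[OF z(1)] unfolding pow th(2) BM_one[OF z(1)] by simp
 qed
qed

end

end

lemma left_module_hom_inv:
 assumes f: "f \<in> left_module_hom Q M N" "bij_betw f (carrier M) (carrier N)"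
  and add: "\<And>x y. \<lbrakk>x \<in> carrier M; y \<in> carrier M\<rbrakk> \<Longrightarrow> x \<oplus>\<^bsub>M\<^esub> y \<in> carrier M"
  and smult: "\<And>q x. \<lbrakk>q \<in> carrier Q; x \<in> carrier M\<rbrakk> \<Longrightarrow> q \<odot>\<^bsub>M\<^esub> x \<in> carrier M"
 shows "inv_into (carrier M) f \<in> left_module_hom Q N M"
proof -
 let ?g = "inv_into (carrier M) f"
 note gc = bij_betw_apply[OF bij_betw_inv_into[OF f(2)]]
 note fg = bij_betw_inv_into_right[OF f(2)] and gf = bij_betw_inv_into_left[OF f(2)]
 show ?thesis
 proof (rule left_module_homI, rule add_homI)
  show "?g (x \<oplus>\<^bsub>N\<^esub> y) = ?g x \<oplus>\<^bsub>M\<^esub> ?g y" if x: "x \<in> carrier N" and y: "y \<in> carrier N" for x y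
   using gf[OF add[OF gc[OF x] gc[OF y]]] left_module_hom_add[OF f(1) gc[OF x] gc[OF y]]
   by (simp add: fg[OF x] fg[OF y])
  show "?g (q \<odot>\<^bsub>N\<^esub> x) = q \<odot>\<^bsub>M\<^esub> ?g x" if q: "q \<in> carrier Q" and x: "x \<in> carrier N" for q x
   using gf[OF smult[OF q gc[OF x]]] left_module_hom_smult[OF f(1) q gc[OF x]] by (simp add: fg[OF x])
 qed (rule gc)
qed

lemma left_module_hom_comp:
 "\<lbrakk>f \<in> left_module_hom Q M N; g \<in> left_module_hom Q N L\<rbrakk> \<Longrightarrow> (\<lambda>x. g (f x)) \<in> left_module_hom Q M L"
 by (auto simp: left_module_hom_def Pi_iff)

context galois_base_change
begin

text \<open>The retraction from \<open>twist_fixed_points\<close> is a left inverse of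
  \<open>x \<mapsto> 1 \<otimes> x\<close>.\<close>

lemma tM_one_inj:
 assumes "left_module A M" "x \<in> carrier M" "y \<in> carrier M" "tM M \<one> x = tM M \<one> y"
 shows "x = y"
proof -
 obtain \<rho> where "\<And>x. x \<in> carrier M \<Longrightarrow> \<rho> (tM M \<one> x) = x"
  by (rule twist_fixed_points[OF assms(1)]; rule that; assumption)
 then show ?thesis using assms(2-4) by metis
qed

text \<open>\<open>M\<close> and \<open>L\<close> are the fixed points of
  \<open>F \<otimes> 1\<close> on their base changes, embedded as \<open>1 \<otimes> x\<close>. An
  isomorphism commuting with these twists restricts to the fixed points, and so does its
  inverse.\<close>

lemma descend_isomorphism:
 assumes M: "left_module A M" and L: "left_module A L"
  and w: "w \<in> left_module_hom A' (BM M) (BM L)" "bij_betw w (carrier (BM M)) (carrier (BM L))"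
  and tw: "\<And>z. z \<in> carrier (BM M) \<Longrightarrow> twist L (w z) = w (twist M z)"
 obtains h where "h \<in> left_module_hom A M L" "bij_betw h (carrier M) (carrier L)"
  "\<And>x. x \<in> carrier M \<Longrightarrow> tM L \<one> (h x) = w (tM M \<one> x)"
proof -
 interpret M: left_module A M by (rule M)
 interpret L: left_module A L by (rule L)
 obtain \<rho>M where \<rho>M: "\<And>z. z \<in> carrier (BM M) \<Longrightarrow> \<rho>M z \<in> carrier M"
  "\<And>z. \<lbrakk>z \<in> carrier (BM M); twist M z = z\<rbrakk> \<Longrightarrow> tM M \<one> (\<rho>M z) = z"
  by (rule twist_fixed_points[OF M]; rule that; assumption)
 obtain \<rho>L where \<rho>L: "\<And>z. z \<in> carrier (BM L) \<Longrightarrow> \<rho>L z \<in> carrier L"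
  "\<And>z. \<lbrakk>z \<in> carrier (BM L); twist L z = z\<rbrakk> \<Longrightarrow> tM L \<one> (\<rho>L z) = z"
  by (rule twist_fixed_points[OF L]; rule that; assumption)
 define h where "h x = \<rho>L (w (tM M \<one> x))" for x
 note wc = left_module_hom_closed[OF w(1)]
 note M1 = tM_closed[OF M S.one_closed] and L1 = tM_closed[OF L S.one_closed]
 have tM1: "twist M (tM M \<one> x) = tM M \<one> x" if "x \<in> carrier M" for x
  using twist_pure[OF M S.one_closed that] ring_hom_one[OF F_hom] by simp
 have tL1: "twist L (tM L \<one> x) = tM L \<one> x" if "x \<in> carrier L" for x
  using twist_pure[OF L S.one_closed that] ring_hom_one[OF F_hom] by simp
 have hc: "h x \<in> carrier L" if "x \<in> carrier M" for x
  unfolding h_def by (rule \<rho>L(1)[OF wc[OF M1[OF that]]])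
 have h: "tM L \<one> (h x) = w (tM M \<one> x)" if x: "x \<in> carrier M" for x
  unfolding h_def using \<rho>L(2)[OF wc[OF M1[OF x]]] tw[OF M1[OF x]] tM1[OF x] by simp
 note injL = tM_one_inj[OF L]
 show ?thesis
 proof (rule that)
  show "tM L \<one> (h x) = w (tM M \<one> x)" if "x \<in> carrier M" for x by (rule h[OF that])
  show "h \<in> left_module_hom A M L"
  proof (rule left_module_homI, rule add_homI)
   show "h (x \<oplus>\<^bsub>M\<^esub> y) = h x \<oplus>\<^bsub>L\<^esub> h y" if x: "x \<in> carrier M" and y: "y \<in> carrier M" for x y
   proof (rule injL)
    have "tM L \<one> (h (x \<oplus>\<^bsub>M\<^esub> y)) = w (tM M \<one> x \<oplus>\<^bsub>BM M\<^esub> tM M \<one> y)"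
     using h[of "x \<oplus>\<^bsub>M\<^esub> y"] add_hom_add[OF additive_tM_right[OF M S.one_closed] x y] x y by simp
    also have "\<dots> = tM L \<one> (h x) \<oplus>\<^bsub>BM L\<^esub> tM L \<one> (h y)"
     using left_module_hom_add[OF w(1) M1[OF x] M1[OF y]] h[OF x] h[OF y] by simp
    also have "\<dots> = tM L \<one> (h x \<oplus>\<^bsub>L\<^esub> h y)"
     by (rule add_hom_add[OF additive_tM_right[OF L S.one_closed] hc[OF x] hc[OF y], symmetric])
    finally show "tM L \<one> (h (x \<oplus>\<^bsub>M\<^esub> y)) = tM L \<one> (h x \<oplus>\<^bsub>L\<^esub> h y)" .
   qed (use hc x y in auto)
   show "h (c \<odot>\<^bsub>M\<^esub> x) = c \<odot>\<^bsub>L\<^esub> h x" if c: "c \<in> carrier A" and x: "x \<in> carrier M" for c x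
   proof (rule injL)
    have "tM L \<one> (h (c \<odot>\<^bsub>M\<^esub> x)) = w (inA c \<odot>\<^bsub>BM M\<^esub> tM M \<one> x)"
     using h[OF M.smult_closed[OF c x]] BM_smult_pure[OF M S.one_closed c S.one_closed x] by simp
    also have "\<dots> = inA c \<odot>\<^bsub>BM L\<^esub> tM L \<one> (h x)"
     using left_module_hom_smult[OF w(1) tA_closed[OF S.one_closed c] M1[OF x]] h[OF x] by simp
    also have "\<dots> = tM L \<one> (c \<odot>\<^bsub>L\<^esub> h x)"
     using BM_smult_pure[OF L S.one_closed c S.one_closed hc[OF x]] by simp
    finally show "tM L \<one> (h (c \<odot>\<^bsub>M\<^esub> x)) = tM L \<one> (c \<odot>\<^bsub>L\<^esub> h x)" .
   qed (use hc L.smult_closed M.smult_closed c x in auto)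
  qed (rule hc)
  have w_inj: "u = z" if "u \<in> carrier (BM M)" "z \<in> carrier (BM M)" "w u = w z" for u z
   using bij_betw_imp_inj_on[OF w(2)] that by (simp add: inj_on_def)
  show "bij_betw h (carrier M) (carrier L)"
  proof (rule bij_betwI')
   show "(h x = h y) = (x = y)" if x: "x \<in> carrier M" and y: "y \<in> carrier M" for x y
   proof
    assume "h x = h y"
    then have "w (tM M \<one> x) = w (tM M \<one> y)" using h[OF x] h[OF y] by simp
    then show "x = y" by (rule tM_one_inj[OF M x y w_inj[OF M1[OF x] M1[OF y]]])
   qed simp
   show "\<exists>x\<in>carrier M. y = h x" if y: "y \<in> carrier L" for y
   proof -
    have "tM L \<one> y \<in> w ` carrier (BM M)" unfolding bij_betw_imp_surj_on[OF w(2)] by (rule L1[OF y])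
    then obtain z where z: "tM L \<one> y = w z" "z \<in> carrier (BM M)" by (rule imageE)
    \<comment> \<open>The preimage of a fixed point is fixed, because \<open>w\<close> is injective
      and commutes with the twists.\<close>
    have "w (twist M z) = w z" using tw[OF z(2)] tL1[OF y] z(1) by simp
    then have fz: "twist M z = z"
     by (rule w_inj[OF add_hom_closed[OF twist_additive[OF M] z(2)] z(2)])
    have "tM L \<one> y = tM L \<one> (h (\<rho>M z))" using h[OF \<rho>M(1)[OF z(2)]] \<rho>M(2)[OF z(2) fz] z(1) by simp
    then have "y = h (\<rho>M z)" by (rule injL[OF y hc[OF \<rho>M(1)[OF z(2)]]])
    then show ?thesis using \<rho>M(1)[OF z(2)] by blast
   qed
  qed (rule hc)
 qed
qed

end

section \<open>Uniqueness of the descended complex\<close>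

context galois_complex
begin

abbreviation base_diff :: "('a, 'n) chain_complex \<Rightarrow> int \<Rightarrow> ('s \<times> 'n \<Rightarrow>\<^sub>0 int) set \<Rightarrow> ('s \<times> 'n \<Rightarrow>\<^sub>0 int) set" where
 "base_diff D n \<equiv> tensor_map R S_mod (restrict_scalars A (chain_obj D (n - 1))) (\<lambda>s. s) (chain_diff D n)"

text \<open>An isomorphism from the base change of \<open>D\<close> to \<open>C\<close> carries
  \<open>F \<otimes> 1\<close> to a semilinear automorphism of \<open>C\<close> whose
  \<open>m\<close>-th power is trivial. Every form of \<open>C\<close> over \<open>A\<close> is
  thereby encoded by a descent datum on the one complex \<open>C\<close>, where the uniqueness
  theorem applies.\<close>

lemma twist_transport:
 fixes D :: "('a, 'n) chain_complex"
 assumes D: "is_chain_complex A D" and iso: "complex_isomorphic A' (base_change_complex R S A D) C"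
 obtains G psi where
  "\<And>n. G n \<in> left_module_hom A' (BM (chain_obj D n)) (Cn n)"
  "\<And>n. bij_betw (G n) (carrier (BM (chain_obj D n))) (carrier (Cn n))"
  "\<And>n z. z \<in> carrier (BM (chain_obj D n)) \<Longrightarrow> G (n - 1) (base_diff D n z) = d n (G n z)"
  "semi_chain F psi" "\<And>n x. x \<in> carrier (Cn n) \<Longrightarrow> (psi n ^^ m) x = x"
  "\<And>n z. z \<in> carrier (BM (chain_obj D n)) \<Longrightarrow> psi n (G n z) = G n (twist (chain_obj D n) z)"
proof -
 have M: "left_module A (chain_obj D n)" and dD: "chain_diff D n \<in> left_module_hom A (chain_obj D n) (chain_obj D (n - 1))" for n
  using D by (auto simp: is_chain_complex_def)
 obtain G where G: "\<And>n. G n \<in> left_module_hom A' (BM (chain_obj D n)) (Cn n)"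
  "\<And>n. bij_betw (G n) (carrier (BM (chain_obj D n))) (carrier (Cn n))"
  "\<And>n z. z \<in> carrier (BM (chain_obj D n)) \<Longrightarrow> G (n - 1) (base_diff D n z) = d n (G n z)"
  using iso by (auto simp: complex_isomorphic_def base_change_complex_def)
 define psi where "psi n x = G n (twist (chain_obj D n) (inv_into (carrier (BM (chain_obj D n))) (G n) x))" for n x
 have psiG: "psi n (G n z) = G n (twist (chain_obj D n) z)" if "z \<in> carrier (BM (chain_obj D n))" for n z
  unfolding psi_def using bij_betw_inv_into_left[OF G(2) that] by simp
 have surj: "\<exists>z\<in>carrier (BM (chain_obj D n)). x = G n z" if "x \<in> carrier (Cn n)" for n x
  using bij_betw_imp_surj_on[OF G(2)] that by (metis imageE)
 note tc = add_hom_closed[OF twist_additive[OF M]]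
 note Gc = left_module_hom_closed[OF G(1)] and Ga = left_module_hom_add[OF G(1)] and Gs = left_module_hom_smult[OF G(1)]
 interpret B: abelian_group "BM (chain_obj D n)" for n by (rule BM_abelian[OF M])
 note Bs = tensor_moduleD(4)[OF BM_tensor_module[OF M]]
 have psi_act: "psi n (tA s c \<odot>\<^bsub>Cn n\<^esub> x) = tA (F s) c \<odot>\<^bsub>Cn n\<^esub> psi n x"
  if s: "s \<in> carrier S" and c: "c \<in> carrier A" and x: "x \<in> carrier (Cn n)" for n s c x
 proof -
  obtain z where z: "z \<in> carrier (BM (chain_obj D n))" "x = G n z" using surj[OF x] by blast
  show ?thesis
   unfolding z(2) psiG[OF z(1)] Gs[OF tA_closed[OF s c] z(1), symmetric] psiG[OF Bs[OF tA_closed[OF s c] z(1)]]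
    twist_smult[OF M s c z(1)]
   by (rule Gs[OF tA_closed[OF ring_hom_closed[OF F_hom s] c] tc[OF z(1)]])
 qed
 have semi: "semi_chain F psi"
  unfolding semi_chain_def
 proof (intro allI conjI ballI)
  fix n
  show "psi n \<in> add_hom (Cn n) (Cn n)"
  proof (rule add_homI)
   fix x assume x: "x \<in> carrier (Cn n)"
   then obtain z where z: "z \<in> carrier (BM (chain_obj D n))" "x = G n z" using surj by blast
   show "psi n x \<in> carrier (Cn n)" unfolding z(2) psiG[OF z(1)] by (rule Gc[OF tc[OF z(1)]])
   fix y assume y: "y \<in> carrier (Cn n)"
   then obtain u where u: "u \<in> carrier (BM (chain_obj D n))" "y = G n u" using surj by blast
   show "psi n (x \<oplus>\<^bsub>Cn n\<^esub> y) = psi n x \<oplus>\<^bsub>Cn n\<^esub> psi n y"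
    unfolding z(2) u(2) psiG[OF z(1)] psiG[OF u(1)] Ga[OF z(1) u(1), symmetric] psiG[OF B.a_closed[OF z(1) u(1)]]
     add_hom_add[OF twist_additive[OF M] z(1) u(1)]
    by (rule Ga[OF tc[OF z(1)] tc[OF u(1)]])
  qed
  fix x assume x: "x \<in> carrier (Cn n)"
  show "psi n (act_S n s x) = act_S n (F s) (psi n x)" if "s \<in> carrier S" for s
   by (rule psi_act[OF that A.one_closed x])
  show "psi n (act_A n c x) = act_A n c (psi n x)" if "c \<in> carrier A" for c
   using psi_act[OF S.one_closed that x] ring_hom_one[OF F_hom] by simp
  obtain z where z: "z \<in> carrier (BM (chain_obj D n))" "x = G n z" using surj[OF x] by blast
  note bd = base_change_map[OF M M id_hom dD[of n]]
  have "base_diff D n (twist (chain_obj D n) z) = twist (chain_obj D (n - 1)) (base_diff D n z)"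
  proof (rule BM_eqI[OF M BM_abelian[OF M] add_hom_comp[OF twist_additive[OF M] bd(1)]
     add_hom_comp[OF bd(1) twist_additive[OF M]] _ z(1)])
   fix s y assume "s \<in> carrier S" "y \<in> carrier (chain_obj D n)"
   then show "base_diff D n (twist (chain_obj D n) (tM (chain_obj D n) s y)) =
     twist (chain_obj D (n - 1)) (base_diff D n (tM (chain_obj D n) s y))"
    using ring_hom_closed[OF F_hom] left_module_hom_closed[OF dD] by (simp add: bd(2) twist_pure[OF M])
  qed
  then show "psi (n - 1) (d n x) = d n (psi n x)"
   unfolding z(2) psiG[OF z(1)] G(3)[OF z(1), symmetric] G(3)[OF tc[OF z(1)], symmetric]
    psiG[OF add_hom_closed[OF bd(1) z(1)]] by simp
 qed
 have order: "(psi n ^^ m) x = x" if x: "x \<in> carrier (Cn n)" for n x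
 proof -
  obtain z where z: "z \<in> carrier (BM (chain_obj D n))" "x = G n z" using surj[OF x] by blast
  have "(psi n ^^ k) (G n z) = G n ((twist (chain_obj D n) ^^ k) z)" for k
   by (induction k) (simp_all add: psiG add_hom_closed[OF add_hom_funpow[OF twist_additive[OF M]] z(1)])
  then show ?thesis using twist_order[OF M z(1)] z(2) by simp
 qed
 show ?thesis by (rule that[OF G semi order psiG]) assumption+
qed

text \<open>The two forms give descent data on \<open>C\<close> that are conjugate under a chain
  automorphism \<open>v\<close>. Corrected by \<open>v\<close>, the comparison of the two base
  changes commutes with the twists and therefore descends.\<close>

lemma descent_unique:
 fixes D1 :: "('a, 'n1) chain_complex" and D2 :: "('a, 'n2) chain_complex"
 assumes D1: "is_chain_complex A D1" "complex_isomorphic A' (base_change_complex R S A D1) C"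
  and D2: "is_chain_complex A D2" "complex_isomorphic A' (base_change_complex R S A D2) C"
 shows "complex_isomorphic A D1 D2"
proof -
 let ?M = "chain_obj D1" and ?L = "chain_obj D2"
 have M: "left_module A (?M n)" and dM: "chain_diff D1 n \<in> left_module_hom A (?M n) (?M (n - 1))" for n
  using D1 by (auto simp: is_chain_complex_def)
 have L: "left_module A (?L n)" and dL: "chain_diff D2 n \<in> left_module_hom A (?L n) (?L (n - 1))" for n
  using D2 by (auto simp: is_chain_complex_def)
 obtain G1 psi1 where G1:
  "\<And>n. G1 n \<in> left_module_hom A' (BM (?M n)) (Cn n)"
  "\<And>n. bij_betw (G1 n) (carrier (BM (?M n))) (carrier (Cn n))"
  "\<And>n z. z \<in> carrier (BM (?M n)) \<Longrightarrow> G1 (n - 1) (base_diff D1 n z) = d n (G1 n z)"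
  and psi1: "semi_chain F psi1" "\<And>n x. x \<in> carrier (Cn n) \<Longrightarrow> (psi1 n ^^ m) x = x"
  "\<And>n z. z \<in> carrier (BM (?M n)) \<Longrightarrow> psi1 n (G1 n z) = G1 n (twist (?M n) z)"
  by (rule twist_transport[OF D1]; rule that; assumption)
 obtain G2 psi2 where G2:
  "\<And>n. G2 n \<in> left_module_hom A' (BM (?L n)) (Cn n)"
  "\<And>n. bij_betw (G2 n) (carrier (BM (?L n))) (carrier (Cn n))"
  "\<And>n z. z \<in> carrier (BM (?L n)) \<Longrightarrow> G2 (n - 1) (base_diff D2 n z) = d n (G2 n z)"
  and psi2: "semi_chain F psi2" "\<And>n x. x \<in> carrier (Cn n) \<Longrightarrow> (psi2 n ^^ m) x = x"
  "\<And>n z. z \<in> carrier (BM (?L n)) \<Longrightarrow> psi2 n (G2 n z) = G2 n (twist (?L n) z)"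
  by (rule twist_transport[OF D2]; rule that; assumption)
 have bij1: "bij_betw (psi1 n) (carrier (Cn n)) (carrier (Cn n))" for n
  by (rule funpow_id_bij[OF semi_chainD(5)[OF psi1(1)] m_pos psi1(2)])
 obtain v where v: "semi_chain (\<lambda>s. s) v" "\<And>n. bij_betw (v n) (carrier (Cn n)) (carrier (Cn n))"
  "\<And>n x. x \<in> carrier (Cn n) \<Longrightarrow> psi2 n (v n x) = v n (psi1 n x)"
  by (rule descent_chain_unique[OF psi2(1,2) psi1(1,2) bij1]; (rule that | assumption); assumption)
 note g1c = left_module_hom_closed[OF G1(1)] and vc = semi_chainD(5)[OF v(1)]
 define i2 where "i2 n = inv_into (carrier (BM (?L n))) (G2 n)" for n
 \<comment> \<open>Without \<open>v\<close> the comparison of the two base changes need not commute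
   with the twists.\<close>
 define w where "w n z = i2 n (v n (G1 n z))" for n z
 interpret L: abelian_group "BM (?L n)" for n by (rule BM_abelian[OF L])
 have i2: "i2 n \<in> left_module_hom A' (Cn n) (BM (?L n))" for n
  unfolding i2_def
  by (rule left_module_hom_inv[OF G2(1,2)]) (auto intro: tensor_moduleD(4)[OF BM_tensor_module[OF L]])
 have w_hom: "w n \<in> left_module_hom A' (BM (?M n)) (BM (?L n))" for n
  unfolding w_def[abs_def]
  by (rule left_module_hom_comp[OF left_module_hom_comp[OF G1(1) semi_chain_hom[OF v(1)]] i2])
 note wc = left_module_hom_closed[OF w_hom]
 have w_bij: "bij_betw (w n) (carrier (BM (?M n))) (carrier (BM (?L n)))" for n
  using bij_betw_trans[OF bij_betw_trans[OF G1(2) v(2)] bij_betw_inv_into[OF G2(2)], of n]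
  by (simp add: w_def[abs_def] i2_def comp_def)
 have G2w: "G2 n (w n z) = v n (G1 n z)" if "z \<in> carrier (BM (?M n))" for n z
  unfolding w_def i2_def by (rule bij_betw_inv_into_right[OF G2(2) vc[OF g1c[OF that]]])
 have G2_inj: "x = y" if "x \<in> carrier (BM (?L n))" "y \<in> carrier (BM (?L n))" "G2 n x = G2 n y" for n x y
  using bij_betw_imp_inj_on[OF G2(2)] that by (simp add: inj_on_def)
 note t1 = add_hom_closed[OF twist_additive[OF M]] and t2 = add_hom_closed[OF twist_additive[OF L]]
 note b1 = base_change_map[OF M M id_hom dM] and b2 = base_change_map[OF L L id_hom dL]
 note b1c = add_hom_closed[OF b1(1)] and b2c = add_hom_closed[OF b2(1)]
 \<comment> \<open>Checked after applying the injective map \<open>G2 n\<close>, which turns the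
   twists into the descent data on \<open>C\<close>.\<close>
 have w_twist: "twist (?L n) (w n z) = w n (twist (?M n) z)" if z: "z \<in> carrier (BM (?M n))" for n z
  by (rule G2_inj[OF t2[OF wc[OF z]] wc[OF t1[OF z]]])
   (simp add: psi2(3)[OF wc[OF z], symmetric] G2w[OF z] v(3)[OF g1c[OF z]] psi1(3)[OF z] G2w[OF t1[OF z]])
 have w_diff: "w (n - 1) (base_diff D1 n z) = base_diff D2 n (w n z)" if z: "z \<in> carrier (BM (?M n))" for n z
  by (rule G2_inj[OF wc[OF b1c[OF z]] b2c[OF wc[OF z]]])
   (simp add: G2w[OF b1c[OF z]] G1(3)[OF z] G2(3)[OF wc[OF z]] G2w[OF z] semi_chainD(4)[OF v(1) g1c[OF z]])
 have "\<forall>n. \<exists>h. h \<in> left_module_hom A (?M n) (?L n) \<and> bij_betw h (carrier (?M n)) (carrier (?L n)) \<and>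
   (\<forall>x\<in>carrier (?M n). tM (?L n) \<one> (h x) = w n (tM (?M n) \<one> x))"
 proof
  fix n
  obtain h where "h \<in> left_module_hom A (?M n) (?L n)" "bij_betw h (carrier (?M n)) (carrier (?L n))"
   "\<And>x. x \<in> carrier (?M n) \<Longrightarrow> tM (?L n) \<one> (h x) = w n (tM (?M n) \<one> x)"
   by (rule descend_isomorphism[of "?M n" "?L n" "w n", OF M L w_hom w_bij w_twist]; (rule that | assumption); assumption)
  then show "\<exists>h. h \<in> left_module_hom A (?M n) (?L n) \<and> bij_betw h (carrier (?M n)) (carrier (?L n)) \<and>
   (\<forall>x\<in>carrier (?M n). tM (?L n) \<one> (h x) = w n (tM (?M n) \<one> x))" by blast
 qed
 then obtain h where h: "\<And>n. h n \<in> left_module_hom A (?M n) (?L n)"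
  "\<And>n. bij_betw (h n) (carrier (?M n)) (carrier (?L n))"
  "\<And>n x. x \<in> carrier (?M n) \<Longrightarrow> tM (?L n) \<one> (h n x) = w n (tM (?M n) \<one> x)"
  by metis
 have "h (n - 1) (chain_diff D1 n x) = chain_diff D2 n (h n x)" if x: "x \<in> carrier (?M n)" for n x
 proof (rule tM_one_inj[OF L])
  note dx = left_module_hom_closed[OF dM x] and hx = left_module_hom_closed[OF h(1) x]
  show "h (n - 1) (chain_diff D1 n x) \<in> carrier (?L (n - 1))" by (rule left_module_hom_closed[OF h(1) dx])
  show "chain_diff D2 n (h n x) \<in> carrier (?L (n - 1))" by (rule left_module_hom_closed[OF dL hx])
  show "tM (?L (n - 1)) \<one> (h (n - 1) (chain_diff D1 n x)) = tM (?L (n - 1)) \<one> (chain_diff D2 n (h n x))"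
   unfolding h(3)[OF dx] b1(2)[OF S.one_closed x, symmetric] w_diff[OF tM_closed[OF M S.one_closed x]]
    h(3)[OF x, symmetric] by (rule b2(2)[OF S.one_closed hx])
 qed
 then show ?thesis unfolding complex_isomorphic_def using h(1,2) by blast
qed

end

theorem theorem6:
  fixes p :: nat
    and K R K' R' :: "'s ring"
    and A :: "('s, 'a) module"
    and A' :: "('s \<times> 'a \<Rightarrow>\<^sub>0 int) set ring"
  assumes "p_modular_extension p K R K' R'"
    and "finite (carrier (residue_field R))"
    and "finite (carrier (residue_field R'))"
    and "absolutely_unramified p R"
    and "absolutely_unramified p R'"
    and "associative_algebra R A"
    and "finitely_generated_module R A"
    and "A' = base_change_algebra R R' A"
  shows
    "(\<forall>C :: (('s \<times> 'a \<Rightarrow>\<^sub>0 int) set, 'm) chain_complex.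
        is_bounded_fg_complex A' C \<and> indecomposable_complex A' C \<and> galois_stable R R' A C \<longrightarrow>
          (\<exists>D :: ('a, 'm) chain_complex.
             is_bounded_fg_complex A D \<and>
             complex_isomorphic A' (base_change_complex R R' A D) C) \<and>
          (\<forall>(D1 :: ('a, 'm1) chain_complex) (D2 :: ('a, 'm2) chain_complex).
             is_bounded_fg_complex A D1 \<and>
             complex_isomorphic A' (base_change_complex R R' A D1) C \<and>
             is_bounded_fg_complex A D2 \<and>
             complex_isomorphic A' (base_change_complex R R' A D2) C \<longrightarrow>
             complex_isomorphic A D1 D2)) \<and>
     (\<forall>D :: ('a, 'n) chain_complex.
        is_bounded_fg_complex A D \<longrightarrow>
          galois_stable R R' A (base_change_complex R R' A D))"
proof -
 have dvr: "complete_discrete_valuation_ring R" "complete_discrete_valuation_ring R'"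
  "Factorial_Ring.prime p" "is_subring_of R R'"
  using assms(1) by (auto simp: p_modular_extension_def p_modular_system_def)
 note radical = unramified_dvr_padic_ring(2)[OF dvr(2,3) assms(3,5)]
 have ext: "padic_extension R R' p"
  by (intro padic_extension.intro padic_extension_axioms.intro dvr(4)
    unramified_dvr_padic_ring(1)[OF dvr(1,3) assms(2,4)] unramified_dvr_padic_ring(1)[OF dvr(2,3) assms(3,5)])
 interpret B: base_change R R' p A by (rule base_change.intro[OF ext assms(6)])
 \<comment> \<open>The lifted Frobenius and its coordinates depend only on the two rings, so one
   choice serves all complexes.\<close>
 obtain F m N a b where F: "F \<in> ring_hom R' R'" "\<And>r. r \<in> carrier R \<Longrightarrow> F r = r"
  "m > 0" "\<And>x. x \<in> carrier R' \<Longrightarrow> (F ^^ m) x = x"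
  "a \<in> {..<N::nat} \<rightarrow> carrier R'" "b \<in> {..<N} \<rightarrow> carrier R'"
  "\<And>j. j < m \<Longrightarrow> (\<Oplus>\<^bsub>R'\<^esub>i\<in>{..<N}. a i \<otimes>\<^bsub>R'\<^esub> (F ^^ j) (b i)) = (if j = 0 then \<one>\<^bsub>R'\<^esub> else \<zero>\<^bsub>R'\<^esub>)"
  "\<And>x. \<lbrakk>x \<in> carrier R'; F x = x\<rbrakk> \<Longrightarrow> x \<in> carrier R"
  by (rule B.galois_generator; rule that; assumption)
 have "galois_base_change_axioms R R' F m N a b"
  by (rule galois_base_change_axioms.intro) (fact F)+
 with B.base_change_axioms have gal: "galois_base_change R R' p A F m N a b"
  by (rule galois_base_change.intro)
 have galois: "galois_complex R R' p A C F m N a b"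
  if "is_bounded_fg_complex A' C" "indecomposable_complex A' C" for C :: "(('s \<times> 'a \<Rightarrow>\<^sub>0 int) set, 'm) chain_complex"
 proof (rule galois_complex.intro[OF bounded_base_change_complex.intro[OF B.base_change_axioms] gal])
  show "bounded_base_change_complex_axioms R R' A C"
   by (rule bounded_base_change_complex_axioms.intro[OF assms(7) that(1)[unfolded assms(8)]])
  show "galois_complex_axioms R R' A C"
   by (rule galois_complex_axioms.intro[OF that(2)[unfolded assms(8)]])
 qed
 show ?thesis
 proof (intro conjI allI impI)
  fix C :: "(('s \<times> 'a \<Rightarrow>\<^sub>0 int) set, 'm) chain_complex"
  assume C: "is_bounded_fg_complex A' C \<and> indecomposable_complex A' C \<and> galois_stable R R' A C"
  then interpret galois_complex R R' p A C F m N a b by (intro galois) simp_all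
  show "\<exists>D :: ('a, 'm) chain_complex. is_bounded_fg_complex A D \<and>
    complex_isomorphic A' (base_change_complex R R' A D) C"
   unfolding assms(8) by (rule descent_exists[OF _ radical]) (use C in simp)
  fix D1 :: "('a, 'm1) chain_complex" and D2 :: "('a, 'm2) chain_complex"
  assume D: "is_bounded_fg_complex A D1 \<and> complex_isomorphic A' (base_change_complex R R' A D1) C \<and>
   is_bounded_fg_complex A D2 \<and> complex_isomorphic A' (base_change_complex R R' A D2) C"
  show "complex_isomorphic A D1 D2"
   by (rule descent_unique) (use D in \<open>simp_all add: is_bounded_fg_complex_def assms(8)\<close>)
 next
  fix D :: "('a, 'n) chain_complex"
  assume "is_bounded_fg_complex A D"
  then have D: "is_chain_complex A D" by (simp add: is_bounded_fg_complex_def)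
  show "galois_stable R R' A (base_change_complex R R' A D)"
   unfolding galois_stable_def
  proof
   fix \<sigma> assume \<sigma>: "\<sigma> \<in> residue_galois_group R R'"
   \<comment> \<open>Here all Galois elements occur, not only the Frobenius; every automorphism of
     \<open>R'\<close> over \<open>R\<close> untwists a base change.\<close>
   have "B.S_linear_auto (residue_lift R' \<sigma>)"
    unfolding B.S_linear_auto_def by (intro conjI ballI B.residue_lift_automorphism[OF radical \<sigma>])
   then show "complex_isomorphic B.A' (galois_twist_complex R R' A (residue_lift R' \<sigma>) (base_change_complex R R' A D))
     (base_change_complex R R' A D)"
    by (rule B.base_change_twist_complex_iso[OF _ D])
  qed
 qed
qed

end
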